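(* From a nondeterministic stepwise tree automaton (nSTA) $\mathcal{A}$ over the alphabet $\Sigma\times\{0,1\}$ with $m$ states and a forest straight-line program (f-SLP) $\mathcal{F}$ over $\Sigma$ one can compute in preprocessing time $|\mathcal{F}|\cdot 2^{\mathcal{O}(m^4)}$ a data structure that allows to enumerate, for a given vertex $A$ of $\mathcal{F}$ of type $0$ (forest vertex), the set $\mathrm{select}(\mathcal{A},[\![A]\!]_{\mathcal{F}})$ with output-linear delay. In the enumeration, every vertex of the forest $[\![A]\!]_{\mathcal{F}}$ is represented by its preorder number. (The vertex $A$ is not known during preprocessing.)
   Context: Forests. $\Sigma$ is a finite alphabet. A forest is a finite ordered sequence of finite rooted ordered unranked $\Sigma$-labelled trees. Preorder numbers are positions (starting with $0$) in the depth-first left-to-right preorder. Forest algebra. Let $\ast\notin\Sigma$. A forest context is a forest over $\Sigma\cup\{\ast\}$ with exactly one occurrence of $\ast$, at a leaf. $F_1\ominus F_2$ (defined if at most one of them is a context) concatenates the sequences of trees; $F_1\odot F_2$ (defined if $F_1$ is a context) replaces the unique $\ast$ in $F_1$ by $F_2$. For $a\in\Sigma$, $a_\ast$ is the context $a(\ast)$. A forest algebra expression is a binary tree with inner vertices labelled $\ominus$ or $\odot$ and leaves labelled $a$ or $a_\ast$ ($a\in\Sigma$). It is valid if all operations are defined on evaluation; it has type $0$ if it evaluates to a forest and type $1$ if it evaluates to a context. f-SLP. A binary DAG is a vertex-labelled acyclic directed graph $(V,E,\lambda)$ with $E\subseteq V\times\{\ell,r\}\times V$ in which every vertex either is a leaf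 or has exactly one outgoing $\ell$-edge (to its left child) and exactly one outgoing $r$-edge (to its right child); its size is $|V|+|E|$. Its unfolding from $A$ is the binary tree of all paths starting in $A$, each labelled with the label of its terminal vertex. An f-SLP is a binary DAG $\mathcal{F}$ all of whose unfoldings are valid forest algebra expressions; $[\![A]\!]_{\mathcal{F}}$ is the value of the unfolding from $A$, and the type of $A$ is the type of this expression. nSTA. An nSTA over an alphabet $\Gamma$ is a tuple $(Q,\Gamma,\delta,\iota,q_0,q_f)$ with $Q$ a finite set of states, $\delta\subseteq Q\times Q\times Q$, $\iota:\Gamma\to 2^Q$, $q_0,q_f\in Q$. It accepts a $\Gamma$-labelled forest with vertex set $V$, labelling $\lambda$ and roots $v_1,\dots,v_k$ (from left to right) if there are mappings $\rho_0,\rho_1,\rho_f:V\to Q$ with: $\rho_0(v_1)=q_0$; $\rho_f(v_k)=q_f$; $\rho_0(v)\in\iota(\lambda(u))$ if $v$ is the first child of $u$; $\rho_0(v)=\rho_f(u)$ if $u$ is the left sibling of $v$ (including consecutive roots); $\rho_1(v)\in\iota(\lambda(v))$ if $v$ is a leaf; $\rho_1(v)=\rho_f(u)$ if $u$ is the last child of $v$; $(\rho_0(v),\rho_1(v),\rho_f(v))\in\delta$ for all $v$. For a $\Sigma$-labelled forest $F$ with vertex set $V$ and $S\subseteq V$, $(F,S)$ is the forest over $\Sigma\times\{0,1\}$ obtained by relabelling each $a$-labelled vertex $v$ with $(a,1)$ if $v\in S$ and $(a,0)$ otherwise. Then $\mathrm{select}(\mathcal{A},F)=\{S\subseteq V:(F,S)\text{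 is accepted by }\mathcal{A}\}$. Enumeration. RAM with registers of word length $\mathcal{O}(|\mathcal{F}|)$. The elements $s_1,\dots,s_n$ of the set are output without repetition, followed by an end marker $s_{n+1}$ (outputs are terminated by a separator symbol, so an empty output has size at least $1$). Output-linear delay: with $t_i$ the time when the output of $s_i$ starts, $t_{i+1}-t_i=\mathcal{O}(|s_i|)$ for all $1\le i\le n$, where $|s_i|$ is the number of registers occupied by $s_i$. For the delay, data complexity is assumed, i.e. $m$ is regarded as a constant (so the delay after outputting $S$ is at most $f(m)\cdot|S|$ for some function $f$). *)

theory Defs
  imports Main "HOL-Library.Log_Nat"
begin

section \<open>Forests\<close>

datatype 'a rtree = Node (rlabel: 'a) (rchildren: "'a rtree list")

type_synonym 'a forest = "'a rtree list"

text \<open>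
  A vertex of a forest is given by its address: the index of its root followed by the child
  indices on the path to it (all indices start with 0). Hence the children of \<open>v\<close> are the
  addresses \<open>v @ [i]\<close>, and \<open>v @ [i]\<close> is the left sibling of \<open>v @ [Suc i]\<close>, where \<open>v = []\<close> is
  allowed and yields the roots.
\<close>

primrec tree_preorder :: "'a rtree \<Rightarrow> nat list list" where
  "tree_preorder (Node a ts) =
     [] # concat (map2 (\<lambda>i. map ((#) i)) [0..<length ts] (map tree_preorder ts))"

definition preorder :: "'a forest \<Rightarrow> nat list list" where
  "preorder F = concat (map2 (\<lambda>i. map ((#) i)) [0..<length F] (map tree_preorder F))"

definition vertices :: "'a forest \<Rightarrow> nat list set" where
  "vertices F = set (preorder F)"

definition preorder_number :: "'a forest \<Rightarrow> nat list \<Rightarrow> nat" where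
  "preorder_number F v = length (takeWhile (\<lambda>u. u \<noteq> v) (preorder F))"

text \<open>The subtree rooted in a vertex (unspecified for addresses that are not vertices).\<close>

fun subtree :: "'a forest \<Rightarrow> nat list \<Rightarrow> 'a rtree" where
  "subtree F [] = undefined"
| "subtree F [i] = F ! i"
| "subtree F (i # p) = subtree (rchildren (F ! i)) p"

definition label_of :: "'a forest \<Rightarrow> nat list \<Rightarrow> 'a" where
  "label_of F v = rlabel (subtree F v)"

definition num_children :: "'a forest \<Rightarrow> nat list \<Rightarrow> nat" where
  "num_children F v = length (rchildren (subtree F v))"


section \<open>Forest algebra\<close>

text \<open>
  Forests and forest contexts over \<open>\<Sigma>\<close> are both forests over \<open>\<Sigma> \<union> {\<ast>}\<close>;
  the symbol \<open>\<ast>\<close> is \<^term>\<open>None\<close>.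
\<close>

primrec num_holes :: "'a option rtree \<Rightarrow> nat" where
  "num_holes (Node l ts) = (if l = None then 1 else 0) + sum_list (map num_holes ts)"

primrec holes_at_leaves :: "'a option rtree \<Rightarrow> bool" where
  "holes_at_leaves (Node l ts) = ((l = None \<longrightarrow> ts = []) \<and> list_all id (map holes_at_leaves ts))"

definition is_forest :: "'a option forest \<Rightarrow> bool" where
  "is_forest F \<longleftrightarrow> sum_list (map num_holes F) = 0"

definition is_context :: "'a option forest \<Rightarrow> bool" where
  "is_context F \<longleftrightarrow> sum_list (map num_holes F) = 1 \<and> list_all holes_at_leaves F"

primrec plug :: "'a option forest \<Rightarrow> 'a option rtree \<Rightarrow> 'a option forest" where
  "plug G (Node l ts) = (if l = None then G else [Node l (concat (map (plug G) ts))])"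

definition hconc :: "'a option forest \<Rightarrow> 'a option forest \<Rightarrow> 'a option forest option" where
  "hconc F1 F2 = (if is_context F1 \<and> is_context F2 then None else Some (F1 @ F2))"

definition vconc :: "'a option forest \<Rightarrow> 'a option forest \<Rightarrow> 'a option forest option" where
  "vconc F1 F2 = (if is_context F1 then Some (concat (map (plug F2) F1)) else None)"

text \<open>
  Vertex labels of forest algebra expressions: \<open>Atom a\<close> is \<open>a\<close>, \<open>CtxAtom a\<close> is \<open>a\<^sub>\<ast>\<close>,
  \<open>HConc\<close> is \<open>\<ominus>\<close> and \<open>VConc\<close> is \<open>\<odot>\<close>.
\<close>

datatype 'a fsym = Atom 'a | CtxAtom 'a | HConc | VConc

datatype 'l btree = BLeaf 'l | BNode 'l "'l btree" "'l btree"

text \<open>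
  The result is \<^term>\<open>None\<close> if the tree is not a valid forest algebra expression, i.e. if it is
  wrongly labelled or some operation is undefined.
\<close>

fun eval_fexp :: "'a fsym btree \<Rightarrow> 'a option forest option" where
  "eval_fexp (BLeaf (Atom a)) = Some [Node (Some a) []]"
| "eval_fexp (BLeaf (CtxAtom a)) = Some [Node (Some a) [Node None []]]"
| "eval_fexp (BNode HConc e1 e2) =
     Option.bind (eval_fexp e1) (\<lambda>F1. Option.bind (eval_fexp e2) (\<lambda>F2. hconc F1 F2))"
| "eval_fexp (BNode VConc e1 e2) =
     Option.bind (eval_fexp e1) (\<lambda>F1. Option.bind (eval_fexp e2) (\<lambda>F2. vconc F1 F2))"
| "eval_fexp _ = None"


section \<open>Forest straight-line programs\<close>

datatype side = LeftChild | RightChild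

record ('v, 'l) dag =
  dverts :: "'v set"
  dedges :: "('v \<times> side \<times> 'v) set"
  dlabel :: "'v \<Rightarrow> 'l"

definition is_dag_leaf :: "('v, 'l) dag \<Rightarrow> 'v \<Rightarrow> bool" where
  "is_dag_leaf D v \<longleftrightarrow> (\<nexists>s w. (v, s, w) \<in> dedges D)"

definition binary_dag :: "('v, 'l) dag \<Rightarrow> bool" where
  "binary_dag D \<longleftrightarrow>
     finite (dverts D) \<and>
     dedges D \<subseteq> dverts D \<times> UNIV \<times> dverts D \<and>
     acyclic {(v, w). \<exists>s. (v, s, w) \<in> dedges D} \<and>
     (\<forall>v \<in> dverts D. is_dag_leaf D v \<or>
        (\<exists>!w. (v, LeftChild, w) \<in> dedges D) \<and> (\<exists>!w. (v, RightChild, w) \<in> dedges D))"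

definition dag_size :: "('v, 'l) dag \<Rightarrow> nat" where
  "dag_size D = card (dverts D) + card (dedges D)"

inductive unfolds_to :: "('v, 'l) dag \<Rightarrow> 'v \<Rightarrow> 'l btree \<Rightarrow> bool" for D where
  "\<lbrakk>v \<in> dverts D; is_dag_leaf D v\<rbrakk> \<Longrightarrow> unfolds_to D v (BLeaf (dlabel D v))"
| "\<lbrakk>(v, LeftChild, w1) \<in> dedges D; (v, RightChild, w2) \<in> dedges D;
    unfolds_to D w1 e1; unfolds_to D w2 e2\<rbrakk>
   \<Longrightarrow> unfolds_to D v (BNode (dlabel D v) e1 e2)"

text \<open>In a binary DAG, every vertex unfolds to exactly one tree.\<close>

definition unfolding_from :: "('v, 'l) dag \<Rightarrow> 'v \<Rightarrow> 'l btree" where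
  "unfolding_from D v = (THE e. unfolds_to D v e)"

definition fslp :: "'a set \<Rightarrow> ('v, 'a fsym) dag \<Rightarrow> bool" where
  "fslp \<Sigma> D \<longleftrightarrow>
     binary_dag D \<and>
     (\<forall>v \<in> dverts D. set_fsym (dlabel D v) \<subseteq> \<Sigma>) \<and>
     (\<forall>v \<in> dverts D. eval_fexp (unfolding_from D v) \<noteq> None)"

definition forest_vertex :: "('v, 'a fsym) dag \<Rightarrow> 'v \<Rightarrow> bool" where
  "forest_vertex D v \<longleftrightarrow> v \<in> dverts D \<and> is_forest (the (eval_fexp (unfolding_from D v)))"

text \<open>The forest \<open>\<lbrakk>v\<rbrakk>\<close> over \<open>\<Sigma>\<close> of a forest vertex \<open>v\<close>.\<close>

definition forest_value :: "('v, 'a fsym) dag \<Rightarrow> 'v \<Rightarrow> 'a forest" where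
  "forest_value D v = map (map_rtree the) (the (eval_fexp (unfolding_from D v)))"


section \<open>Nondeterministic stepwise tree automata\<close>

record ('q, 'g) nsta =
  states :: "'q set"
  delta :: "('q \<times> 'q \<times> 'q) set"
  iota :: "'g \<Rightarrow> 'q set"
  q0 :: 'q
  qf :: 'q

definition is_nsta :: "'g set \<Rightarrow> ('q, 'g) nsta \<Rightarrow> bool" where
  "is_nsta \<Gamma> M \<longleftrightarrow>
     finite (states M) \<and>
     delta M \<subseteq> states M \<times> states M \<times> states M \<and>
     (\<forall>g \<in> \<Gamma>. iota M g \<subseteq> states M) \<and>
     q0 M \<in> states M \<and> qf M \<in> states M"

text \<open>
  The empty forest has no first and last root and is not accepted; it is not the value of any
  forest algebra expression.
\<close>

definition accepts :: "('q, 'g) nsta \<Rightarrow> 'g forest \<Rightarrow> bool" where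
  "accepts M F \<longleftrightarrow> F \<noteq> [] \<and>
     (\<exists>\<rho>0 \<rho>1 \<rho>f.
        (\<forall>v \<in> vertices F. \<rho>0 v \<in> states M \<and> \<rho>1 v \<in> states M \<and> \<rho>f v \<in> states M) \<and>
        \<rho>0 [0] = q0 M \<and>
        \<rho>f [length F - 1] = qf M \<and>
        (\<forall>u \<in> vertices F. u @ [0] \<in> vertices F \<longrightarrow> \<rho>0 (u @ [0]) \<in> iota M (label_of F u)) \<and>
        (\<forall>u i. u @ [Suc i] \<in> vertices F \<longrightarrow> \<rho>0 (u @ [Suc i]) = \<rho>f (u @ [i])) \<and>
        (\<forall>v \<in> vertices F. num_children F v = 0 \<longrightarrow> \<rho>1 v \<in> iota M (label_of F v)) \<and>
        (\<forall>v \<in> vertices F. num_children F v \<noteq> 0 \<longrightarrow>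
           \<rho>1 v = \<rho>f (v @ [num_children F v - 1])) \<and>
        (\<forall>v \<in> vertices F. (\<rho>0 v, \<rho>1 v, \<rho>f v) \<in> delta M))"

text \<open>The forest \<open>(F, S)\<close>; the second components 1 and 0 are \<^term>\<open>True\<close> and \<^term>\<open>False\<close>.\<close>

primrec mark_tree :: "'a rtree \<Rightarrow> nat list set \<Rightarrow> ('a \<times> bool) rtree" where
  "mark_tree (Node a ts) = (\<lambda>S. Node (a, [] \<in> S)
     (map2 (\<lambda>i f. f {p. i # p \<in> S}) [0..<length ts] (map mark_tree ts)))"

definition mark :: "'a forest \<Rightarrow> nat list set \<Rightarrow> ('a \<times> bool) forest" where
  "mark F S = map2 (\<lambda>i t. mark_tree t {p. i # p \<in> S}) [0..<length F] F"

definition select :: "('q, 'a \<times> bool) nsta \<Rightarrow> 'a forest \<Rightarrow> nat list set set" where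
  "select M F = {S. S \<subseteq> vertices F \<and> accepts M (mark F S)}"


section \<open>Random access machines\<close>

text \<open>
  A program refers to finitely many registers and finitely many arrays of registers, each
  array being addressed by the content of a register. (Finitely many arrays can be interleaved
  into a single one with constant overhead.) Every instruction takes one time unit. Arithmetic
  consists of addition and truncated subtraction.
\<close>

datatype instr =
    Const nat nat
  | Add nat nat nat
  | Sub nat nat nat
  | Load nat nat nat
  | Store nat nat nat
  | Jump nat
  | JumpLess nat nat nat
  | OutReg nat
  | OutSep
  | OutEnd
  | Halt

record config =
  pc :: nat
  regs :: "nat \<Rightarrow> nat"
  mem :: "nat \<Rightarrow> nat \<Rightarrow> nat"

fun exec :: "instr \<Rightarrow> config \<Rightarrow> config" where
  "exec (Const r k) c = c\<lparr>pc := Suc (pc c), regs := (regs c)(r := k)\<rparr>"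
| "exec (Add r s t) c = c\<lparr>pc := Suc (pc c), regs := (regs c)(r := regs c s + regs c t)\<rparr>"
| "exec (Sub r s t) c = c\<lparr>pc := Suc (pc c), regs := (regs c)(r := regs c s - regs c t)\<rparr>"
| "exec (Load r a s) c = c\<lparr>pc := Suc (pc c), regs := (regs c)(r := mem c a (regs c s))\<rparr>"
| "exec (Store a s r) c =
     c\<lparr>pc := Suc (pc c), mem := (mem c)(a := (mem c a)(regs c s := regs c r))\<rparr>"
| "exec (Jump l) c = c\<lparr>pc := l\<rparr>"
| "exec (JumpLess r s l) c = c\<lparr>pc := (if regs c r < regs c s then l else Suc (pc c))\<rparr>"
| "exec (OutReg r) c = c\<lparr>pc := Suc (pc c)\<rparr>"
| "exec OutSep c = c\<lparr>pc := Suc (pc c)\<rparr>"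
| "exec OutEnd c = c\<lparr>pc := Suc (pc c)\<rparr>"
| "exec Halt c = c"

definition halted :: "instr list \<Rightarrow> config \<Rightarrow> bool" where
  "halted P c \<longleftrightarrow> pc c \<ge> length P \<or> P ! pc c = Halt"

definition step :: "instr list \<Rightarrow> config \<Rightarrow> config" where
  "step P c = (if halted P c then c else exec (P ! pc c) c)"

definition config_at :: "instr list \<Rightarrow> config \<Rightarrow> nat \<Rightarrow> config" where
  "config_at P c t = (step P ^^ t) c"

datatype osym = Num nat | Sep | EndMarker

definition emitted :: "instr list \<Rightarrow> config \<Rightarrow> osym list" where
  "emitted P c =
     (if halted P c then [] else
      case P ! pc c of OutReg r \<Rightarrow> [Num (regs c r)] | OutSep \<Rightarrow> [Sep] | OutEnd \<Rightarrow> [EndMarker]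
      | _ \<Rightarrow> [])"

definition output_trace :: "instr list \<Rightarrow> config \<Rightarrow> nat \<Rightarrow> (nat \<times> osym) list" where
  "output_trace P c T = concat (map (\<lambda>t. map (Pair t) (emitted P (config_at P c t))) [0..<T])"

definition fits_word :: "nat \<Rightarrow> config \<Rightarrow> bool" where
  "fits_word w c \<longleftrightarrow> (\<forall>r. regs c r < 2 ^ w) \<and> (\<forall>a i. mem c a i < 2 ^ w)"

definition halts_within :: "nat \<Rightarrow> instr list \<Rightarrow> config \<Rightarrow> nat \<Rightarrow> bool" where
  "halts_within w P c T \<longleftrightarrow>
     halted P (config_at P c T) \<and> (\<forall>t \<le> T. fits_word w (config_at P c t))"


section \<open>Enumeration with output-linear delay\<close>

text \<open>
  A set of numbers is output as a list of its elements without repetition, in any order,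
  followed by a separator. The output number \<open>i\<close> (starting with 0) of a run writing \<open>xss\<close>
  starts when its first symbol is written; output number \<open>length xss\<close> is the end marker.
\<close>

definition output_symbols :: "nat list list \<Rightarrow> osym list" where
  "output_symbols xss = concat (map (\<lambda>xs. map Num xs @ [Sep]) xss) @ [EndMarker]"

definition output_length :: "nat list \<Rightarrow> nat" where
  "output_length xs = length xs + 1"

definition start_time :: "nat list list \<Rightarrow> (nat \<times> osym) list \<Rightarrow> nat \<Rightarrow> nat" where
  "start_time xss tr i = fst (tr ! (\<Sum>xs \<leftarrow> take i xss. output_length xs))"

text \<open>
  The first output has to start after at most \<open>d\<close> steps. Without this requirement, a machine
  could compute the whole set before the first output, which would make the condition on the
  other delays meaningless.
\<close>

definition enumerates_with_delay ::
  "nat \<Rightarrow> nat \<Rightarrow> instr list \<Rightarrow> config \<Rightarrow> nat set set \<Rightarrow> bool" where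
  "enumerates_with_delay w d P c \<S> \<longleftrightarrow>
     (\<exists>T xss. let tr = output_trace P c T in
        halts_within w P c T \<and>
        map snd tr = output_symbols xss \<and>
        (\<forall>xs \<in> set xss. distinct xs) \<and>
        distinct (map set xss) \<and>
        set (map set xss) = \<S> \<and>
        start_time xss tr 0 \<le> d \<and>
        (\<forall>i < length xss.
           start_time xss tr (Suc i) - start_time xss tr i \<le> d * output_length (xss ! i)))"


section \<open>Input and queries\<close>

text \<open>
  Inputs consist of natural numbers: \<open>\<Sigma> = {..<\<sigma>}\<close>, the states are \<open>{..<m}\<close> and the vertices of
  the f-SLP are \<open>{..<n}\<close>, in an arbitrary order. Arrays 0 to 2 hold the f-SLP: the kind of the
  vertex; its letter (leaf) or left child (inner vertex); its right child. Arrays 3 and 4 hold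
  the characteristic functions of \<open>\<delta>\<close> and \<open>\<iota>\<close>. All other registers are 0.
\<close>

primrec kind_code :: "'a fsym \<Rightarrow> nat" where
  "kind_code (Atom a) = 0"
| "kind_code (CtxAtom a) = 1"
| "kind_code HConc = 2"
| "kind_code VConc = 3"

definition child :: "('v, 'l) dag \<Rightarrow> side \<Rightarrow> 'v \<Rightarrow> 'v" where
  "child D s v = (THE w. (v, s, w) \<in> dedges D)"

definition input_regs ::
  "nat \<Rightarrow> (nat, nat \<times> bool) nsta \<Rightarrow> (nat, nat fsym) dag \<Rightarrow> nat \<Rightarrow> nat" where
  "input_regs \<sigma> M D r =
     (if r = 0 then card (dverts D)
      else if r = 1 then card (states M)
      else if r = 2 then \<sigma>
      else if r = 3 then q0 M
      else if r = 4 then qf M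
      else 0)"

definition input_mem ::
  "nat \<Rightarrow> (nat, nat \<times> bool) nsta \<Rightarrow> (nat, nat fsym) dag \<Rightarrow> nat \<Rightarrow> nat \<Rightarrow> nat" where
  "input_mem \<sigma> M D a i =
     (if a = 0 \<and> i \<in> dverts D then kind_code (dlabel D i)
      else if a = 1 \<and> i \<in> dverts D then
        (case dlabel D i of Atom x \<Rightarrow> x | CtxAtom x \<Rightarrow> x | _ \<Rightarrow> child D LeftChild i)
      else if a = 2 \<and> i \<in> dverts D then
        (case dlabel D i of Atom x \<Rightarrow> 0 | CtxAtom x \<Rightarrow> 0 | _ \<Rightarrow> child D RightChild i)
      else if a = 3 then
        (let m = card (states M) in of_bool (\<exists>(p, q, r) \<in> delta M. i = (p * m + q) * m + r))
      else if a = 4 then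
        of_bool (\<exists>x < \<sigma>. \<exists>b. \<exists>q \<in> iota M (x, b). i = q * (2 * \<sigma>) + 2 * x + of_bool b)
      else 0)"

definition input_config ::
  "nat \<Rightarrow> (nat, nat \<times> bool) nsta \<Rightarrow> (nat, nat fsym) dag \<Rightarrow> config" where
  "input_config \<sigma> M D = \<lparr>pc = 0, regs = input_regs \<sigma> M D, mem = input_mem \<sigma> M D\<rparr>"

text \<open>
  A query is started on the registers left behind by the preprocessing, with the queried
  vertex in register 0.
\<close>

definition query_config :: "config \<Rightarrow> nat \<Rightarrow> config" where
  "query_config c v = c\<lparr>pc := 0, regs := (regs c)(0 := v)\<rparr>"

text \<open>
  For fixed \<open>m\<close> and \<open>\<Sigma>\<close> the word length is \<open>O(|D|)\<close>. The further summands are needed to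
  address the automaton and the data structure, whose size depends on \<open>m\<close> and \<open>\<Sigma>\<close>, too.
\<close>

definition word_length :: "nat \<Rightarrow> nat \<Rightarrow> nat \<Rightarrow> ('v, 'l) dag \<Rightarrow> nat" where
  "word_length k \<sigma> m D = k * (dag_size D + m ^ 4 + floorlog 2 \<sigma>)"

end

theory Submission
 imports Defs
begin

text \<open>
 The automaton is made deterministic: the state of an expression is the set of quadruples \<open>(p, q, p', q')\<close>
 such that the automaton passes from \<open>p\<close> to \<open>q\<close> if the hole is passed from \<open>p'\<close> to \<open>q'\<close>; there are at
 most \<open>2 ^ m ^ 4\<close> states. A marking of the value of a vertex decomposes uniquely into markings of the values of
 its children, so the nonempty markings that lead to a given state are a disjoint union of products over pairs of
 states of the children. These unions and products are shared between the vertices: a reference to a child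
 carries an affine map of the preorder numbers, and since every empty marking is kept apart, every product has
 two nonempty factors. A pointer from each nested union to its first alternative that is not a union, enumerated
 first, makes the delay after a set proportional to its size. Both programs are written in a small structured
 language, verified by weakest preconditions with ghost time, and compiled to machine instructions.
\<close>

section \<open>Preorder words and runs\<close>

text \<open>The delay after a set has to be paid by that set alone, yet the next set may take long
  to assemble. Therefore every cell also stores an affine term for the first number of its first
  set. That number is written as soon as an alternative is taken up, and all further work is charged
  to the set just begun, whose size exceeds the number of buffered positions plus pending factors.
  This also makes the delay constant 400 independent of \<open>m\<close>. Contexts shape the
  treatment of positions: plugging separates the positions before the hole from those after it, so
  an occurrence is located by a pair of start positions. Positions may be exponential in the number
  of vertices; they fit into words of linear length because every offset is bounded through the cell
  index or the rank in the DAG. As the vertices are numbered arbitrarily, the preprocessing has to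
  find a children-first order itself.\<close>

primrec labs_tree :: "'g rtree => 'g list" where
 "labs_tree (Node a ts) = a # concat (map labs_tree ts)"

definition labs :: "'g forest => 'g list" where
 "labs F = concat (map labs_tree F)"

text \<open>\<open>subtree\<close> takes addresses in a forest and is unspecified at
  \<open>[]\<close>. Addresses relative to a tree, with \<open>[]\<close> for its root, recurse
  uniformly through the children.\<close>

definition tsub :: "'g rtree => nat list => 'g rtree" where
 "tsub t u = (if u = [] then t else subtree (rchildren t) u)"

lemma tsub_Nil [simp]: "tsub t [] = t"
 by (simp add: tsub_def)

lemma subtree_Cons: "subtree F (i # p) = tsub (F ! i) p"
 by (cases p) (auto simp: tsub_def)

lemma tsub_Cons [simp]: "tsub (Node a ts) (i # p) = tsub (ts ! i) p"
 by (simp add: tsub_def subtree_Cons)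

lemma map2_upt: "map2 f [0..<length ts] (map g ts) = map (\<lambda>i. f i (g (ts ! i))) [0..<length ts]"
 by (rule nth_equalityI) auto

lemma map2_upt': "map2 f [0..<length ts] ts = map (\<lambda>i. f i (ts ! i)) [0..<length ts]"
 by (rule nth_equalityI) auto

lemma tree_preorder_Node: "tree_preorder (Node a ts) =
 [] # concat (map (\<lambda>i. map ((#) i) (tree_preorder (ts ! i))) [0..<length ts])"
 by (simp add: map2_upt)

lemma preorder_eq: "preorder F = concat (map (\<lambda>i. map ((#) i) (tree_preorder (F ! i))) [0..<length F])"
 by (simp add: preorder_def map2_upt)

lemma mark_tree_Node: "mark_tree (Node a ts) S =
 Node (a, [] \<in> S) (map (\<lambda>i. mark_tree (ts ! i) {p. i # p \<in> S}) [0..<length ts])"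
 by (simp add: map2_upt)

lemma mark_eq: "mark F S = map (\<lambda>i. mark_tree (F ! i) {p. i # p \<in> S}) [0..<length F]"
 by (simp add: mark_def map2_upt')

declare tree_preorder.simps [simp del] mark_tree.simps [simp del]

lemma in_tree_preorder_Node:
 "v \<in> set (tree_preorder (Node a ts)) \<longleftrightarrow>
   v = [] \<or> (\<exists>i u. v = i # u \<and> i < length ts \<and> u \<in> set (tree_preorder (ts ! i)))"
 by (auto simp: tree_preorder_Node)

lemma in_vertices: "v \<in> vertices F \<longleftrightarrow>
   (\<exists>i u. v = i # u \<and> i < length F \<and> u \<in> set (tree_preorder (F ! i)))"
 by (auto simp: vertices_def preorder_eq)

lemma tree_preorder_Nil [simp]: "[] \<in> set (tree_preorder t)"
 by (cases t) (simp add: tree_preorder_Node)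

text \<open>\<open>accepts\<close> reaches children by appending an index, while all recursions here
  consume addresses from the front; this lemma mediates between the two.\<close>

lemma tree_preorder_snoc:
 "u @ [j] \<in> set (tree_preorder t) \<longleftrightarrow>
   u \<in> set (tree_preorder t) \<and> j < length (rchildren (tsub t u))"
proof (induction t arbitrary: u)
 case (Node a ts)
 show ?case
 proof (cases u)
  case Nil
  then show ?thesis by (auto simp: in_tree_preorder_Node)
 next
  case (Cons i v)
  then show ?thesis using Node[of "ts ! i"] by (auto simp: in_tree_preorder_Node)
 qed
qed

lemma vertices_snoc:
 "v @ [j] \<in> vertices F \<longleftrightarrow> (v = [] \<and> j < length F) \<or> (v \<in> vertices F \<and> j < num_children F v)"
 by (cases v) (auto simp: in_vertices tree_preorder_snoc num_children_def subtree_Cons)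

lemma distinct_concat_Cons:
 "(\<And>i. i < n ==> distinct (f i)) ==> distinct (concat (map (\<lambda>i. map ((#) i) (f i)) [0..<n]))"
 by (induction n) (auto simp: distinct_map)

lemma distinct_tree_preorder: "distinct (tree_preorder t)"
 by (induction t) (auto simp: tree_preorder_Node intro!: distinct_concat_Cons)

lemma distinct_preorder: "distinct (preorder F)"
 by (auto simp: preorder_eq intro!: distinct_concat_Cons distinct_tree_preorder)

lemma labs_tree_eq: "labs_tree t = map (\<lambda>v. rlabel (tsub t v)) (tree_preorder t)"
proof (induction t)
 case (Node a ts)
 have "concat (map labs_tree ts) = concat (map (\<lambda>i. labs_tree (ts ! i)) [0..<length ts])"
  by (rule arg_cong[of _ _ concat], rule nth_equalityI) auto
 also have "\<dots> = concat (map (\<lambda>i. map (\<lambda>v. rlabel (tsub (ts ! i) v)) (tree_preorder (ts ! i))) [0..<length ts])"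
  using Node by (intro arg_cong[of _ _ concat] map_cong) auto
 finally show ?case by (simp add: tree_preorder_Node map_concat o_def)
qed

lemma labs_mark_tree:
 "labs_tree (mark_tree t S) = map (\<lambda>v. (rlabel (tsub t v), v \<in> S)) (tree_preorder t)"
proof (induction t arbitrary: S)
 case (Node a ts)
 have "map labs_tree (map (\<lambda>i. mark_tree (ts ! i) {p. i # p \<in> S}) [0..<length ts]) =
   map (\<lambda>i. map (\<lambda>v. (rlabel (tsub (ts ! i) v), i # v \<in> S)) (tree_preorder (ts ! i))) [0..<length ts]"
  using Node by (auto intro!: map_cong)
 from arg_cong[OF this, of concat] show ?case
  by (simp add: tree_preorder_Node map_concat o_def mark_tree_Node)
qed

lemma labs_eq: "labs F = map (label_of F) (preorder F)"
proof -
 have "map labs_tree F = map (\<lambda>i. map (\<lambda>v. rlabel (tsub (F ! i) v)) (tree_preorder (F ! i))) [0..<length F]"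
  by (rule nth_equalityI) (auto simp: labs_tree_eq)
 from arg_cong[OF this, of concat] show ?thesis
  by (simp add: labs_def preorder_eq map_concat o_def label_of_def subtree_Cons)
qed

lemma labs_mark: "labs (mark F S) = map (\<lambda>v. (label_of F v, v \<in> S)) (preorder F)"
 by (simp add: labs_def preorder_eq map_concat o_def label_of_def subtree_Cons mark_eq labs_mark_tree)

lemma erase_mark_tree: "map_rtree fst (mark_tree t S) = t"
proof (induction t arbitrary: S)
 case (Node a ts)
 then show ?case
  by (auto simp: mark_tree_Node intro!: nth_equalityI)
qed

lemma erase_mark: "map (map_rtree fst) (mark F S) = F"
 by (auto simp: mark_eq erase_mark_tree intro!: nth_equalityI)

lemma length_labs_map [simp]: "length (labs_tree (map_rtree f t)) = length (labs_tree t)"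
 by (induction t) (auto simp: length_concat o_def intro!: arg_cong[of _ _ sum_list])

lemma labs_tree_map: "labs_tree (map_rtree f t) = map f (labs_tree t)"
proof (induction t)
 case (Node a ts)
 then have "map (labs_tree \<circ> map_rtree f) ts = map (map f \<circ> labs_tree) ts"
  by auto
 from arg_cong[OF this, of concat] show ?case by (simp add: map_concat)
qed

lemma labs_map: "labs (map (map_rtree f) F) = map f (labs F)"
 by (simp add: labs_def map_concat o_def labs_tree_map)

text \<open>Equal shapes give blocks of equal lengths, so a concatenation of blocks can be cut in
  only one way.\<close>

lemma map_labs_tree_inj:
 assumes "map (map_rtree f) ts = map (map_rtree f) us"
  and "concat (map labs_tree ts) = concat (map labs_tree us)"
 shows "map labs_tree ts = map labs_tree us"
proof (rule concat_injective[OF assms(2)])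
 have l: "length ts = length us" using assms(1) by (metis length_map)
 then show "length (map labs_tree ts) = length (map labs_tree us)" by simp
 show "\<forall>(x, y)\<in>set (zip (map labs_tree ts) (map labs_tree us)). length x = length y"
 proof (clarsimp simp: set_zip)
  fix i assume i: "i < length ts" "i < length us"
  then have "map_rtree f (ts ! i) = map_rtree f (us ! i)"
   using assms(1) by (metis nth_map)
  then show "length (labs_tree (ts ! i)) = length (labs_tree (us ! i))"
   by (metis length_labs_map)
 qed
qed

lemma labs_tree_inj:
 "map_rtree f t = map_rtree f u ==> labs_tree t = labs_tree u ==> t = u"
proof (induction t arbitrary: u)
 case (Node a ts)
 obtain b us where u: "u = Node b us" by (cases u)
 have e: "map (map_rtree f) ts = map (map_rtree f) us" and l: "map labs_tree ts = map labs_tree us"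
  using Node.prems map_labs_tree_inj[of f ts us] by (auto simp: u)
 have "ts = us"
 proof (rule nth_equalityI)
  show len: "length ts = length us" using e by (metis length_map)
  fix i assume i: "i < length ts"
  show "ts ! i = us ! i"
   by (rule Node.IH) (use i len e l in \<open>auto simp: list_eq_iff_nth_eq\<close>)
 qed
 then show ?case using Node.prems by (simp add: u)
qed

text \<open>Shape and preorder word determine a forest. This later identifies the value of a marked
  expression with \<open>mark F S\<close> by comparing words only, without following addresses
  through the evaluation.\<close>

lemma labs_inj:
 assumes "map (map_rtree f) F = map (map_rtree f) G" "labs F = labs G"
 shows "F = G"
proof (rule nth_equalityI)
 show len: "length F = length G" using assms by (metis length_map)
 have "map labs_tree F = map labs_tree G"
  using map_labs_tree_inj[OF assms(1)] assms(2) by (simp add: labs_def)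
 then show "F ! i = G ! i" if "i < length F" for i
  using that len assms(1) by (intro labs_tree_inj[of f]) (auto simp: list_eq_iff_nth_eq)
qed

text \<open>\<open>preorder F\<close> is free of repetitions, so the number of its entry
  \<open>i\<close> is \<open>i\<close> itself.\<close>

lemma preorder_number_image:
 assumes "S \<subseteq> vertices F"
 shows "preorder_number F ` S = {i. i < length (preorder F) \<and> preorder F ! i \<in> S}"
proof -
 have n: "preorder_number F (preorder F ! i) = i" if "i < length (preorder F)" for i
 proof -
  have "takeWhile (\<lambda>u. u ~= preorder F ! i) (preorder F) = take i (preorder F)"
   by (rule takeWhile_eq_take_P_nth)
    (use that in \<open>auto simp: nth_eq_iff_index_eq[OF distinct_preorder]\<close>)
  then show ?thesis using that by (simp add: preorder_number_def)
 qed
 show ?thesis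
 proof (intro subset_antisym subsetI)
  fix x assume "x \<in> preorder_number F ` S"
  then obtain v where v: "v \<in> S" "x = preorder_number F v" by auto
  then obtain i where "i < length (preorder F)" "preorder F ! i = v"
   using assms unfolding vertices_def by (metis in_set_conv_nth subsetD)
  then show "x \<in> {i. i < length (preorder F) \<and> preorder F ! i \<in> S}" using n v by auto
 next
  fix x assume "x \<in> {i. i < length (preorder F) \<and> preorder F ! i \<in> S}"
  then show "x \<in> preorder_number F ` S" using n by (force intro!: image_eqI[of _ _ "preorder F ! x"])
 qed
qed

section \<open>Runs as compositions of relations on states\<close>

fun chain :: "('q => 'q => bool) list => 'q => 'q => bool" where
 "chain [] p q = (p = q)"
| "chain (R # Rs) p q = (\<exists>r. R p r \<and> chain Rs r q)"

text \<open>A hole is passed from \<open>fst z\<close> to \<open>snd z\<close>.\<close>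

primrec trel :: "('q, 'g) nsta => 'q \<times> 'q => 'g option rtree => 'q => 'q => bool" where
 "trel M z (Node l ts) = (\<lambda>p q. case l of None => z = (p, q) | Some a =>
   \<exists>t p0. (p, t, q) \<in> delta M \<and> p0 \<in> iota M a \<and> chain (map (trel M z) ts) p0 t)"

definition frel :: "('q, 'g) nsta => 'q \<times> 'q => 'g option forest => 'q => 'q => bool" where
 "frel M z F = chain (map (trel M z) F)"

lemma chain_iff:
 "chain Rs p q \<longleftrightarrow> (\<exists>c. c 0 = p \<and> c (length Rs) = q \<and> (\<forall>i < length Rs. (Rs ! i) (c i) (c (Suc i))))"
proof (induction Rs arbitrary: p)
 case Nil
 then show ?case by auto
next
 case (Cons R Rs)
 show ?case
 proof
  assume "chain (R # Rs) p q"
  then obtain r c where "R p r" "c 0 = r" "c (length Rs) = q"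
   "\<forall>i < length Rs. (Rs ! i) (c i) (c (Suc i))" using Cons by auto
  then show "\<exists>c. c 0 = p \<and> c (length (R # Rs)) = q \<and>
   (\<forall>i < length (R # Rs). ((R # Rs) ! i) (c i) (c (Suc i)))"
   by (intro exI[of _ "case_nat p c"]) (auto simp: less_Suc_eq_0_disj)
 next
  assume "\<exists>c. c 0 = p \<and> c (length (R # Rs)) = q \<and>
   (\<forall>i < length (R # Rs). ((R # Rs) ! i) (c i) (c (Suc i)))"
  then obtain c where c: "c 0 = p" "c (Suc (length Rs)) = q"
   "\<forall>i < Suc (length Rs). ((R # Rs) ! i) (c i) (c (Suc i))" by auto
  have "R p (c 1)" using c(1) c(3)[rule_format, of 0] by simp
  moreover have "chain Rs (c 1) q"
   unfolding Cons using c by (intro exI[of _ "\<lambda>i. c (Suc i)"]) auto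
  ultimately show "chain (R # Rs) p q" by auto
 qed
qed

lemma chain_append: "chain (Rs @ Ss) p q \<longleftrightarrow> (\<exists>r. chain Rs p r \<and> chain Ss r q)"
 by (induction Rs arbitrary: p) auto

text \<open>Addresses are relative to the tree, so the run on child \<open>i\<close> is the same run
  read through \<open>(#) i\<close>. The form \<open>map (run M) ts ! i\<close> makes the recursive
  call acceptable to primitive recursion.\<close>

primrec run :: "('q, 'g) nsta => 'g rtree =>
  (nat list => 'q) => (nat list => 'q) => (nat list => 'q) => bool" where
 "run M (Node a ts) = (\<lambda>\<rho>0 \<rho>1 \<rho>f. (\<rho>0 [], \<rho>1 [], \<rho>f []) \<in> delta M \<and>
   (if ts = [] then \<rho>1 [] \<in> iota M a else \<rho>0 [0] \<in> iota M a \<and> \<rho>1 [] = \<rho>f [length ts - 1]) \<and>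
   (\<forall>i. Suc i < length ts --> \<rho>0 [Suc i] = \<rho>f [i]) \<and>
   (\<forall>i < length ts. (map (run M) ts ! i) (\<lambda>u. \<rho>0 (i # u)) (\<lambda>u. \<rho>1 (i # u)) (\<lambda>u. \<rho>f (i # u))))"

definition frun :: "('q, 'g) nsta => 'g forest =>
  (nat list => 'q) => (nat list => 'q) => (nat list => 'q) => bool" where
 "frun M F \<rho>0 \<rho>1 \<rho>f \<longleftrightarrow> (\<forall>i. Suc i < length F --> \<rho>0 [Suc i] = \<rho>f [i]) \<and>
   (\<forall>i < length F. run M (F ! i) (\<lambda>u. \<rho>0 (i # u)) (\<lambda>u. \<rho>1 (i # u)) (\<lambda>u. \<rho>f (i # u)))"

lemma run_Node: "run M (Node a ts) \<rho>0 \<rho>1 \<rho>f \<longleftrightarrow> (\<rho>0 [], \<rho>1 [], \<rho>f []) \<in> delta M \<and>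
   (if ts = [] then \<rho>1 [] \<in> iota M a else \<rho>0 [0] \<in> iota M a \<and> \<rho>1 [] = \<rho>f [length ts - 1]) \<and>
   frun M ts \<rho>0 \<rho>1 \<rho>f"
 by (auto simp: frun_def)

declare run.simps [simp del]

text \<open>The first assumption is the induction hypothesis of \<open>run_iff\<close>.
  \<open>frun\<close> never reads its functions at \<open>[]\<close>; there the parent keeps its own
  states, so values \<open>a\<close>, \<open>b\<close>, \<open>c\<close> may be prescribed at that
  address.\<close>

lemma frun_iff_aux:
 assumes "\<And>t p q. t \<in> set F ==>
   (\<exists>\<rho>0 \<rho>1 \<rho>f. \<rho>0 [] = p \<and> \<rho>f [] = q \<and> run M t \<rho>0 \<rho>1 \<rho>f) \<longleftrightarrow> trel M z (map_rtree Some t) p q"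
  and "F ~= []"
 shows "(\<exists>\<rho>0 \<rho>1 \<rho>f. \<rho>0 [0] = p \<and> \<rho>f [length F - 1] = q \<and> \<rho>0 [] = a \<and> \<rho>1 [] = b \<and> \<rho>f [] = c \<and> frun M F \<rho>0 \<rho>1 \<rho>f)
   \<longleftrightarrow> chain (map (trel M z) (map (map_rtree Some) F)) p q" (is "?L = ?R")
proof
 assume ?L
 then obtain \<rho>0 \<rho>1 \<rho>f where r: "\<rho>0 [0] = p" "\<rho>f [length F - 1] = q" "frun M F \<rho>0 \<rho>1 \<rho>f" by auto
 \<comment> \<open>\<open>c i\<close> is the state between root \<open>i - 1\<close> and root
   \<open>i\<close>; the sibling condition says that both roots agree on it.\<close>
 define c where "c i = (if i = 0 then p else \<rho>f [i - 1])" for i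
 have "trel M z (map_rtree Some (F ! i)) (c i) (c (Suc i))" if i: "i < length F" for i
 proof -
  have "\<rho>0 [i] = c i" using r i unfolding frun_def c_def by (cases i) auto
  moreover have "\<rho>f [i] = c (Suc i)" by (simp add: c_def)
  moreover have "run M (F ! i) (\<lambda>u. \<rho>0 (i # u)) (\<lambda>u. \<rho>1 (i # u)) (\<lambda>u. \<rho>f (i # u))"
   using r i by (simp add: frun_def)
  ultimately show ?thesis
   by (intro assms(1)[OF nth_mem[OF i], THEN iffD1] exI[of _ "\<lambda>u. \<rho>0 (i # u)"]
     exI[of _ "\<lambda>u. \<rho>1 (i # u)"] exI[of _ "\<lambda>u. \<rho>f (i # u)"]) simp
 qed
 then show ?R unfolding chain_iff using r assms(2) by (intro exI[of _ c]) (auto simp: c_def)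
next
 assume ?R
 then obtain d where d: "d 0 = p" "d (length F) = q"
  "\<forall>i < length F. trel M z (map_rtree Some (F ! i)) (d i) (d (Suc i))"
  unfolding chain_iff by auto
 have "\<forall>i < length F. \<exists>\<rho>0 \<rho>1 \<rho>f. \<rho>0 [] = d i \<and> \<rho>f [] = d (Suc i) \<and> run M (F ! i) \<rho>0 \<rho>1 \<rho>f"
  using d(3) assms(1) by simp
 then obtain r0 r1 rf where r: "\<forall>i < length F. r0 i [] = d i \<and> rf i [] = d (Suc i) \<and>
   run M (F ! i) (r0 i) (r1 i) (rf i)" by metis
 \<comment> \<open>The runs of the single trees are glued along their root index, and
   \<open>[]\<close> receives the prescribed values.\<close>
 define \<rho>0 where "\<rho>0 v = (case v of [] => a | i # u => r0 i u)" for v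
 define \<rho>1 where "\<rho>1 v = (case v of [] => b | i # u => r1 i u)" for v
 define \<rho>f where "\<rho>f v = (case v of [] => c | i # u => rf i u)" for v
 have "frun M F \<rho>0 \<rho>1 \<rho>f" unfolding frun_def \<rho>0_def \<rho>1_def \<rho>f_def using r by auto
 moreover have "\<rho>0 [0] = p" "\<rho>f [length F - 1] = q"
  using r assms(2) d by (auto simp: \<rho>0_def \<rho>f_def)
 ultimately show ?L
  by (intro exI[of _ \<rho>0] exI[of _ \<rho>1] exI[of _ \<rho>f]) (simp add: \<rho>0_def \<rho>1_def \<rho>f_def)
qed

lemma run_iff:
 "(\<exists>\<rho>0 \<rho>1 \<rho>f. \<rho>0 [] = p \<and> \<rho>f [] = q \<and> run M t \<rho>0 \<rho>1 \<rho>f) \<longleftrightarrow> trel M z (map_rtree Some t) p q"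
proof (induction t arbitrary: p q)
 case (Node a ts)
 show ?case
 proof (cases "ts = []")
  case True
  have "(\<exists>\<rho>0 \<rho>1 \<rho>f. \<rho>0 [] = p \<and> \<rho>f [] = q \<and> run M (Node a ts) \<rho>0 \<rho>1 \<rho>f) \<longleftrightarrow>
   (\<exists>t. (p, t, q) \<in> delta M \<and> t \<in> iota M a)"
  proof
   assume "\<exists>t. (p, t, q) \<in> delta M \<and> t \<in> iota M a"
   then obtain t where "(p, t, q) \<in> delta M \<and> t \<in> iota M a" by auto
   then show "\<exists>\<rho>0 \<rho>1 \<rho>f. \<rho>0 [] = p \<and> \<rho>f [] = q \<and> run M (Node a ts) \<rho>0 \<rho>1 \<rho>f"
    by (intro exI[of _ "\<lambda>_. p"] exI[of _ "\<lambda>_. t"] exI[of _ "\<lambda>_. q"])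
     (simp add: True run_Node frun_def)
  qed (auto simp: True run_Node frun_def)
  then show ?thesis by (auto simp: True)
 next
  case False
  note aux = frun_iff_aux[OF Node.IH False]
  show ?thesis
  proof
   assume "\<exists>\<rho>0 \<rho>1 \<rho>f. \<rho>0 [] = p \<and> \<rho>f [] = q \<and> run M (Node a ts) \<rho>0 \<rho>1 \<rho>f"
   then obtain \<rho>0 \<rho>1 \<rho>f where r: "\<rho>0 [] = p" "\<rho>f [] = q" "run M (Node a ts) \<rho>0 \<rho>1 \<rho>f" by auto
   then have "chain (map (trel M z) (map (map_rtree Some) ts)) (\<rho>0 [0]) (\<rho>1 [])"
    using False by (subst aux[symmetric, of _ _ "\<rho>0 []" "\<rho>1 []" "\<rho>f []"]) (auto simp: run_Node)
   then show "trel M z (map_rtree Some (Node a ts)) p q"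
    using r False by (auto simp: run_Node o_def)
  next
   assume "trel M z (map_rtree Some (Node a ts)) p q"
   then obtain t p0 where t: "(p, t, q) \<in> delta M" "p0 \<in> iota M a"
    "chain (map (trel M z) (map (map_rtree Some) ts)) p0 t" by auto
   from t(3) obtain \<rho>0 \<rho>1 \<rho>f where "\<rho>0 [0] = p0" "\<rho>f [length ts - 1] = t" "\<rho>0 [] = p" "\<rho>1 [] = t"
    "\<rho>f [] = q" "frun M ts \<rho>0 \<rho>1 \<rho>f"
    using aux[of p0 t p t q] by auto
   then show "\<exists>\<rho>0 \<rho>1 \<rho>f. \<rho>0 [] = p \<and> \<rho>f [] = q \<and> run M (Node a ts) \<rho>0 \<rho>1 \<rho>f"
    using t False by (intro exI[of _ \<rho>0] exI[of _ \<rho>1] exI[of _ \<rho>f]) (simp add: run_Node)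
  qed
 qed
qed

lemma frun_iff:
 assumes "F ~= []"
 shows "(\<exists>\<rho>0 \<rho>1 \<rho>f. \<rho>0 [0] = p \<and> \<rho>f [length F - 1] = q \<and> frun M F \<rho>0 \<rho>1 \<rho>f)
   \<longleftrightarrow> frel M z (map (map_rtree Some) F) p q"
 unfolding frel_def
proof (subst frun_iff_aux[symmetric, OF _ assms, of M z p q p p p])
 show "(\<exists>\<rho>0 \<rho>1 \<rho>f. \<rho>0 [] = p \<and> \<rho>f [] = q \<and> run M t \<rho>0 \<rho>1 \<rho>f) \<longleftrightarrow> trel M z (map_rtree Some t) p q"
  for t p q by (rule run_iff)
next
 \<comment> \<open>\<open>frun\<close> does not look at \<open>[]\<close>, so the values prescribed
   there can be established afterwards.\<close>
 have "frun M F (\<rho>0([] := p)) (\<rho>1([] := p)) (\<rho>f([] := p)) = frun M F \<rho>0 \<rho>1 \<rho>f" for \<rho>0 \<rho>1 \<rho>f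
  by (simp add: frun_def)
 then show "(\<exists>\<rho>0 \<rho>1 \<rho>f. \<rho>0 [0] = p \<and> \<rho>f [length F - 1] = q \<and> frun M F \<rho>0 \<rho>1 \<rho>f) \<longleftrightarrow>
  (\<exists>\<rho>0 \<rho>1 \<rho>f. \<rho>0 [0] = p \<and> \<rho>f [length F - 1] = q \<and> \<rho>0 [] = p \<and> \<rho>1 [] = p \<and> \<rho>f [] = p \<and> frun M F \<rho>0 \<rho>1 \<rho>f)"
  by (metis (no_types, lifting) fun_upd_other fun_upd_same list.distinct(1))
qed

text \<open>\<open>accepts\<close> states its conditions one kind at a time, each for all vertices.
  Collected per vertex, with only its children involved, they can be matched with the recursion of
  \<open>run\<close>.\<close>

definition local_run :: "('q, 'g) nsta => 'g rtree => (nat list => 'q) => (nat list => 'q) =>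
  (nat list => 'q) => nat list => bool" where
 "local_run M s \<rho>0 \<rho>1 \<rho>f v \<longleftrightarrow> (let n = length (rchildren s) in
   (\<rho>0 v, \<rho>1 v, \<rho>f v) \<in> delta M \<and> (n ~= 0 --> \<rho>0 (v @ [0]) \<in> iota M (rlabel s)) \<and>
   (\<forall>i. Suc i < n --> \<rho>0 (v @ [Suc i]) = \<rho>f (v @ [i])) \<and>
   (n = 0 --> \<rho>1 v \<in> iota M (rlabel s)) \<and> (n ~= 0 --> \<rho>1 v = \<rho>f (v @ [n - 1])))"

lemma run_local:
 "run M t \<rho>0 \<rho>1 \<rho>f \<longleftrightarrow> (\<forall>v \<in> set (tree_preorder t). local_run M (tsub t v) \<rho>0 \<rho>1 \<rho>f v)"
proof (induction t arbitrary: \<rho>0 \<rho>1 \<rho>f)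
 case (Node a ts)
 have sh: "local_run M s (\<lambda>u. \<rho>0 (i # u)) (\<lambda>u. \<rho>1 (i # u)) (\<lambda>u. \<rho>f (i # u)) v =
   local_run M s \<rho>0 \<rho>1 \<rho>f (i # v)" for s i v
  by (simp add: local_run_def)
 have "(\<forall>i < length ts. run M (ts ! i) (\<lambda>u. \<rho>0 (i # u)) (\<lambda>u. \<rho>1 (i # u)) (\<lambda>u. \<rho>f (i # u))) \<longleftrightarrow>
   (\<forall>i < length ts. \<forall>v \<in> set (tree_preorder (ts ! i)). local_run M (tsub (ts ! i) v) \<rho>0 \<rho>1 \<rho>f (i # v))"
  using Node by (auto simp: sh)
 moreover have "(\<forall>v \<in> set (tree_preorder (Node a ts)). P v) \<longleftrightarrow>
   P [] \<and> (\<forall>i < length ts. \<forall>u \<in> set (tree_preorder (ts ! i)). P (i # u))" for P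
  unfolding in_tree_preorder_Node Ball_def by auto
 moreover have "local_run M (Node a ts) \<rho>0 \<rho>1 \<rho>f [] \<longleftrightarrow> (\<rho>0 [], \<rho>1 [], \<rho>f []) \<in> delta M \<and>
   (if ts = [] then \<rho>1 [] \<in> iota M a else \<rho>0 [0] \<in> iota M a \<and> \<rho>1 [] = \<rho>f [length ts - 1]) \<and>
   (\<forall>i. Suc i < length ts --> \<rho>0 [Suc i] = \<rho>f [i])"
  by (auto simp: local_run_def Let_def)
 ultimately show ?case
  by (simp only: run_Node frun_def tsub_Nil tsub_Cons) blast
qed

text \<open>Membership in \<open>states\<close> follows from the transition condition, and the
  sibling condition for the address \<open>[]\<close> is exactly the one between consecutive
  roots.\<close>

lemma accepts_iff_frun:
 assumes "is_nsta \<Gamma> M"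
 shows "accepts M F \<longleftrightarrow> F ~= [] \<and> (\<exists>\<rho>0 \<rho>1 \<rho>f. \<rho>0 [0] = q0 M \<and> \<rho>f [length F - 1] = qf M \<and> frun M F \<rho>0 \<rho>1 \<rho>f)"
proof -
 have loc: "(\<forall>i < length F. run M (F ! i) (\<lambda>u. \<rho>0 (i # u)) (\<lambda>u. \<rho>1 (i # u)) (\<lambda>u. \<rho>f (i # u))) \<longleftrightarrow>
   (\<forall>v \<in> vertices F. local_run M (subtree F v) \<rho>0 \<rho>1 \<rho>f v)" for \<rho>0 \<rho>1 \<rho>f
 proof -
  have "local_run M s (\<lambda>u. \<rho>0 (i # u)) (\<lambda>u. \<rho>1 (i # u)) (\<lambda>u. \<rho>f (i # u)) v =
   local_run M s \<rho>0 \<rho>1 \<rho>f (i # v)" for s i v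
   by (simp add: local_run_def)
  moreover have "(\<forall>v \<in> vertices F. P v) \<longleftrightarrow> (\<forall>i < length F. \<forall>u \<in> set (tree_preorder (F ! i)). P (i # u))"
   for P by (auto simp: in_vertices)
  ultimately show ?thesis unfolding run_local by (simp only: subtree_Cons)
 qed
 have d: "(\<rho>0 v, \<rho>1 v, \<rho>f v) \<in> delta M ==> \<rho>0 v \<in> states M \<and> \<rho>1 v \<in> states M \<and> \<rho>f v \<in> states M"
  for \<rho>0 \<rho>1 \<rho>f :: "nat list => _" and v
  using assms unfolding is_nsta_def by auto
 have key: "((\<forall>v \<in> vertices F. \<rho>0 v \<in> states M \<and> \<rho>1 v \<in> states M \<and> \<rho>f v \<in> states M) \<and>
    (\<forall>u \<in> vertices F. u @ [0] \<in> vertices F --> \<rho>0 (u @ [0]) \<in> iota M (label_of F u)) \<and>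
    (\<forall>u i. u @ [Suc i] \<in> vertices F --> \<rho>0 (u @ [Suc i]) = \<rho>f (u @ [i])) \<and>
    (\<forall>v \<in> vertices F. num_children F v = 0 --> \<rho>1 v \<in> iota M (label_of F v)) \<and>
    (\<forall>v \<in> vertices F. num_children F v ~= 0 -->
      \<rho>1 v = \<rho>f (v @ [num_children F v - 1])) \<and>
    (\<forall>v \<in> vertices F. (\<rho>0 v, \<rho>1 v, \<rho>f v) \<in> delta M)) \<longleftrightarrow> frun M F \<rho>0 \<rho>1 \<rho>f" for \<rho>0 \<rho>1 \<rho>f
 proof -
  have s: "(\<forall>u i. u @ [Suc i] \<in> vertices F --> \<rho>0 (u @ [Suc i]) = \<rho>f (u @ [i])) \<longleftrightarrow>
    (\<forall>i. Suc i < length F --> \<rho>0 [Suc i] = \<rho>f [i]) \<and>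
    (\<forall>v \<in> vertices F. \<forall>i. Suc i < num_children F v --> \<rho>0 (v @ [Suc i]) = \<rho>f (v @ [i]))"
   unfolding vertices_snoc by auto
  have l: "local_run M (subtree F v) \<rho>0 \<rho>1 \<rho>f v \<longleftrightarrow> (\<rho>0 v, \<rho>1 v, \<rho>f v) \<in> delta M \<and>
    (num_children F v ~= 0 --> \<rho>0 (v @ [0]) \<in> iota M (label_of F v)) \<and>
    (\<forall>i. Suc i < num_children F v --> \<rho>0 (v @ [Suc i]) = \<rho>f (v @ [i])) \<and>
    (num_children F v = 0 --> \<rho>1 v \<in> iota M (label_of F v)) \<and>
    (num_children F v ~= 0 --> \<rho>1 v = \<rho>f (v @ [num_children F v - 1]))" for v
   by (simp add: local_run_def Let_def num_children_def label_of_def)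
  have c: "u @ [0] \<in> vertices F \<longleftrightarrow> num_children F u ~= 0" if "u \<in> vertices F" for u
   using that unfolding vertices_snoc by (auto simp: in_vertices)
  show ?thesis
   unfolding frun_def loc s l using c d[of \<rho>0 _ \<rho>1 \<rho>f] by (simp only: ball_conj_distrib) blast
 qed
 have "((\<forall>v \<in> vertices F. \<rho>0 v \<in> states M \<and> \<rho>1 v \<in> states M \<and> \<rho>f v \<in> states M) \<and>
    \<rho>0 [0] = q0 M \<and> \<rho>f [length F - 1] = qf M \<and>
    (\<forall>u \<in> vertices F. u @ [0] \<in> vertices F --> \<rho>0 (u @ [0]) \<in> iota M (label_of F u)) \<and>
    (\<forall>u i. u @ [Suc i] \<in> vertices F --> \<rho>0 (u @ [Suc i]) = \<rho>f (u @ [i])) \<and>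
    (\<forall>v \<in> vertices F. num_children F v = 0 --> \<rho>1 v \<in> iota M (label_of F v)) \<and>
    (\<forall>v \<in> vertices F. num_children F v ~= 0 -->
      \<rho>1 v = \<rho>f (v @ [num_children F v - 1])) \<and>
    (\<forall>v \<in> vertices F. (\<rho>0 v, \<rho>1 v, \<rho>f v) \<in> delta M)) \<longleftrightarrow>
   \<rho>0 [0] = q0 M \<and> \<rho>f [length F - 1] = qf M \<and> frun M F \<rho>0 \<rho>1 \<rho>f" for \<rho>0 \<rho>1 \<rho>f
  unfolding key[symmetric] by blast
 then show ?thesis unfolding accepts_def by (simp only:)
qed

text \<open>\<open>z\<close> is arbitrary: after \<open>map_rtree Some\<close> there is no hole at
  which it could be read.\<close>

theorem accepts_iff_frel:
 assumes "is_nsta \<Gamma> M"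
 shows "accepts M F \<longleftrightarrow> F ~= [] \<and> frel M z (map (map_rtree Some) F) (q0 M) (qf M)"
 using frun_iff[of F "q0 M" "qf M" M z] by (auto simp: accepts_iff_frun[OF assms])

section \<open>Values of forest algebra expressions\<close>

lemma labs_simps [simp]: "labs [] = []" "labs (t # F) = labs_tree t @ labs F" "labs (F @ G) = labs F @ labs G"
 by (simp_all add: labs_def)

lemma num_holes_tree: "num_holes t = count_list (labs_tree t) None"
proof (induction t)
 case (Node l ts)
 have "count_list (concat xs) y = sum_list (map (\<lambda>x. count_list x y) xs)" for xs :: "'a option list list" and y
  by (induction xs) auto
 with Node show ?case by (auto intro!: arg_cong[of _ _ sum_list])
qed

lemma num_holes_forest: "sum_list (map num_holes F) = count_list (labs F) None"
 by (induction F) (auto simp: num_holes_tree)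

lemma is_forest_iff: "is_forest F \<longleftrightarrow> None \<notin> set (labs F)"
 by (simp add: is_forest_def num_holes_forest count_list_0_iff)

lemma is_context_iff: "is_context F \<longleftrightarrow> count_list (labs F) None = 1 \<and> list_all holes_at_leaves F"
 by (simp add: is_context_def num_holes_forest)

definition plugs :: "'a option forest => 'a option forest => 'a option forest" where
 "plugs G F = concat (map (plug G) F)"

lemma plugs_simps [simp]: "plugs G [] = []" "plugs G (t # F) = plug G t @ plugs G F"
 by (simp_all add: plugs_def)

definition subst_hole :: "'a option list => 'a option list => 'a option list" where
 "subst_hole w l = concat (map (\<lambda>x. case x of None => w | Some a => [Some a]) l)"

lemma subst_hole_simps [simp]:
 "subst_hole w [] = []" "subst_hole w (None # l) = w @ subst_hole w l"
 "subst_hole w (Some a # l) = Some a # subst_hole w l"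
 "subst_hole w (k @ l) = subst_hole w k @ subst_hole w l"
 by (simp_all add: subst_hole_def)

lemma subst_hole_id: "None \<notin> set l ==> subst_hole w l = l"
 by (induction l) (auto split: option.splits simp: subst_hole_def)

text \<open>\<open>plug\<close> drops whatever stands below a hole; \<open>holes_at_leaves\<close>
  guarantees that nothing is lost, so that plugging is a substitution in the preorder word.\<close>

lemma labs_plug: "holes_at_leaves t ==> labs (plug G t) = subst_hole (labs G) (labs_tree t)"
proof (induction t)
 case (Node l ts)
 show ?case
 proof (cases l)
  case None
  then show ?thesis using Node.prems by simp
 next
  case (Some a)
  have "list_all holes_at_leaves ts" using Node.prems by (simp add: list_all_iff)
  then have "labs (concat (map (plug G) ts)) = subst_hole (labs G) (concat (map labs_tree ts))"
   using Node.IH by (induction ts) auto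
  then show ?thesis using Some by (simp add: labs_def)
 qed
qed

lemma labs_plugs: "list_all holes_at_leaves F ==> labs (plugs G F) = subst_hole (labs G) (labs F)"
 by (induction F) (auto simp: labs_plug)

lemma holes_at_leaves_plug:
 "holes_at_leaves t ==> list_all holes_at_leaves G ==> list_all holes_at_leaves (plug G t)"
proof (induction t)
 case (Node l ts)
 have "list_all holes_at_leaves ts" using Node.prems by (simp add: list_all_iff)
 then have "list_all holes_at_leaves (concat (map (plug G) ts))"
  using Node by (induction ts) auto
 then show ?case using Node.prems by (auto simp: list_all_iff)
qed

lemma plug_no_hole: "None \<notin> set (labs_tree t) ==> plug G t = [t]"
proof (induction t)
 case (Node l ts)
 then have "concat (map (plug G) ts) = ts" by (induction ts) auto
 with Node.prems show ?case by auto
qed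

lemma plugs_no_hole: "None \<notin> set (labs F) ==> plugs G F = F"
 by (induction F) (auto simp: plug_no_hole)

lemma plug_nonempty: "G ~= [] ==> plug G t ~= []"
 by (cases t) auto

lemma count_list_subst_hole:
 "count_list (subst_hole w l) None = count_list l None * count_list w None"
 by (induction l) (auto split: option.splits simp: subst_hole_def)

lemma vconc_plugs: "vconc F G = (if is_context F then Some (plugs G F) else None)"
 by (simp add: vconc_def plugs_def)

text \<open>\<open>hconc\<close> only rejects two contexts, so its definition alone does not keep
  out values with several or badly placed holes. That every value is a forest or a context has to be
  carried through the induction; nonemptiness comes along and later bounds the intermediate
  states.\<close>

lemma eval_fexp_wf:
 "eval_fexp e = Some F ==> F ~= [] \<and> list_all holes_at_leaves F \<and> (is_forest F \<or> is_context F)"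
proof (induction e arbitrary: F rule: eval_fexp.induct)
 case (3 e1 e2)
 then obtain F1 F2 where F: "eval_fexp e1 = Some F1" "eval_fexp e2 = Some F2" "hconc F1 F2 = Some F"
  by (auto simp: bind_eq_Some_conv)
 then show ?case using 3(1)[OF F(1)] 3(2)[OF F(1,2)]
  by (auto simp: hconc_def is_forest_iff is_context_iff count_list_0_iff split: if_splits)
next
 case (4 e1 e2)
 then obtain F1 F2 where F: "eval_fexp e1 = Some F1" "eval_fexp e2 = Some F2" "vconc F1 F2 = Some F"
  by (auto simp: bind_eq_Some_conv)
 note IH = 4(1)[OF F(1)] 4(2)[OF F(1,2)]
 from F(3) have c: "is_context F1" "F = plugs F2 F1" by (auto simp: vconc_plugs split: if_splits)
 have h: "list_all holes_at_leaves (plugs F2 F1)"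
 proof -
  have "list_all holes_at_leaves F1" using IH by simp
  then show ?thesis by (induction F1) (use IH in \<open>auto simp: holes_at_leaves_plug\<close>)
 qed
 have "plugs F2 F1 ~= []" using IH by (cases F1) (auto simp: plug_nonempty)
 then show ?case using c h IH labs_plugs[of F1 F2]
  by (auto simp: is_forest_iff is_context_iff count_list_subst_hole simp flip: count_list_0_iff)
qed (auto simp: is_forest_iff is_context_iff)

lemma count_list_map_option: "count_list (map (map_option f) l) None = count_list l None"
 by (induction l) auto

abbreviation map_forest :: "('a => 'b) => 'a option forest => 'b option forest" where
 "map_forest f \<equiv> map (map_rtree (map_option f))"

lemma holes_at_leaves_map: "holes_at_leaves (map_rtree (map_option f) t) = holes_at_leaves t"
 by (induction t) (auto simp: list_all_iff)

lemma is_context_map: "is_context (map_forest f F) = is_context F"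
 by (simp add: is_context_iff labs_map count_list_map_option list_all_iff holes_at_leaves_map)

lemma plug_map: "plug (map_forest f G) (map_rtree (map_option f) t) = map_forest f (plug G t)"
proof (induction t)
 case (Node l ts)
 have "concat (map (plug (map_forest f G)) (map_forest f ts)) = map_forest f (concat (map (plug G) ts))"
  using Node by (induction ts) auto
 then show ?case by auto
qed

lemma plugs_map: "plugs (map_forest f G) (map_forest f F) = map_forest f (plugs G F)"
 by (induction F) (auto simp: plug_map)

text \<open>Relabelling does not touch holes, so it commutes with evaluation. With
  \<open>fst\<close> this says that erasing the marks of an expression erases the marks of its
  value.\<close>

lemma eval_fexp_map:
 "eval_fexp (map_btree (map_fsym f) e) = map_option (map_forest f) (eval_fexp e)"
proof (induction e rule: eval_fexp.induct)
 case (3 e1 e2)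
 then show ?case
  by (cases "eval_fexp e1"; cases "eval_fexp e2") (auto simp: hconc_def is_context_map)
next
 case (4 e1 e2)
 then show ?case
  by (cases "eval_fexp e1"; cases "eval_fexp e2") (auto simp: vconc_plugs is_context_map plugs_map)
qed auto

section \<open>Relations of contexts and of plugging\<close>

lemma trel_no_hole: "None \<notin> set (labs_tree t) ==> trel M z t = trel M z' t"
proof (induction t)
 case (Node l ts)
 then have m: "map (trel M z) ts = map (trel M z') ts" by auto
 show ?case
 proof (cases l)
  case None
  then show ?thesis using Node.prems by simp
 next
  case (Some a)
  then show ?thesis by (simp only: trel.simps m option.case)
 qed
qed

lemma frel_no_hole: "None \<notin> set (labs F) ==> frel M z F = frel M z' F"
proof -
 assume "None \<notin> set (labs F)"
 then have "map (trel M z) F = map (trel M z') F"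
  by (induction F) (simp_all add: trel_no_hole[of _ M z z'])
 then show ?thesis by (simp only: frel_def)
qed

lemma frel_append: "frel M z (F @ G) p q \<longleftrightarrow> (\<exists>r. frel M z F p r \<and> frel M z G r q)"
 by (simp add: frel_def chain_append)

lemma frel_simps [simp]: "frel M z [] p q \<longleftrightarrow> p = q"
 "frel M z (t # F) p q \<longleftrightarrow> (\<exists>r. trel M z t p r \<and> frel M z F r q)"
 by (simp_all add: frel_def)

lemma trel_Node: "trel M z (Node l ts) p q \<longleftrightarrow> (case l of None => z = (p, q) | Some a =>
   \<exists>t p0. (p, t, q) \<in> delta M \<and> p0 \<in> iota M a \<and> frel M z ts p0 t)"
 by (simp add: frel_def split: option.splits)

declare trel.simps [simp del]

text \<open>Exactly one tree contains the hole. The other relations do not depend on the pair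
  \<open>y\<close>, so the existential over \<open>y\<close> can be pulled out of the chain. The
  first assumption is the induction hypothesis of \<open>trel_plug\<close>.\<close>

lemma frel_plugs_aux:
 assumes "\<And>t p q. t \<in> set F ==> count_list (labs_tree t) None = 1 ==>
   frel M z (plug G t) p q \<longleftrightarrow> (\<exists>y. trel M y t p q \<and> frel M z G (fst y) (snd y))"
  and "count_list (labs F) None = 1"
 shows "frel M z (plugs G F) p q \<longleftrightarrow> (\<exists>y. frel M y F p q \<and> frel M z G (fst y) (snd y))"
 using assms
proof (induction F arbitrary: p q)
 case (Cons t F)
 show ?case
 proof (cases "count_list (labs_tree t) None = 1")
  case True
  then have n: "None \<notin> set (labs F)" using Cons.prems(2) by (simp add: count_list_0_iff)
  have t: "frel M z (plug G t) p r \<longleftrightarrow> (\<exists>y. trel M y t p r \<and> frel M z G (fst y) (snd y))" for r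
   using Cons.prems(1)[of t] True by simp
  \<comment> \<open>One relation \<open>R\<close> serves all \<open>y\<close>, because the remaining
    trees have no hole.\<close>
  obtain R where "frel M y F = R" for y using frel_no_hole[OF n] by metis
  then show ?thesis using n by (simp add: frel_append plugs_no_hole t del: split_paired_Ex) blast
 next
  case False
  then have n: "None \<notin> set (labs_tree t)" and c: "count_list (labs F) None = 1"
   using Cons.prems(2) by (auto simp: count_list_0_iff[symmetric])
  have "frel M z (plugs G F) r q \<longleftrightarrow> (\<exists>y. frel M y F r q \<and> frel M z G (fst y) (snd y))" for r
   using Cons.IH[OF _ c] Cons.prems(1) by auto
  moreover obtain R where "trel M y t = R" for y using trel_no_hole[OF n] by metis
  ultimately show ?thesis using n by (simp add: frel_append plug_no_hole del: split_paired_Ex) blast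
 qed
qed simp

lemma trel_plug:
 "count_list (labs_tree t) None = 1 ==> holes_at_leaves t ==>
   frel M z (plug G t) p q \<longleftrightarrow> (\<exists>y. trel M y t p q \<and> frel M z G (fst y) (snd y))"
proof (induction t arbitrary: p q)
 case (Node l ts)
 show ?case
 proof (cases l)
  case None
  then show ?thesis by (simp add: trel_Node)
 next
  case (Some a)
  have h: "holes_at_leaves t" if "t \<in> set ts" for t using Node.prems(2) that by (auto simp: list_all_iff)
  have "frel M z (plugs G ts) p q \<longleftrightarrow> (\<exists>y. frel M y ts p q \<and> frel M z G (fst y) (snd y))" for p q
   by (rule frel_plugs_aux) (use Node h Some in \<open>auto simp: labs_def\<close>)
  then show ?thesis using Some unfolding plug.simps plugs_def[symmetric] by (auto simp: trel_Node)
 qed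
qed

lemma frel_plugs:
 "is_context F ==>
   frel M z (plugs G F) p q \<longleftrightarrow> (\<exists>y. frel M y F p q \<and> frel M z G (fst y) (snd y))"
 by (rule frel_plugs_aux) (auto simp: is_context_iff list_all_iff trel_plug)

lemma trel_range:
 "delta M \<subseteq> Q \<times> Q \<times> Q ==> z \<in> Q \<times> Q ==> trel M z t p q ==> p \<in> Q \<and> q \<in> Q"
 by (cases t) (auto simp: trel_Node split: option.splits)

text \<open>The empty forest relates every state to itself, also outside of \<open>Q\<close>; hence
  the assumption of nonemptiness. The lemma allows quantifiers over intermediate states to be
  bounded by \<open>m\<close>.\<close>

lemma frel_range:
 assumes "delta M \<subseteq> Q \<times> Q \<times> Q" "z \<in> Q \<times> Q" "F ~= []" "frel M z F p q"
 shows "p \<in> Q \<and> q \<in> Q"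
 using assms(3,4)
proof (induction F arbitrary: p)
 case (Cons t F)
 then obtain r where r: "trel M z t p r" "frel M z F r q" by auto
 show ?case using trel_range[OF assms(1,2) r(1)] Cons.IH[OF _ r(2)] r(2) by (cases F) auto
qed simp

section \<open>Positions\<close>

text \<open>
 The positions of a word with at most one hole: the part before the hole is numbered from \<open>x\<close>,
 the part after it from \<open>y\<close>.
\<close>

fun mp :: "('a => bool) => 'a option list => nat => nat => nat set" where
 "mp P [] x y = {}"
| "mp P (None # l) x y = mp P l y y"
| "mp P (Some a # l) x y = (if P a then {x} else {}) \<union> mp P l (Suc x) y"

text \<open>With a hole, \<open>lc\<close> and \<open>rc\<close> are the lengths of the parts before
  and after it; without a hole they are the whole length and 0.\<close>

definition lc :: "'a option list => nat" where
 "lc l = length (takeWhile (\<lambda>x. x ~= None) l)"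

definition rc :: "'a option list => nat" where
 "rc l = length (tl (dropWhile (\<lambda>x. x ~= None) l))"

lemma lc_no_hole: "None \<notin> set l ==> lc l = length l"
proof (induction l)
 case (Cons a l)
 then show ?case by (cases a) (auto simp: lc_def)
qed (simp add: lc_def)

lemma rc_no_hole: "None \<notin> set l ==> rc l = 0"
proof (induction l)
 case (Cons a l)
 then show ?case by (cases a) (auto simp: rc_def)
qed (simp add: rc_def)

lemma lc_hole: "None \<notin> set u ==> lc (u @ None # v) = length u"
proof (induction u)
 case (Cons a u)
 then show ?case by (cases a) (auto simp: lc_def)
qed (simp add: lc_def)

lemma rc_hole: "None \<notin> set u ==> rc (u @ None # v) = length v"
proof (induction u)
 case (Cons a u)
 then show ?case by (cases a) (auto simp: rc_def)
qed (simp add: rc_def)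

lemma lc_map [simp]: "lc (map (map_option f) l) = lc l"
 by (induction l) (auto simp: lc_def)

lemma rc_map [simp]: "rc (map (map_option f) l) = rc l"
 by (induction l) (auto simp: rc_def)

text \<open>The second start is read only behind a hole, so on a hole-free prefix it may be replaced
  by any \<open>y'\<close>.\<close>

lemma mp_append: "None \<notin> set u ==> mp P (u @ v) x y = mp P u x y' \<union> mp P v (x + length u) y"
proof (induction u arbitrary: x)
 case (Cons a u)
 then show ?case by (cases a) auto
qed simp

lemma mp_hole: "None \<notin> set u ==> mp P (u @ None # v) x y = mp P u x y' \<union> mp P v y y"
 by (simp add: mp_append[of u P "None # v" x y y'])

lemma mp_no_hole: "None \<notin> set u ==> mp P u x y = mp P u x y'"
 using mp_append[of u P "[]" x y y'] by simp

lemma mp_forest: "mp P (map Some l) x y = {x + i | i. i < length l \<and> P (l ! i)}"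
proof (induction l arbitrary: x)
 case (Cons a l)
 have "{x + i | i. i < length (a # l) \<and> P ((a # l) ! i)} =
  (if P a then {x} else {}) \<union> {Suc x + i | i. i < length l \<and> P (l ! i)}"
  by (auto simp: less_Suc_eq_0_disj)
 then show ?case using Cons by simp
qed simp

lemma no_hole_map_Some: "None \<notin> set l \<longleftrightarrow> (\<exists>k. l = map Some k)"
proof
 assume "None \<notin> set l"
 then have "l = map Some (map the l)"
  by (intro nth_equalityI) (auto simp: in_set_conv_nth)
 then show "\<exists>k. l = map Some k" ..
qed auto

lemma mp_all:
 assumes "count_list l None \<le> 1"
 shows "mp (\<lambda>_. True) l x y = {x..<x + lc l} \<union> {y..<y + rc l}"
proof -
 have f: "mp (\<lambda>_. True) u x y = {x..<x + length u}" if nh: "None \<notin> set u" for u :: "'a option list" and x y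
 proof -
  obtain k where k: "u = map Some k" using no_hole_map_Some[THEN iffD1, OF nh] by (rule exE)
  have "{x + i |i. i < length k} = {x..<x + length k}"
  proof (intro set_eqI iffI)
   fix j assume "j \<in> {x..<x + length k}"
   then have "j = x + (j - x) \<and> j - x < length k" by auto
   then show "j \<in> {x + i |i. i < length k}" by blast
  qed auto
  then show ?thesis by (simp add: k mp_forest)
 qed
 show ?thesis
 proof (cases "None \<in> set l")
  case False
  then show ?thesis by (simp add: f lc_no_hole rc_no_hole)
 next
  case True
  then obtain u v where l: "l = u @ None # v" "None \<notin> set u" by (metis split_list_first)
  then have "count_list v None = 0" using assms by (simp add: count_list_0_iff)
  then have v: "None \<notin> set v" by (simp add: count_list_0_iff)
  show ?thesis using l v by (simp add: mp_hole[of u _ v x y x] f lc_hole rc_hole)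
 qed
qed

section \<open>Offset maps\<close>

text \<open>
 A pair \<open>p\<close> consists of the first position of the part before the hole and of the first position
 of the part after it. Every entry of the pair passed to a subexpression is an entry of the
 current pair (selected by the first component) plus a constant.
\<close>

type_synonym elm = "nat \<times> nat"
type_synonym emap = "elm \<times> elm"

definition ev :: "elm => nat \<times> nat => nat" where
 "ev e p = (if fst e = 0 then fst p else snd p) + snd e"

definition ap :: "emap => nat \<times> nat => nat \<times> nat" where
 "ap f p = (ev (fst f) p, ev (snd f) p)"

definition idm :: emap where "idm = ((0, 0), (1, 0))"

definition cme :: "emap => elm => elm" where
 "cme f e = (if fst e = 0 then (fst (fst f), snd (fst f) + snd e) else (fst (snd f), snd (snd f) + snd e))"

text \<open>Composition in the order of the path: \<open>f\<close> leads to a child and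
  \<open>g\<close> further down, see \<open>ap_cm\<close>.\<close>

definition cm :: "emap => emap => emap" where
 "cm f g = (cme f (fst g), cme f (snd g))"

lemma ev_cme [simp]: "ev (cme f e) p = ev e (ap f p)"
 by (auto simp: ev_def cme_def ap_def)

lemma ap_cm [simp]: "ap (cm f g) p = ap g (ap f p)"
 by (simp add: ap_def cm_def)

lemma ap_idm [simp]: "ap idm p = p"
 by (simp add: ap_def idm_def ev_def)

lemma cm_idm [simp]: "cm f idm = f"
 by (simp add: cm_def idm_def cme_def)

text \<open>Kind 2 is concatenation, which leaves the starts of the left operand unchanged. For
  plugging, the left operand keeps its first start. The part behind its hole begins after the
  \<open>L1\<close> letters before the hole and the \<open>L2\<close> letters of a plugged forest,
  or, if a context is plugged in, after the \<open>R2\<close> letters that follow the inner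
  hole.\<close>

definition lmap :: "nat => nat => nat => nat => nat => emap" where
 "lmap k t2 L1 L2 R2 = (if k = 2 then idm else if t2 = 0 then ((0, 0), (0, L1 + L2)) else ((0, 0), (1, R2)))"

text \<open>The right operand starts after the \<open>L1\<close> letters in front of it. Only if a
  context stands to its left does it lie behind the hole, and then it starts after the
  \<open>R1\<close> letters that follow this hole.\<close>

definition rmap :: "nat => nat => nat => nat => emap" where
 "rmap k t1 L1 R1 = (if k = 2 \<and> t1 ~= 0 then ((1, R1), (1, 0)) else ((0, L1), (1, 0)))"

definition ty :: "'a option list => nat" where
 "ty w = (if None \<in> set w then 1 else 0)"

definition wop :: "nat => 'a option list => 'a option list => 'a option list" where
 "wop k w1 w2 = (if k = 2 then w1 @ w2 else subst_hole w2 w1)"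

text \<open>The definedness conditions of both operations, read off the words of the
  operands.\<close>

definition wpre :: "nat => 'a option list => 'a option list => bool" where
 "wpre k w1 w2 \<longleftrightarrow> count_list w1 None \<le> 1 \<and> count_list w2 None \<le> 1 \<and>
   (if k = 2 then ty w1 = 0 \<or> ty w2 = 0 else count_list w1 None = 1)"

lemma one_hole:
 assumes "count_list w None \<le> 1" "None \<in> set w"
 obtains u v where "w = u @ None # v" "None \<notin> set u" "None \<notin> set v"
proof -
 obtain u v where w: "w = u @ None # v" "None \<notin> set u" using assms(2) by (metis split_list_first)
 then have "count_list v None = 0" using assms by (simp add: count_list_0_iff)
 then show ?thesis using that w by (simp add: count_list_0_iff)
qed

lemma wop_cases:
 assumes "wpre k w1 w2"
 obtains (FF) "k = 2" "None \<notin> set w1" "None \<notin> set w2"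
 | (FC) u v where "k = 2" "None \<notin> set w1" "w2 = u @ None # v" "None \<notin> set u" "None \<notin> set v"
 | (CF) u v where "k = 2" "None \<notin> set w2" "w1 = u @ None # v" "None \<notin> set u" "None \<notin> set v"
 | (VF) u v where "k ~= 2" "None \<notin> set w2" "w1 = u @ None # v" "None \<notin> set u" "None \<notin> set v"
 | (VC) u v u' v' where "k ~= 2" "w2 = u' @ None # v'" "None \<notin> set u'" "None \<notin> set v'"
   "w1 = u @ None # v" "None \<notin> set u" "None \<notin> set v"
proof (cases "k = 2")
 case True
 then have d: "None \<notin> set w1 \<or> None \<notin> set w2" using assms by (auto simp: wpre_def ty_def split: if_splits)
 show ?thesis
 proof (cases "None \<in> set w1")
  case True
  then show ?thesis using assms d one_hole[of w1] CF \<open>k = 2\<close> unfolding wpre_def by metis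
 next
  case False
  then show ?thesis using assms one_hole[of w2] FF FC \<open>k = 2\<close> unfolding wpre_def by metis
 qed
next
 case False
 then have "count_list w1 None = 1" using assms by (simp add: wpre_def)
 then have "None \<in> set w1" "count_list w1 None \<le> 1" using count_notin by fastforce+
 then show ?thesis using assms False one_hole[of w1] one_hole[of w2] VF VC unfolding wpre_def by metis
qed

lemma wop_info:
 assumes "wpre k w1 w2"
 shows "count_list (wop k w1 w2) None \<le> 1"
  and "ty (wop k w1 w2) = (if k = 2 \<and> ty w1 ~= 0 then 1 else ty w2)"
  and "lc (wop k w1 w2) = (if k = 2 then if ty w1 = 0 then lc w1 + lc w2 else lc w1
      else if ty w2 = 0 then lc w1 + lc w2 + rc w1 else lc w1 + lc w2)"
  and "rc (wop k w1 w2) = (if k = 2 then if ty w1 = 0 then rc w2 else rc w1 + lc w2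
      else if ty w2 = 0 then 0 else rc w2 + rc w1)"
proof -
 have t: "lc (u @ w) = length u + lc w" if "None \<notin> set u" for u w :: "'a option list"
  using that
 proof (induction u)
  case (Cons a u)
  then show ?case by (cases a) (auto simp: lc_def)
 qed simp
 have r: "rc (u @ w) = rc w" if "None \<notin> set u" for u w :: "'a option list"
  using that
 proof (induction u)
  case (Cons a u)
  then show ?case by (cases a) (auto simp: rc_def)
 qed simp
 have h: "lc (None # u) = 0" "rc (None # u) = length u" for u :: "'a option list"
  by (simp_all add: lc_def rc_def)
 from assms show "count_list (wop k w1 w2) None \<le> 1"
  by (cases rule: wop_cases) (auto simp: wop_def subst_hole_id count_notin)
 from assms show "ty (wop k w1 w2) = (if k = 2 \<and> ty w1 ~= 0 then 1 else ty w2)"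
  by (cases rule: wop_cases) (auto simp: wop_def subst_hole_id ty_def)
 from assms show "lc (wop k w1 w2) = (if k = 2 then if ty w1 = 0 then lc w1 + lc w2 else lc w1
      else if ty w2 = 0 then lc w1 + lc w2 + rc w1 else lc w1 + lc w2)"
  by (cases rule: wop_cases) (auto simp: wop_def subst_hole_id ty_def lc_hole rc_hole lc_no_hole rc_no_hole t h)
 from assms show "rc (wop k w1 w2) = (if k = 2 then if ty w1 = 0 then rc w2 else rc w1 + lc w2
      else if ty w2 = 0 then 0 else rc w2 + rc w1)"
  by (cases rule: wop_cases) (auto simp: wop_def subst_hole_id ty_def lc_hole rc_hole lc_no_hole rc_no_hole r h)
qed

abbreviation mpp :: "('a => bool) => 'a option list => nat \<times> nat => nat set" where
 "mpp P w p \<equiv> mp P w (fst p) (snd p)"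

text \<open>Each operand is shifted blockwise: the block before its hole and the block after it move
  independently, each as a whole. This is why one affine term per block suffices.\<close>

lemma mp_wop:
 assumes "wpre k w1 w2"
 shows "mpp P (wop k w1 w2) p = mpp P w1 (ap (lmap k (ty w2) (lc w1) (lc w2) (rc w2)) p)
   \<union> mpp P w2 (ap (rmap k (ty w1) (lc w1) (rc w1)) p)"
proof -
 obtain x y where p: "p = (x, y)" by (cases p)
 have a: "mp P (u @ v) x y = mp P u x 0 \<union> mp P v (x + length u) y" if "None \<notin> set u" for u v :: "'a option list" and x y
  using that by (rule mp_append)
 \<comment> \<open>The second start of a hole-free word is normalized to 0, to compare instances
   that differ only there.\<close>
 have n: "mp P u x y = mp P u x 0" if "None \<notin> set u" for u :: "'a option list" and x y
  using that by (rule mp_no_hole)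
 from assms show ?thesis
 proof (cases rule: wop_cases)
  case FF
  then show ?thesis using n[of w2 "x + length w1" y] n[of w1 x y]
   by (simp add: p wop_def ap_def lmap_def rmap_def ty_def ev_def idm_def lc_no_hole a)
 next
  case (FC u v)
  then show ?thesis using n[of w1 x y]
   by (simp add: p wop_def ap_def lmap_def rmap_def ty_def ev_def idm_def lc_no_hole a)
 next
  case (CF u v)
  then show ?thesis using n[of w2 "y + length v" y] n[of v y y]
   by (simp add: p wop_def ap_def lmap_def rmap_def ty_def ev_def idm_def rc_hole a Un_assoc)
 next
  case (VF u v)
  then show ?thesis using n[of w2 "x + length u" y] n[of v "x + (length u + length w2)" y]
    n[of v "x + (length u + length w2)" "x + (length u + length w2)"]
   by (simp add: p wop_def ap_def lmap_def rmap_def ty_def ev_def lc_hole lc_no_hole a subst_hole_id add.assoc) blast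
 next
  case (VC u v u' v')
  then show ?thesis using n[of v' y y] n[of v "y + length v'" y] n[of v "y + length v'" "y + length v'"]
   by (simp add: p wop_def ap_def lmap_def rmap_def ty_def ev_def lc_hole rc_hole a subst_hole_id) blast
 qed
qed

lemma mp_mono: "mp P l x y \<subseteq> mp (\<lambda>_. True) l x y"
 by (induction P l x y rule: mp.induct) auto

text \<open>The block before the hole has to end before the block behind it begins; the gap is where
  plugged material goes. A forest has a single block and hence no condition.\<close>

definition valid :: "'a option list => nat \<times> nat => bool" where
 "valid w p \<longleftrightarrow> (ty w ~= 0 --> fst p + lc w \<le> snd p)"

text \<open>Disjointness of the positions of the operands is the source of unique decomposition, and
  hence of enumeration without repetition.\<close>

lemma valid_wop:
 assumes "wpre k w1 w2" "valid (wop k w1 w2) p"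
 defines "p1 \<equiv> ap (lmap k (ty w2) (lc w1) (lc w2) (rc w2)) p"
  and "p2 \<equiv> ap (rmap k (ty w1) (lc w1) (rc w1)) p"
 shows "valid w1 p1" "valid w2 p2"
  "mpp (\<lambda>_. True) w1 p1 \<inter> mpp (\<lambda>_. True) w2 p2 = {}"
proof -
 note i = wop_info[OF assms(1)]
 have c: "count_list w1 None \<le> 1" "count_list w2 None \<le> 1" using assms(1) by (auto simp: wpre_def)
 have r: "rc w = 0" if "ty w = 0" for w :: "'a option list"
  using that by (auto simp: ty_def rc_no_hole split: if_splits)
 have t: "ty w1 = 0 \<or> ty w2 = 0" if "k = 2" using that assms(1) by (auto simp: wpre_def)
 have t': "ty w1 = 1" if "k ~= 2"
  using that assms(1) count_notin[of None w1] by (auto simp: wpre_def ty_def)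
 show "valid w1 p1" "valid w2 p2"
  using assms(2) t t' unfolding valid_def i p1_def p2_def
  by (auto simp: ap_def lmap_def rmap_def ev_def idm_def split: if_splits)
 show "mpp (\<lambda>_. True) w1 p1 \<inter> mpp (\<lambda>_. True) w2 p2 = {}"
  using assms(2) t t' r[of w1] r[of w2] unfolding mp_all[OF c(1)] mp_all[OF c(2)] valid_def i p1_def p2_def
  by (cases "k = 2"; cases "ty w1 = 0"; cases "ty w2 = 0")
   (auto simp: ap_def lmap_def rmap_def ev_def idm_def)
qed

section \<open>Marked expressions\<close>

definition wd :: "'a fsym btree => 'a option list" where
 "wd e = labs (the (eval_fexp e))"

abbreviation erase :: "('a \<times> bool) fsym btree => 'a fsym btree" where
 "erase \<equiv> map_btree (map_fsym fst)"

lemma wd_BLeaf [simp]: "wd (BLeaf (Atom a)) = [Some a]" "wd (BLeaf (CtxAtom a)) = [Some a, None]"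
 by (simp_all add: wd_def)

lemma wd_count: "eval_fexp e ~= None ==> count_list (wd e) None \<le> 1"
 using eval_fexp_wf[of e] by (auto simp: wd_def is_forest_iff is_context_iff count_notin)

lemma eval_BNode:
 assumes "eval_fexp (BNode l e1 e2) ~= None"
 obtains F1 F2 where "l = HConc \<or> l = VConc" "eval_fexp e1 = Some F1" "eval_fexp e2 = Some F2"
  "eval_fexp (BNode l e1 e2) = Some (if l = HConc then F1 @ F2 else plugs F2 F1)"
  "l = VConc ==> is_context F1"
  "wpre (kind_code l) (wd e1) (wd e2)" "wd (BNode l e1 e2) = wop (kind_code l) (wd e1) (wd e2)"
proof -
 have l: "l = HConc \<or> l = VConc" using assms by (cases l) auto
 obtain F1 F2 where F: "eval_fexp e1 = Some F1" "eval_fexp e2 = Some F2"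
  using assms l by (auto simp: bind_eq_Some_conv)
 note wf = eval_fexp_wf[OF F(1)] eval_fexp_wf[OF F(2)]
 have c: "count_list (labs F1) None \<le> 1" "count_list (labs F2) None \<le> 1"
  using wd_count[of e1] wd_count[of e2] F by (auto simp: wd_def)
 show ?thesis
 proof (cases "l = HConc")
  case True
  then have h: "\<not> (is_context F1 \<and> is_context F2)" using assms F by (auto simp: hconc_def)
  then have "\<not> (None \<in> set (labs F1) \<and> None \<in> set (labs F2))" using wf by (auto simp: is_forest_iff)
  then show ?thesis using that[of F1 F2] F h c True
   by (auto simp: hconc_def wpre_def wop_def wd_def ty_def)
 next
  case False
  then have v: "l = VConc" "is_context F1" using l assms F by (auto simp: vconc_plugs split: if_splits)
  then have "labs (plugs F2 F1) = subst_hole (labs F2) (labs F1)"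
   using wf by (intro labs_plugs) simp
  then show ?thesis using that[of F1 F2] F v c
   by (auto simp: vconc_plugs wpre_def wop_def wd_def is_context_iff)
 qed
qed

lemma eval_erase: "eval_fexp (erase e') = map_option (map_forest fst) (eval_fexp e')"
 by (rule eval_fexp_map)

lemma wd_erase:
 assumes "erase e' = e" "eval_fexp e ~= None"
 shows "eval_fexp e' ~= None" "wd e = map (map_option fst) (wd e')"
  "ty (wd e') = ty (wd e)" "lc (wd e') = lc (wd e)" "rc (wd e') = rc (wd e)"
proof -
 obtain F where F: "eval_fexp e' = Some F" using assms eval_erase[of e'] by auto
 then have "eval_fexp e = Some (map_forest fst F)" using eval_erase[of e'] assms(1) by simp
 with F show "eval_fexp e' ~= None" and w: "wd e = map (map_option fst) (wd e')"
  by (auto simp: wd_def labs_map)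
 show "ty (wd e') = ty (wd e)" unfolding w by (auto simp: ty_def)
 show "lc (wd e') = lc (wd e)" "rc (wd e') = rc (wd e)" unfolding w by simp_all
qed

lemma map_btree_BNode:
 "map_btree f e' = BNode l e1 e2 \<longleftrightarrow>
   (\<exists>l' e1' e2'. e' = BNode l' e1' e2' \<and> f l' = l \<and> map_btree f e1' = e1 \<and> map_btree f e2' = e2)"
 by (cases e') auto

lemma map_btree_BLeaf: "map_btree f e' = BLeaf l \<longleftrightarrow> (\<exists>l'. e' = BLeaf l' \<and> f l' = l)"
 by (cases e') auto

lemma map_fsym_eq:
 "map_fsym f l = HConc \<longleftrightarrow> l = HConc" "map_fsym f l = VConc \<longleftrightarrow> l = VConc"
 "map_fsym f l = Atom a \<longleftrightarrow> (\<exists>b. l = Atom b \<and> f b = a)"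
 "map_fsym f l = CtxAtom a \<longleftrightarrow> (\<exists>b. l = CtxAtom b \<and> f b = a)"
 by (cases l; auto)+

definition lm :: "'a fsym => 'a fsym btree => 'a fsym btree => emap" where
 "lm l e1 e2 = lmap (kind_code l) (ty (wd e2)) (lc (wd e1)) (lc (wd e2)) (rc (wd e2))"

definition rm :: "'a fsym => 'a fsym btree => emap" where
 "rm l e1 = rmap (kind_code l) (ty (wd e1)) (lc (wd e1)) (rc (wd e1))"

text \<open>The converse of reading off positions: the pair is handed down by the offset maps, and
  each leaf has exactly one letter, located at the first entry of its pair.\<close>

primrec mke :: "'a fsym btree => nat set => nat \<times> nat => ('a \<times> bool) fsym btree" where
 "mke (BLeaf l) S p = BLeaf (map_fsym (\<lambda>a. (a, fst p \<in> S)) l)"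
| "mke (BNode l e1 e2) S p = BNode (map_fsym (\<lambda>a. (a, True)) l)
   (mke e1 S (ap (lm l e1 e2) p)) (mke e2 S (ap (rm l e1) p))"

lemma erase_mke: "erase (mke e S p) = e"
 by (induction e arbitrary: p) (auto simp: fsym.map_comp o_def fsym.map_ident)

lemma kind_code_erase: "map_fsym f l = l' ==> kind_code l = kind_code l'"
 by (cases l) auto

text \<open>Marks change neither types nor lengths, so the offset maps of the unmarked expression
  also place the marked one.\<close>

lemma mpp_erase_BNode:
 assumes "eval_fexp (BNode l e1 e2) ~= None" "erase e1' = e1" "erase e2' = e2" "map_fsym fst l' = l"
 shows "mpp P (wd (BNode l' e1' e2')) p =
  mpp P (wd e1') (ap (lm l e1 e2) p) \<union> mpp P (wd e2') (ap (rm l e1) p)"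
proof -
 have "erase (BNode l' e1' e2') = BNode l e1 e2" using assms by simp
 then have ok: "eval_fexp (BNode l' e1' e2') ~= None" using wd_erase(1) assms(1) by metis
 obtain F1 F2 where n: "eval_fexp e1 = Some F1" "eval_fexp e2 = Some F2"
  using eval_BNode[OF assms(1)] by metis
 obtain F1' F2' where b: "wpre (kind_code l') (wd e1') (wd e2')"
  "wd (BNode l' e1' e2') = wop (kind_code l') (wd e1') (wd e2')"
  using eval_BNode[OF ok] by metis
 show ?thesis unfolding b(2) mp_wop[OF b(1)] lm_def rm_def
  using wd_erase[OF assms(2)] wd_erase[OF assms(3)] n kind_code_erase[OF assms(4)] by simp
qed

lemma mpp_BNode:
 assumes "eval_fexp (BNode l e1 e2) ~= None"
 shows "mpp P (wd (BNode l e1 e2)) p =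
  mpp P (wd e1) (ap (lm l e1 e2) p) \<union> mpp P (wd e2) (ap (rm l e1) p)"
 using eval_BNode[OF assms] mp_wop[of "kind_code l" "wd e1" "wd e2"] unfolding lm_def rm_def by metis

lemma mpp_mke:
 "eval_fexp e ~= None ==> mpp snd (wd (mke e S p)) p = S \<inter> mpp (\<lambda>_. True) (wd e) p"
proof (induction e arbitrary: p)
 case (BLeaf l)
 then show ?case by (cases l) auto
next
 case (BNode l e1 e2)
 have n: "eval_fexp e1 ~= None" "eval_fexp e2 ~= None"
  using eval_BNode[OF BNode.prems] by (metis option.distinct(1))+
 have m: "map_fsym fst (map_fsym (\<lambda>a. (a, True)) l) = l"
  by (simp add: fsym.map_comp o_def fsym.map_ident)
 show ?case
  unfolding mke.simps mpp_erase_BNode[OF BNode.prems erase_mke erase_mke m] mpp_BNode[OF BNode.prems]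
  using BNode.IH n by auto
qed

section \<open>States of the deterministic automaton\<close>

definition enc :: "nat => (nat => bool) => nat" where
 "enc K Z = (\<Sum>i<K. if Z i then 2 ^ i else 0)"

lemma enc_0 [simp]: "enc 0 Z = 0"
 by (simp add: enc_def)

lemma enc_Suc: "enc (Suc K) Z = enc K Z + (if Z K then 2 ^ K else 0)"
 by (simp add: enc_def)

lemma enc_less: "enc K Z < 2 ^ K"
 by (induction K) (auto simp: enc_Suc)

lemma enc_cong: "(\<And>i. i < K ==> Z i = Z' i) ==> enc K Z = enc K Z'"
 by (simp add: enc_def)

text \<open>The Horner form connects the code of a set with \<open>bit\<close>, by which membership
  is tested from now on.\<close>

lemma enc_horner: "enc K Z = horner_sum of_bool 2 (map Z [0..<K])"
 unfolding enc_def horner_sum_eq_sum by (rule sum.cong) auto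

lemma bit_enc: "bit (enc K Z) i \<longleftrightarrow> i < K \<and> Z i"
 by (auto simp: enc_horner bit_horner_sum_bit_iff)

lemma mult_add_less: "a < x ==> b < y ==> a * y + b < x * (y :: nat)"
proof -
 assume "a < x" "b < y"
 then have "a * y + b < Suc a * y" by simp
 also have "\<dots> \<le> x * y" using \<open>a < x\<close> by (intro mult_le_mono1) simp
 finally show ?thesis .
qed

section \<open>The deterministic automaton on marked expressions\<close>

locale automaton =
 fixes \<sigma> m :: nat and M :: "(nat, nat \<times> bool) nsta"
 assumes nsta: "is_nsta ({..<\<sigma>} \<times> UNIV) M" and states: "states M = {..<m}"
begin

abbreviation "K \<equiv> m ^ 4"

lemma delta_sub: "delta M \<subseteq> {..<m} \<times> {..<m} \<times> {..<m}"
 using nsta states by (auto simp: is_nsta_def)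

lemma q_less: "q0 M < m" "qf M < m"
 using nsta states by (auto simp: is_nsta_def)

lemma m_pos: "0 < m" using q_less by simp

text \<open>
 A state is a set of quadruples \<open>(p, q, p', q')\<close>, i.e. there is a run from \<open>p\<close> to \<open>q\<close> on the
 context provided that the hole is passed from \<open>p'\<close> to \<open>q'\<close>. Forests are treated as contexts whose
 relation does not depend on \<open>(p', q')\<close>, which makes both operations uniform.
\<close>

definition idx :: "nat => nat => nat => nat" where
 "idx p q z = (p * m + q) * m\<^sup>2 + z"

definition stz :: "nat => nat \<times> nat" where "stz z = (z div m, z mod m)"

definition st :: "(nat \<times> bool) fsym btree => nat" where
 "st e = enc K (\<lambda>i. frel M (stz (i mod m\<^sup>2)) (the (eval_fexp e)) (i div m\<^sup>2 div m) (i div m\<^sup>2 mod m))"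

text \<open>Concatenation composes the relations for one fixed hole pair; handing the same pair to
  both operands is sound because at most one of them has a hole. Plugging is a product of Boolean
  matrices indexed by pairs of states, where \<open>y\<close> is the pair at the hole of the left
  operand.\<close>

definition op_bit :: "nat => nat => nat => nat => bool" where
 "op_bit k s1 s2 i =
  (if k = 2 then \<exists>r<m. bit s1 (idx (i div m\<^sup>2 div m) r (i mod m\<^sup>2)) \<and> bit s2 (idx r (i div m\<^sup>2 mod m) (i mod m\<^sup>2))
   else \<exists>y<m\<^sup>2. bit s1 (i div m\<^sup>2 * m\<^sup>2 + y) \<and> bit s2 (y * m\<^sup>2 + i mod m\<^sup>2))"

definition opst :: "nat => nat => nat => nat" where
 "opst k s1 s2 = enc K (op_bit k s1 s2)"

text \<open>\<open>t\<close> plays two roles. For an atom it is the state \<open>\<rho>1\<close> of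
  the vertex. For a context atom the hole is the only child, so its first state \<open>p'\<close>
  has to lie in \<open>iota\<close> and its last state \<open>q'\<close> is the middle entry of the
  transition. Phrasing both as one bounded search lets a single loop compute them.\<close>

definition leaf_bit :: "nat => nat => bool => nat => bool" where
 "leaf_bit k x b i = (let p = i div m\<^sup>2 div m; q = i div m\<^sup>2 mod m; p' = i mod m\<^sup>2 div m; q' = i mod m\<^sup>2 mod m in
   \<exists>t<m. if k = 0 then t \<in> iota M (x, b) \<and> (p, t, q) \<in> delta M
    else t = p' \<and> t \<in> iota M (x, b) \<and> (p, q', q) \<in> delta M)"

definition leafst :: "nat => nat => bool => nat" where
 "leafst k x b = enc K (leaf_bit k x b)"

lemma idx_less: "p < m ==> q < m ==> z < m\<^sup>2 ==> idx p q z < K"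
proof -
 assume a: "p < m" "q < m" "z < m\<^sup>2"
 have "p * m + q < m\<^sup>2" using mult_add_less[OF a(1,2)] by (simp add: power2_eq_square)
 then show ?thesis using mult_add_less[of "p * m + q" "m\<^sup>2" z "m\<^sup>2"] a
  by (simp add: idx_def power2_eq_square power4_eq_xxxx mult.assoc)
qed

lemma idx_div: "q < m ==> z < m\<^sup>2 ==> idx p q z div m\<^sup>2 div m = p \<and> idx p q z div m\<^sup>2 mod m = q \<and> idx p q z mod m\<^sup>2 = z"
 by (simp add: idx_def)

lemma bit_st:
 assumes "p < m" "q < m" "z < m\<^sup>2"
 shows "bit (st e) (idx p q z) \<longleftrightarrow> frel M (stz z) (the (eval_fexp e)) p q"
 using idx_less[OF assms] idx_div[OF assms(2,3)] by (simp add: st_def bit_enc)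

lemma stz_less: "z < m\<^sup>2 ==> stz z \<in> {..<m} \<times> {..<m}"
 using m_pos by (simp add: stz_def less_mult_imp_div_less power2_eq_square)

lemma digits: "i < K ==> i div m\<^sup>2 < m\<^sup>2 \<and> i mod m\<^sup>2 < m\<^sup>2 \<and> i div m\<^sup>2 div m < m \<and> i div m\<^sup>2 mod m < m"
 using m_pos by (auto intro!: less_mult_imp_div_less simp: power2_eq_square power4_eq_xxxx mult.assoc)

lemma st_leaf:
 "st (BLeaf (Atom (x, b))) = leafst 0 x b"  "st (BLeaf (CtxAtom (x, b))) = leafst 1 x b"
proof -
 show "st (BLeaf (Atom (x, b))) = leafst 0 x b"
  unfolding st_def leafst_def
 proof (rule enc_cong)
  fix i
  show "frel M (stz (i mod m\<^sup>2)) (the (eval_fexp (BLeaf (Atom (x, b))))) (i div m\<^sup>2 div m) (i div m\<^sup>2 mod m) = leaf_bit 0 x b i"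
   using delta_sub by (auto simp: trel_Node leaf_bit_def Let_def)
 qed
 show "st (BLeaf (CtxAtom (x, b))) = leafst 1 x b"
  unfolding st_def leafst_def
 proof (rule enc_cong)
  fix i assume "i < K"
  then have "i mod m\<^sup>2 div m < m" using digits[of i] stz_less[of "i mod m\<^sup>2"] by (auto simp: stz_def)
  then show "frel M (stz (i mod m\<^sup>2)) (the (eval_fexp (BLeaf (CtxAtom (x, b))))) (i div m\<^sup>2 div m) (i div m\<^sup>2 mod m) = leaf_bit 1 x b i"
   by (auto simp: trel_Node leaf_bit_def Let_def stz_def)
 qed
qed

text \<open>The composition laws for \<open>frel\<close> quantify over all states;
  \<open>frel_range\<close>, applied to the nonempty values, bounds them by \<open>m\<close> and
  turns the laws into operations on bits.\<close>

lemma st_op: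
 assumes "eval_fexp (BNode l e1 e2) ~= None"
 shows "st (BNode l e1 e2) = opst (kind_code l) (st e1) (st e2)"
 unfolding st_def[of "BNode l e1 e2"] opst_def
proof (rule enc_cong)
 fix i assume i: "i < K"
 obtain F1 F2 where F: "l = HConc \<or> l = VConc" "eval_fexp e1 = Some F1" "eval_fexp e2 = Some F2"
  "eval_fexp (BNode l e1 e2) = Some (if l = HConc then F1 @ F2 else plugs F2 F1)"
  "l = VConc ==> is_context F1"
  using eval_BNode[OF assms] by metis
 have ne: "F1 ~= []" "F2 ~= []" using eval_fexp_wf F by blast+
 define p q z where "p = i div m\<^sup>2 div m" and "q = i div m\<^sup>2 mod m" and "z = i mod m\<^sup>2"
 have l: "p < m" "q < m" "z < m\<^sup>2" using digits[OF i] by (auto simp: p_def q_def z_def)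
 have pq: "i div m\<^sup>2 = p * m + q" by (simp add: p_def q_def)
 show "frel M (stz (i mod m\<^sup>2)) (the (eval_fexp (BNode l e1 e2))) (i div m\<^sup>2 div m) (i div m\<^sup>2 mod m) =
   op_bit (kind_code l) (st e1) (st e2) i"
 proof (cases "l = HConc")
  case True
  have "frel M (stz z) (F1 @ F2) p q \<longleftrightarrow> (\<exists>r<m. frel M (stz z) F1 p r \<and> frel M (stz z) F2 r q)"
   using frel_range[OF delta_sub stz_less[OF l(3)] ne(1)] by (auto simp: frel_append)
  also have "\<dots> \<longleftrightarrow> (\<exists>r<m. bit (st e1) (idx p r z) \<and> bit (st e2) (idx r q z))"
   using l F by (auto simp: bit_st)
  finally show ?thesis using True F by (simp add: op_bit_def p_def q_def z_def)
 next
  case False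
  then have c: "l = VConc" "is_context F1" using F by auto
  have "frel M (stz z) (plugs F2 F1) p q \<longleftrightarrow> (\<exists>a b. frel M (a, b) F1 p q \<and> frel M (stz z) F2 a b)"
   using frel_plugs[OF c(2)] by simp
  also have "\<dots> \<longleftrightarrow> (\<exists>a<m. \<exists>b<m. frel M (a, b) F1 p q \<and> frel M (stz z) F2 a b)"
   using frel_range[OF delta_sub stz_less[OF l(3)] ne(2)] by auto
  also have "\<dots> \<longleftrightarrow> (\<exists>y<m\<^sup>2. frel M (stz y) F1 p q \<and> frel M (stz z) F2 (fst (stz y)) (snd (stz y)))"
  proof
   assume "\<exists>a<m. \<exists>b<m. frel M (a, b) F1 p q \<and> frel M (stz z) F2 a b"
   then obtain a b where ab: "a < m" "b < m" "frel M (a, b) F1 p q" "frel M (stz z) F2 a b" by auto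
   then have "stz (a * m + b) = (a, b)" "a * m + b < m\<^sup>2"
    using mult_add_less[of a m b m] by (auto simp: stz_def power2_eq_square)
   then show "\<exists>y<m\<^sup>2. frel M (stz y) F1 p q \<and> frel M (stz z) F2 (fst (stz y)) (snd (stz y))"
    using ab by (metis fst_conv snd_conv)
  next
   assume "\<exists>y<m\<^sup>2. frel M (stz y) F1 p q \<and> frel M (stz z) F2 (fst (stz y)) (snd (stz y))"
   then obtain y where "y < m\<^sup>2" "frel M (stz y) F1 p q" "frel M (stz z) F2 (fst (stz y)) (snd (stz y))" by auto
   then show "\<exists>a<m. \<exists>b<m. frel M (a, b) F1 p q \<and> frel M (stz z) F2 a b"
    using stz_less[of y] by (auto simp: stz_def)
  qed
  also have "\<dots> \<longleftrightarrow> (\<exists>y<m\<^sup>2. bit (st e1) (idx p q y) \<and> bit (st e2) (idx (fst (stz y)) (snd (stz y)) z))"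
   using l F stz_less by (auto simp: bit_st mem_Times_iff)
  also have "\<dots> \<longleftrightarrow> (\<exists>y<m\<^sup>2. bit (st e1) (i div m\<^sup>2 * m\<^sup>2 + y) \<and> bit (st e2) (y * m\<^sup>2 + z))"
   by (simp add: idx_def stz_def pq)
  finally show ?thesis using False c F by (simp add: op_bit_def p_def q_def z_def)
 qed
qed

lemma st_less: "st e < 2 ^ K" by (simp add: st_def enc_less)
lemma opst_less: "opst k s t < 2 ^ K" by (simp add: opst_def enc_less)
lemma leafst_less: "leafst k x b < 2 ^ K" by (simp add: leafst_def enc_less)

text \<open>All markings of \<open>e\<close>, each reduced to its state and to its set of marked
  positions when the expression is placed at \<open>p\<close>.\<close>

definition G :: "nat fsym btree => nat \<times> nat => (nat \<times> nat set) set" where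
 "G e p = (\<lambda>e'. (st e', mpp snd (wd e') p)) ` {e'. erase e' = e}"

lemma G_leaf: "G (BLeaf (Atom x)) p = {(leafst 0 x False, {}), (leafst 0 x True, {fst p})}"
 "G (BLeaf (CtxAtom x)) p = {(leafst 1 x False, {}), (leafst 1 x True, {fst p})}"
proof -
 have "{e'. erase e' = BLeaf (Atom x)} = {BLeaf (Atom (x, False)), BLeaf (Atom (x, True))}"
  by (auto simp: map_btree_BLeaf map_fsym_eq)
 then show "G (BLeaf (Atom x)) p = {(leafst 0 x False, {}), (leafst 0 x True, {fst p})}"
  by (simp add: G_def st_leaf)
 have "{e'. erase e' = BLeaf (CtxAtom x)} = {BLeaf (CtxAtom (x, False)), BLeaf (CtxAtom (x, True))}"
  by (auto simp: map_btree_BLeaf map_fsym_eq)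
 then show "G (BLeaf (CtxAtom x)) p = {(leafst 1 x False, {}), (leafst 1 x True, {fst p})}"
  by (simp add: G_def st_leaf)
qed

text \<open>Inner vertices carry no letter, so a marking of the expression is just a pair of
  markings of its operands.\<close>

lemma G_BNode:
 assumes "eval_fexp (BNode l e1 e2) ~= None"
 shows "G (BNode l e1 e2) p = {(opst (kind_code l) s1 s2, P1 \<union> P2) | s1 P1 s2 P2.
   (s1, P1) \<in> G e1 (ap (lm l e1 e2) p) \<and> (s2, P2) \<in> G e2 (ap (rm l e1) p)}" (is "?L = ?R")
proof -
 have *: "(st (BNode l' e1' e2'), mpp snd (wd (BNode l' e1' e2')) p) =
   (opst (kind_code l) (st e1') (st e2'),
    mpp snd (wd e1') (ap (lm l e1 e2) p) \<union> mpp snd (wd e2') (ap (rm l e1) p))"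
  if e: "erase e1' = e1" "erase e2' = e2" "map_fsym fst l' = l" for l' e1' e2'
 proof -
  have "erase (BNode l' e1' e2') = BNode l e1 e2" using e by simp
  then have "eval_fexp (BNode l' e1' e2') ~= None" using wd_erase(1) assms by metis
  then show ?thesis using mpp_erase_BNode[OF assms e] st_op kind_code_erase[OF e(3)] by simp
 qed
 show ?thesis
 proof (intro subset_antisym subsetI)
  fix x assume "x \<in> ?L"
  then obtain l' e1' e2' where e: "erase e1' = e1" "erase e2' = e2" "map_fsym fst l' = l"
   and x: "x = (st (BNode l' e1' e2'), mpp snd (wd (BNode l' e1' e2')) p)"
   by (auto simp: G_def map_btree_BNode)
  show "x \<in> ?R" unfolding x *[OF e]
   by (intro CollectI exI conjI) (rule refl, use e in \<open>auto simp: G_def\<close>)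
 next
  fix x assume "x \<in> ?R"
  then obtain e1' e2' where e: "erase e1' = e1" "erase e2' = e2"
   and x: "x = (opst (kind_code l) (st e1') (st e2'),
     mpp snd (wd e1') (ap (lm l e1 e2) p) \<union> mpp snd (wd e2') (ap (rm l e1) p))"
   by (auto simp: G_def)
  obtain l' where l': "map_fsym fst l' = l" "l' = map_fsym (\<lambda>a. (a, True)) l"
   by (simp add: fsym.map_comp o_def fsym.map_ident)
  show "x \<in> ?L" unfolding x *[OF e l'(1), symmetric] G_def
   by (rule image_eqI[of _ _ "BNode l' e1' e2'"]) (use e l' in auto)
 qed
qed

lemma G_subset: "eval_fexp e ~= None ==> (s, P) \<in> G e p ==> P \<subseteq> mpp (\<lambda>_. True) (wd e) p \<and> s < 2 ^ K"
proof -
 assume "(s, P) \<in> G e p" and ok: "eval_fexp e ~= None"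
 then obtain e' where e': "erase e' = e" "s = st e'" "P = mpp snd (wd e') p" by (auto simp: G_def)
 note w = wd_erase[OF e'(1) ok]
 have "P \<subseteq> mpp (\<lambda>_. True) (wd e') p" using e' mp_mono by metis
 also have "\<dots> = mpp (\<lambda>_. True) (wd e) p"
  using wd_count[OF ok] wd_count[OF w(1)] w by (simp add: mp_all)
 finally show ?thesis using e' st_less by simp
qed

definition pos_ok :: "nat fsym btree => nat \<times> nat => bool" where
 "pos_ok e p \<longleftrightarrow> valid (wd e) p"

text \<open>The position blocks of the operands are disjoint, so a union
  \<open>P1 \<union> P2\<close> determines both of its parts.\<close>

lemma pos_ok_BNode:
 assumes "eval_fexp (BNode l e1 e2) ~= None" "pos_ok (BNode l e1 e2) p"
 shows "pos_ok e1 (ap (lm l e1 e2) p)" "pos_ok e2 (ap (rm l e1) p)"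
  "(s1, P1) \<in> G e1 (ap (lm l e1 e2) p) ==> (s2, P2) \<in> G e2 (ap (rm l e1) p) ==> P1 \<inter> P2 = {}"
  "(s1, P1) \<in> G e1 (ap (lm l e1 e2) p) ==> (s2, P2) \<in> G e2 (ap (rm l e1) p) ==>
   (s1', P1') \<in> G e1 (ap (lm l e1 e2) p) ==> (s2', P2') \<in> G e2 (ap (rm l e1) p) ==>
   P1 \<union> P2 = P1' \<union> P2' ==> P1 = P1' \<and> P2 = P2'"
proof -
 obtain F1 F2 where b: "eval_fexp e1 = Some F1" "eval_fexp e2 = Some F2"
  "wpre (kind_code l) (wd e1) (wd e2)" "wd (BNode l e1 e2) = wop (kind_code l) (wd e1) (wd e2)"
  using eval_BNode[OF assms(1)] by metis
 note v = valid_wop[OF b(3) assms(2)[unfolded pos_ok_def b(4)]]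
 show "pos_ok e1 (ap (lm l e1 e2) p)" "pos_ok e2 (ap (rm l e1) p)"
  using v(1,2) by (simp_all add: pos_ok_def lm_def rm_def)
 have s: "P1 \<subseteq> mpp (\<lambda>_. True) (wd e1) (ap (lm l e1 e2) p)" if "(s1, P1) \<in> G e1 (ap (lm l e1 e2) p)" for s1 P1
  using G_subset that b by blast
 have t: "P2 \<subseteq> mpp (\<lambda>_. True) (wd e2) (ap (rm l e1) p)" if "(s2, P2) \<in> G e2 (ap (rm l e1) p)" for s2 P2
  using G_subset that b by blast
 have d: "mpp (\<lambda>_. True) (wd e1) (ap (lm l e1 e2) p) \<inter> mpp (\<lambda>_. True) (wd e2) (ap (rm l e1) p) = {}"
  using v(3) by (simp add: lm_def rm_def)
 show "(s1, P1) \<in> G e1 (ap (lm l e1 e2) p) ==> (s2, P2) \<in> G e2 (ap (rm l e1) p) ==> P1 \<inter> P2 = {}"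
  using s[of s1 P1] t[of s2 P2] d by blast
 show "(s1, P1) \<in> G e1 (ap (lm l e1 e2) p) ==> (s2, P2) \<in> G e2 (ap (rm l e1) p) ==>
   (s1', P1') \<in> G e1 (ap (lm l e1 e2) p) ==> (s2', P2') \<in> G e2 (ap (rm l e1) p) ==>
   P1 \<union> P2 = P1' \<union> P2' ==> P1 = P1' \<and> P2 = P2'"
  using s[of s1 P1] t[of s2 P2] s[of s1' P1'] t[of s2' P2'] d by blast
qed

text \<open>A set of positions fixes the marking and thereby the state: it splits uniquely at every
  inner vertex, and at a leaf it tells whether the letter is marked. Families of different states
  are therefore disjoint.\<close>

lemma G_unique:
 "eval_fexp e ~= None ==> pos_ok e p ==> (s, P) \<in> G e p ==> (s', P) \<in> G e p ==> s = s'"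
proof (induction e arbitrary: p s s' P)
 case (BLeaf l)
 then show ?case by (cases l) (auto simp: G_leaf)
next
 case (BNode l e1 e2)
 have n: "eval_fexp e1 ~= None" "eval_fexp e2 ~= None"
  using eval_BNode[OF BNode.prems(1)] by (metis option.distinct(1))+
 obtain s1 P1 s2 P2 where a: "s = opst (kind_code l) s1 s2" "P = P1 \<union> P2"
  "(s1, P1) \<in> G e1 (ap (lm l e1 e2) p)" "(s2, P2) \<in> G e2 (ap (rm l e1) p)"
  using BNode.prems(3) unfolding G_BNode[OF BNode.prems(1)] by auto
 obtain s1' P1' s2' P2' where b: "s' = opst (kind_code l) s1' s2'" "P = P1' \<union> P2'"
  "(s1', P1') \<in> G e1 (ap (lm l e1 e2) p)" "(s2', P2') \<in> G e2 (ap (rm l e1) p)"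
  using BNode.prems(4) unfolding G_BNode[OF BNode.prems(1)] by auto
 note p = pos_ok_BNode[OF BNode.prems(1,2)]
 have "P1 = P1' \<and> P2 = P2'" using p(4)[OF a(3,4) b(3,4)] a(2) b(2) by simp
 then show ?case using BNode.IH(1)[OF n(1) p(1)] BNode.IH(2)[OF n(2) p(2)] a b by metis
qed

lemma map_rtree_Some_the: "None \<notin> set (labs_tree t) ==> map_rtree Some (map_rtree the t) = t"
 by (induction t) (auto simp: o_def intro!: map_idI)

lemma map_Some_the_forest: "None \<notin> set (labs F) ==> map (map_rtree Some) (map (map_rtree the) F) = F"
 by (induction F) (auto simp: map_rtree_Some_the)

text \<open>Both sides erase to the same forest and have the same preorder word, the marks being
  compared through the assumption on positions; \<open>labs_inj\<close> then identifies
  them.\<close>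

lemma marked_value:
 assumes "eval_fexp e = Some F" "is_forest F" "erase e' = e" "S \<subseteq> vertices (map (map_rtree the) F)"
  and "mpp snd (wd e') (0, 0) = preorder_number (map (map_rtree the) F) ` S"
 shows "the (eval_fexp e') = map (map_rtree Some) (mark (map (map_rtree the) F) S)"
proof (rule labs_inj[where f = "map_option fst"])
 let ?F = "map (map_rtree the) F"
 have nh: "None \<notin> set (labs F)" using assms(2) by (simp add: is_forest_iff)
 obtain F' where F': "eval_fexp e' = Some F'" "F = map_forest fst F'"
  using eval_erase[of e'] assms(1,3) by (cases "eval_fexp e'") auto
 have "map_forest fst (map (map_rtree Some) (mark ?F S)) = map (map_rtree Some) (map (map_rtree fst) (mark ?F S))"
  by (simp add: rtree.map_comp o_def)
 also have "\<dots> = F" unfolding erase_mark by (rule map_Some_the_forest[OF nh])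
 finally show "map_forest fst (the (eval_fexp e')) = map_forest fst (map (map_rtree Some) (mark ?F S))"
  using F' by simp
 have "None \<notin> set (labs F')" using nh unfolding F'(2) labs_map by auto
 then obtain l where l: "labs F' = map Some l" using no_hole_map_Some by metis
 have wd: "wd e' = map Some l" using F' l by (simp add: wd_def)
 have e1: "map fst l = labs ?F"
  unfolding labs_map F'(2) l by simp
 have "labs (mark ?F S) = l"
 proof (rule nth_equalityI)
  have len: "length (preorder ?F) = length l" using e1 by (metis labs_eq length_map)
  then show "length (labs (mark ?F S)) = length l" by (simp add: labs_mark)
  fix i assume i: "i < length (labs (mark ?F S))"
  then have i': "i < length l" "i < length (preorder ?F)" using len by (simp_all add: labs_mark)
  have "fst (l ! i) = label_of ?F (preorder ?F ! i)"
   using e1 i' by (metis labs_eq nth_map)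
  moreover have "snd (l ! i) \<longleftrightarrow> preorder ?F ! i \<in> S"
   using assms(5) i' unfolding wd preorder_number_image[OF assms(4)] by (auto simp: mp_forest set_eq_iff)
  ultimately show "labs (mark ?F S) ! i = l ! i"
   using i' by (simp add: labs_mark prod_eq_iff)
 qed
 then show "labs (the (eval_fexp e')) = labs (map (map_rtree Some) (mark ?F S))"
  using F' l by (simp add: labs_map)
qed

text \<open>A forest has no hole, so its relation is the same for every hole pair; pair 0 is the one
  tested.\<close>

definition acc :: "nat => bool" where
 "acc s = bit s (idx (q0 M) (qf M) 0)"

text \<open>Reduces selection to accepting states. A selected set of vertices is realized by the
  marking \<open>mke\<close>; conversely, marked positions are turned into addresses through the
  list \<open>preorder\<close>.\<close>

theorem select_eq:
 assumes "eval_fexp e = Some F" "is_forest F"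
 shows "(\<lambda>S. preorder_number (map (map_rtree the) F) ` S) ` select M (map (map_rtree the) F) =
   {P. \<exists>s. (s, P) \<in> G e (0, 0) \<and> acc s}" (is "?L = ?R")
proof -
 let ?F = "map (map_rtree the) F"
 have nh: "None \<notin> set (labs F)" using assms(2) by (simp add: is_forest_iff)
 have ne: "F ~= []" using eval_fexp_wf[OF assms(1)] by simp
 have all: "mpp (\<lambda>_. True) (wd e) (0, 0) = {..<length (preorder ?F)}"
 proof -
  have "lc (wd e) = length (preorder ?F)" "rc (wd e) = 0"
   using nh assms(1) labs_eq[of ?F] labs_map[of the F] by (auto simp: wd_def lc_no_hole rc_no_hole dest: arg_cong[of _ _ length])
  then show ?thesis using wd_count[of e] assms(1) by (auto simp: mp_all)
 qed
 have m2: "0 < m\<^sup>2" using m_pos by simp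
 have acc: "acc (st e') \<longleftrightarrow> accepts M (mark ?F S)"
  if "erase e' = e" "S \<subseteq> vertices ?F" "mpp snd (wd e') (0, 0) = preorder_number ?F ` S" for e' S
 proof -
  have "mark ?F S ~= []" using ne by (simp add: mark_eq)
  then show ?thesis
   unfolding acc_def bit_st[OF q_less m2] marked_value[OF assms that] accepts_iff_frel[OF nsta, of _ "stz 0"] by simp
 qed
 show ?thesis
 proof (intro subset_antisym subsetI)
  fix N assume "N \<in> ?L"
  then obtain S where S: "S \<subseteq> vertices ?F" "accepts M (mark ?F S)" "N = preorder_number ?F ` S"
   by (auto simp: select_def)
  let ?e = "mke e N (0, 0)"
  have "N \<subseteq> {..<length (preorder ?F)}" using S by (auto simp: preorder_number_image)
  then have "mpp snd (wd ?e) (0, 0) = N" using mpp_mke[of e N "(0, 0)"] assms(1) all by auto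
  moreover from this have "acc (st ?e)" using acc[OF erase_mke S(1)] S by simp
  ultimately show "N \<in> ?R" unfolding G_def using erase_mke by blast
 next
  fix N assume "N \<in> ?R"
  then obtain e' where e': "erase e' = e" "N = mpp snd (wd e') (0, 0)" "acc (st e')" by (auto simp: G_def)
  then have "(st e', N) \<in> G e (0, 0)" by (auto simp: G_def)
  then have sub: "N \<subseteq> {..<length (preorder ?F)}" using G_subset[of e] assms(1) all by blast
  define S where "S = (!) (preorder ?F) ` N"
  have S: "S \<subseteq> vertices ?F" using sub by (auto simp: S_def vertices_def)
  have "preorder_number ?F ` S = N"
   unfolding preorder_number_image[OF S] unfolding S_def
   using sub by (auto simp: nth_eq_iff_index_eq[OF distinct_preorder] subset_iff)
  then show "N \<in> ?L" using acc[OF e'(1) S] e' S by (auto simp: select_def)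
 qed
qed

end

section \<open>Enumeration trees\<close>

text \<open>
 \<open>CU\<close> is a disjoint union, \<open>CP\<close> a product, \<open>CL\<close> a single marked position. The tree is the
 unfolding of the cells computed by the preprocessing.
\<close>

datatype ct = CL | CU ct emap ct emap | CP ct emap ct emap

text \<open>
 To reach a leaf or a product below nested unions in constant time, the first such alternative
 (\<open>first\<close>) is enumerated before all others (\<open>pend\<close>).
\<close>

fun first :: "ct => nat \<times> nat => nat list list" and pend :: "ct => nat \<times> nat => nat list list" where
 "first CL p = [[fst p]]"
| "first (CP t f u g) p = concat (map (\<lambda>a. map (\<lambda>b. a @ b)
   (first u (ap g p) @ pend u (ap g p))) (first t (ap f p) @ pend t (ap f p)))"
| "first (CU t f u g) p = first t (ap f p)"
| "pend CL p = []"
| "pend (CP t f u g) p = []"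
| "pend (CU t f u g) p = first u (ap g p) @ pend u (ap g p) @ pend t (ap f p)"

definition alls :: "ct => nat \<times> nat => nat list list" where
 "alls t p = first t p @ pend t p"

lemma alls_CL [simp]: "alls CL p = [[fst p]]"
 by (simp add: alls_def)

lemma alls_CP [simp]: "alls (CP t f u g) p =
 concat (map (\<lambda>a. map (\<lambda>b. a @ b) (alls u (ap g p))) (alls t (ap f p)))"
 by (simp add: alls_def)

lemma alls_CU: "alls (CU t f u g) p = first t (ap f p) @ alls u (ap g p) @ pend t (ap f p)"
 by (simp add: alls_def)

lemma pend_CU: "pend (CU t f u g) p = alls u (ap g p) @ pend t (ap f p)"
 by (simp add: alls_def)

text \<open>The end of the left spine of unions with the composed map leading to it. Every cell
  stores this pair, so nested unions are skipped in one step.\<close>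

fun lead :: "ct => ct \<times> emap" where
 "lead (CU t f u g) = (fst (lead t), cm f (snd (lead t)))"
| "lead t = (t, idm)"

text \<open>An affine term for the first number of the first set (\<open>hd_alls\<close>). It
  depends on the tree only, so it can be stored in the cell and evaluated in constant time at any
  position pair.\<close>

fun el :: "ct => elm" where
 "el CL = (0, 0)"
| "el (CU t f u g) = cme f (el t)"
| "el (CP t f u g) = cme f (el t)"

fun is_CU :: "ct => bool" where
 "is_CU (CU _ _ _ _) = True"
| "is_CU _ = False"

lemma pend_not_CU: "\<not> is_CU t ==> pend t p = []"
 by (cases t) auto

lemma lead_not_CU: "\<not> is_CU (fst (lead t))"
 by (induction t) auto

lemma first_lead: "first t p = alls (fst (lead t)) (ap (snd (lead t)) p)"
proof (induction t arbitrary: p)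
 case CL
 show ?case by simp
next
 case (CU t f u g)
 then show ?case by simp
next
 case (CP t f u g)
 show ?case by (simp add: alls_def)
qed

lemma first_nonempty: "first t p ~= []"
 by (induction t arbitrary: p) auto

lemma first_pend_nonempty: "[] \<notin> set (first t p) \<and> [] \<notin> set (pend t p)"
proof (induction t arbitrary: p)
 case (CU t f u g)
 then show ?case by simp
next
 case (CP t f u g)
 show ?case using CP(1)[of "ap f p"] CP(2)[of "ap g p"] by auto
qed simp

lemma alls_nonempty: "alls t p ~= []" "xs \<in> set (alls t p) ==> xs ~= []"
 using first_nonempty[of t p] first_pend_nonempty[of t p] by (auto simp: alls_def)

lemma hd_alls: "hd (hd (alls t p)) = ev (el t) p"
proof (induction t arbitrary: p)
 case CL
 show ?case by (simp add: ev_def)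
next
 case (CU t f u g)
 have "hd (alls (CU t f u g) p) = hd (alls t (ap f p))"
  using first_nonempty[of t "ap f p"] by (simp add: alls_def)
 then show ?case using CU by simp
next
 case (CP t f u g)
 obtain a as where a: "alls t (ap f p) = a # as" using alls_nonempty(1)[of t "ap f p"] by (cases "alls t (ap f p)") auto
 obtain b bs where b: "alls u (ap g p) = b # bs" using alls_nonempty(1)[of u "ap g p"] by (cases "alls u (ap g p)") auto
 have "a ~= []" using alls_nonempty(2)[of a t "ap f p"] a by simp
 then show ?case using CP(1)[of "ap f p"] a b by simp
qed

type_synonym titem = "ct \<times> nat \<times> nat"

text \<open>The ways to complete a set by one choice for each pending factor.\<close>

fun prodl :: "titem list => nat list list" where
 "prodl [] = [[]]"
| "prodl ((t, p) # td) = concat (map (\<lambda>a. map (\<lambda>r. a @ r) (prodl td)) (alls t p))"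

lemma prodl_nonempty: "prodl td ~= []"
 by (induction td rule: prodl.induct) (auto simp: alls_nonempty)

text \<open>No enumerated set is empty, so each pending factor contributes at least one number to
  the output. This pays for the steps spent on it.\<close>

lemma length_prodl: "r \<in> set (prodl td) ==> length td \<le> length r"
proof (induction td arbitrary: r rule: prodl.induct)
 case (2 t p td)
 then obtain a r' where r: "r = a @ r'" "a \<in> set (alls t p)" "r' \<in> set (prodl td)" by auto
 have "a ~= []" using r alls_nonempty by blast
 then show ?case using 2(1)[OF _ r(3)] r alls_nonempty(1) by (cases a) force+
qed simp

definition enumerates :: "nat list list => nat set set => bool" where
 "enumerates xss A \<longleftrightarrow> distinct (map set xss) \<and> (\<forall>xs \<in> set xss. distinct xs) \<and> set ` set xss = A"

lemma enumerates_append: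
 assumes "enumerates xss A" "enumerates yss B" "A \<inter> B = {}"
 shows "enumerates (xss @ yss) (A \<union> B)"
 using assms unfolding enumerates_def by (auto simp: image_Un)

lemma enumerates_Nil: "enumerates [] {}"
 by (simp add: enumerates_def)

lemma enumerates_CU:
 assumes "enumerates (alls t (ap f p)) A" "enumerates (alls u (ap g p)) B" "A \<inter> B = {}"
 shows "enumerates (alls (CU t f u g) p) (A \<union> B)"
proof -
 \<comment> \<open>Inserting all of \<open>u\<close> between the first part and the rest of
   \<open>t\<close> only permutes the list.\<close>
 have "enumerates (a @ b @ c) S \<longleftrightarrow> enumerates ((a @ c) @ b) S" for a b c S
  unfolding enumerates_def by auto
 then show ?thesis using enumerates_append[OF assms] by (simp only: alls_CU) (simp only: alls_def[of t])
qed

text \<open>Distinctness inside a set comes from the disjointness of the factors, distinctness of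
  the sets from the unique splitting \<open>inj\<close>.\<close>

lemma enumerates_product:
 assumes "enumerates xss A" "enumerates yss B"
  and "\<And>P Q. P \<in> A ==> Q \<in> B ==> P \<inter> Q = {}"
  and inj: "\<And>P Q P' Q'. P \<in> A ==> Q \<in> B ==> P' \<in> A ==> Q' \<in> B ==> P \<union> Q = P' \<union> Q' ==> P = P' \<and> Q = Q'"
 shows "enumerates (concat (map (\<lambda>a. map (\<lambda>b. a @ b) yss) xss)) {P \<union> Q | P Q. P \<in> A \<and> Q \<in> B}"
 unfolding enumerates_def
proof (intro conjI ballI)
 have dy: "distinct (map set yss)" and B: "set ` set yss = B" using assms(2) by (auto simp: enumerates_def)
 have d: "distinct (map set (concat (map (\<lambda>a. map (\<lambda>b. a @ b) yss) zss)))"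
  if "set zss \<subseteq> set xss" "distinct (map set zss)" for zss
  using that
 proof (induction zss)
  case (Cons a zss)
  have aA: "set a \<in> A" using Cons.prems assms(1) by (auto simp: enumerates_def)
  have "inj_on set (set yss)" using dy by (simp add: distinct_map)
  have "inj_on (set \<circ> (\<lambda>b. a @ b)) (set yss)"
  proof (rule inj_onI)
   fix b b' assume b: "b \<in> set yss" "b' \<in> set yss" "(set \<circ> (\<lambda>b. a @ b)) b = (set \<circ> (\<lambda>b. a @ b)) b'"
   then have "set b \<in> B" "set b' \<in> B" using B by auto
   then have "set b = set b'" using inj[OF aA _ aA, of "set b" "set b'"] b(3) by simp
   then show "b = b'" using \<open>inj_on set (set yss)\<close> b by (auto dest: inj_onD)
  qed
  then have 1: "distinct (map (set \<circ> (\<lambda>b. a @ b)) yss)"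
   using dy by (simp add: distinct_map)
  have 2: "set a \<union> set b ~= set a' \<union> set b'"
   if h: "a' \<in> set zss" "b \<in> set yss" "b' \<in> set yss" for a' b b'
  proof
   assume e: "set a \<union> set b = set a' \<union> set b'"
   have "set a' \<in> A" using h Cons.prems assms(1) by (auto simp: enumerates_def)
   then have "set a = set a'" using inj[OF aA _ _ _ e] h B by blast
   then show False using Cons.prems(2) h(1) by auto
  qed
  have 3: "distinct (map set (concat (map (\<lambda>a. map (\<lambda>b. a @ b) yss) zss)))"
   using Cons by simp
  have "set (map (set \<circ> (\<lambda>b. a @ b)) yss) \<inter>
    set (map set (concat (map (\<lambda>a. map (\<lambda>b. a @ b) yss) zss))) = {}"
   using 2 by auto
  with 1 3 show ?case by simp
 qed simp
 show "distinct (map set (concat (map (\<lambda>a. map (\<lambda>b. a @ b) yss) xss)))"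
  by (rule d) (use assms(1) in \<open>auto simp: enumerates_def\<close>)
next
 fix xs assume "xs \<in> set (concat (map (\<lambda>a. map (\<lambda>b. a @ b) yss) xss))"
 then obtain a b where "a \<in> set xss" "b \<in> set yss" "xs = a @ b" by auto
 then show "distinct xs" using assms(1-3) unfolding enumerates_def by auto
next
 show "set ` set (concat (map (\<lambda>a. map (\<lambda>b. a @ b) yss) xss)) = {P \<union> Q | P Q. P \<in> A \<and> Q \<in> B}"
  using assms(1,2) unfolding enumerates_def by (auto simp: image_iff) blast+
qed

lemma enumerates_CP:
 assumes "enumerates (alls t (ap f p)) A" "enumerates (alls u (ap g p)) B"
  and "\<And>P Q. P \<in> A ==> Q \<in> B ==> P \<inter> Q = {}"
  and "\<And>P Q P' Q'. P \<in> A ==> Q \<in> B ==> P' \<in> A ==> Q' \<in> B ==> P \<union> Q = P' \<union> Q' ==> P = P' \<and> Q = Q'"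
 shows "enumerates (alls (CP t f u g) p) {P \<union> Q | P Q. P \<in> A \<and> Q \<in> B}"
 unfolding alls_CP by (rule enumerates_product[OF assms])

section \<open>A structured language for the machine\<close>

datatype com =
  Skip
 | Basic instr
 | Seq com com  (infixr \<open>;;\<close> 60)
 | Cond nat nat com com
 | Loop nat nat com

text \<open>Besides registers and arrays, a state carries the elapsed time and the trace as ghost data.\<close>

record st =
 rg :: "nat => nat"
 mm :: "nat => nat => nat"
 tm :: nat
 tr :: "(nat \<times> osym) list"

fun bstep :: "instr => st => st" where
 "bstep (Const r k) s = s(|rg := (rg s)(r := k), tm := Suc (tm s)|)"
| "bstep (Add r a b) s = s(|rg := (rg s)(r := rg s a + rg s b), tm := Suc (tm s)|)"
| "bstep (Sub r a b) s = s(|rg := (rg s)(r := rg s a - rg s b), tm := Suc (tm s)|)"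
| "bstep (Load r a b) s = s(|rg := (rg s)(r := mm s a (rg s b)), tm := Suc (tm s)|)"
| "bstep (Store a b r) s =
   s(|mm := (mm s)(a := (mm s a)(rg s b := rg s r)), tm := Suc (tm s)|)"
| "bstep (OutReg r) s = s(|tm := Suc (tm s), tr := tr s @ [(tm s, Num (rg s r))]|)"
| "bstep OutSep s = s(|tm := Suc (tm s), tr := tr s @ [(tm s, Sep)]|)"
| "bstep OutEnd s = s(|tm := Suc (tm s), tr := tr s @ [(tm s, EndMarker)]|)"
| "bstep _ s = s"

text \<open>Guards for single instructions: jumps and \<open>Halt\<close> are excluded, and
  constants and sums have to fit the word. The other instructions cannot leave the range.\<close>

fun bok :: "nat => instr => st => bool" where
 "bok W (Const r k) s = (k < W)"
| "bok W (Add r a b) s = (rg s a + rg s b < W)"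
| "bok W (Jump l) s = False"
| "bok W (JumpLess a b l) s = False"
| "bok W Halt s = False"
| "bok W _ s = True"

text \<open>The added time units are the jumps of the compiled code: one for each test, and one more
  to skip the other branch after the else part, to leave a loop, or to return to its head.\<close>

inductive big :: "nat => com => st => st => bool" for W where
 big_Skip: "big W Skip s s"
| big_Basic: "bok W i s ==> big W (Basic i) s (bstep i s)"
| big_Seq: "big W c s s1 ==> big W d s1 s2 ==> big W (c ;; d) s s2"
| big_CondT: "rg s a < rg s b ==> big W c (s(|tm := Suc (tm s)|)) s' ==> big W (Cond a b c d) s s'"
| big_CondF: "\<not> rg s a < rg s b ==> big W d (s(|tm := Suc (tm s)|)) s' ==>
  big W (Cond a b c d) s (s'(|tm := Suc (tm s')|))"
| big_LoopF: "\<not> rg s a < rg s b ==> big W (Loop a b c) s (s(|tm := Suc (Suc (tm s))|))"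
| big_LoopT: "rg s a < rg s b ==> big W c (s(|tm := Suc (tm s)|)) s1 ==>
  big W (Loop a b c) (s1(|tm := Suc (tm s1)|)) s' ==> big W (Loop a b c) s s'"

inductive_cases big_SkipE: "big W Skip s s'"
inductive_cases big_BasicE: "big W (Basic i) s s'"
inductive_cases big_SeqE: "big W (c ;; d) s s'"
inductive_cases big_CondE: "big W (Cond a b c d) s s'"
inductive_cases big_LoopE: "big W (Loop a b c) s s'"

fun csize :: "com => nat" where
 "csize Skip = 0"
| "csize (Basic i) = 1"
| "csize (c ;; d) = csize c + csize d"
| "csize (Cond a b c d) = csize c + csize d + 2"
| "csize (Loop a b c) = csize c + 3"

fun comp :: "nat => com => instr list" where
 "comp i Skip = []"
| "comp i (Basic x) = [x]"
| "comp i (c ;; d) = comp i c @ comp (i + csize c) d"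
| "comp i (Cond a b c d) =
   [JumpLess a b (i + csize d + 2)] @ comp (i + 1) d @ [Jump (i + csize d + 2 + csize c)]
    @ comp (i + csize d + 2) c"
| "comp i (Loop a b c) =
   [JumpLess a b (i + 2), Jump (i + csize c + 3)] @ comp (i + 2) c @ [Jump i]"

lemma length_comp [simp]: "length (comp i c) = csize c"
 by (induction c arbitrary: i) auto

definition code_at :: "instr list => nat => instr list => bool" where
 "code_at P i Q \<longleftrightarrow> i + length Q \<le> length P \<and> (\<forall>j < length Q. P ! (i + j) = Q ! j)"

lemma code_at_append: "code_at P i (Q @ R) \<longleftrightarrow> code_at P i Q \<and> code_at P (i + length Q) R"
proof
 assume a: "code_at P i (Q @ R)"
 have "\<forall>j < length Q. P ! (i + j) = Q ! j"
  using a unfolding code_at_def by (metis length_append nth_append trans_less_add1)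
 moreover have "\<forall>j < length R. P ! (i + length Q + j) = R ! j"
  using a unfolding code_at_def
  by (metis add.assoc length_append nat_add_left_cancel_less nth_append_length_plus)
 ultimately show "code_at P i Q \<and> code_at P (i + length Q) R"
  using a unfolding code_at_def by simp
next
 assume a: "code_at P i Q \<and> code_at P (i + length Q) R"
 show "code_at P i (Q @ R)"
  unfolding code_at_def
 proof (intro conjI allI impI)
  show "i + length (Q @ R) \<le> length P" using a unfolding code_at_def by simp
 next
  fix j assume j: "j < length (Q @ R)"
  show "P ! (i + j) = (Q @ R) ! j"
  proof (cases "j < length Q")
   case True then show ?thesis using a unfolding code_at_def by (simp add: nth_append)
  next
   case False
   then have "P ! (i + length Q + (j - length Q)) = R ! (j - length Q)"
    using a j unfolding code_at_def by (metis add_diff_inverse_nat length_append nat_add_left_cancel_less)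
   then show ?thesis using False by (simp add: nth_append)
  qed
 qed
qed

lemma code_at_Cons: "code_at P i (x # Q) \<longleftrightarrow> i < length P \<and> P ! i = x \<and> code_at P (i + 1) Q"
 using code_at_append[of P i "[x]" Q] by (auto simp: code_at_def)

definition cfg :: "nat => st => config" where
 "cfg i s = (|pc = i, regs = rg s, mem = mm s|)"

definition fits :: "nat => st => bool" where
 "fits W s \<longleftrightarrow> (\<forall>r. rg s r < W) \<and> (\<forall>a i. mm s a i < W)"

text \<open>
 \<open>reach\<close> is a run of the machine from one instruction address to another that takes exactly
 the ghost time, writes exactly the ghost trace and never leaves the word range.
\<close>

inductive reach :: "nat => instr list => nat \<times> st => nat \<times> st => bool" for W P where
 reach_refl: "fits W s ==> reach W P (i, s) (i, s)"
| reach_step: "fits W s ==> i < length P ==> P ! i ~= Halt ==>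
  exec (P ! i) (cfg i s) = cfg j s1 ==> tm s1 = tm s + 1 ==>
  tr s1 = tr s @ map (Pair (tm s)) (emitted P (cfg i s)) ==>
  reach W P (j, s1) y ==> reach W P (i, s) y"

lemma reach_trans: "reach W P x y ==> reach W P y z ==> reach W P x z"
 by (induction rule: reach.induct) (auto intro: reach_step)

lemma reach_fits: "reach W P x y ==> fits W (snd x) \<and> fits W (snd y)"
 by (induction rule: reach.induct) auto

lemma reach_jump:
 assumes "fits W s" "i < length P" "P ! i = Jump j"
 shows "reach W P (i, s) (j, s(|tm := Suc (tm s)|))"
 by (rule reach_step[where j = j and ?s1.0 = "s(|tm := Suc (tm s)|)"])
  (use assms in \<open>auto simp: cfg_def emitted_def halted_def fits_def intro!: reach_refl\<close>)

lemma reach_jumpless: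
 assumes "fits W s" "i < length P" "P ! i = JumpLess a b l"
 shows "reach W P (i, s) (if rg s a < rg s b then l else i + 1, s(|tm := Suc (tm s)|))"
 by (rule reach_step[where j = "if rg s a < rg s b then l else i + 1" and ?s1.0 = "s(|tm := Suc (tm s)|)"])
  (use assms in \<open>auto simp: cfg_def emitted_def halted_def fits_def intro!: reach_refl\<close>)

lemma bstep_fits:
 assumes "bok W x s" "fits W s"
 shows "fits W (bstep x s)"
proof -
 have "rg s a - rg s b < W" for a b
  using assms(2) le_less_trans[OF diff_le_self] unfolding fits_def by blast
 then show ?thesis using assms by (cases x) (simp_all add: fits_def)
qed

lemma reach_basic:
 assumes "fits W s" "i < length P" "P ! i = x" "bok W x s"
 shows "reach W P (i, s) (i + 1, bstep x s)"
 by (rule reach_step[where j = "i + 1" and ?s1.0 = "bstep x s"])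
  (use assms bstep_fits[OF assms(4,1)] in \<open>cases x; auto simp: cfg_def emitted_def halted_def intro!: reach_refl\<close>)+

lemma big_reach:
 "big W c s s' ==> fits W s ==> code_at P i (comp i c) ==> reach W P (i, s) (i + csize c, s')"
proof (induction arbitrary: i rule: big.induct)
 case (big_Skip s)
 then show ?case by (auto intro: reach_refl)
next
 case (big_Basic x s)
 then show ?case using reach_basic[of W s i P x] by (simp add: code_at_Cons)
next
 case (big_Seq c s s1 d s2)
 have 1: "reach W P (i, s) (i + csize c, s1)"
  using big_Seq by (simp add: code_at_append)
 have 2: "reach W P (i + csize c, s1) (i + csize c + csize d, s2)"
  using big_Seq.IH(2)[of "i + csize c"] big_Seq.prems reach_fits[OF 1] by (simp add: code_at_append)
 show ?case using reach_trans[OF 1 2] by (simp add: add.assoc)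
next
 case (big_CondT s a b c s' d)
 let ?t = "s(|tm := Suc (tm s)|)"
 have 0: "i < length P" "P ! i = JumpLess a b (i + csize d + 2)"
  using big_CondT.prems by (simp_all add: code_at_Cons code_at_append)
 have 1: "reach W P (i, s) (i + csize d + 2, ?t)"
  using reach_jumpless[OF big_CondT.prems(1) 0] big_CondT.hyps by simp
 have 2: "reach W P (i + csize d + 2, ?t) (i + csize d + 2 + csize c, s')"
  using big_CondT.IH[of "i + csize d + 2"] big_CondT.prems reach_fits[OF 1]
  by (simp add: code_at_append code_at_Cons)
 show ?case using reach_trans[OF 1 2] by (simp add: algebra_simps)
next
 case (big_CondF s a b d s' c)
 let ?t = "s(|tm := Suc (tm s)|)"
 have 0: "i < length P" "P ! i = JumpLess a b (i + csize d + 2)"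
  "i + 1 + csize d < length P" "P ! (i + 1 + csize d) = Jump (i + csize d + 2 + csize c)"
  using big_CondF.prems by (simp_all add: code_at_Cons code_at_append)
 have 1: "reach W P (i, s) (i + 1, ?t)"
  using reach_jumpless[OF big_CondF.prems(1) 0(1,2)] big_CondF.hyps by simp
 have 2: "reach W P (i + 1, ?t) (i + 1 + csize d, s')"
  using big_CondF.IH[of "i + 1"] big_CondF.prems reach_fits[OF 1]
  by (simp add: code_at_append code_at_Cons)
 have 3: "reach W P (i + 1 + csize d, s') (i + csize d + 2 + csize c, s'(|tm := Suc (tm s')|))"
  using reach_jump[OF _ 0(3,4)] reach_fits[OF 2] by simp
 show ?case using reach_trans[OF 1 reach_trans[OF 2 3]] by (simp add: algebra_simps)
next
 case (big_LoopF s a b c)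
 let ?t = "s(|tm := Suc (tm s)|)"
 have 0: "i < length P" "P ! i = JumpLess a b (i + 2)" "i + 1 < length P"
  "P ! (i + 1) = Jump (i + csize c + 3)"
  using big_LoopF.prems by (simp_all add: code_at_Cons code_at_append)
 have 1: "reach W P (i, s) (i + 1, ?t)"
  using reach_jumpless[OF big_LoopF.prems(1) 0(1,2)] big_LoopF.hyps by simp
 show ?case
  using reach_trans[OF 1 reach_jump[OF _ 0(3,4)]] reach_fits[OF 1] by (simp add: algebra_simps)
next
 case (big_LoopT s a b c s1 s')
 let ?t = "s(|tm := Suc (tm s)|)"
 have 0: "i < length P" "P ! i = JumpLess a b (i + 2)"
  "i + 2 + csize c < length P" "P ! (i + 2 + csize c) = Jump i"
  using big_LoopT.prems by (simp_all add: code_at_Cons code_at_append)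
 have 1: "reach W P (i, s) (i + 2, ?t)"
  using reach_jumpless[OF big_LoopT.prems(1) 0(1,2)] big_LoopT.hyps by simp
 have 2: "reach W P (i + 2, ?t) (i + 2 + csize c, s1)"
  using big_LoopT.IH(1)[of "i + 2"] big_LoopT.prems reach_fits[OF 1]
  by (simp add: code_at_append code_at_Cons)
 have 3: "reach W P (i + 2 + csize c, s1) (i, s1(|tm := Suc (tm s1)|))"
  using reach_jump[OF _ 0(3,4)] reach_fits[OF 2] by simp
 have 4: "reach W P (i, s1(|tm := Suc (tm s1)|)) (i + csize (Loop a b c), s')"
  using big_LoopT.IH(2)[of i] big_LoopT.prems reach_fits[OF 3] by simp
 show ?case using reach_trans[OF 1 reach_trans[OF 2 reach_trans[OF 3 4]]] .
qed

lemma config_at_0: "config_at P c 0 = c"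
 by (simp add: config_at_def)

lemma config_at_Suc: "config_at P c (Suc t) = config_at P (step P c) t"
 by (simp only: config_at_def funpow_Suc_right o_apply)

lemma output_trace_Suc:
 "output_trace P c (Suc T) =
   map (Pair 0) (emitted P c) @ map (apfst Suc) (output_trace P (step P c) T)"
proof -
 have "[0..<Suc T] = 0 # map Suc [0..<T]"
  by (simp add: map_Suc_upt upt_conv_Cons del: upt_Suc)
 then show ?thesis
  by (simp only: output_trace_def list.map concat.simps config_at_0 map_map o_def
    config_at_Suc map_concat apfst_conv)
qed

text \<open>Transfers the ghost data to the definitions of the machine. A machine trace starts at
  time 0, so the ghost time at the start is added to all of its entries.\<close>

lemma reach_run:
 "reach W P x y ==> tm (snd x) \<le> tm (snd y) \<and>
  (let d = tm (snd y) - tm (snd x); c = cfg (fst x) (snd x) in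
   config_at P c d = cfg (fst y) (snd y) \<and>
   (\<forall>t \<le> d. (\<forall>r. regs (config_at P c t) r < W) \<and> (\<forall>a i. mem (config_at P c t) a i < W)) \<and>
   tr (snd y) = tr (snd x) @ map (apfst ((+) (tm (snd x)))) (output_trace P c d))"
proof (induction rule: reach.induct)
 case (reach_refl s i)
 then show ?case by (simp add: config_at_def output_trace_def fits_def cfg_def)
next
 case (reach_step s i j s1 y)
 let ?c = "cfg i s"
 let ?d = "tm (snd y) - tm s1"
 have h: "\<not> halted P ?c" using reach_step by (simp add: halted_def cfg_def)
 have st: "step P ?c = cfg j s1" using reach_step h by (simp add: step_def cfg_def)
 have "tm s1 \<le> tm (snd y)" using reach_step.IH by simp
 then have d: "tm (snd y) - tm s = Suc ?d" using reach_step.hyps(5) by simp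
 have f: "(\<forall>r. regs ?c r < W) \<and> (\<forall>a i. mem ?c a i < W)"
  using reach_step.hyps(1) by (simp add: fits_def cfg_def)
 have IH: "config_at P (cfg j s1) ?d = cfg (fst y) (snd y)"
   "\<forall>t \<le> ?d. (\<forall>r. regs (config_at P (cfg j s1) t) r < W) \<and> (\<forall>a i. mem (config_at P (cfg j s1) t) a i < W)"
   "tr (snd y) = tr s1 @ map (apfst ((+) (tm s1))) (output_trace P (cfg j s1) ?d)"
   "tm s1 \<le> tm (snd y)"
  using reach_step.IH by (simp_all add: Let_def)
 have fa: "\<forall>t \<le> Suc ?d. (\<forall>r. regs (config_at P ?c t) r < W) \<and> (\<forall>a i. mem (config_at P ?c t) a i < W)"
 proof (intro allI impI)
  fix t assume "t \<le> Suc ?d"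
  then show "(\<forall>r. regs (config_at P ?c t) r < W) \<and> (\<forall>a i. mem (config_at P ?c t) a i < W)"
   using f IH(2) by (cases t) (auto simp: config_at_0 config_at_Suc st)
 qed
 have "apfst ((+) (tm s)) (apfst Suc z) = apfst ((+) (tm s1)) z" for z :: "nat \<times> osym"
  using reach_step by (cases z) auto
 then have o: "tr (snd y) = tr s @ map (apfst ((+) (tm s))) (output_trace P ?c (Suc ?d))"
  using IH(3) reach_step.hyps by (simp add: output_trace_Suc st o_def)
 show ?case
  using fa o IH(1,4) reach_step.hyps(5) unfolding Let_def fst_conv snd_conv d
  by (simp add: config_at_Suc st)
qed

theorem big_run:
 assumes "big (2 ^ w) c s s'" "fits (2 ^ w) s" "tm s = 0" "tr s = []"
 shows "halts_within w (comp 0 c) (cfg 0 s) (tm s')"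
  and "config_at (comp 0 c) (cfg 0 s) (tm s') = cfg (csize c) s'"
  and "output_trace (comp 0 c) (cfg 0 s) (tm s') = tr s'"
  and "fits (2 ^ w) s'"
proof -
 have "code_at (comp 0 c) 0 (comp 0 c)" by (simp add: code_at_def)
 from big_reach[OF assms(1,2) this] have r: "reach (2 ^ w) (comp 0 c) (0, s) (csize c, s')" by simp
 have "apfst ((+) (0::nat)) = (id :: nat \<times> osym => _)" by (auto simp: fun_eq_iff)
 then show "config_at (comp 0 c) (cfg 0 s) (tm s') = cfg (csize c) s'"
  "output_trace (comp 0 c) (cfg 0 s) (tm s') = tr s'"
  "halts_within w (comp 0 c) (cfg 0 s) (tm s')"
  using reach_run[OF r] assms(3,4)
  by (simp_all add: Let_def halts_within_def fits_word_def halted_def cfg_def)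
 show "fits (2 ^ w) s'" using reach_fits[OF r] by simp
qed

section \<open>Weakest preconditions\<close>

text \<open>An evaluation exists only if the program terminates without overflow, so this is total
  correctness including the word bound.\<close>

definition wp :: "nat => com => (st => bool) => st => bool" where
 "wp W c Q s \<longleftrightarrow> (\<exists>s'. big W c s s' \<and> Q s')"

lemma wp_Skip [simp]: "wp W Skip Q s = Q s"
 by (auto simp: wp_def intro: big_Skip elim: big_SkipE)

lemma wp_Basic [simp]: "wp W (Basic i) Q s \<longleftrightarrow> bok W i s \<and> Q (bstep i s)"
 by (auto simp: wp_def intro: big_Basic elim: big_BasicE)

lemma wp_Seq [simp]: "wp W (c ;; d) Q s = wp W c (wp W d Q) s"
 by (auto simp: wp_def intro: big_Seq elim!: big_SeqE)

lemma wp_Cond [simp]: "wp W (Cond a b c d) Q s =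
 (if rg s a < rg s b then wp W c Q (s(|tm := Suc (tm s)|))
  else wp W d (\<lambda>s'. Q (s'(|tm := Suc (tm s')|))) (s(|tm := Suc (tm s)|)))"
 unfolding wp_def by (cases "rg s a < rg s b") (auto intro: big_CondT big_CondF elim!: big_CondE; blast intro: big_CondT big_CondF)+

lemma wp_mono: "wp W c P s ==> (\<And>s'. P s' ==> Q s') ==> wp W c Q s"
 by (auto simp: wp_def)

lemma wp_LoopF: "\<not> rg s a < rg s b ==> wp W (Loop a b c) Q s = Q (s(|tm := Suc (Suc (tm s))|))"
 by (auto simp: wp_def intro: big_LoopF elim: big_LoopE)

lemma wp_LoopT: "rg s a < rg s b ==>
 wp W (Loop a b c) Q s =
  wp W c (\<lambda>s'. wp W (Loop a b c) Q (s'(|tm := Suc (tm s')|))) (s(|tm := Suc (tm s)|))"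
 unfolding wp_def by (auto elim: big_LoopE) (blast intro: big_LoopT elim: big_LoopE)+

fun modr :: "com => nat set" where
 "modr (Basic (Const r k)) = {r}"
| "modr (Basic (Add r a b)) = {r}"
| "modr (Basic (Sub r a b)) = {r}"
| "modr (Basic (Load r a b)) = {r}"
| "modr (c ;; d) = modr c \<union> modr d"
| "modr (Cond a b c d) = modr c \<union> modr d"
| "modr (Loop a b c) = modr c"
| "modr _ = {}"

fun moda :: "com => nat set" where
 "moda (Basic (Store a b r)) = {a}"
| "moda (c ;; d) = moda c \<union> moda d"
| "moda (Cond a b c d) = moda c \<union> moda d"
| "moda (Loop a b c) = moda c"
| "moda _ = {}"

fun silent :: "com => bool" where
 "silent (Basic (OutReg r)) = False"
| "silent (Basic OutSep) = False"
| "silent (Basic OutEnd) = False"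
| "silent (c ;; d) = (silent c \<and> silent d)"
| "silent (Cond a b c d) = (silent c \<and> silent d)"
| "silent (Loop a b c) = silent c"
| "silent _ = True"

lemma big_frame:
 "big W c s s' ==> (\<forall>r. r \<notin> modr c --> rg s' r = rg s r) \<and> (\<forall>a. a \<notin> moda c --> mm s' a = mm s a) \<and>
   (silent c --> tr s' = tr s)"
proof (induction rule: big.induct)
 case (big_Basic i s)
 then show ?case by (cases i) auto
qed auto

text \<open>Registers and arrays that a command cannot modify are framed automatically, so
  specifications only have to speak about what changes.\<close>

lemma wp_use:
 assumes "wp W c P s"
  and "\<And>s'. P s' ==> (\<And>r. r \<notin> modr c ==> rg s' r = rg s r) ==>
   (\<And>a. a \<notin> moda c ==> mm s' a = mm s a) ==> (silent c ==> tr s' = tr s) ==> Q s'"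
 shows "wp W c Q s"
 using assms big_frame unfolding wp_def by blast

lemma wp_Loop:
 fixes f :: "st => nat"
 assumes "Inv s"
  and "\<And>s. Inv s ==> rg s a < rg s b ==>
   wp W c (\<lambda>s'. Inv (s'(|tm := Suc (tm s')|)) \<and> f (s'(|tm := Suc (tm s')|)) < f s) (s(|tm := Suc (tm s)|))"
  and "\<And>s. Inv s ==> \<not> rg s a < rg s b ==> Q (s(|tm := Suc (Suc (tm s))|))"
 shows "wp W (Loop a b c) Q s"
 using assms(1)
proof (induction "f s" arbitrary: s rule: less_induct)
 case less
 show ?case
 proof (cases "rg s a < rg s b")
  case True
  show ?thesis unfolding wp_LoopT[OF True]
   by (rule wp_mono[OF assms(2)[OF less.prems True]]) (auto intro: less.hyps)
 next
  case False
  then show ?thesis using assms(3) less.prems by (simp add: wp_LoopF)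
 qed
qed

text \<open>For invariants with data that are not read off the state, such as the sets still to be
  output or the set of processed vertices; the measure is taken on this ghost data.\<close>

lemma wp_Loop_ghost:
 fixes f :: "'a => nat"
 assumes "Inv g s"
  and "\<And>g s. Inv g s ==> rg s a < rg s b ==>
   wp W c (\<lambda>s'. \<exists>g'. Inv g' (s'(|tm := Suc (tm s')|)) \<and> f g' < f g) (s(|tm := Suc (tm s)|))"
  and "\<And>g s. Inv g s ==> \<not> rg s a < rg s b ==> Q (s(|tm := Suc (Suc (tm s))|))"
 shows "wp W (Loop a b c) Q s"
 using assms(1)
proof (induction "f g" arbitrary: g s rule: less_induct)
 case less
 show ?case
 proof (cases "rg s a < rg s b")
  case True
  show ?thesis unfolding wp_LoopT[OF True]
   by (rule wp_mono[OF assms(2)[OF less.prems True]]) (auto intro: less.hyps)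
 next
  case False
  then show ?thesis using assms(3) less.prems by (simp add: wp_LoopF)
 qed
qed

text \<open>Register 5 holds the constant 0 and register 6 the constant 1 throughout.\<close>

abbreviation "ZERO \<equiv> 5::nat"
abbreviation "ONE \<equiv> 6::nat"

definition Copy :: "nat => nat => com" where "Copy d a = Basic (Sub d a ZERO)"
definition For :: "nat => nat => com => com" where
 "For i n c = Basic (Const i 0) ;; Loop i n (c ;; Basic (Add i i ONE))"

lemma modr_Copy [simp]: "modr (Copy d a) = {d}" by (simp add: Copy_def)
lemma moda_Copy [simp]: "moda (Copy d a) = {}" by (simp add: Copy_def)
lemma silent_Copy [simp]: "silent (Copy d a)" by (simp add: Copy_def)
lemma modr_For [simp]: "modr (For i n c) = insert i (modr c)" by (auto simp: For_def)
lemma moda_For [simp]: "moda (For i n c) = moda c" by (auto simp: For_def)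
lemma silent_For [simp]: "silent (For i n c) = silent c" by (auto simp: For_def)

lemma wp_Copy [simp]: "rg s ZERO = 0 ==>
 wp W (Copy d a) Q s = Q (s(|rg := (rg s)(d := rg s a), tm := Suc (tm s)|))"
 by (simp add: Copy_def)

text \<open>Each round costs 3 steps besides the body (test, increment, jump back), and 3 more are
  spent on initialization and exit. \<open>stable\<close> forbids the invariant to read the counter
  or the clock.\<close>

lemma wp_For:
 assumes "rg s n < W" "rg s ONE = 1" "i ~= n" "i ~= ONE" "i \<notin> modr c" "n \<notin> modr c" "ONE \<notin> modr c"
  and init: "Inv 0 (s(|rg := (rg s)(i := 0), tm := Suc (tm s)|))"
  and body: "\<And>k s'. k < rg s n ==> Inv k s' ==> rg s' i = k ==> rg s' n = rg s n ==>
   (\<And>r. r \<notin> modr (For i n c) ==> rg s' r = rg s r) ==>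
   (\<And>a. a \<notin> moda c ==> mm s' a = mm s a) ==>
   wp W c (\<lambda>s''. Inv (Suc k) s'' \<and> tm s'' \<le> tm s' + C) s'"
  and stable: "\<And>k s' v t. Inv k s' ==> Inv k (s'(|rg := (rg s')(i := v), tm := t|))"
 shows "wp W (For i n c) (\<lambda>s'. Inv (rg s n) s' \<and> tm s' \<le> tm s + rg s n * (C + 3) + 3) s"
proof -
 let ?I = "\<lambda>s'. rg s' i \<le> rg s n \<and> Inv (rg s' i) s' \<and> tm s' \<le> tm s + 1 + rg s' i * (C + 3) \<and>
   (\<forall>r. r \<notin> modr (For i n c) --> rg s' r = rg s r) \<and> (\<forall>a. a \<notin> moda c --> mm s' a = mm s a)"
 have stab2: "Inv k s' ==> Inv k (s'(|tm := t|))" for k s' t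
  using stable[where k = k and s' = s' and v = "rg s' i" and t = t] by simp
 have nn: "n \<notin> modr (For i n c)" "ONE \<notin> modr (For i n c)" using assms by auto
 have "wp W (Loop i n (c ;; Basic (Add i i ONE)))
   (\<lambda>s'. Inv (rg s n) s' \<and> tm s' \<le> tm s + rg s n * (C + 3) + 3) (s(|rg := (rg s)(i := 0), tm := Suc (tm s)|))"
 proof (rule wp_Loop[where Inv = ?I and f = "\<lambda>s'. rg s n - rg s' i"], goal_cases)
  case 1
  then show ?case using init by simp
 next
  case (2 s')
  let ?k = "rg s' i"
  have k: "?k < rg s n" and n': "rg s' n = rg s n" using 2 nn by auto
  have b: "wp W c (\<lambda>s''. Inv (Suc ?k) s'' \<and> tm s'' \<le> tm (s'(|tm := Suc (tm s')|)) + C) (s'(|tm := Suc (tm s')|))"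
  proof (rule body[OF k])
   show "Inv ?k (s'(|tm := Suc (tm s')|))" using 2 stab2 by blast
  qed (use 2 n' in auto)
  show ?case unfolding wp_Seq
  proof (rule wp_use[OF b], goal_cases)
   case (1 s'')
   have i: "rg s'' i = ?k" and one: "rg s'' ONE = 1" using 1 assms(5,7) 2 nn assms(2) by auto
   have "Inv (Suc ?k) (s''(|rg := (rg s'')(i := Suc ?k), tm := Suc (tm s'') + 1|))"
    using 1(1) stable by blast
   moreover have "tm s'' + 2 \<le> tm s + 1 + Suc ?k * (C + 3)"
    using 1(1) 2(1) by simp
   moreover have "\<forall>r. r \<notin> modr (For i n c) --> rg s'' r = rg s r"
    using 1(2) 2(1) by simp
   moreover have "\<forall>a. a \<notin> moda c --> mm s'' a = mm s a" using 1(3) 2(1) by simp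
   ultimately show ?case
    using k i one assms(1) by simp
  qed
 next
  case (3 s')
  then have "rg s' n = rg s n" using nn by auto
  then have "rg s' i = rg s n" using 3 by auto
  then show ?case using 3 stab2 by auto
 qed
 then show ?thesis using assms(1) by (simp add: For_def)
qed

declare [[coercion Basic]]

section \<open>The enumeration program\<close>

text \<open>
 Arrays 16 to 33 hold the cells: kind (0 leaf, 1 product, 2 union), first child and its map, second
 child and its map, leading alternative and its map, first element. A map or element occupies one
 array per entry. The remaining arrays are the choice stack (41 to 46), the list of pending factors
 (47 to 50), the output buffer (51) and a selection buffer (52).
\<close>

definition mapat :: "(nat => nat => nat) => nat => nat => emap => bool" where
 "mapat \<mu> a c f \<longleftrightarrow> \<mu> a c = fst (fst f) \<and> \<mu> (a + 1) c = snd (fst f) \<and>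
   \<mu> (a + 2) c = fst (snd f) \<and> \<mu> (a + 3) c = snd (snd f)"

definition map_ok :: "nat => emap => bool" where
 "map_ok X f \<longleftrightarrow> fst (fst f) \<le> 1 \<and> fst (snd f) \<le> 1 \<and> snd (fst f) \<le> X \<and> snd (snd f) \<le> X"

definition hdr :: "(nat => nat => nat) => nat => ct => bool" where
 "hdr \<mu> c t \<longleftrightarrow> mapat \<mu> 28 c (snd (lead t)) \<and> \<mu> 32 c = fst (el t) \<and> \<mu> 33 c = snd (el t)"

text \<open>Children have smaller indices, which makes the shared cells acyclic and provides a rank
  for all size estimates. \<open>X\<close> bounds the constants of a single reference.\<close>

primrec rep :: "(nat => nat => nat) => nat => nat => ct => bool" where
 "rep \<mu> X c CL \<longleftrightarrow> \<mu> 16 c = 0 \<and> \<mu> 27 c = c \<and> hdr \<mu> c CL"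
| "rep \<mu> X c (CU t f u g) \<longleftrightarrow> \<mu> 16 c = 2 \<and> \<mu> 27 c = \<mu> 27 (\<mu> 17 c) \<and> hdr \<mu> c (CU t f u g) \<and>
   mapat \<mu> 18 c f \<and> mapat \<mu> 23 c g \<and> map_ok X f \<and> map_ok X g \<and> \<mu> 17 c < c \<and> \<mu> 22 c < c \<and>
   rep \<mu> X (\<mu> 17 c) t \<and> rep \<mu> X (\<mu> 22 c) u"
| "rep \<mu> X c (CP t f u g) \<longleftrightarrow> \<mu> 16 c = 1 \<and> \<mu> 27 c = c \<and> hdr \<mu> c (CP t f u g) \<and>
   mapat \<mu> 18 c f \<and> mapat \<mu> 23 c g \<and> map_ok X f \<and> map_ok X g \<and> \<mu> 17 c < c \<and> \<mu> 22 c < c \<and>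
   rep \<mu> X (\<mu> 17 c) t \<and> rep \<mu> X (\<mu> 22 c) u"

lemma map_ok_idm: "map_ok X idm"
 by (simp add: map_ok_def idm_def)

lemma map_ok_mono: "map_ok X f ==> X \<le> Y ==> map_ok Y f"
 by (auto simp: map_ok_def)

lemma map_ok_cm: "map_ok X f ==> map_ok Y g ==> map_ok (X + Y) (cm f g)"
 by (auto simp: map_ok_def cm_def cme_def)

lemma cme_ok: "map_ok X f ==> snd e \<le> Y ==> fst (cme f e) \<le> 1 \<and> snd (cme f e) \<le> X + Y"
 by (auto simp: map_ok_def cme_def)

text \<open>Each union on the way strictly decreases the index and adds at most \<open>X\<close>, so
  the composed map is bounded by the index difference times \<open>X\<close>.\<close>

lemma rep_lead:
 "rep \<mu> X c t ==> rep \<mu> X (\<mu> 27 c) (fst (lead t)) \<and> \<mu> 27 c \<le> c \<and>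
   map_ok ((c - \<mu> 27 c) * X) (snd (lead t)) \<and> (is_CU t --> \<mu> 27 c < c)"
proof (induction t arbitrary: c)
 case (CU t f u g)
 let ?d = "\<mu> 17 c"
 have IH: "rep \<mu> X (\<mu> 27 ?d) (fst (lead t))" "\<mu> 27 ?d \<le> ?d" "map_ok ((?d - \<mu> 27 ?d) * X) (snd (lead t))"
  using CU.IH(1)[of ?d] CU.prems by auto
 have d: "?d < c" "\<mu> 27 c = \<mu> 27 ?d" using CU.prems by auto
 have "X + (?d - \<mu> 27 ?d) * X = (Suc (?d - \<mu> 27 ?d)) * X" by simp
 also have "\<dots> \<le> (c - \<mu> 27 c) * X" using d IH(2) by (intro mult_le_mono1) linarith
 finally have "map_ok ((c - \<mu> 27 c) * X) (cm f (snd (lead t)))"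
  using map_ok_cm[OF _ IH(3), of X f] CU.prems map_ok_mono by auto
 then show ?case using IH d by simp
qed (auto simp: map_ok_idm)

lemma rep_el: "rep \<mu> X c t ==> fst (el t) \<le> 1 \<and> snd (el t) \<le> c * X"
proof (induction t arbitrary: c)
 case CL
 then show ?case by simp
next
 case (CU t f u g)
 let ?d = "\<mu> 17 c"
 have IH: "snd (el t) \<le> ?d * X" using CU.IH(1)[of ?d] CU.prems by auto
 have "X + ?d * X = Suc ?d * X" by simp
 also have "\<dots> \<le> c * X" using CU.prems by (intro mult_le_mono1) simp
 finally show ?case using cme_ok[of X f "el t" "?d * X"] IH CU.prems by auto
next
 case (CP t f u g)
 let ?d = "\<mu> 17 c"
 have IH: "snd (el t) \<le> ?d * X" using CP.IH(1)[of ?d] CP.prems by auto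
 have "X + ?d * X = Suc ?d * X" by simp
 also have "\<dots> \<le> c * X" using CP.prems by (intro mult_le_mono1) simp
 finally show ?case using cme_ok[of X f "el t" "?d * X"] IH CP.prems by auto
qed

lemma ev_le: "snd e \<le> Y ==> fst p \<le> B ==> snd p \<le> B ==> ev e p \<le> B + Y"
 by (auto simp: ev_def)

text \<open>Branch-free selection: both entries are stored in array 52 and the selector of the map
  serves as address. This keeps the old values available while the registers are overwritten, and
  the cost is the same for every map.\<close>

definition MapAt :: "nat => nat => nat => nat => com" where
 "MapAt a c x y = (Store 52 ZERO x) ;; Store 52 ONE y ;;
   Load 20 a c ;; Load x 52 20 ;; Load 21 (a + 1) c ;; Add x x 21 ;;
   Load 20 (a + 2) c ;; Load y 52 20 ;; Load 21 (a + 3) c ;; Add y y 21"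

lemma modr_MapAt [simp]: "modr (MapAt a c x y) = {20, 21, x, y}" by (auto simp: MapAt_def)
lemma moda_MapAt [simp]: "moda (MapAt a c x y) = {52}" by (auto simp: MapAt_def)
lemma silent_MapAt [simp]: "silent (MapAt a c x y)" by (auto simp: MapAt_def)

lemma wp_MapAt:
 assumes "rg s ZERO = 0" "rg s ONE = 1" "mapat (mm s) a (rg s c) f" "map_ok Z f" "a + 3 < 52"
  and "x \<notin> {20, 21, ZERO, ONE, c, y}" "y \<notin> {20, 21, ZERO, ONE, c}" "c \<notin> {20, 21}"
  and "rg s x \<le> B" "rg s y \<le> B" "B + Z < W"
 shows "wp W (MapAt a c x y) Q s = Q (s(|mm := (mm s)(52 := (mm s 52)(0 := rg s x, 1 := rg s y)),
  rg := (rg s)(x := fst (ap f (rg s x, rg s y)), 20 := fst (snd f), 21 := snd (snd f), y := snd (ap f (rg s x, rg s y))),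
  tm := Suc (Suc (Suc (Suc (Suc (Suc (Suc (Suc (Suc (Suc (tm s))))))))))|))"
proof -
 have "ev (fst f) (rg s x, rg s y) < W" "ev (snd f) (rg s x, rg s y) < W"
  using ev_le[of "fst f" Z "(rg s x, rg s y)" B] ev_le[of "snd f" Z "(rg s x, rg s y)" B] assms
  by (auto simp: map_ok_def)
 moreover have "fst (fst f) = 0 \<or> fst (fst f) = 1" "fst (snd f) = 0 \<or> fst (snd f) = 1"
  using assms(4) by (auto simp: map_ok_def)
 moreover have "c ~= x" "c ~= y" "x ~= y" "y ~= x" "x ~= 20" "x ~= 21" "20 ~= x" "21 ~= x" "y ~= 20" "y ~= 21"
  "20 ~= y" "21 ~= y" "20 ~= c" "21 ~= c" "ZERO ~= x" "ONE ~= x" using assms(6-8) by auto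
 ultimately show ?thesis
  using assms(1-3,5-8) unfolding MapAt_def mapat_def
  by (elim disjE) (simp_all add: ap_def ev_def)
qed

text \<open>Registers 10 to 12 hold the current cell and its pair, 13 the head of the list of
  pending factors, 14 the length of the output buffer, 15 the next free list cell, 16 the height of
  the choice stack, 17 whether the first number of the current set has been written, and 18 whether
  the loop continues. A choice saves 13 to 15, so returning to it restores list and buffer.\<close>

definition push_choice :: "nat => nat => nat => com" where
 "push_choice c x y = (Store 41 16 c) ;; Store 42 16 x ;; Store 43 16 y ;;
   Store 44 16 13 ;; Store 45 16 14 ;; Store 46 16 15 ;; Add 16 16 ONE"

text \<open>Writes the first number of the next set before this set is assembled: the first buffered
  position if there is one, and otherwise the stored first element of the current cell, evaluated at
  the current pair.\<close>

definition start_out :: com where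
 "start_out = Cond 17 ONE
   (Cond ZERO 14 (Load 22 51 ZERO)
    (Store 52 ZERO 11 ;; Store 52 ONE 12 ;; Load 20 32 10 ;;
     Load 22 52 20 ;; Load 21 33 10 ;; Add 22 22 21) ;;
   OutReg 22 ;; Const 17 1) Skip"

definition take_lead :: com where
 "take_lead = (Load 23 16 10) ;; Cond ONE 23 (push_choice 10 11 12) Skip ;;
   MapAt 28 10 11 12 ;; Load 10 27 10"

definition enter_product :: com where
 "enter_product = Copy 24 11 ;; Copy 25 12 ;; MapAt 23 10 24 25 ;; Load 26 22 10 ;;
   Store 47 15 26 ;; Store 48 15 24 ;; Store 49 15 25 ;; Store 50 15 13 ;;
   Copy 13 15 ;; Add 15 15 ONE ;; MapAt 18 10 11 12 ;; Load 10 17 10"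

definition next_factor :: com where
 "next_factor = (Load 10 47 13) ;; Load 11 48 13 ;; Load 12 49 13 ;; Load 13 50 13"

text \<open>Starts at index 1, because the number at index 0 was already written by
  \<open>start_out\<close>.\<close>

definition print_rest :: com where
 "print_rest = (Const 24 1) ;; Loop 24 14 (Load 25 51 24 ;; OutReg 25 ;; Add 24 24 ONE) ;;
   OutSep ;; Const 17 0"

text \<open>By \<open>pend_CU\<close> the rest of a union consists of its second child followed by
  the rest of its first child. The latter is pushed again only if it is a union, since otherwise it
  has no rest.\<close>

definition pop_choice :: com where
 "pop_choice = (Sub 16 16 ONE) ;; Load 10 41 16 ;; Load 11 42 16 ;; Load 12 43 16 ;;
   Load 13 44 16 ;; Load 14 45 16 ;; Load 15 46 16 ;;
   Copy 24 11 ;; Copy 25 12 ;; MapAt 18 10 24 25 ;; Load 26 17 10 ;; Load 23 16 26 ;;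
   Cond ONE 23 (push_choice 26 24 25) Skip ;; MapAt 23 10 11 12 ;; Load 10 22 10"

definition enum_body :: com where
 "enum_body = start_out ;; take_lead ;; Load 23 16 10 ;;
   Cond ZERO 23 enter_product
    (Store 51 14 11 ;; Add 14 14 ONE ;;
    Cond ZERO 13 next_factor
     (print_rest ;; Cond ZERO 16 pop_choice (Const 18 0)))"

text \<open>The list of factors begins at address 1, so that 0 can be its end. The empty set is
  written at once if array 40 says so; array 53 leads to the slot of all nonempty accepted sets,
  whose map is applied to the pair of zeros.\<close>

definition enum_prog :: com where
 "enum_prog = (Const 11 0) ;; Const 12 0 ;; Const 13 0 ;; Const 14 0 ;;
   Const 15 1 ;; Const 16 0 ;; Const 17 0 ;; Const 18 0 ;;
   Load 20 40 0 ;; Cond ZERO 20 (OutSep) Skip ;;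
   Load 22 53 0 ;; MapAt 12 22 11 12 ;; Load 10 11 22 ;;
   Cond ZERO 10 (Const 18 1) Skip ;;
   Loop ZERO 18 enum_body ;; OutEnd"

text \<open>The part \<open>grp pre xss td\<close> of the output extends the prefix \<open>pre\<close> by a set of \<open>xss\<close> and by the pending factors \<open>td\<close>.\<close>

definition grp :: "nat list => nat list list => titem list => nat list list" where
 "grp pre xss td = concat (map (\<lambda>a. map (\<lambda>r. pre @ a @ r) (prodl td)) xss)"

lemma grp_simps [simp]: "grp pre [] td = []" "grp pre (xss @ yss) td = grp pre xss td @ grp pre yss td"
 "grp pre [xs] [] = [pre @ xs]"
 by (simp_all add: grp_def)

lemma grp_product: "grp pre (alls (CP t f u g) p) td = grp pre (alls t (ap f p)) ((u, ap g p) # td)"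
proof -
 have "concat (concat xss) = concat (map concat xss)" for xss :: "nat list list list list"
  by (induction xss) auto
 then show ?thesis by (simp add: grp_def map_concat o_def)
qed

lemma grp_factor: "grp pre [[x]] ((t, q) # td) = grp (pre @ [x]) (alls t q) td"
 by (simp add: grp_def map_concat o_def)

type_synonym choice = "ct \<times> (nat \<times> nat) \<times> titem list \<times> nat \<times> nat"

text \<open>A saved alternative refers to the buffer as it was when saved, that is, to its first
  \<open>l\<close> entries.\<close>

definition louts :: "nat list => choice list => nat list list" where
 "louts pre cs = concat (map (\<lambda>(t, p, td, l, h). grp (take l pre) (pend t p) td) cs)"

definition remaining :: "ct => nat \<times> nat => titem list => nat list => choice list => nat list list" where
 "remaining t p td pre cs = grp pre (alls t p) td @ louts pre cs"

lemma louts_simps [simp]: "louts pre [] = []"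
 "louts pre ((t, p, td, l, h) # cs) = grp (take l pre) (pend t p) td @ louts pre cs"
 by (simp_all add: louts_def)

lemma hd_remaining:
 "remaining t p td pre cs ~= []"
 "hd (remaining t p td pre cs) = pre @ hd (alls t p) @ hd (prodl td)"
proof -
 obtain a as where a: "alls t p = a # as" using alls_nonempty(1)[of t p] by (cases "alls t p") auto
 obtain r rs where r: "prodl td = r # rs" using prodl_nonempty[of td] by (cases "prodl td") auto
 show "remaining t p td pre cs ~= []" "hd (remaining t p td pre cs) = pre @ hd (alls t p) @ hd (prodl td)"
  by (simp_all add: remaining_def grp_def a r)
qed

lemma wp_Seq_fun: "wp W (c ;; d) Q = wp W c (wp W d Q)"
 by (rule ext) simp

section \<open>Invariants of the enumeration\<close>

locale cells =
 fixes \<mu>0 :: "nat => nat => nat" and N X W Bd :: nat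
 assumes NX: "N * X < W" and phi_W: "(2 * Bd + 3) * (N + 2) + N < W"
begin

text \<open>Going down one reference adds at most \<open>X\<close> to a position and decreases the
  index by at least 1. Bounding the positions at index \<open>c\<close> by
  \<open>(N - c) * X\<close> is therefore inductive, and positions never exceed
  \<open>N * X\<close>.\<close>

definition item :: "nat => nat \<times> nat => ct => nat \<times> nat => bool" where
 "item c q t p \<longleftrightarrow> q = p \<and> rep \<mu>0 X c t \<and> c \<le> N \<and> fst p \<le> (N - c) * X \<and> snd p \<le> (N - c) * X"

primrec trep :: "(nat => nat => nat) => nat => titem list => bool" where
 "trep \<mu> q [] \<longleftrightarrow> q = 0"
| "trep \<mu> q (x # td) \<longleftrightarrow> q ~= 0 \<and> item (\<mu> 47 q) (\<mu> 48 q, \<mu> 49 q) (fst x) (snd x) \<and> \<mu> 50 q < q \<and> trep \<mu> (\<mu> 50 q) td"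

text \<open>This potential bounds the height of the choice stack.\<close>

definition \<phi> :: "nat => nat => nat" where "\<phi> lev c = lev * (N + 2) + (N - c)"

text \<open>The saved heights decrease down the stack and never exceed the current ones. Buffer and
  factor list are written only at or beyond their current heights, so saved entries stay
  intact.\<close>

fun srep :: "(nat => nat => nat) => nat => nat => nat => choice list => bool" where
 "srep \<mu> k len h [] \<longleftrightarrow> k = 0"
| "srep \<mu> k len h ((t, p, td, l', h') # cs) \<longleftrightarrow> (\<exists>j. k = Suc j \<and>
   item (\<mu> 41 j) (\<mu> 42 j, \<mu> 43 j) t p \<and> is_CU t \<and> \<mu> 44 j < h' \<and> trep \<mu> (\<mu> 44 j) td \<and>
   \<mu> 45 j = l' \<and> \<mu> 46 j = h' \<and> h' = l' + length td + 1 \<and> l' \<le> len \<and> h' \<le> h \<and>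
   Suc j \<le> \<phi> (l' + h') (\<mu> 41 j) \<and> srep \<mu> j l' h' cs)"

lemma trep_cong:
 "(\<And>a i. a \<in> {47..50} ==> i \<le> q ==> \<mu>' a i = \<mu> a i) ==> trep \<mu> q td ==> trep \<mu>' q td"
proof (induction td arbitrary: q)
 case (Cons x td)
 have e: "\<mu>' 47 q = \<mu> 47 q" "\<mu>' 48 q = \<mu> 48 q" "\<mu>' 49 q = \<mu> 49 q" "\<mu>' 50 q = \<mu> 50 q"
  using Cons.prems(1) by simp_all
 have "trep \<mu>' (\<mu> 50 q) td"
  by (rule Cons.IH) (use Cons.prems in auto)
 then show ?case using Cons.prems(2) e by simp
qed simp

lemma srep_cong:
 "srep \<mu> k len h cs ==> (\<And>a i. a \<in> {41..46} ==> i < k ==> \<mu>' a i = \<mu> a i) ==>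
  (\<And>a i. a \<in> {47..50} ==> i < h ==> \<mu>' a i = \<mu> a i) ==> srep \<mu>' k len h cs"
proof (induction \<mu> k len h cs rule: srep.induct)
 case (2 \<mu> k len h t p td l' h' cs)
 from 2(2) obtain j where j: "k = Suc j" "\<mu> 44 j < h'" "trep \<mu> (\<mu> 44 j) td" "h' \<le> h" "srep \<mu> j l' h' cs"
  by auto
 have e: "\<mu>' a j = \<mu> a j" if "a \<in> {41..46}" for a using 2(3) j that by simp
 have "srep \<mu>' j l' h' cs"
  by (rule 2(1)) (use 2(3,4) j in auto)
 moreover have "trep \<mu>' (\<mu> 44 j) td"
  by (rule trep_cong[OF _ j(3)]) (use 2(4) j in auto)
 ultimately show ?case using 2(2) e j(1) by auto
qed simp

lemma srep_mono: "srep \<mu> k len h cs ==> len \<le> len' ==> h \<le> h' ==> srep \<mu> k len' h' cs"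
 by (cases cs) auto

text \<open>Every allocated list cell belongs to a pending factor or has been traded for a buffered
  position; this is the equation for register 15. The level \<open>rg s 14 + rg s 15\<close> grows
  with each product entered and with each position buffered before a further factor, and the
  potential at this level bounds the choice stack.\<close>

definition cur_ok :: "st => ct => nat \<times> nat => titem list => nat list => choice list => bool" where
 "cur_ok s t p td pre cs \<longleftrightarrow> rg s 5 = 0 \<and> rg s 6 = 1 \<and> (\<forall>a \<in> {16..33}. mm s a = \<mu>0 a) \<and>
   item (rg s 10) (rg s 11, rg s 12) t p \<and> trep (mm s) (rg s 13) td \<and> rg s 13 < rg s 15 \<and>
   rg s 15 = rg s 14 + length td + 1 \<and> rg s 14 = length pre \<and> (\<forall>i < length pre. mm s 51 i = pre ! i) \<and>
   srep (mm s) (rg s 16) (rg s 14) (rg s 15) cs \<and> rg s 16 + 1 \<le> \<phi> (rg s 14 + rg s 15) (rg s 10)"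

lemma cur_ok_frame:
 assumes "cur_ok s t p td pre cs" "\<And>r. r \<in> {5, 6, 10, 11, 12, 13, 14, 15, 16} ==> rg s' r = rg s r"
  and "\<And>a. a \<in> {16..33} \<union> {41..51} ==> mm s' a = mm s a"
 shows "cur_ok s' t p td pre cs"
proof -
 have t: "trep (mm s') q td = trep (mm s) q td" for q td
  using trep_cong[of q "mm s'" "mm s" td] trep_cong[of q "mm s" "mm s'" td] assms(3) by auto
 have r: "rg s' 5 = rg s 5" "rg s' 6 = rg s 6" "rg s' 10 = rg s 10" "rg s' 11 = rg s 11" "rg s' 12 = rg s 12"
  "rg s' 13 = rg s 13" "rg s' 14 = rg s 14" "rg s' 15 = rg s 15" "rg s' 16 = rg s 16" "mm s' 51 = mm s 51"
  using assms(2,3) by simp_all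
 have "srep (mm s') (rg s 16) (rg s 14) (rg s 15) cs"
  by (rule srep_cong[of "mm s"]) (use assms in \<open>auto simp: cur_ok_def\<close>)
 moreover have "\<forall>a \<in> {16..33}. mm s' a = \<mu>0 a" using assms(1,3) by (simp add: cur_ok_def)
 ultimately show ?thesis using assms(1) unfolding cur_ok_def r t by blast
qed

lemma cur_ok_tm: "cur_ok s t p td pre cs ==> cur_ok (s(|tm := k|)) t p td pre cs"
 by (erule cur_ok_frame) auto

lemma shift_le: "c' < c ==> c \<le> N ==> (N - c) * X + X \<le> (N - c') * X"
proof -
 assume "c' < c" "c \<le> N"
 then have "Suc (N - c) * X \<le> (N - c') * X" by (intro mult_le_mono1) simp
 then show ?thesis by simp
qed

lemma lead_le: "c' \<le> c ==> c \<le> N ==> (N - c) * X + (c - c') * X = (N - c') * X"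
 by (simp flip: add_mult_distrib)

lemma sub_le_W: "(N - c) * X < W"
 by (rule le_less_trans[OF mult_le_mono1[OF diff_le_self] NX])

lemma phi_less: "len + d + 1 \<le> Bd ==> \<phi> (len + (len + d + 1)) c < W"
proof -
 assume "len + d + 1 \<le> Bd"
 then have "(len + (len + d + 1)) * (N + 2) \<le> (2 * Bd + 3) * (N + 2)" by (intro mult_le_mono1) simp
 then show ?thesis using phi_W unfolding \<phi>_def by linarith
qed

lemma Bd_W: "Bd + 3 < W"
proof -
 have "Bd + 3 \<le> (2 * Bd + 3) * 1" by simp
 also have "\<dots> \<le> (2 * Bd + 3) * (N + 2)" by (rule mult_le_mono2) simp
 also have "\<dots> < W" by (rule add_lessD1[OF phi_W])
 finally show ?thesis .
qed

lemma item_map: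
 assumes "item c q t p" "map_ok X f" "c' < c" "rep \<mu>0 X c' u" "q' = ap f p"
 shows "item c' q' u (ap f p)"
 using assms shift_le[of c' c] ev_le[of "fst f" X p "(N - c) * X"] ev_le[of "snd f" X p "(N - c) * X"]
 unfolding item_def map_ok_def by (auto simp: ap_def)

lemma item_lead:
 assumes "item c q t p" "q' = ap (snd (lead t)) p"
 shows "item (\<mu>0 27 c) q' (fst (lead t)) (ap (snd (lead t)) p)"
proof -
 have r: "rep \<mu>0 X (\<mu>0 27 c) (fst (lead t))" "\<mu>0 27 c \<le> c" "map_ok ((c - \<mu>0 27 c) * X) (snd (lead t))"
  and c: "c \<le> N" "fst p \<le> (N - c) * X" "snd p \<le> (N - c) * X"
  using assms(1) rep_lead[of \<mu>0 X c t] by (auto simp: item_def)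
 have "ev e p \<le> (N - \<mu>0 27 c) * X" if "snd e \<le> (c - \<mu>0 27 c) * X" for e
  using ev_le[OF that c(2,3)] unfolding lead_le[OF r(2) c(1)] .
 then show ?thesis using assms(2) r c by (auto simp: item_def ap_def map_ok_def)
qed

lemma wp_start:
 assumes "cur_ok s t p td pre cs" "rg s 17 \<le> 1"
 shows "wp W start_out (\<lambda>s'. cur_ok s' t p td pre cs \<and> rg s' 17 = 1 \<and> rg s' 18 = rg s 18 \<and> tm s' \<le> tm s + 12 \<and>
   (if rg s 17 = 0 then \<exists>u. tm s \<le> u \<and> u \<le> tm s + 12 \<and> tr s' = tr s @ [(u, Num (hd (hd (remaining t p td pre cs))))]
   else tr s' = tr s)) s"
proof -
 let ?h = "hd (hd (remaining t p td pre cs))"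
 have c: "rg s 5 = 0" "rg s 6 = 1" "rg s 14 = length pre" "\<And>a. a \<in> {16..33} ==> mm s a = \<mu>0 a"
  and it: "item (rg s 10) (rg s 11, rg s 12) t p" and pr: "\<forall>i < length pre. mm s 51 i = pre ! i"
  using assms(1) by (auto simp: cur_ok_def)
 have el: "fst (el t) \<le> 1" "snd (el t) \<le> rg s 10 * X" and h: "hdr \<mu>0 (rg s 10) t" and p: "p = (rg s 11, rg s 12)"
  using it rep_el[of \<mu>0 X "rg s 10" t] by (cases t; auto simp: item_def)+
 \<comment> \<open>The position bound of the item and the bound on the stored first element, the
   index times \<open>X\<close>, add up to \<open>N * X\<close>.\<close>
 have "(N - rg s 10) * X + rg s 10 * X = N * X" using it by (simp add: item_def flip: add_mult_distrib)
 then have "ev (el t) p \<le> N * X"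
  using ev_le[OF el(2), of p "(N - rg s 10) * X"] it by (auto simp: item_def)
 then have evW: "ev (el t) p < W" using NX by simp
 have hne: "pre ~= [] ==> ?h = pre ! 0" "pre = [] ==> ?h = ev (el t) p"
  using hd_remaining[of t p td pre cs] alls_nonempty(1)[of t p] alls_nonempty(2)[OF hd_in_set, of t p]
  by (auto simp: hd_append hd_alls hd_conv_nth[of pre])
 have elr: "mm s 32 (rg s 10) = fst (el t)" "mm s 33 (rg s 10) = snd (el t)" using c(4) h by (auto simp: hdr_def)
 have "wp W start_out (\<lambda>s'. rg s' 17 = 1 \<and> tm s' \<le> tm s + 12 \<and>
   (if rg s 17 = 0 then \<exists>u. tm s \<le> u \<and> u \<le> tm s + 12 \<and> tr s' = tr s @ [(u, Num ?h)] else tr s' = tr s)) s"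
 proof (cases "rg s 17 = 0")
  case False
  then show ?thesis using c assms(2) by (simp add: start_out_def)
 next
  case 0: True
  show ?thesis
  proof (cases "pre = []")
   case True
   have "fst (el t) = 0 \<or> fst (el t) = 1" using el(1) by auto
   then show ?thesis using c 0 True hne evW elr p Bd_W by (elim disjE) (simp_all add: start_out_def ev_def)
  next
   case False
   then show ?thesis using c 0 hne pr Bd_W by (simp add: start_out_def)
  qed
 qed
 then show ?thesis
 proof (rule wp_use, goal_cases)
  case (1 s')
  have "cur_ok s' t p td pre cs" using assms(1) by (rule cur_ok_frame) (use 1 in \<open>auto simp: start_out_def\<close>)
  moreover have "rg s' 18 = rg s 18" using 1 by (simp add: start_out_def)
  ultimately show ?case using 1(1) by simp
 qed
qed

lemma srep_push:
 assumes "srep \<mu> k len h cs" "item c (x, y) t p" "is_CU t" "q < h" "trep \<mu> q td" "h = len + length td + 1"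
  "Suc k \<le> \<phi> (len + h) c" "\<forall>a < 47. \<forall>i < k. \<mu>' a i = \<mu> a i" "\<forall>a \<in> {47..50}. \<mu>' a = \<mu> a"
  "\<mu>' 41 k = c" "\<mu>' 42 k = x" "\<mu>' 43 k = y" "\<mu>' 44 k = q" "\<mu>' 45 k = len" "\<mu>' 46 k = h"
 shows "srep \<mu>' (Suc k) len h ((t, p, td, len, h) # cs)"
proof -
 have "srep \<mu>' k len h cs" using assms(1) by (rule srep_cong) (use assms in auto)
 moreover have "trep \<mu>' q td" using assms(5) by (rule trep_cong[rotated]) (use assms in auto)
 ultimately show ?thesis using assms by simp
qed

lemma wp_take:
 assumes "cur_ok s t p td pre cs" "length pre + length td + 1 \<le> Bd"
 shows "wp W take_lead (\<lambda>s'. cur_ok s' (fst (lead t)) (ap (snd (lead t)) p) td pre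
    (if is_CU t then (t, p, td, length pre, length pre + length td + 1) # cs else cs) \<and>
   tm s' \<le> tm s + 25) s"
proof -
 have c: "rg s 5 = 0" "rg s 6 = 1" "rg s 14 = length pre" "rg s 15 = length pre + length td + 1"
   "\<And>a. a \<in> {16..33} ==> mm s a = \<mu>0 a" "trep (mm s) (rg s 13) td" "rg s 13 < rg s 15"
   "srep (mm s) (rg s 16) (rg s 14) (rg s 15) cs" "rg s 16 + 1 \<le> \<phi> (rg s 14 + rg s 15) (rg s 10)"
   "\<forall>i < length pre. mm s 51 i = pre ! i"
  and it: "item (rg s 10) (rg s 11, rg s 12) t p"
  using assms(1) by (auto simp: cur_ok_def)
 let ?cs = "if is_CU t then (t, p, td, length pre, length pre + length td + 1) # cs else cs"
 have kd: "mm s 16 (rg s 10) = (if is_CU t then 2 else mm s 16 (rg s 10))" "\<not> is_CU t ==> mm s 16 (rg s 10) \<le> 1"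
  and hdr: "hdr \<mu>0 (rg s 10) t"
  using it c(5) by (cases t; auto simp: item_def)+
 have p: "p = (rg s 11, rg s 12)" "rg s 11 \<le> (N - rg s 10) * X" "rg s 12 \<le> (N - rg s 10) * X" "rg s 10 \<le> N"
  and rep: "rep \<mu>0 X (rg s 10) t" using it by (auto simp: item_def)
 note rl = rep_lead[OF rep]
 have W1: "rg s 16 + 1 < W" using c(9) phi_less[OF assms(2), of "rg s 10"] c(3,4) by simp
 let ?lc = "\<mu>0 27 (rg s 10)"
 have "(N - rg s 10) * X + (rg s 10 - ?lc) * X < W" using lead_le[of ?lc "rg s 10"] rl p(4) sub_le_W by simp
 moreover have "mapat (mm s) 28 (rg s 10) (snd (lead t))" using hdr c(5) by (simp add: hdr_def mapat_def)
 moreover note item_lead[OF it refl]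
 moreover have "trep \<mu> (rg s 13) td" if "\<forall>a \<in> {47..50}. \<mu> a = mm s a" for \<mu>
  by (rule trep_cong[OF _ c(6)]) (use that in auto)
 moreover have "srep \<mu> (rg s 16) (rg s 14) (rg s 15) cs" if "\<forall>a \<in> {41..50}. \<mu> a = mm s a" for \<mu>
  by (rule srep_cong[OF c(8)]) (use that in auto)
 \<comment> \<open>A union is left for a strictly smaller index, which raises the potential enough
   for the entry just pushed.\<close>
 moreover have "rg s 16 + (if is_CU t then 2 else 1) \<le> \<phi> (rg s 14 + rg s 15) ?lc"
  using c(9) rl p(4) unfolding \<phi>_def by auto
 moreover note M = wp_MapAt[where a = 28 and f = "snd (lead t)" and Z = "(rg s 10 - ?lc) * X" and B = "(N - rg s 10) * X"]
 ultimately show ?thesis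
  using kd c p W1 rl srep_push[OF c(8) it _ c(7,6)]
  by (cases "is_CU t") (simp_all add: take_lead_def push_choice_def M cur_ok_def mapat_def del: srep.simps)
qed

lemma wp_product:
 assumes "cur_ok s (CP t f u g) p td pre cs" "length pre + length td + 2 \<le> Bd"
 shows "wp W enter_product (\<lambda>s'. cur_ok s' t (ap f p) ((u, ap g p) # td) pre cs \<and> tm s' \<le> tm s + 40) s"
proof -
 let ?c = "rg s 10" and ?h = "rg s 15"
 have c: "rg s 5 = 0" "rg s 6 = 1" "rg s 14 = length pre" "?h = length pre + length td + 1"
   "\<And>a. a \<in> {16..33} ==> mm s a = \<mu>0 a" "trep (mm s) (rg s 13) td" "rg s 13 < ?h"
   "srep (mm s) (rg s 16) (rg s 14) ?h cs" "rg s 16 + 1 \<le> \<phi> (rg s 14 + ?h) ?c"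
   "\<forall>i < length pre. mm s 51 i = pre ! i"
  and it: "item ?c (rg s 11, rg s 12) (CP t f u g) p"
  using assms(1) by (auto simp: cur_ok_def)
 have p: "p = (rg s 11, rg s 12)" "rg s 11 \<le> (N - ?c) * X" "rg s 12 \<le> (N - ?c) * X" "?c \<le> N"
  and r: "mapat \<mu>0 18 ?c f" "mapat \<mu>0 23 ?c g" "map_ok X f" "map_ok X g" "\<mu>0 17 ?c < ?c" "\<mu>0 22 ?c < ?c"
   "rep \<mu>0 X (\<mu>0 17 ?c) t" "rep \<mu>0 X (\<mu>0 22 ?c) u"
  using it by (auto simp: item_def)
 have BW: "(N - ?c) * X + X < W"
  using shift_le[OF r(5) p(4)] sub_le_W[of "\<mu>0 17 ?c"] by linarith
 have hW: "?h + 1 < W" using c(4) assms(2) Bd_W by simp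
 have tr: "trep \<mu> (rg s 13) td" if "\<forall>a < 51. \<forall>i < ?h. \<mu> a i = mm s a i" for \<mu>
  by (rule trep_cong[OF _ c(6)]) (use that c(7) in auto)
 have sr: "srep \<mu> (rg s 16) (rg s 14) (Suc ?h) cs" if "\<forall>a < 47. \<mu> a = mm s a" "\<forall>a < 51. \<forall>i < ?h. \<mu> a i = mm s a i" for \<mu>
  by (rule srep_mono[OF srep_cong[OF c(8)]]) (use that in auto)
 \<comment> \<open>The factor list grows, so the level rises by one; this outweighs any change of
   the index.\<close>
 have "rg s 16 + 1 \<le> \<phi> (rg s 14 + (?h + 1)) (\<mu>0 17 ?c)" using c(9) unfolding \<phi>_def by simp
 moreover have "mapat (mm s) 18 ?c f" "mapat (mm s) 23 ?c g" using r c(5) by (simp_all add: mapat_def)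
 moreover note item_map[OF it r(4,6,8) refl] item_map[OF it r(3,5,7) refl]
 ultimately show ?thesis
  using c p r BW hW tr sr
  by (simp add: enter_product_def wp_MapAt[where a = 23 and f = g and Z = X and B = "(N - ?c) * X"]
   wp_MapAt[where a = 18 and f = f and Z = X and B = "(N - ?c) * X"] cur_ok_def mapat_def)
qed

lemma wp_factor:
 assumes "cur_ok s CL p ((t, q) # td) pre cs" "length pre + length td + 2 \<le> Bd"
 shows "wp W (Store 51 14 11 ;; Add 14 14 ONE ;; Cond ZERO 13 next_factor d)
   (\<lambda>s'. cur_ok s' t q td (pre @ [fst p]) cs \<and> rg s' 17 = rg s 17 \<and> rg s' 18 = rg s 18 \<and> tr s' = tr s \<and>
    tm s' \<le> tm s + 10) s"
proof -
 let ?r = "rg s 13"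
 have c: "rg s 5 = 0" "rg s 6 = 1" "rg s 14 = length pre" "rg s 15 = length pre + length td + 2"
   "\<And>a. a \<in> {16..33} ==> mm s a = \<mu>0 a" "trep (mm s) ?r ((t, q) # td)" "?r < rg s 15"
   "srep (mm s) (rg s 16) (rg s 14) (rg s 15) cs" "rg s 16 + 1 \<le> \<phi> (rg s 14 + rg s 15) (rg s 10)"
   "\<forall>i < length pre. mm s 51 i = pre ! i"
  and p: "p = (rg s 11, rg s 12)"
  using assms(1) by (auto simp: cur_ok_def item_def)
 have q: "item (mm s 47 ?r) (mm s 48 ?r, mm s 49 ?r) t q" "trep (mm s) (mm s 50 ?r) td" "mm s 50 ?r < ?r"
  using c(6) by auto
 let ?\<mu> = "(mm s)(51 := (mm s 51)(length pre := rg s 11))"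
 have t: "trep ?\<mu> (mm s 50 ?r) td" using q(2) by (rule trep_cong[rotated]) auto
 have "srep ?\<mu> (rg s 16) (rg s 14) (rg s 15) cs" using c(8) by (rule srep_cong) auto
 then have sr: "srep ?\<mu> (rg s 16) (rg s 14 + 1) (rg s 15) cs" by (rule srep_mono) simp_all
 have "rg s 16 + 1 \<le> \<phi> (rg s 14 + 1 + rg s 15) (mm s 47 ?r)"
  using c(9) unfolding \<phi>_def by simp
 moreover have "\<forall>i < Suc (length pre). ((mm s 51)(length pre := rg s 11)) i = (pre @ [rg s 11]) ! i"
  using c(10) by (simp add: nth_append less_Suc_eq)
 moreover have "0 < ?r" using c(6) by simp
 moreover have "mm s 50 ?r < Suc (Suc (length pre + length td))" using q(3) c(4,7) by linarith
 ultimately show ?thesis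
  using c(1-5) t sr q(1) p assms(2) Bd_W by (simp add: next_factor_def cur_ok_def del: fun_upd_apply) (simp add: fun_upd_def)
qed

lemma wp_print:
 assumes "\<forall>i < length xs. mm s 51 i = xs ! i" "rg s 14 = length xs" "rg s 6 = 1" "length xs \<le> Bd" "xs ~= []"
 shows "wp W print_rest (\<lambda>s'. rg s' 17 = 0 \<and> tm s' \<le> tm s + 6 * length xs + 6 \<and>
   (\<exists>b. tr s' = tr s @ b \<and> map snd b = map Num (tl xs) @ [Sep])) s"
proof -
 let ?I = "\<lambda>s'. 1 \<le> rg s' 24 \<and> rg s' 24 \<le> length xs \<and> rg s' 14 = length xs \<and> rg s' 6 = 1 \<and> mm s' 51 = mm s 51 \<and>
   tm s' + 6 \<le> tm s + 2 + 6 * rg s' 24 \<and> (\<exists>b. tr s' = tr s @ b \<and> map snd b = map Num (take (rg s' 24 - 1) (tl xs)))"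
 have "wp W (Loop 24 14 (Load 25 51 24 ;; OutReg 25 ;; Add 24 24 ONE))
  (\<lambda>s'. tm s' \<le> tm s + 6 * length xs + 4 \<and> (\<exists>b. tr s' = tr s @ b \<and> map snd b = map Num (tl xs)))
  (s(|rg := (rg s)(24 := 1), tm := Suc (tm s)|))"
 proof (rule wp_Loop[where Inv = ?I and f = "\<lambda>s'. length xs - rg s' 24"], goal_cases)
  case 1
  then show ?case using assms by (cases xs) auto
 next
  case (2 s')
  then obtain b where b: "tr s' = tr s @ b" "map snd b = map Num (take (rg s' 24 - 1) (tl xs))" by auto
  have l: "rg s' 24 < length xs" "1 \<le> rg s' 24" using 2 by auto
  then have "take (rg s' 24) (tl xs) = take (rg s' 24 - 1) (tl xs) @ [xs ! rg s' 24]"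
   using take_Suc_conv_app_nth[of "rg s' 24 - 1" "tl xs"] by (simp add: nth_tl)
  moreover have "mm s' 51 (rg s' 24) = xs ! rg s' 24" using 2 l assms(1) by simp
  ultimately show ?case using 2 b l assms(4) Bd_W by (simp add: nth_tl)
 next
  case (3 s')
  then have "rg s' 24 = length xs" by linarith
  with 3 show ?case by (cases xs) auto
 qed
 then show ?thesis using assms Bd_W unfolding print_rest_def
  by (auto elim!: wp_mono)
qed

end

text \<open>The last argument is the deadline for the start of the next output: the start of the
  previous output plus its allowance, or \<open>d\<close> at the beginning.\<close>

inductive timed :: "nat => nat list list => (nat \<times> osym) list => nat => bool" for d where
 timed_Nil: "timed d [] [] d"
| timed_snoc: "timed d xss ts e ==> map snd b = map Num xs @ [Sep] ==> fst (hd b) \<le> e ==>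
  timed d (xss @ [xs]) (ts @ b) (fst (hd b) + d * (length xs + 1))"

lemma louts_cong:
 "(\<And>t p td l h. (t, p, td, l, h) \<in> set cs ==> take l pre = take l pre') ==> louts pre cs = louts pre' cs"
 by (induction cs) fastforce+

text \<open>This and the next two lemmas say that moving through the data structure never changes
  the list of sets still to be output.\<close>

lemma remaining_take:
 "remaining t p td pre cs = remaining (fst (lead t)) (ap (snd (lead t)) p) td pre
   (if is_CU t then (t, p, td, length pre, h) # cs else cs)"
proof -
 have "grp pre (alls t p) td = grp pre (alls (fst (lead t)) (ap (snd (lead t)) p)) td @ grp pre (pend t p) td"
  by (simp add: alls_def[of t] first_lead)
 then show ?thesis by (auto simp: remaining_def pend_not_CU)
qed

lemma remaining_product:
 "remaining (CP t f u g) p td pre cs = remaining t (ap f p) ((u, ap g p) # td) pre cs"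
 by (simp only: remaining_def grp_product)

lemma remaining_factor:
 assumes "\<And>t p td l h. (t, p, td, l, h) \<in> set cs ==> l \<le> length pre"
 shows "remaining CL p ((t, q) # td) pre cs = remaining t q td (pre @ [fst p]) cs"
proof -
 have "louts pre cs = louts (pre @ [fst p]) cs" by (rule louts_cong) (use assms in fastforce)
 then show ?thesis by (simp only: remaining_def alls_CL grp_factor)
qed

lemma remaining_finish: "remaining CL p [] pre cs = (pre @ [fst p]) # louts pre cs"
 by (simp add: remaining_def)

lemma louts_pop:
 assumes "\<And>t p td l' h. (t, p, td, l', h) \<in> set cs ==> l' \<le> l"
 shows "louts pre ((CU t f u g, q, td, l, h) # cs) =
  remaining u (ap g q) td (take l pre) (if is_CU t then (t, ap f q, td, l, h) # cs else cs)"
proof -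
 have "louts pre cs = louts (take l pre) cs" by (rule louts_cong) (use assms in \<open>fastforce simp: min_def\<close>)
 then show ?thesis by (simp add: remaining_def pend_CU pend_not_CU del: pend.simps)
qed

context cells
begin

lemma srep_len: "srep \<mu> k len h cs ==> (t, p, td, l, h') \<in> set cs ==> l \<le> len"
proof (induction \<mu> k len h cs rule: srep.induct)
 case (2 \<mu> k len h t0 p0 td0 l0 h0 cs)
 then show ?case by fastforce
qed simp

lemma wp_pop:
 assumes "rg s 5 = 0" "rg s 6 = 1" "\<And>a. a \<in> {16..33} ==> mm s a = \<mu>0 a"
  and sr: "srep (mm s) (rg s 16) len h ((CU t f u g, q, td, l, h') # cs)"
  and "\<forall>i < length pre. mm s 51 i = pre ! i" "len \<le> length pre" "rg s 16 < W"
 shows "wp W pop_choice (\<lambda>s'. cur_ok s' u (ap g q) td (take l pre)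
   (if is_CU t then (t, ap f q, td, l, h') # cs else cs) \<and> tm s' \<le> tm s + 60) s"
proof -
 from sr obtain j where k: "rg s 16 = Suc j" and it: "item (mm s 41 j) (mm s 42 j, mm s 43 j) (CU t f u g) q"
  and j: "mm s 44 j < h'" "trep (mm s) (mm s 44 j) td"
   "mm s 45 j = l" "mm s 46 j = h'" "h' = l + length td + 1" "l \<le> len" "Suc j \<le> \<phi> (l + h') (mm s 41 j)"
   "srep (mm s) j l h' cs"
  unfolding srep.simps by (elim exE conjE) (rule that, assumption+)
 let ?c = "mm s 41 j" and ?cs = "if is_CU t then (t, ap f q, td, l, h') # cs else cs"
 have p: "q = (mm s 42 j, mm s 43 j)" "mm s 42 j \<le> (N - ?c) * X" "mm s 43 j \<le> (N - ?c) * X" "?c \<le> N"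
  and r: "mapat \<mu>0 18 ?c f" "mapat \<mu>0 23 ?c g" "map_ok X f" "map_ok X g" "\<mu>0 17 ?c < ?c" "\<mu>0 22 ?c < ?c"
   "rep \<mu>0 X (\<mu>0 17 ?c) t" "rep \<mu>0 X (\<mu>0 22 ?c) u"
  using it by (auto simp: item_def)
 have BW: "(N - ?c) * X + X < W"
  using shift_le[OF r(5) p(4)] sub_le_W[of "\<mu>0 17 ?c"] by linarith
 have kd: "\<mu>0 16 (\<mu>0 17 ?c) = (if is_CU t then 2 else \<mu>0 16 (\<mu>0 17 ?c))" "\<not> is_CU t ==> \<mu>0 16 (\<mu>0 17 ?c) \<le> 1"
  using r(7) by (cases t; simp)+
 have ph: "\<phi> (l + h') ?c + 1 \<le> \<phi> (l + h') (\<mu>0 17 ?c)" "\<phi> (l + h') ?c + 1 \<le> \<phi> (l + h') (\<mu>0 22 ?c)"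
  using r(5,6) p(4) unfolding \<phi>_def by auto
 have "srep \<mu> j l h' cs" if "\<forall>a \<in> {41..50}. \<mu> a = mm s a" for \<mu>
  by (rule srep_cong[OF j(8)]) (use that in auto)
 moreover have "trep \<mu> (mm s 44 j) td" if "\<forall>a \<in> {47..50}. \<mu> a = mm s a" for \<mu>
  by (rule trep_cong[OF _ j(2)]) (use that in auto)
 moreover have i1: "item (\<mu>0 17 ?c) (fst (ap f q), snd (ap f q)) t (ap f q)"
  and "item (\<mu>0 22 ?c) (fst (ap g q), snd (ap g q)) u (ap g q)"
  by (rule item_map[OF it r(3,5,7)] item_map[OF it r(4,6,8)], simp)+
 moreover have "Suc j \<le> \<phi> (l + h') (\<mu>0 17 ?c)" using j(7) ph by linarith
 moreover note srep_push[OF j(8) i1 _ j(1,2,5) this]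
 moreover have "Suc (Suc j) \<le> \<phi> (l + h') (\<mu>0 22 ?c)" "length (take l pre) = l" using j(6,7) ph assms(6) by simp_all
 moreover have "mapat (mm s) 18 ?c f" "mapat (mm s) 23 ?c g" using r assms(3) by (simp_all add: mapat_def)
 moreover note M = wp_MapAt[where a = 18 and f = f and Z = X and B = "(N - ?c) * X"]
  wp_MapAt[where a = 23 and f = g and Z = X and B = "(N - ?c) * X"]
 ultimately show ?thesis
  using kd assms(1,2,3,5,6,7) k j(1,3-6) p r BW
  by (cases "is_CU t") (simp_all add: pop_choice_def push_choice_def M cur_ok_def mapat_def del: srep.simps)
qed

text \<open>The next set consists of the buffered positions, a nonempty set of the current tree and
  at least one number per pending factor. Up to a factor 2, its size thus dominates the level by
  which work is measured.\<close>

lemma remaining_bound: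
 assumes "remaining t p td pre cs = R" "\<And>xs. xs \<in> set R ==> length xs \<le> Bd"
 shows "length pre + length td + 1 \<le> Bd"
proof -
 have "hd R = pre @ hd (alls t p) @ hd (prodl td)" "R ~= []" using hd_remaining[of t p td pre cs] assms(1) by auto
 moreover have "hd (alls t p) ~= []" using alls_nonempty hd_in_set by metis
 moreover have "length td \<le> length (hd (prodl td))" by (intro length_prodl hd_in_set prodl_nonempty)
 moreover have "hd R \<in> set R" using \<open>R ~= []\<close> by simp
 ultimately show ?thesis using assms(2)[of "hd R"] by (cases "hd (alls t p)") auto
qed

text \<open>With no factor pending, the leaf completes a set in the buffer. It is printed at 6 steps
  per number, and the youngest choice, if any, provides the next item in constant time.\<close>

lemma wp_finish:
 assumes cur: "cur_ok s CL p [] pre cs" and lim: "length pre + 1 \<le> Bd"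
 shows "wp W (Store 51 14 11 ;; Add 14 14 ONE ;;
    Cond ZERO 13 n (print_rest ;; Cond ZERO 16 pop_choice (Const 18 0)))
   (\<lambda>s'. rg s' 17 = 0 \<and> rg s' 5 = 0 \<and> tm s' \<le> tm s + 6 * length pre + 90 \<and>
    (\<exists>b. tr s' = tr s @ b \<and> map snd b = map Num (tl (pre @ [fst p])) @ [Sep]) \<and>
    (if cs = [] then rg s' 18 = 0 else rg s' 18 = rg s 18 \<and> (\<exists>t q td pre' cs'. cur_ok s' t q td pre' cs' \<and>
     remaining t q td pre' cs' = louts (pre @ [fst p]) cs))) s"
proof -
 have c: "rg s 5 = 0" "rg s 6 = 1" "rg s 14 = length pre" "rg s 15 = length pre + 1"
   "\<And>a. a \<in> {16..33} ==> mm s a = \<mu>0 a" "rg s 13 = 0"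
   "srep (mm s) (rg s 16) (rg s 14) (rg s 15) cs" "rg s 16 + 1 \<le> \<phi> (rg s 14 + rg s 15) (rg s 10)"
   "\<forall>i < length pre. mm s 51 i = pre ! i"
  and p: "p = (rg s 11, rg s 12)"
  using cur by (auto simp: cur_ok_def item_def)
 let ?Q = "\<lambda>s'. rg s' 17 = 0 \<and> rg s' 5 = 0 \<and> Suc (tm s') \<le> tm s + 6 * length pre + 90 \<and>
   (\<exists>b. tr s' = tr s @ b \<and> map snd b = map Num (tl (pre @ [fst p])) @ [Sep]) \<and>
   (if cs = [] then rg s' 18 = 0 else rg s' 18 = rg s 18 \<and> (\<exists>t q td pre' cs'. cur_ok s' t q td pre' cs' \<and>
     remaining t q td pre' cs' = louts (pre @ [fst p]) cs))"
 let ?pre = "pre @ [fst p]"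
 let ?s1 = "s(|mm := (mm s)(51 := (mm s 51)(length pre := rg s 11)), rg := (rg s)(14 := length pre + 1), tm := Suc (Suc (Suc (tm s)))|)"
 have out: "\<forall>i < length ?pre. mm ?s1 51 i = ?pre ! i"
  using c(9) p by (simp add: nth_append less_Suc_eq)
 have sr1: "srep (mm ?s1) (rg s 16) (length pre) (length pre + 1) cs"
  using c(7) unfolding c(3,4) by (rule srep_cong) simp_all
 have k16: "rg s 16 < W" using c(8) phi_less[of "length pre" 0 "rg s 10"] lim c(3,4) by simp
 have pr: "wp W print_rest (\<lambda>s'. rg s' 17 = 0 \<and> tm s' \<le> tm ?s1 + 6 * length ?pre + 6 \<and>
   (\<exists>b. tr s' = tr ?s1 @ b \<and> map snd b = map Num (tl ?pre) @ [Sep])) ?s1"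
  by (rule wp_print) (use out lim c in auto)
 have "wp W print_rest (wp W (Cond ZERO 16 pop_choice (Const 18 0)) ?Q) ?s1"
 proof (rule wp_use[OF pr], goal_cases)
  case (1 s2)
  have f: "rg s2 5 = 0" "rg s2 6 = 1" "rg s2 16 = rg s 16" "rg s2 18 = rg s 18" "mm s2 = mm ?s1" "rg s2 17 = 0"
   using 1 c by (simp_all add: print_rest_def fun_eq_iff)
  obtain b where b: "tr s2 = tr s @ b" "map snd b = map Num (tl ?pre) @ [Sep]" "tm s2 \<le> tm s + 6 * length pre + 16"
   using 1(1) by auto
  show ?case
  proof (cases cs)
   case Nil
   then show ?thesis using f b c(7) Bd_W by simp
  next
   case (Cons x cs')
   obtain t q td l h where x: "x = (t, q, td, l, h)" by (cases x)
   have sr: "srep (mm s2) (rg s2 16) (length pre) (length pre + 1) ((t, q, td, l, h) # cs')"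
    using sr1 f Cons x by simp
   then obtain t1 f1 t2 f2 where t: "t = CU t1 f1 t2 f2" by (cases t) auto
   have k: "0 < rg s2 16" using sr by auto
   have sl: "\<And>t p td l' h'. (t, p, td, l', h') \<in> set cs' ==> l' \<le> l" using sr srep_len by fastforce
   have po: "wp W pop_choice (\<lambda>s'. cur_ok s' t2 (ap f2 q) td (take l ?pre)
     (if is_CU t1 then (t1, ap f1 q, td, l, h) # cs' else cs') \<and> tm s' \<le> tm (s2(|tm := Suc (tm s2)|)) + 60) (s2(|tm := Suc (tm s2)|))"
    by (rule wp_pop[where len = "length pre" and h = "length pre + 1"])
     (use f c(5) sr[unfolded t] out k16 in \<open>simp_all del: srep.simps\<close>)
   have "wp W pop_choice ?Q (s2(|tm := Suc (tm s2)|))"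
   proof (rule wp_use[OF po], goal_cases)
    case (1 s3)
    have rg3: "rg s3 17 = 0" "rg s3 18 = rg s 18" "tr s3 = tr s @ b" "rg s3 5 = 0"
     using 1 f b by (simp_all add: pop_choice_def push_choice_def)
    have "remaining t2 (ap f2 q) td (take l ?pre) (if is_CU t1 then (t1, ap f1 q, td, l, h) # cs' else cs') = louts ?pre cs"
     unfolding Cons x t by (rule louts_pop[symmetric]) (rule sl)
    then have ex: "\<exists>t q td pre' cs'. cur_ok s3 t q td pre' cs' \<and> remaining t q td pre' cs' = louts ?pre cs"
     using 1(1) by blast
    then show ?case using rg3 b 1(1) Cons by simp
   qed
   then show ?thesis using k f by simp
  qed
 qed
 then have w1: "wp W (print_rest ;; Cond ZERO 16 pop_choice (Const 18 0)) ?Q ?s1"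
  by (simp only: wp_Seq_fun)
 have tick: "cur_ok (s'(|tm := k|)) t q td pre' cs' = cur_ok s' t q td pre' cs'" for s' k t q td pre' cs'
  using cur_ok_tm[of s' t q td pre' cs' k] cur_ok_tm[of "s'(|tm := k|)" t q td pre' cs' "tm s'"] by auto
 have W1: "length pre + 1 < W" using lim Bd_W by simp
 \<comment> \<open>Register 13 is 0, so the test for a pending factor fails; the additional time
   unit is the jump at the end of the else part.\<close>
 have red: "wp W (print_rest ;; Cond ZERO 16 pop_choice (Const 18 0)) (\<lambda>s'. Q (s'(|tm := Suc (tm s')|))) ?s1 ==>
   wp W (Store 51 14 11 ;; Add 14 14 ONE ;;
    Cond ZERO 13 n (print_rest ;; Cond ZERO 16 pop_choice (Const 18 0))) Q s" for Q
  using c(1-4,6) W1 by (simp del: wp_Seq add: wp_Seq[of _ "Store 51 14 11"] wp_Seq[of _ "Add 14 14 ONE"])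
 show ?thesis
  by (rule red) (rule wp_mono[OF w1], simp add: tick split: if_splits)
qed

text \<open>Until the first number of a set is written, at least 20 steps are left to the deadline.
  Afterwards the clock has advanced by at most 100 steps per unit of the level \<open>w\<close>
  since the start \<open>u\<close>; every round that does not complete the set raises
  \<open>w\<close>.\<close>

definition running :: "nat list list => nat list list => nat => st => bool" where
 "running LST R w s \<longleftrightarrow> rg s 18 = 1 \<and> (\<exists>t p td pre cs dn ts e. LST = dn @ R \<and> remaining t p td pre cs = R \<and>
   cur_ok s t p td pre cs \<and> rg s 17 \<le> 1 \<and> w = rg s 14 + rg s 15 \<and> timed 400 dn ts e \<and>
   (if rg s 17 = 0 then tr s = ts \<and> tm s + 20 \<le> e
   else \<exists>u. u \<le> e \<and> tr s = ts @ [(u, Num (hd (hd R)))] \<and> tm s \<le> u + 100 * w))"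

definition stopped :: "nat list list => st => bool" where
 "stopped LST s \<longleftrightarrow> rg s 18 = 0 \<and> rg s 5 = 0 \<and> (\<exists>e. timed 400 LST (tr s) e \<and> tm s + 20 \<le> e)"

lemma wp_body:
 assumes run: "running LST R w s" and Bd: "\<And>xs. xs \<in> set LST ==> length xs \<le> Bd"
 shows "wp W enum_body (\<lambda>s'. (\<exists>w'. running LST R w' (s'(|tm := Suc (tm s')|)) \<and> w < w' \<and> w' \<le> 2 * Bd + 2) \<or>
   (\<exists>w'. running LST (tl R) w' (s'(|tm := Suc (tm s')|)) \<and> R ~= []) \<or> stopped LST (s'(|tm := Suc (tm s')|)))
   (s(|tm := Suc (tm s)|))"
proof -
 obtain t p td pre cs dn ts e where L: "LST = dn @ R" and R: "remaining t p td pre cs = R"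
  and cur: "cur_ok s t p td pre cs" and s17: "rg s 17 \<le> 1" and w: "w = rg s 14 + rg s 15" and timed: "timed 400 dn ts e"
  and tm: "if rg s 17 = 0 then tr s = ts \<and> tm s + 20 \<le> e
   else \<exists>u. u \<le> e \<and> tr s = ts @ [(u, Num (hd (hd R)))] \<and> tm s \<le> u + 100 * w" and s18: "rg s 18 = 1"
  using run unfolding running_def by blast
 let ?s = "s(|tm := Suc (tm s)|)"
 have BdR: "xs \<in> set R ==> length xs \<le> Bd" for xs using Bd L by simp
 have lim: "length pre + length td + 1 \<le> Bd" by (rule remaining_bound[OF R BdR])
 have wv: "w = 2 * length pre + length td + 1" using cur w by (simp add: cur_ok_def)
 have start: "wp W start_out (\<lambda>s'. cur_ok s' t p td pre cs \<and> rg s' 17 = 1 \<and> rg s' 18 = rg ?s 18 \<and> tm s' \<le> tm ?s + 12 \<and>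
   (if rg ?s 17 = 0 then \<exists>u. tm ?s \<le> u \<and> u \<le> tm ?s + 12 \<and> tr s' = tr ?s @ [(u, Num (hd (hd (remaining t p td pre cs))))]
   else tr s' = tr ?s)) ?s"
  by (rule wp_start) (use cur cur_ok_tm s17 in auto)
 show ?thesis unfolding enum_body_def wp_Seq_fun
 proof (rule wp_use[OF start], goal_cases)
  case (1 s1)
  have s1: "cur_ok s1 t p td pre cs" "rg s1 17 = 1" "rg s1 18 = 1" using 1(1) s18 by auto
  obtain u where u: "u \<le> e" "tr s1 = ts @ [(u, Num (hd (hd R)))]" "tm s1 \<le> u + 100 * w + 13"
  proof (cases "rg s 17 = 0")
   case True
   then obtain u where "tm ?s \<le> u" "u \<le> tm ?s + 12" "tr s1 = tr ?s @ [(u, Num (hd (hd R)))]" using 1(1) R by auto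
   then show ?thesis using that[of u] tm True 1(1) by simp
  next
   case False
   then obtain u where "u \<le> e" "tr s = ts @ [(u, Num (hd (hd R)))]" "tm s \<le> u + 100 * w" using tm by auto
   then show ?thesis using that[of u] False 1(1) by simp
  qed
  let ?t = "fst (lead t)" and ?p = "ap (snd (lead t)) p"
  define cs2 where "cs2 = (if is_CU t then (t, p, td, length pre, length pre + length td + 1) # cs else cs)"
  show ?case
  proof (rule wp_use[OF wp_take[OF s1(1) lim, folded cs2_def]], goal_cases)
   case (1 s2)
   have c2: "cur_ok s2 ?t ?p td pre cs2" and R2: "remaining ?t ?p td pre cs2 = R"
    using 1(1) R remaining_take[of t p td pre cs "length pre + length td + 1"] unfolding cs2_def by simp_all
   have s2: "rg s2 17 = 1" "rg s2 18 = 1" "tr s2 = ts @ [(u, Num (hd (hd R)))]" "tm s2 \<le> u + 100 * w + 38"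
    using 1 s1 u by (simp_all add: take_lead_def push_choice_def)
   have r2: "rg s2 5 = 0" "rg s2 6 = 1" "rg s2 14 = length pre" "rg s2 15 = length pre + length td + 1"
    "mm s2 16 = \<mu>0 16" "item (rg s2 10) (rg s2 11, rg s2 12) ?t ?p" "trep (mm s2) (rg s2 13) td"
    using c2 by (auto simp: cur_ok_def)
   let ?s2 = "s2(|rg := (rg s2)(23 := \<mu>0 16 (rg s2 10)), tm := Suc (Suc (tm s2))|)"
   have c2': "cur_ok ?s2 ?t ?p td pre cs2" using c2 by (rule cur_ok_frame) auto
   show ?case
   proof (cases ?t)
    case (CU t1 f t2 g)
    then show ?thesis using lead_not_CU[of t] by simp
   next
    case (CP t1 f t2 g)
    have k: "\<mu>0 16 (rg s2 10) = 1" using r2(6) CP by (simp add: item_def)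
    let ?td = "(t2, ap g ?p) # td"
    have R3: "remaining t1 (ap f ?p) ?td pre cs2 = R" using R2 unfolding CP remaining_product .
    have lim3: "length pre + length td + 2 \<le> Bd" using remaining_bound[OF R3 BdR] by simp
    have "wp W enter_product (\<lambda>s'. (\<exists>w'. running LST R w' (s'(|tm := Suc (tm s')|)) \<and> w < w' \<and> w' \<le> 2 * Bd + 2)) ?s2"
    proof (rule wp_use[OF wp_product[OF c2'[unfolded CP] lim3]], goal_cases)
     case (1 s3)
     have c3: "cur_ok (s3(|tm := Suc (tm s3)|)) t1 (ap f ?p) ?td pre cs2"
      using 1(1) cur_ok_tm unfolding CP by blast
     have f: "rg s3 17 = 1" "rg s3 18 = 1" "tr s3 = ts @ [(u, Num (hd (hd R)))]" "tm s3 \<le> u + 100 * w + 80"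
      using 1 s2 by (simp_all add: enter_product_def)
     have w3: "rg s3 14 + rg s3 15 = w + 1" using c3 wv by (simp add: cur_ok_def)
     have "running LST R (w + 1) (s3(|tm := Suc (tm s3)|))"
      unfolding running_def
      by (rule conjI, simp add: f, intro exI conjI, rule L, rule R3, rule c3)
       (use f w3 timed u(1) in auto)
     then show ?case using lim wv by (intro exI[of _ "w + 1"]) auto
    qed
    then show ?thesis using k r2 CP by (auto elim: wp_mono)
   next
    case CL
    have k: "\<mu>0 16 (rg s2 10) = 0" using r2(6) CL by (simp add: item_def)
    have sr2: "srep (mm s2) (rg s2 16) (rg s2 14) (rg s2 15) cs2" and pr2: "\<forall>i < length pre. mm s2 51 i = pre ! i"
     and ph2: "rg s2 16 + 1 \<le> \<phi> (rg s2 14 + rg s2 15) (rg s2 10)" and cells2: "\<And>a. a \<in> {16..33} ==> mm s2 a = \<mu>0 a"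
     using c2 by (auto simp: cur_ok_def)
    have lens: "\<And>t p td l h. (t, p, td, l, h) \<in> set cs2 ==> l \<le> length pre"
     using srep_len[OF sr2] r2(3) by simp
    let ?Q = "\<lambda>s'. (\<exists>w'. running LST R w' (s'(|tm := Suc (tm s')|)) \<and> w < w' \<and> w' \<le> 2 * Bd + 2) \<or>
   (\<exists>w'. running LST (tl R) w' (s'(|tm := Suc (tm s')|)) \<and> R ~= []) \<or> stopped LST (s'(|tm := Suc (tm s')|))"
    let ?code = "Store 51 14 11 ;; Add 14 14 ONE ;; Cond ZERO 13 next_factor
        (print_rest ;; Cond ZERO 16 pop_choice (Const 18 0))"
    have code: "wp W ?code (\<lambda>s'. ?Q (s'(|tm := Suc (tm s')|))) ?s2"
    proof (cases td)
     case (Cons x td')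
     obtain t3 q where x: "x = (t3, q)" by (cases x)
     have "remaining CL ?p ((t3, q) # td') pre cs2 = remaining t3 q td' (pre @ [fst ?p]) cs2"
      by (rule remaining_factor) (rule lens)
     then have R3: "remaining t3 q td' (pre @ [fst ?p]) cs2 = R" using R2 by (simp only: CL Cons x)
     have lim4: "length pre + length td' + 2 \<le> Bd" using lim Cons by simp
     show ?thesis
     proof (rule wp_mono[OF wp_factor[OF c2'[unfolded CL Cons x] lim4]], goal_cases)
      case (1 s5)
      let ?s5 = "s5(|tm := Suc (Suc (tm s5))|)"
      have c5: "cur_ok ?s5 t3 q td' (pre @ [fst ?p]) cs2" using 1 cur_ok_tm unfolding Cons x by blast
      have f: "rg s5 17 = 1" "rg s5 18 = 1" "tr s5 = ts @ [(u, Num (hd (hd R)))]" "tm s5 \<le> u + 100 * w + 80"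
       using 1 s2 by simp_all
      have w5: "rg s5 14 + rg s5 15 = w + 1" using c5 wv Cons by (simp add: cur_ok_def)
      have "running LST R (w + 1) ?s5"
       unfolding running_def
       by (rule conjI, simp add: f, intro exI conjI, rule L, rule R3, rule c5)
        (use f w5 timed u(1) in auto)
      then show ?case using lim wv by (intro disjI1 exI[of _ "w + 1"]) auto
     qed
    next
     case Nil
     have R3: "R = (pre @ [fst ?p]) # louts (pre @ [fst ?p]) cs2"
      using R2 unfolding CL Nil remaining_finish using louts_cong[of cs2 pre "pre @ [fst ?p]"] lens by fastforce
     have lim4: "length pre + 1 \<le> Bd" using lim by simp
     show ?thesis
     proof (rule wp_mono[OF wp_finish[OF c2'[unfolded CL Nil] lim4]], goal_cases)
      case (1 s5)
      let ?s5 = "s5(|tm := Suc (Suc (tm s5))|)" and ?xs = "pre @ [fst ?p]"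
      obtain b where b: "tr s5 = ts @ [(u, Num (hd ?xs))] @ b" "map snd b = map Num (tl ?xs) @ [Sep]"
       using 1 s2(3) unfolding R3 list.sel by auto
      have xs: "map snd ([(u, Num (hd ?xs))] @ b) = map Num ?xs @ [Sep]"
       using b(2) by (cases pre) simp_all
      have timed': "timed 400 (dn @ [?xs]) (ts @ [(u, Num (hd ?xs))] @ b) (u + 400 * (length ?xs + 1))"
       using timed_snoc[OF timed xs] u(1) by simp
      \<comment> \<open>With no pending factor \<open>w\<close> is
        \<open>2 * length pre + 1\<close>, so 100 steps per unit, 6 per printed number and the
        constant overhead stay within 400 for each number and the separator.\<close>
      have tm5: "tm ?s5 + 20 \<le> u + 400 * (length ?xs + 1)" using 1 s2(4) wv Nil by simp
      have L': "LST = (dn @ [?xs]) @ tl R" using L R3 by simp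
      show ?case
      proof (cases "cs2 = []")
       case True
       then have "stopped LST ?s5" unfolding stopped_def using 1 timed' tm5 L' R3 b(1) unfolding Nil by auto
       then show ?thesis by simp
      next
       case False
       then obtain t q td0 pre' cs' where n: "cur_ok s5 t q td0 pre' cs'"
        "remaining t q td0 pre' cs' = tl R" "rg s5 18 = 1"
        using 1 s2 R3 unfolding Nil by (auto split: if_splits)
       have n': "cur_ok ?s5 t q td0 pre' cs'" using n(1) cur_ok_tm by blast
       have "running LST (tl R) (rg s5 14 + rg s5 15) ?s5"
        unfolding running_def
        by (rule conjI, simp add: n, intro exI conjI, rule L', rule n(2), rule n')
         (use 1 n(3) timed' tm5 b(1) in auto)
       then show ?thesis using R3 by auto
      qed
     qed
    qed
    have "wp W (Load 23 16 10) (wp W (Cond ZERO 23 enter_product ?code) ?Q) s2"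
     using code k r2 by (simp del: wp_Seq)
    then show ?thesis by (simp only: wp_Seq_fun)
   qed
  qed
 qed
qed

end

context cells
begin

lemma wp_enum_loop:
 assumes "running LST R w s" "\<And>xs. xs \<in> set LST ==> length xs \<le> Bd" "w \<le> 2 * Bd + 2"
 shows "wp W (Loop ZERO 18 enum_body) (\<lambda>s'. \<exists>e. timed 400 LST (tr s') e \<and> tm s' + 5 \<le> e) s"
proof -
 let ?Inv = "\<lambda>g s. case g of None => stopped LST s | Some (R, w) => running LST R w s \<and> w \<le> 2 * Bd + 2"
 \<comment> \<open>Lexicographic in effect: a completed set outweighs any drop of \<open>w\<close>,
   and within a set \<open>w\<close> rises to at most \<open>2 * Bd + 2\<close>.\<close>
 let ?f = "\<lambda>g. case g of None => 0 | Some (R, w) => length R * (2 * Bd + 4) + (2 * Bd + 3 - w)"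
 have z: "rg s 5 = 0 \<and> rg s 18 = 1 \<and> R ~= [] \<and> w \<le> 2 * Bd + 2" if "running LST R w s" for R w s
 proof -
  obtain t p td pre cs dn where r: "rg s 18 = 1" "LST = dn @ R" "remaining t p td pre cs = R" "cur_ok s t p td pre cs" "w = rg s 14 + rg s 15"
   using \<open>running LST R w s\<close> unfolding running_def by blast
  have "length pre + length td + 1 \<le> Bd" by (rule remaining_bound[OF r(3)]) (use assms(2) r(2) in simp)
  then show ?thesis using r hd_remaining(1)[of t p td pre cs] by (auto simp: cur_ok_def)
 qed
 show ?thesis
 proof (rule wp_Loop_ghost[where Inv = ?Inv and f = ?f and g = "Some (R, w)"], goal_cases)
  case 1
  then show ?case using assms by simp
 next
  case (2 g s)
  show ?case
  proof (cases g)
   case None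
   then show ?thesis using 2 by (simp add: stopped_def)
  next
   case (Some Rw)
   obtain R w where g: "g = Some (R, w)" using Some by (cases Rw) auto
   have r: "running LST R w s" using 2(1) g by simp
   show ?thesis
   proof (rule wp_mono[OF wp_body[OF r assms(2)]], goal_cases)
    case (2 s')
    then consider (a) w' where "running LST R w' (s'(|tm := Suc (tm s')|))" "w < w'" "w' \<le> 2 * Bd + 2"
     | (b) w' where "running LST (tl R) w' (s'(|tm := Suc (tm s')|))" "R ~= []"
     | (c) "stopped LST (s'(|tm := Suc (tm s')|))" by blast
    then show ?case
    proof cases
     case a
     then show ?thesis using g by (intro exI[of _ "Some (R, w')"]) simp
    next
     case b
     have "length (tl R) * (2 * Bd + 4) + (2 * Bd + 3 - w') < length R * (2 * Bd + 4) + (2 * Bd + 3 - w)"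
      using b(2) by (cases R) auto
     then show ?thesis using g b z[OF b(1)] by (intro exI[of _ "Some (tl R, w')"]) simp
    next
     case c
     then show ?thesis using g z[OF r] by (intro exI[of _ None]) (cases R, auto)
    qed
   qed (use assms(2) in auto)
  qed
 next
  case (3 g s)
  then show ?case using z by (cases g) (auto simp: stopped_def split: prod.splits intro: exI)
 qed
qed

lemma wp_enum:
 assumes "rg s 5 = 0" "rg s 6 = 1" "\<And>a. a \<in> {16..33} ==> mm s a = \<mu>0 a"
  and "mapat (mm s) 12 (mm s 53 (rg s 0)) f" "map_ok X f"
  and "mm s 40 (rg s 0) = of_bool eb" "tm s = 0" "tr s = []"
  and L: "mm s 11 (mm s 53 (rg s 0)) = 0 \<and> LST = [] \<or>
   0 < mm s 11 (mm s 53 (rg s 0)) \<and> mm s 11 (mm s 53 (rg s 0)) < N \<and>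
   rep \<mu>0 X (mm s 11 (mm s 53 (rg s 0))) t \<and> LST = alls t (ap f (0, 0))"
  and Bd: "\<And>xs. xs \<in> set LST ==> length xs \<le> Bd" and XW: "X < W"
 shows "wp W enum_prog (\<lambda>s'. \<exists>ts u e. timed 400 ((if eb then [[]] else []) @ LST) ts e \<and>
   tr s' = ts @ [(u, EndMarker)] \<and> u \<le> e) s"
proof -
 let ?c = "mm s 11 (mm s 53 (rg s 0))" and ?L = "(if eb then [[]] else []) @ LST"
 let ?pre = "Const 11 0 ;; Const 12 0 ;; Const 13 0 ;; Const 14 0 ;;
   Const 15 1 ;; Const 16 0 ;; Const 17 0 ;; Const 18 0 ;;
   Load 20 40 0 ;; Cond ZERO 20 (OutSep) Skip ;;
   Load 22 53 0 ;; MapAt 12 22 11 12 ;; Load 10 11 22 ;; Cond ZERO 10 (Const 18 1) Skip"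
 have e: "wp W enum_prog Q = wp W ?pre (wp W (Loop ZERO 18 enum_body) (wp W (OutEnd) Q))" for Q
  by (simp only: enum_prog_def wp_Seq_fun)
 have W: "3 < W" using Bd_W by simp
 have pre: "wp W ?pre (\<lambda>s'. rg s' 13 = 0 \<and> rg s' 14 = 0 \<and> rg s' 15 = 1 \<and> rg s' 16 = 0 \<and> rg s' 17 = 0 \<and>
   rg s' 10 = ?c \<and> rg s' 18 = (if 0 < ?c then 1 else 0) \<and> (rg s' 11, rg s' 12) = ap f (0, 0) \<and> tm s' \<le> 40 \<and>
   (\<exists>u\<le>20. tr s' = (if eb then [(u, Sep)] else []))) s"
  using assms(1,2,4-8) W XW by (cases eb; cases "?c = 0") (auto simp: wp_MapAt[where f = f and Z = X and B = 0] mapat_def intro: exI[of _ 0])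
 show ?thesis unfolding e
 proof (rule wp_use[OF pre], goal_cases)
  case (1 s3)
  have f3: "rg s3 5 = 0" "rg s3 6 = 1" "rg s3 13 = 0" "rg s3 14 = 0" "rg s3 15 = 1" "rg s3 16 = 0" "rg s3 17 = 0"
   "rg s3 10 = ?c" "rg s3 18 = (if 0 < ?c then 1 else 0)"
   "\<And>a. a ~= 52 ==> mm s3 a = mm s a" "(rg s3 11, rg s3 12) = ap f (0, 0)" "tm s3 \<le> 40"
   using 1 assms(1,2) by simp_all
  obtain u where u: "u \<le> 20" "tr s3 = (if eb then [(u, Sep)] else [])" using 1(1) by auto
  define dn :: "nat list list" where "dn = (if eb then [[]] else [])"
  obtain e where t0: "timed 400 dn (tr s3) e" "400 \<le> e"
  proof (cases eb)
   case True
   \<comment> \<open>The empty set is a lone separator; writing it moves the deadline to 400 steps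
     after that moment.\<close>
   have "timed 400 ([] @ [[]]) ([] @ [(u, Sep)]) (fst (hd [(u, Sep)]) + 400 * (length ([] :: nat list) + 1))"
    by (rule timed_snoc[OF timed_Nil]) (use u in auto)
   then show ?thesis using that[of "u + 400"] True u f3 by (simp add: dn_def)
  next
   case False
   then show ?thesis using that[of 400] u f3 by (simp add: dn_def timed_Nil)
  qed
  show ?case
  proof (cases "0 < ?c")
   case False
   then have "LST = []" using L by auto
   then have "timed 400 ?L (tr s3) e" using t0(1) by (simp add: dn_def)
   then show ?thesis using False f3 t0(2) by (subst wp_LoopF) auto
  next
   case True
   then have c: "?c < N" "rep \<mu>0 X ?c t" "LST = alls t (ap f (0, 0))" using L by auto
   have "1 \<le> N - ?c" using c(1) by linarith
   then have "X \<le> (N - ?c) * X" by simp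
   then have XB: "a \<le> (N - ?c) * X" if "a \<le> X" for a using that by (rule le_trans[rotated])
   then have it: "item (rg s3 10) (rg s3 11, rg s3 12) t (ap f (0, 0))"
    using c f3 assms(5) XB by (simp add: item_def ap_def ev_def map_ok_def)
   have cur: "cur_ok s3 t (ap f (0, 0)) [] [] []"
    unfolding cur_ok_def using f3 it assms(3) by (simp add: \<phi>_def)
   have rem: "remaining t (ap f (0, 0)) [] [] [] = LST"
    using c(3) by (simp add: remaining_def grp_def concat_map_singleton)
   have run: "running ?L LST 1 s3"
    unfolding running_def
    by (rule conjI, simp add: f3 True, intro exI conjI, rule dn_def[symmetric, THEN arg_cong[where f = "\<lambda>x. x @ LST"]], rule rem, rule cur)
     (use f3 t0 in auto)
   have "\<And>xs. xs \<in> set ?L ==> length xs \<le> Bd" using Bd by (auto split: if_splits)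
   then show ?thesis
    by (rule wp_mono[OF wp_enum_loop[OF run]]) (auto intro!: exI)
  qed
 qed
qed

end

lemma timed_props:
 "timed d xss ts e ==> length ts = (\<Sum>xs\<leftarrow>xss. output_length xs) \<and>
   map snd ts = concat (map (\<lambda>xs. map Num xs @ [Sep]) xss)"
proof (induction rule: timed.induct)
 case (timed_snoc xss ts e b xs)
 have "length (map snd b) = length (map Num xs @ [Sep])" by (simp only: timed_snoc(2))
 then have "length b = length xs + 1" by simp
 then show ?case using timed_snoc by (simp add: output_length_def)
qed simp

text \<open>The suffix stands for everything written later. The induction needs it arbitrary, with
  its first symbol no later than the deadline \<open>e\<close>.\<close>

lemma timed_start:
 "timed d xss ts e ==> suf ~= [] ==> fst (hd suf) \<le> e ==> start_time xss (ts @ suf) 0 \<le> d \<and>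
   (\<forall>i < length xss. start_time xss (ts @ suf) (Suc i) - start_time xss (ts @ suf) i \<le> d * output_length (xss ! i))"
proof (induction arbitrary: suf rule: timed.induct)
 case timed_Nil
 then show ?case by (cases suf) (auto simp: start_time_def)
next
 case (timed_snoc xss ts e b xs)
 have b: "b ~= []" "length b = output_length xs"
 proof -
  have "length (map snd b) = length (map Num xs @ [Sep])" by (simp only: timed_snoc(2))
  then show "b ~= []" "length b = output_length xs" by (auto simp: output_length_def)
 qed
 have IH: "start_time xss (ts @ b @ suf) 0 \<le> d"
  "\<forall>i < length xss. start_time xss (ts @ b @ suf) (Suc i) - start_time xss (ts @ b @ suf) i \<le> d * output_length (xss ! i)"
  using timed_snoc.IH[of "b @ suf"] b(1) timed_snoc(3) by auto
 have st: "start_time (xss @ [xs]) ((ts @ b) @ suf) i = start_time xss (ts @ b @ suf) i" if "i \<le> length xss" for i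
  using that by (simp add: start_time_def)
 have l: "length ts = (\<Sum>xs\<leftarrow>xss. output_length xs)" using timed_props[OF timed_snoc(1)] by simp
 have 1: "start_time xss (ts @ b @ suf) (length xss) = fst (hd b)"
  using b(1) by (simp add: start_time_def l[symmetric] nth_append hd_conv_nth)
 have 2: "start_time (xss @ [xs]) ((ts @ b) @ suf) (Suc (length xss)) = fst (hd suf)"
  using timed_snoc(5) b(2) by (simp add: start_time_def l[symmetric] nth_append hd_conv_nth)
 have "fst (hd suf) - fst (hd b) \<le> d * output_length xs"
  using timed_snoc(6) by (simp add: output_length_def)
 then show ?case using IH st 1 2 by (auto simp: less_Suc_eq nth_append)
qed

theorem enum_correct:
 fixes c :: config and w :: nat
 assumes fits: "fits_word w c" and pc: "pc c = 0" and N: "cells N X (2 ^ w) Bd"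
  and "regs c 5 = 0" "regs c 6 = 1"
  and "mapat (mem c) 12 (mem c 53 (regs c 0)) f" "map_ok X f"
  and "mem c 40 (regs c 0) = of_bool eb"
  and "mem c 11 (mem c 53 (regs c 0)) = 0 \<and> LST = [] \<or>
   0 < mem c 11 (mem c 53 (regs c 0)) \<and> mem c 11 (mem c 53 (regs c 0)) < N \<and>
   rep (mem c) X (mem c 11 (mem c 53 (regs c 0))) t \<and> LST = alls t (ap f (0, 0))"
  and "\<And>xs. xs \<in> set LST ==> length xs \<le> Bd" "X < 2 ^ w"
  and en: "enumerates ((if eb then [[]] else []) @ LST) S"
 shows "enumerates_with_delay w 400 (comp 0 enum_prog) c S"
proof -
 interpret cells "mem c" N X "2 ^ w" Bd by (rule N)
 let ?s = "(|rg = regs c, mm = mem c, tm = 0, tr = []|)" and ?L = "(if eb then [[]] else []) @ LST"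
 have c: "cfg 0 ?s = c" using pc by (simp add: cfg_def)
 have "wp (2 ^ w) enum_prog (\<lambda>s'. \<exists>ts u e. timed 400 ?L ts e \<and>
   tr s' = ts @ [(u, EndMarker)] \<and> u \<le> e) ?s"
  by (rule wp_enum) (use assms in simp_all)
 then obtain s' ts u e where b: "big (2 ^ w) enum_prog ?s s'" and t: "timed 400 ?L ts e" "tr s' = ts @ [(u, EndMarker)]" "u \<le> e"
  unfolding wp_def by blast
 have "fits (2 ^ w) ?s" using fits by (simp add: fits_word_def fits_def)
 note r = big_run[OF b this, unfolded c, simplified]
 show ?thesis
  unfolding enumerates_with_delay_def
 proof (intro exI[of _ "tm s'"] exI[of _ ?L], unfold Let_def r(3) t(2), intro conjI)
  show "halts_within w (comp 0 enum_prog) c (tm s')" using r(1) .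
  show "map snd (ts @ [(u, EndMarker)]) = output_symbols ?L"
   using timed_props[OF t(1)] by (simp only: map_append output_symbols_def) simp
 qed (use timed_start[OF t(1), of "[(u, EndMarker)]"] t(3) en in \<open>auto simp: enumerates_def simp del: append_assoc\<close>)
qed

section \<open>The preprocessing program: states\<close>

definition Mul :: "nat => nat => nat => nat => com" where
 "Mul d a b i = (Const d 0) ;; For i b (Add d d a)"

text \<open>\<open>Loop\<close> tests for strict inequality only; \<open>t\<close> holds the
  remainder plus one, so \<open>b < t\<close> expresses that \<open>b\<close> still fits.\<close>

definition DivMod :: "nat => nat => nat => nat => nat => com" where
 "DivMod d r a b t = Copy r a ;; Const d 0 ;; Add t r ONE ;;
   Loop b t (Sub r r b ;; Add d d ONE ;; Add t r ONE)"

lemma mod_Mul [simp]: "modr (Mul d a b i) = {d, i}" "moda (Mul d a b i) = {}" "silent (Mul d a b i)"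
 by (auto simp: Mul_def)

lemma mod_DivMod [simp]: "modr (DivMod d r a b t) = {d, r, t}" "moda (DivMod d r a b t) = {}" "silent (DivMod d r a b t)"
 by (auto simp: DivMod_def)

lemma Mul_loop:
 assumes "rg s i + k = rg s b" "rg s ONE = 1" "rg s d + rg s a * k < W" "rg s b < W"
  and "d \<notin> {a, b, i, ONE}" "i \<notin> {a, b, ONE}"
 shows "wp W (Loop i b (Add d d a ;; Add i i ONE)) Q s =
  Q (s(|rg := (rg s)(d := rg s d + rg s a * k, i := rg s b), tm := Suc (Suc (tm s + 4 * k))|))"
 using assms
proof (induction k arbitrary: s)
 case 0
 have "(rg s)(i := rg s b) = rg s" using 0(1) by auto
 then show ?case using 0 by (simp add: wp_LoopF)
next
 case (Suc k)
 have w: "rg s i < rg s b" "rg s d + rg s a < W" "Suc (rg s i) < W" using Suc.prems(1,3,4) by simp_all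
 let ?s = "s(|rg := (rg s)(d := rg s d + rg s a, i := Suc (rg s i)), tm := Suc (Suc (Suc (Suc (tm s))))|)"
 have f: "(rg ?s)(d := x, i := y) = (rg s)(d := x, i := y)" for x y by auto
 have "wp W (Loop i b (Add d d a ;; Add i i ONE)) Q s = wp W (Loop i b (Add d d a ;; Add i i ONE)) Q ?s"
  using Suc.prems w by (simp add: wp_LoopT[OF w(1)])
 also have "\<dots> = Q (?s(|rg := (rg ?s)(d := rg ?s d + rg ?s a * k, i := rg ?s b), tm := Suc (Suc (tm ?s + 4 * k))|))"
  by (rule Suc.IH) (use Suc.prems in auto)
 finally have *: "wp W (Loop i b (Add d d a ;; Add i i ONE)) Q s = \<dots>" .
 have h: "tm s + 4 * Suc k = Suc (Suc (Suc (Suc (tm s + 4 * k))))" by simp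
 show ?case unfolding * f h using Suc.prems by (simp add: add.assoc fun_upd_def)
qed

lemma wp_Mul:
 assumes "rg s ONE = 1" "rg s b < W" "rg s a * rg s b < W" "d \<notin> {a, b, i, ONE}" "i \<notin> {a, b, ONE}" "b ~= ONE"
 shows "wp W (Mul d a b i) Q s =
  Q (s(|rg := (rg s)(d := rg s a * rg s b, i := rg s b), tm := Suc (Suc (Suc (Suc (tm s + 4 * rg s b))))|))"
 using assms by (auto simp: Mul_def For_def Mul_loop[where k = "rg s b"])

lemma DivMod_loop:
 assumes "rg s t = rg s r + 1" "rg s ONE = 1" "0 < rg s b" "rg s d + rg s r + 1 < W" "distinct [d, r, b, t, ONE]"
 shows "wp W (Loop b t (Sub r r b ;; Add d d ONE ;; Add t r ONE)) Q s =
  Q (s(|rg := (rg s)(r := rg s r mod rg s b, d := rg s d + rg s r div rg s b, t := rg s r mod rg s b + 1),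
    tm := Suc (Suc (tm s + 5 * (rg s r div rg s b)))|))"
 using assms(1-4)
proof (induction "rg s r" arbitrary: s rule: less_induct)
 case less
 have n: "d ~= r" "r ~= d" "b ~= d" "b ~= r" "b ~= t" "t ~= d" "d ~= t" "t ~= r" "r ~= t" "ONE ~= d" "ONE ~= r" "ONE ~= t" using assms(5) by auto
 show ?case
 proof (cases "rg s b \<le> rg s r")
  case False
  then have "(rg s)(r := rg s r mod rg s b, d := rg s d + rg s r div rg s b, t := rg s r mod rg s b + 1) = rg s"
   using less.prems by auto
  then show ?thesis using False less.prems by (simp add: wp_LoopF)
 next
  case True
  then have l: "rg s b < rg s t" "rg s r - rg s b < rg s r" using less.prems by simp_all
  have w: "Suc (rg s r - rg s b) < W" using less.prems(4) by linarith
  have e: "rg s r div rg s b = Suc ((rg s r - rg s b) div rg s b)" "rg s r mod rg s b = (rg s r - rg s b) mod rg s b"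
   using True less.prems(3) by (simp_all add: le_div_geq le_mod_geq)
  let ?s = "s(|rg := (rg s)(r := rg s r - rg s b, d := Suc (rg s d), t := Suc (rg s r - rg s b)), tm := Suc (Suc (Suc (Suc (Suc (tm s)))))|)"
  have f: "(rg ?s)(r := x, d := y, t := z) = (rg s)(r := x, d := y, t := z)" for x y z by auto
  have "wp W (Loop b t (Sub r r b ;; Add d d ONE ;; Add t r ONE)) Q s =
   wp W (Loop b t (Sub r r b ;; Add d d ONE ;; Add t r ONE)) Q ?s"
   using less.prems n True w by (simp add: wp_LoopT[OF l(1)])
  also have "\<dots> = Q (?s(|rg := (rg ?s)(r := rg ?s r mod rg ?s b, d := rg ?s d + rg ?s r div rg ?s b, t := rg ?s r mod rg ?s b + 1),
    tm := Suc (Suc (tm ?s + 5 * (rg ?s r div rg ?s b)))|))"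
   by (rule less.hyps) (use less.prems l n True in simp_all)
  finally have *: "wp W (Loop b t (Sub r r b ;; Add d d ONE ;; Add t r ONE)) Q s = \<dots>" .
  have h: "tm s + 5 * Suc x = Suc (Suc (Suc (Suc (Suc (tm s + 5 * x)))))" for x by simp
  show ?thesis unfolding * f e h using n by simp
 qed
qed

lemma wp_DivMod:
 assumes "rg s ZERO = 0" "rg s ONE = 1" "0 < rg s b" "rg s a + 1 < W"
  and "distinct [d, r, b, t, ONE]" "a \<notin> {d, r, t}" "ZERO \<notin> {d, r, t}"
 shows "wp W (DivMod d r a b t) Q s = Q (s(|rg := (rg s)(r := rg s a mod rg s b, d := rg s a div rg s b, t := rg s a mod rg s b + 1),
   tm := Suc (Suc (Suc (Suc (Suc (tm s + 5 * (rg s a div rg s b))))))|))"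
proof -
 have n: "d ~= r" "r ~= d" "b ~= d" "b ~= r" "b ~= t" "t ~= d" "d ~= t" "t ~= r" "r ~= t" "ONE ~= d" "ONE ~= r" "ONE ~= t" "ZERO ~= r" "0 < W"
  using assms(4-7) by auto
 let ?s = "s(|rg := (rg s)(r := rg s a, d := 0, t := Suc (rg s a)), tm := Suc (Suc (Suc (tm s)))|)"
 have f: "(rg ?s)(r := x, d := y, t := z) = (rg s)(r := x, d := y, t := z)" for x y z by auto
 have "wp W (DivMod d r a b t) Q s = wp W (Loop b t (Sub r r b ;; Add d d ONE ;; Add t r ONE)) Q ?s"
  using assms(1-4) n by (simp add: DivMod_def)
 also have "\<dots> = Q (?s(|rg := (rg ?s)(r := rg ?s r mod rg ?s b, d := rg ?s d + rg ?s r div rg ?s b, t := rg ?s r mod rg ?s b + 1),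
    tm := Suc (Suc (tm ?s + 5 * (rg ?s r div rg ?s b)))|))"
  by (rule DivMod_loop) (use assms n in simp_all)
 finally show ?thesis unfolding f using n by simp
qed

text \<open>Greedy from the top: a power of two from array 34 is subtracted whenever the rest is
  large enough.\<close>

definition decode :: "nat => nat => com" where
 "decode x arr = Copy 20 x ;; For 21 8 (Sub 22 8 21 ;; Sub 22 22 ONE ;; Load 23 34 22 ;;
   Cond 20 23 (Store arr 22 ZERO) (Store arr 22 ONE ;; Sub 20 20 23))"

definition encode :: com where
 "encode = (Const 53 0) ;; For 21 8 (Load 22 37 21 ;;
   Cond ZERO 22 (Load 23 34 21 ;; Add 53 53 23) Skip)"

lemma mod_decode [simp]: "modr (decode x arr) = {20, 21, 22, 23}" "moda (decode x arr) = {arr}" "silent (decode x arr)"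
 by (auto simp: decode_def)

lemma mod_encode [simp]: "modr encode = {21, 22, 23, 53}" "moda encode = {}" "silent encode"
 by (auto simp: encode_def)

definition test_bit :: com where
 "test_bit = Cond ZERO 63 (Cond ZERO 64 (Const 27 1) Skip) Skip"

definition op_h :: com where
 "op_h = DivMod 28 29 25 1 62 ;; For 60 1 (Mul 61 28 1 62 ;; Add 61 61 60 ;; Mul 63 61 7 62 ;;
   Add 63 63 26 ;; Load 63 35 63 ;; Mul 61 60 1 62 ;; Add 61 61 29 ;; Mul 64 61 7 62 ;;
   Add 64 64 26 ;; Load 64 36 64 ;; test_bit)"

definition op_v :: com where
 "op_v = For 60 7 (Mul 63 25 7 62 ;; Add 63 63 60 ;; Load 63 35 63 ;; Mul 64 60 7 62 ;;
   Add 64 64 26 ;; Load 64 36 64 ;; test_bit)"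

definition op_code :: com where
 "op_code = decode 50 35 ;; decode 51 36 ;; For 24 8 (DivMod 25 26 24 7 62 ;; Const 27 0 ;;
   Cond 43 39 op_h op_v ;; Store 37 24 27) ;; encode"

definition leaf_code :: com where
 "leaf_code = For 24 8 (DivMod 25 26 24 7 62 ;; DivMod 28 29 25 1 62 ;; DivMod 46 47 26 1 62 ;; Const 27 0 ;;
   For 60 1 (Cond 43 ONE (Copy 48 60 ;; Copy 49 60) (Copy 48 47 ;; Copy 49 46) ;;
    Mul 61 31 49 62 ;; Add 61 61 44 ;; Add 61 61 44 ;; Add 61 61 45 ;; Load 63 4 61 ;;
    Mul 61 28 1 62 ;; Add 61 61 48 ;; Mul 64 61 1 62 ;; Add 64 64 29 ;; Load 64 3 64 ;; test_bit) ;;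
   Store 37 24 27) ;; encode"

lemma mod_test [simp]: "modr test_bit = {27}" "moda test_bit = {}" "silent test_bit"
 by (auto simp: test_bit_def)

lemma mod_op_h [simp]: "modr op_h = {27, 28, 29, 60, 61, 62, 63, 64}" "moda op_h = {}" "silent op_h"
 by (auto simp: op_h_def)

lemma mod_op_v [simp]: "modr op_v = {27, 60, 62, 63, 64}" "moda op_v = {}" "silent op_v"
 by (auto simp: op_v_def)

lemma mod_op [simp]: "modr op_code = {20, 21, 22, 23, 24, 25, 26, 27, 28, 29, 53, 60, 61, 62, 63, 64}"
 "moda op_code = {35, 36, 37}" "silent op_code"
 by (auto simp: op_code_def)

lemma mod_leaf [simp]: "modr leaf_code = {21, 22, 23, 24, 25, 26, 27, 28, 29, 46, 47, 48, 49, 53, 60, 61, 62, 63, 64}"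
 "moda leaf_code = {37}" "silent leaf_code"
 by (auto simp: leaf_code_def)

locale machine = automaton +
 fixes W n :: nat
 assumes KW: "2 ^ K * 16 < W" and sW: "4 * m * (\<sigma> + 1) < W"
begin

text \<open>The registers and arrays that are fixed after the initialization.\<close>

definition glob :: "st => bool" where
 "glob s \<longleftrightarrow> rg s 0 = n \<and> rg s 1 = m \<and> rg s 5 = 0 \<and> rg s 6 = 1 \<and> rg s 7 = m\<^sup>2 \<and> rg s 8 = K \<and> rg s 9 = 2 ^ K \<and>
   rg s 30 = idx (q0 M) (qf M) 0 \<and> rg s 31 = 2 * \<sigma> \<and> rg s 34 = 2 ^ K + 1 \<and> rg s 39 = 3 \<and>
   (\<forall>i \<le> K. mm s 34 i = 2 ^ i) \<and>
   (\<forall>p < m. \<forall>t < m. \<forall>q < m. mm s 3 ((p * m + t) * m + q) = of_bool ((p, t, q) \<in> delta M)) \<and>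
   (\<forall>x < \<sigma>. \<forall>b. \<forall>q < m. mm s 4 (q * (2 * \<sigma>) + 2 * x + of_bool b) = of_bool (q \<in> iota M (x, b)))"

lemma glob_frame:
 assumes "glob s" "\<And>r. r \<in> {0, 1, 5, 6, 7, 8, 9, 30, 31, 34, 39} ==> rg s' r = rg s r"
  "\<And>a. a \<in> {3, 4, 34} ==> mm s' a = mm s a"
 shows "glob s'"
proof -
 have "rg s' 0 = rg s 0" "rg s' 1 = rg s 1" "rg s' 5 = rg s 5" "rg s' 6 = rg s 6" "rg s' 7 = rg s 7" "rg s' 8 = rg s 8"
  "rg s' 9 = rg s 9" "rg s' 30 = rg s 30" "rg s' 31 = rg s 31" "rg s' 34 = rg s 34" "rg s' 39 = rg s 39"
  "mm s' 3 = mm s 3" "mm s' 4 = mm s 4" "mm s' 34 = mm s 34" using assms(2,3) by simp_all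
 then show ?thesis using assms(1) unfolding glob_def by simp
qed

lemma globD: "glob s ==> rg s 0 = n \<and> rg s 1 = m \<and> rg s 5 = 0 \<and> rg s 6 = 1 \<and> rg s 7 = m\<^sup>2 \<and> rg s 8 = K \<and> rg s 9 = 2 ^ K \<and>
   rg s 30 = idx (q0 M) (qf M) 0 \<and> rg s 31 = 2 * \<sigma> \<and> rg s 34 = 2 ^ K + 1 \<and> rg s 39 = 3"
 by (simp add: glob_def)

lemma bounds: "1 \<le> K" "m\<^sup>2 \<le> K" "m \<le> K" "K < 2 ^ K" "K + 2 < W" "1 < W" "m\<^sup>2 * m\<^sup>2 = K"
proof -
 have m: "1 \<le> m" using m_pos by simp
 show K1: "1 \<le> K" using m by simp
 show "m\<^sup>2 \<le> K" by (rule power_increasing) (use m in auto)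
 show "m \<le> K" using power_increasing[of 1 4 m] m by simp
 show k: "K < 2 ^ K" by (rule less_exp)
 have "(2::nat) \<le> 2 ^ K" using K1 power_increasing[of 1 K "2::nat"] by simp
 then show "K + 2 < W" using k KW by linarith
 then show "1 < W" by simp
 show "m\<^sup>2 * m\<^sup>2 = K" by (simp add: power2_eq_square power4_eq_xxxx)
qed

lemma KK: "K \<le> K * K" "1 \<le> K * K" "K * K \<le> K * K * K"
 using mult_le_mono[OF le_refl[of K] bounds(1)] mult_le_mono[OF bounds(1) bounds(1)]
  mult_le_mono[OF le_refl[of "K * K"] bounds(1)] by linarith+

lemma wp_decode:
 assumes "glob s" "rg s x < 2 ^ K" "x \<notin> {20, 21, 22, 23}" "arr ~= 34"
 shows "wp W (decode x arr) (\<lambda>s'. (\<forall>i < K. mm s' arr i = of_bool (bit (rg s x) i)) \<and> tm s' \<le> tm s + 15 * K) s"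
proof -
 let ?v = "rg s x"
 let ?s = "s(|rg := (rg s)(20 := ?v), tm := Suc (tm s)|)"
 let ?body = "Sub 22 8 21 ;; Sub 22 22 ONE ;; Load 23 34 22 ;;
   Cond 20 23 (Store arr 22 ZERO) (Store arr 22 ONE ;; Sub 20 20 23)"
 \<comment> \<open>After \<open>k\<close> rounds the rest consists of the lowest
   \<open>K - k\<close> bits, and the bits above are final.\<close>
 let ?I = "\<lambda>k (s' :: st). rg s' 20 = take_bit (K - k) ?v \<and> (\<forall>i. K - k \<le> i --> i < K --> mm s' arr i = of_bool (bit ?v i))"
 note g = globD[OF assms(1)]
 have "wp W (For 21 8 ?body) (\<lambda>s'. ?I (rg ?s 8) s' \<and> tm s' \<le> tm ?s + rg ?s 8 * (8 + 3) + 3) ?s"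
 proof (rule wp_For[where Inv = ?I and C = 8])
  show "?I 0 (?s(|rg := (rg ?s)(21 := 0), tm := Suc (tm ?s)|))"
   using assms(2) by (simp add: take_bit_nat_eq_self)
 next
  fix k and s' :: st assume k: "k < rg ?s 8" and I: "?I k s'" and i: "rg s' 21 = k" "rg s' 8 = rg ?s 8"
   and fr: "\<And>r. r \<notin> modr (For 21 8 ?body) ==> rg s' r = rg ?s r" and fa: "\<And>a. a \<notin> moda ?body ==> mm s' a = mm ?s a"
  have kK: "k < K" using k g by simp
  define j where "j = K - k - 1"
  have j: "j < K" "K - k = Suc j" "K - Suc k = j" using kK by (auto simp: j_def)
  have f: "rg s' 5 = 0" "rg s' 6 = 1" "rg s' 8 = K" "mm s' 34 j = 2 ^ j"
   using fr[of 5] fr[of 6] i fa[of 34] g assms(1,4) j by (simp_all add: glob_def)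
  have tb: "take_bit (Suc j) ?v = take_bit j ?v + (if bit ?v j then 2 ^ j else 0)"
   by (simp add: take_bit_Suc_from_most add.commute)
  have lt: "take_bit j ?v < 2 ^ j" by simp
  have arrI: "\<forall>i. j \<le> i --> i < K --> ((mm s' arr)(j := of_bool (bit ?v j))) i = of_bool (bit ?v i)"
  proof (intro allI impI)
   fix i assume i: "j \<le> i" "i < K"
   then consider "i = j" | "Suc j \<le> i" by linarith
   then show "((mm s' arr)(j := of_bool (bit ?v j))) i = of_bool (bit ?v i)"
    using I i unfolding j(2) by cases auto
  qed
  show "wp W ?body (\<lambda>s''. ?I (Suc k) s'' \<and> tm s'' \<le> tm s' + 8) s'"
  proof (cases "bit ?v j")
   case True
   then show ?thesis using I f i tb lt arrI j bounds unfolding j(2,3) by (simp add: j(3))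
  next
   case False
   then show ?thesis using I f i tb lt arrI j bounds unfolding j(2,3) by (simp add: j(3))
  qed
 qed (use g bounds in auto)
 then show ?thesis unfolding decode_def wp_Seq using g assms(3) bounds(1) by (auto elim!: wp_mono)
qed

lemma wp_encode:
 assumes "glob s" "\<And>i. i < K ==> mm s 37 i = of_bool (Z i)"
 shows "wp W encode (\<lambda>s'. rg s' 53 = enc K Z \<and> tm s' \<le> tm s + 15 * K) s"
proof -
 let ?s = "s(|rg := (rg s)(53 := 0), tm := Suc (tm s)|)"
 let ?body = "Load 22 37 21 ;; Cond ZERO 22 (Load 23 34 21 ;; Add 53 53 23) Skip"
 note g = globD[OF assms(1)]
 have "wp W (For 21 8 ?body) (\<lambda>s'. rg s' 53 = enc (rg ?s 8) Z \<and> tm s' \<le> tm ?s + rg ?s 8 * (8 + 3) + 3) ?s"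
 proof (rule wp_For[where Inv = "\<lambda>k (s' :: st). rg s' 53 = enc k Z"])
  fix k and s' :: st assume k: "k < rg ?s 8" and I: "rg s' 53 = enc k Z" and i: "rg s' 21 = k" "rg s' 8 = rg ?s 8"
   and fr: "\<And>r. r \<notin> modr (For 21 8 ?body) ==> rg s' r = rg ?s r" and fa: "\<And>a. a \<notin> moda ?body ==> mm s' a = mm ?s a"
  have kK: "k < K" using k g by simp
  have f: "rg s' 5 = 0" "mm s' 34 k = 2 ^ k" "mm s' 37 k = of_bool (Z k)"
   using fr[of 5] fa[of 34] fa[of 37] g assms kK by (simp_all add: glob_def)
  have "enc (Suc k) Z < 2 ^ Suc k" by (rule enc_less)
  also have "(2::nat) ^ Suc k \<le> 2 ^ K" using kK by (intro power_increasing) auto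
  finally have "enc (Suc k) Z < W" using KW by linarith
  then show "wp W ?body (\<lambda>s''. rg s'' 53 = enc (Suc k) Z \<and> tm s'' \<le> tm s' + 8) s'"
   using f I i by (cases "Z k") (simp_all add: enc_Suc)
 qed (use g bounds in auto)
 then show ?thesis unfolding encode_def wp_Seq wp_Basic using g bounds by (auto elim!: wp_mono)
qed

lemma wp_op_h:
 assumes g: "glob s" and X: "\<forall>i < K. mm s 35 i = of_bool (bit s1 i)" and Y: "\<forall>i < K. mm s 36 i = of_bool (bit s2 i)"
  and pz: "rg s 25 = pq" "pq < m\<^sup>2" "rg s 26 = z" "z < m\<^sup>2" "rg s 27 = 0"
 shows "wp W op_h (\<lambda>s'. rg s' 27 = of_bool (\<exists>r<m. bit s1 (idx (pq div m) r z) \<and> bit s2 (idx r (pq mod m) z)) \<and>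
   tm s' \<le> tm s + 80 * (K * K)) s"
proof -
 let ?body = "Mul 61 28 1 62 ;; Add 61 61 60 ;; Mul 63 61 7 62 ;;
   Add 63 63 26 ;; Load 63 35 63 ;; Mul 61 60 1 62 ;; Add 61 61 29 ;; Mul 64 61 7 62 ;;
   Add 64 64 26 ;; Load 64 36 64 ;; test_bit"
 let ?B = "\<lambda>r. bit s1 (idx (pq div m) r z) \<and> bit s2 (idx r (pq mod m) z)"
 note gd = globD[OF g]
 have pm: "pq div m < m" "pq mod m < m"
  using pz(2) m_pos by (auto intro!: less_mult_imp_div_less simp: power2_eq_square)
 have idxW: "idx p q z < W" "(p * m + q) * m\<^sup>2 < W" "p * m + q < W" "p * m < W" if "p < m" "q < m" for p q
 proof -
  have i: "idx p q z < K" using idx_less that pz(4) by simp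
  have "p * m + q \<le> (p * m + q) * m\<^sup>2" using m_pos by simp
  then show "idx p q z < W" "(p * m + q) * m\<^sup>2 < W" "p * m + q < W" "p * m < W"
   using i bounds(5) unfolding idx_def by linarith+
 qed
 have mW: "m < W" "m\<^sup>2 < W" "pq + 1 < W" "1 < W" using bounds pz(2) by linarith+
 define s0 where "s0 = s(|rg := (rg s)(29 := pq mod m, 28 := pq div m, 62 := pq mod m + 1), tm := Suc (Suc (Suc (Suc (Suc (tm s + 5 * (pq div m))))))|)"
 have "wp W (For 60 1 ?body) (\<lambda>s'. rg s' 27 = of_bool (\<exists>r<rg s0 1. ?B r) \<and> tm s' \<le> tm s0 + rg s0 1 * (60 * K + 3) + 3) s0"
 proof (rule wp_For[where Inv = "\<lambda>k (s' :: st). rg s' 27 = of_bool (\<exists>r<k. ?B r)"])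
  fix k and s' :: st assume k: "k < rg s0 1" and I: "rg s' 27 = of_bool (\<exists>r<k. ?B r)" and i: "rg s' 60 = k" "rg s' 1 = rg s0 1"
   and fr: "\<And>r. r \<notin> modr (For 60 1 ?body) ==> rg s' r = rg s0 r" and fa: "\<And>a. a \<notin> moda ?body ==> mm s' a = mm s0 a"
  have km: "k < m" using k gd by (simp add: s0_def)
  have f: "rg s' 5 = 0" "rg s' 6 = 1" "rg s' 1 = m" "rg s' 7 = m\<^sup>2" "rg s' 26 = z" "rg s' 28 = pq div m" "rg s' 29 = pq mod m"
   using fr[of 5] fr[of 6] fr[of 7] fr[of 26] fr[of 28] fr[of 29] gd pz i by (simp_all add: s0_def)
  have b: "mm s' 35 (idx (pq div m) k z) = of_bool (bit s1 (idx (pq div m) k z))" "mm s' 36 (idx k (pq mod m) z) = of_bool (bit s2 (idx k (pq mod m) z))"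
   using fa[of 35] fa[of 36] X Y idx_less[OF pm(1) km pz(4)] idx_less[OF km pm(2) pz(4)] by (simp_all add: s0_def)
  have ex: "(\<exists>r<Suc k. ?B r) \<longleftrightarrow> (\<exists>r<k. ?B r) \<or> ?B k" by (auto simp: less_Suc_eq)
  have "4 * m + 4 + (4 * m\<^sup>2 + 4) + (4 * m + 4) + (4 * m\<^sup>2 + 4) + 12 \<le> 60 * K" using bounds(1-3) by linarith
  then show "wp W ?body (\<lambda>s''. rg s'' 27 = of_bool (\<exists>r<Suc k. ?B r) \<and> tm s'' \<le> tm s' + 60 * K) s'"
   unfolding ex using f i(1) I mW idxW[OF pm(1) km] idxW[OF km pm(2)] b[unfolded idx_def]
   by (simp add: wp_Mul test_bit_def idx_def)
 qed (use gd pz mW in \<open>simp_all add: s0_def\<close>)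
 then have "wp W (For 60 1 ?body) (\<lambda>s'. rg s' 27 = of_bool (\<exists>r<m. ?B r) \<and> tm s' \<le> tm s + 80 * (K * K)) s0"
 proof (rule wp_mono, goal_cases)
  case (1 s')
  have "m * (60 * K + 3) \<le> K * (63 * K)" using bounds by (intro mult_le_mono) linarith+
  moreover have "5 * (pq div m) \<le> 5 * K" using pm(1) bounds(3) by linarith
  moreover note KK
  ultimately have "m * (60 * K + 3) + 3 + (5 * (pq div m) + 5) \<le> 80 * (K * K)" by linarith
  then show ?case using 1 gd by (simp add: s0_def)
 qed
 then show ?thesis using gd pz m_pos mW unfolding op_h_def wp_Seq_fun[of _ "DivMod 28 29 25 1 62"] by (simp add: wp_DivMod s0_def del: wp_Seq split del: if_split)
qed

lemma wp_op_v:
 assumes g: "glob s" and X: "\<forall>i < K. mm s 35 i = of_bool (bit s1 i)" and Y: "\<forall>i < K. mm s 36 i = of_bool (bit s2 i)"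
  and pz: "rg s 25 = pq" "pq < m\<^sup>2" "rg s 26 = z" "z < m\<^sup>2" "rg s 27 = 0"
 shows "wp W op_v (\<lambda>s'. rg s' 27 = of_bool (\<exists>y<m\<^sup>2. bit s1 (pq * m\<^sup>2 + y) \<and> bit s2 (y * m\<^sup>2 + z)) \<and>
   tm s' \<le> tm s + 80 * (K * K)) s"
proof -
 let ?body = "Mul 63 25 7 62 ;; Add 63 63 60 ;; Load 63 35 63 ;; Mul 64 60 7 62 ;;
   Add 64 64 26 ;; Load 64 36 64 ;; test_bit"
 let ?B = "\<lambda>y. bit s1 (pq * m\<^sup>2 + y) \<and> bit s2 (y * m\<^sup>2 + z)"
 note gd = globD[OF g]
 have ix: "a * m\<^sup>2 + b < K" if "a < m\<^sup>2" "b < m\<^sup>2" for a b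
  using mult_add_less[OF that] bounds(7) by simp
 have ixW: "a * m\<^sup>2 + b < W" "a * m\<^sup>2 < W" if "a < m\<^sup>2" "b < m\<^sup>2" for a b
  using ix[OF that] bounds(5) by linarith+
 have mW: "m\<^sup>2 < W" "1 < W" using bounds by linarith+
 have "wp W op_v (\<lambda>s'. rg s' 27 = of_bool (\<exists>r<rg s 7. ?B r) \<and> tm s' \<le> tm s + rg s 7 * (60 * K + 3) + 3) s"
  unfolding op_v_def
 proof (rule wp_For[where Inv = "\<lambda>k (s' :: st). rg s' 27 = of_bool (\<exists>r<k. ?B r)"])
  fix k and s' :: st assume k: "k < rg s 7" and I: "rg s' 27 = of_bool (\<exists>r<k. ?B r)" and i: "rg s' 60 = k" "rg s' 7 = rg s 7"
   and fr: "\<And>r. r \<notin> modr (For 60 7 ?body) ==> rg s' r = rg s r" and fa: "\<And>a. a \<notin> moda ?body ==> mm s' a = mm s a"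
  have km: "k < m\<^sup>2" using k gd by simp
  have f: "rg s' 5 = 0" "rg s' 6 = 1" "rg s' 7 = m\<^sup>2" "rg s' 26 = z" "rg s' 25 = pq"
   using fr[of 5] fr[of 6] fr[of 26] fr[of 25] gd pz i by simp_all
  have b: "mm s' 35 (pq * m\<^sup>2 + k) = of_bool (bit s1 (pq * m\<^sup>2 + k))" "mm s' 36 (k * m\<^sup>2 + z) = of_bool (bit s2 (k * m\<^sup>2 + z))"
   using fa[of 35] fa[of 36] X Y ix[OF pz(2) km] ix[OF km pz(4)] by simp_all
  have ex: "(\<exists>r<Suc k. ?B r) \<longleftrightarrow> (\<exists>r<k. ?B r) \<or> ?B k" by (auto simp: less_Suc_eq)
  have "4 * m\<^sup>2 + 4 + (4 * m\<^sup>2 + 4) + 12 \<le> 60 * K" using bounds(1,2) by linarith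
  then show "wp W ?body (\<lambda>s''. rg s'' 27 = of_bool (\<exists>r<Suc k. ?B r) \<and> tm s'' \<le> tm s' + 60 * K) s'"
   unfolding ex using f i(1) I mW ixW[OF pz(2) km] ixW[OF km pz(4)] b by (simp add: wp_Mul test_bit_def)
 qed (use gd pz mW in simp_all)
 then show ?thesis
 proof (rule wp_mono, goal_cases)
  case (1 s')
  have "m\<^sup>2 * (60 * K + 3) \<le> K * (63 * K)" using bounds by (intro mult_le_mono) linarith+
  then have "m\<^sup>2 * (60 * K + 3) + 3 \<le> 80 * (K * K)" using KK by linarith
  then show ?case using 1 gd by simp
 qed
qed

text \<open>A multiplication by repeated addition costs \<open>O(K)\<close>, a bit needs
  \<open>O(K)\<close> of them, and there are \<open>K\<close> bits. This polynomial factor is later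
  absorbed by powers of \<open>2 ^ K\<close>.\<close>

lemma wp_op:
 assumes g: "glob s" and k: "rg s 43 = 2 \<or> rg s 43 = 3" and s1: "rg s 50 < 2 ^ K" and s2: "rg s 51 < 2 ^ K"
 shows "wp W op_code (\<lambda>s'. rg s' 53 = opst (rg s 43) (rg s 50) (rg s 51) \<and> tm s' \<le> tm s + 200 * (K * K * K)) s"
proof -
 let ?body = "DivMod 25 26 24 7 62 ;; Const 27 0 ;; Cond 43 39 op_h op_v ;; Store 37 24 27"
 note gd = globD[OF g]
 show ?thesis unfolding op_code_def wp_Seq
 proof (rule wp_use[OF wp_decode[OF g s1]], goal_cases)
  case (3 t1)
  have g1: "glob t1" by (rule glob_frame[OF g]) (use 3 in auto)
  have r1: "rg t1 51 = rg s 51" "rg t1 43 = rg s 43" "rg t1 50 = rg s 50" using 3 by auto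
  have x1: "\<forall>i < K. mm t1 35 i = of_bool (bit (rg s 50) i)" "tm t1 \<le> tm s + 15 * K" using 3 by auto
  show ?case
  proof (rule wp_use[OF wp_decode[OF g1]], goal_cases)
   case (4 t2)
   have g2: "glob t2" by (rule glob_frame[OF g1]) (use 4 in auto)
   have r2: "rg t2 51 = rg s 51" "rg t2 43 = rg s 43" "rg t2 50 = rg s 50" using 4 r1 by auto
   have x2: "\<forall>i < K. mm t2 35 i = of_bool (bit (rg s 50) i)" "\<forall>i < K. mm t2 36 i = of_bool (bit (rg s 51) i)"
    "tm t2 \<le> tm s + 30 * K" using 4 x1 r1 by auto
   note gd2 = globD[OF g2]
   have loop: "wp W (For 24 8 ?body) (\<lambda>s'. (\<forall>i < rg t2 8. mm s' 37 i = of_bool (op_bit (rg s 43) (rg s 50) (rg s 51) i)) \<and>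
     tm s' \<le> tm t2 + rg t2 8 * (100 * (K * K) + 3) + 3) t2"
   proof (rule wp_For[where Inv = "\<lambda>k (s' :: st). \<forall>i<k. mm s' 37 i = of_bool (op_bit (rg s 43) (rg s 50) (rg s 51) i)"
      and C = "100 * (K * K)"])
    fix k and s' :: st assume k: "k < rg t2 8"
     and I: "\<forall>i<k. mm s' 37 i = of_bool (op_bit (rg s 43) (rg s 50) (rg s 51) i)" and i: "rg s' 24 = k" "rg s' 8 = rg t2 8"
     and fr: "\<And>r. r \<notin> modr (For 24 8 ?body) ==> rg s' r = rg t2 r" and fa: "\<And>a. a \<notin> moda ?body ==> mm s' a = mm t2 a"
    have kK: "k < K" using k gd2 by simp
    note dig = digits[OF kK]
    have gs: "glob s'" by (rule glob_frame[OF g2]) (use fr fa i in auto)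
    have r3: "rg s' 43 = rg s 43" "mm s' 35 = mm t2 35" "mm s' 36 = mm t2 36" using fr fa r2 by simp_all
    define t4 where "t4 = s'(|rg := (rg s')(26 := k mod m\<^sup>2, 25 := k div m\<^sup>2, 62 := Suc (k mod m\<^sup>2), 27 := 0),
     tm := Suc (Suc (Suc (Suc (Suc (Suc (tm s' + 5 * (k div m\<^sup>2)))))))|)"
    have g4: "glob (t4(|tm := t|))" for t by (rule glob_frame[OF gs]) (auto simp: t4_def)
    have r4: "rg t4 43 = rg s 43" "rg t4 25 = k div m\<^sup>2" "rg t4 26 = k mod m\<^sup>2" "rg t4 27 = 0" "rg t4 24 = k" "rg t4 39 = 3"
     "\<forall>i<K. mm t4 35 i = of_bool (bit (rg s 50) i)" "\<forall>i<K. mm t4 36 i = of_bool (bit (rg s 51) i)" "mm t4 37 = mm s' 37"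
     using r3 i x2 globD[OF gs] by (simp_all add: t4_def)
    have "5 * (k div m\<^sup>2) \<le> 5 * K" using dig bounds by linarith
    then have tm3: "Suc (tm t4) + 80 * (K * K) + 2 \<le> tm s' + 98 * (K * K)" using KK by (simp add: t4_def)
    have e: "wp W ?body Q s' = wp W (Cond 43 39 op_h op_v) (wp W (Store 37 24 27) Q) t4" for Q
     using globD[OF gs] i m_pos bounds kK by (simp add: wp_DivMod t4_def)
    have b: "wp W (Cond 43 39 op_h op_v) (\<lambda>t. rg t 27 = of_bool (op_bit (rg s 43) (rg s 50) (rg s 51) k) \<and> tm t \<le> tm s' + 98 * (K * K)) t4"
    proof (cases "rg s 43 = 2")
     case True
     have "wp W op_h (\<lambda>t. rg t 27 = of_bool (op_bit (rg s 43) (rg s 50) (rg s 51) k) \<and> tm t \<le> tm s' + 98 * (K * K)) (t4(|tm := Suc (tm t4)|))"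
      by (rule wp_mono[OF wp_op_h[OF g4, of _ "rg s 50" "rg s 51"]]) (use r4 dig True tm3 in \<open>auto simp: op_bit_def\<close>)
     then show ?thesis using True r4 by simp
    next
     case False
     have "wp W op_v (\<lambda>t. rg t 27 = of_bool (op_bit (rg s 43) (rg s 50) (rg s 51) k) \<and> Suc (tm t) \<le> tm s' + 98 * (K * K)) (t4(|tm := Suc (tm t4)|))"
      by (rule wp_mono[OF wp_op_v[OF g4, of _ "rg s 50" "rg s 51"]]) (use r4 dig False tm3 in \<open>auto simp: op_bit_def\<close>)
     then show ?thesis using False assms(2) r4 by simp
    qed
    show "wp W ?body (\<lambda>s''. (\<forall>i<Suc k. mm s'' 37 i = of_bool (op_bit (rg s 43) (rg s 50) (rg s 51) i)) \<and>
     tm s'' \<le> tm s' + 100 * (K * K)) s'"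
     unfolding e
    proof (rule wp_use[OF b], goal_cases)
     case (1 t5)
     have "rg t5 24 = k" "mm t5 37 = mm s' 37" using 1(2)[of 24] 1(3)[of 37] r4 by simp_all
     then show ?case using 1(1) I KK by (auto simp: less_Suc_eq)
    qed
   qed (use gd2 bounds in auto)
   show ?case
   proof (rule wp_use[OF loop], goal_cases)
    case (1 t5)
    have g5: "glob t5" by (rule glob_frame[OF g2]) (use 1 in auto)
    have "wp W encode (\<lambda>s'. rg s' 53 = enc K (op_bit (rg s 43) (rg s 50) (rg s 51)) \<and> tm s' \<le> tm t5 + 15 * K) t5"
     by (rule wp_encode[OF g5]) (use 1 gd2 in simp)
    then show ?case
    proof (rule wp_mono, goal_cases)
     case (1 s')
     have "K * (100 * (K * K) + 3) = 100 * (K * K * K) + 3 * K" by (simp only: add_mult_distrib2 mult_ac)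
     then have "tm t5 \<le> tm t2 + 100 * (K * K * K) + 3 * K + 3" using \<open>_ \<and> tm t5 \<le> _\<close> gd2 by simp
     then show ?case using 1 x2(3) KK bounds(1) by (simp only: opst_def) linarith
    qed
   qed
  qed (use r1 s2 in auto)
 qed auto
qed

lemma wp_leaf:
 assumes g: "glob s" and k: "rg s 43 \<le> 1" and x: "rg s 44 = x" "x < \<sigma>" and b: "rg s 45 = of_bool b"
 shows "wp W leaf_code (\<lambda>s'. rg s' 53 = leafst (rg s 43) x b \<and> tm s' \<le> tm s + 200 * (K * K * K)) s"
proof -
 let ?in = "Cond 43 ONE (Copy 48 60 ;; Copy 49 60) (Copy 48 47 ;; Copy 49 46) ;;
    Mul 61 31 49 62 ;; Add 61 61 44 ;; Add 61 61 44 ;; Add 61 61 45 ;; Load 63 4 61 ;;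
    Mul 61 28 1 62 ;; Add 61 61 48 ;; Mul 64 61 1 62 ;; Add 64 64 29 ;; Load 64 3 64 ;; test_bit"
 let ?body = "DivMod 25 26 24 7 62 ;; DivMod 28 29 25 1 62 ;; DivMod 46 47 26 1 62 ;; Const 27 0 ;; For 60 1 ?in ;; Store 37 24 27"
 note gd = globD[OF g]
 let ?k = "rg s 43"
 have mW: "m < W" "m\<^sup>2 < W" using bounds by linarith+
 have loop: "wp W (For 24 8 ?body) (\<lambda>s'. (\<forall>i < rg s 8. mm s' 37 i = of_bool (leaf_bit ?k x b i)) \<and>
     tm s' \<le> tm s + rg s 8 * (150 * (K * K) + 3) + 3) s"
 proof (rule wp_For[where Inv = "\<lambda>k (s' :: st). \<forall>i<k. mm s' 37 i = of_bool (leaf_bit ?k x b i)" and C = "150 * (K * K)"])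
  fix j and s' :: st assume j: "j < rg s 8"
   and I: "\<forall>i<j. mm s' 37 i = of_bool (leaf_bit ?k x b i)" and i: "rg s' 24 = j" "rg s' 8 = rg s 8"
   and fr: "\<And>r. r \<notin> modr (For 24 8 ?body) ==> rg s' r = rg s r" and fa: "\<And>a. a \<notin> moda ?body ==> mm s' a = mm s a"
  have jK: "j < K" using j gd by simp
  note dig = digits[OF jK]
  have zK: "Suc (j mod m\<^sup>2) < W" "5 * (j mod m\<^sup>2) \<le> 5 * K" using dig bounds by linarith+
  define p q p' q' where "p = j div m\<^sup>2 div m" and "q = j div m\<^sup>2 mod m" and "p' = j mod m\<^sup>2 div m" and "q' = j mod m\<^sup>2 mod m"
  have l: "p < m" "q < m" "p' < m" "q' < m"
   using dig stz_less[of "j mod m\<^sup>2"] by (auto simp: p_def q_def p'_def q'_def stz_def)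
  let ?T = "\<lambda>t. (if ?k = 0 then t else p') \<in> iota M (x, b) \<and> (p, if ?k = 0 then t else q', q) \<in> delta M"
  have leafb: "leaf_bit ?k x b j \<longleftrightarrow> (\<exists>t<m. ?T t)"
   using l(3) m_pos unfolding leaf_bit_def Let_def p_def[symmetric] q_def[symmetric] p'_def[symmetric] q'_def[symmetric]
   by (cases "?k = 0") auto
  have gs: "glob s'" by (rule glob_frame[OF g]) (use fr fa i in auto)
  note gds = globD[OF gs]
  have r3: "rg s' 43 = ?k" "rg s' 44 = x" "rg s' 45 = of_bool b" using fr x b by simp_all
  define s0 where "s0 = s'(|rg := (rg s')(26 := j mod m\<^sup>2, 25 := j div m\<^sup>2, 29 := q, 28 := p, 47 := q', 46 := p', 62 := Suc q', 27 := 0),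
   tm := Suc (Suc (Suc (Suc (Suc (Suc (Suc (Suc (Suc (Suc (Suc (Suc (Suc (Suc (Suc (Suc (tm s' + (5 * (j div m\<^sup>2) + (5 * p + 5 * p'))))))))))))))))))|)"
  have g0: "glob s0" by (rule glob_frame[OF gs]) (auto simp: s0_def)
  have r0: "rg s0 28 = p" "rg s0 29 = q" "rg s0 46 = p'" "rg s0 47 = q'" "rg s0 43 = ?k" "rg s0 44 = x" "rg s0 45 = of_bool b"
   "rg s0 27 = 0" "rg s0 24 = j" "mm s0 37 = mm s' 37"
   using r3 i by (simp_all add: s0_def)
  have t0: "tm s0 \<le> tm s' + 15 * K + 16"
  proof -
   have "5 * (j div m\<^sup>2) + 5 * p + 5 * p' \<le> 15 * K" using dig l bounds(2,3) by linarith
   then show ?thesis by (simp add: s0_def)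
  qed
  have e0: "wp W ?body Q s' = wp W (For 60 1 ?in) (wp W (Store 37 24 27) Q) s0" for Q
  proof -
   have "Suc (j div m\<^sup>2) < W" using dig bounds by linarith
   then show ?thesis using gds i m_pos zK jK bounds
    by (simp add: wp_DivMod s0_def p_def q_def p'_def q'_def fun_upd_twist add.assoc)
  qed
  have inner: "wp W (For 60 1 ?in) (\<lambda>t. rg t 27 = of_bool (\<exists>r<rg s0 1. ?T r) \<and> tm t \<le> tm s0 + rg s0 1 * (60 * K + 3) + 3) s0"
  proof (rule wp_For[where Inv = "\<lambda>r (s' :: st). rg s' 27 = of_bool (\<exists>t<r. ?T t)"])
   fix r and u :: st assume r: "r < rg s0 1" and I': "rg u 27 = of_bool (\<exists>t<r. ?T t)" and i': "rg u 60 = r" "rg u 1 = rg s0 1"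
    and fr': "\<And>r. r \<notin> modr (For 60 1 ?in) ==> rg u r = rg s0 r" and fa': "\<And>a. a \<notin> moda ?in ==> mm u a = mm s0 a"
   have rm: "r < m" using r globD[OF g0] by simp
   have gu: "glob u" by (rule glob_frame[OF g0]) (use fr' fa' i' in auto)
   note gdu = globD[OF gu]
   \<comment> \<open>\<open>a\<close> is the state tested against \<open>iota\<close>, and
     \<open>c\<close> is the middle state of the transition.\<close>
   define a c where "a = (if ?k = 0 then r else p')" and "c = (if ?k = 0 then r else q')"
   have ac: "a < m" "c < m" using rm l by (auto simp: a_def c_def)
   have mu: "mm u 4 (a * (2 * \<sigma>) + 2 * x + of_bool b) = of_bool (a \<in> iota M (x, b))"
    "mm u 3 ((p * m + c) * m + q) = of_bool ((p, c, q) \<in> delta M)"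
    using gu x l ac unfolding glob_def by blast+
   have ad: "a * (2 * \<sigma>) + 2 * x + of_bool b = 2 * \<sigma> * a + x + x + of_bool b" by simp
   have q: "rg u 28 = p" "rg u 29 = q" "rg u 46 = p'" "rg u 47 = q'" "rg u 43 = ?k" "rg u 44 = x" "rg u 45 = of_bool b"
    using fr' r0 by simp_all
   have aW: "2 * \<sigma> * a + x + x + 1 < W"
   proof -
    have "a * (2 * \<sigma>) + (2 * \<sigma>) \<le> m * (2 * \<sigma>)" using mult_le_mono1[of "Suc a" m "2 * \<sigma>"] ac by simp
    moreover have "m * (2 * \<sigma>) \<le> 4 * m * (\<sigma> + 1)" by simp
    moreover have "2 * \<sigma> * a = a * (2 * \<sigma>)" by simp
    ultimately show ?thesis using sW x(2) by linarith
   qed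
   then have oW: "2 * \<sigma> * a < W" "2 * \<sigma> * a + x < W" "2 * \<sigma> * a + x + x < W" "2 * \<sigma> * a + x + x + of_bool b < W"
    by (cases b; simp)+
   have dW: "(p * m + c) * m + q < W" "(p * m + c) * m < W" "p * m + c < W" "p * m < W"
   proof -
    have pc: "p * m + c < m\<^sup>2" using mult_add_less[OF l(1) ac(2)] by (simp add: power2_eq_square)
    then have "(p * m + c) * m + q < m\<^sup>2 * m" using mult_add_less[OF pc l(2)] by simp
    also have "\<dots> \<le> K" using m_pos by (simp add: power2_eq_square power4_eq_xxxx)
    finally show "(p * m + c) * m + q < W" "(p * m + c) * m < W" "p * m + c < W" "p * m < W"
     using pc bounds by linarith+
   qed
   define u1 where "u1 = u(|rg := (rg u)(48 := c, 49 := a), tm := if ?k = 0 then Suc (Suc (Suc (tm u))) else Suc (Suc (Suc (Suc (tm u))))|)"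
   have e1: "wp W (Cond 43 ONE (Copy 48 60 ;; Copy 49 60) (Copy 48 47 ;; Copy 49 46)) Q u = Q u1" for Q
    using q i' gdu k by (simp add: a_def c_def u1_def)
   have w: "a < W" "m < W" "1 < W" using ac mW bounds by linarith+
   have ex: "(\<exists>t<Suc r. ?T t) \<longleftrightarrow> (\<exists>t<r. ?T t) \<or> (a \<in> iota M (x, b) \<and> (p, c, q) \<in> delta M)"
    by (auto simp: less_Suc_eq a_def c_def)
   have v: "rg u1 28 = p" "rg u1 29 = q" "rg u1 44 = x" "rg u1 45 = of_bool b" "rg u1 48 = c" "rg u1 49 = a" "rg u1 1 = m" "rg u1 5 = 0"
    "rg u1 6 = 1" "rg u1 31 = 2 * \<sigma>" "rg u1 27 = of_bool (\<exists>t<r. ?T t)" "mm u1 = mm u" "tm u1 \<le> tm u + 4"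
    using q gdu I' by (simp_all add: u1_def)
   have "4 * a + 4 * m + 4 * m + 30 \<le> 60 * K" using ac bounds(1,3) by linarith
   then have tt: "tm u1 + 4 * a + 4 * m + 4 * m + 26 \<le> tm u + 60 * K" using v(13) by linarith
   show "wp W ?in (\<lambda>t. rg t 27 = of_bool (\<exists>t<Suc r. ?T t) \<and> tm t \<le> tm u + 60 * K) u"
    unfolding wp_Seq_fun[of _ "Cond 43 ONE _ _"] e1 ex
    using v(1-12) tt w oW dW mu[unfolded ad] by (simp add: wp_Mul test_bit_def del: mult_2 mult_2_right)
  qed (use globD[OF g0] r0 bounds in auto)
  show "wp W ?body (\<lambda>s''. (\<forall>i<Suc j. mm s'' 37 i = of_bool (leaf_bit ?k x b i)) \<and> tm s'' \<le> tm s' + 150 * (K * K)) s'"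
   unfolding e0
  proof (rule wp_use[OF inner], goal_cases)
   case (1 t5)
   have "rg t5 24 = j" "mm t5 37 = mm s' 37" using 1(2)[of 24] 1(3)[of 37] r0 by simp_all
   moreover have "tm t5 + 1 \<le> tm s' + 150 * (K * K)"
   proof -
    have "m * (60 * K + 3) \<le> K * (63 * K)" using bounds by (intro mult_le_mono) linarith+
    moreover have "K * (63 * K) = 63 * (K * K)" by (simp only: mult_ac)
    moreover have "tm t5 \<le> tm s0 + m * (60 * K + 3) + 3" using 1(1) globD[OF g0] by simp
    ultimately show ?thesis using t0 KK by linarith
   qed
   ultimately show ?case using 1(1) I leafb globD[OF g0] by (auto simp: less_Suc_eq)
  qed
 qed (use gd bounds in auto)
 show ?thesis unfolding leaf_code_def wp_Seq_fun[of _ "For 24 8 ?body"]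
 proof (rule wp_use[OF loop], goal_cases)
  case (1 t5)
  have g5: "glob t5" by (rule glob_frame[OF g]) (use 1 in auto)
  have "wp W encode (\<lambda>s'. rg s' 53 = enc K (leaf_bit ?k x b) \<and> tm s' \<le> tm t5 + 15 * K) t5"
   by (rule wp_encode[OF g5]) (use 1 gd in simp)
  then show ?case
  proof (rule wp_mono, goal_cases)
   case (1 s')
   have "K * (150 * (K * K) + 3) = 150 * (K * K * K) + 3 * K" by (simp only: add_mult_distrib2 mult_ac)
   then have "tm t5 \<le> tm s + 150 * (K * K * K) + 3 * K + 3" using \<open>_ \<and> tm t5 \<le> _\<close> gd by simp
   then show ?case using 1 KK bounds(1) by (simp only: leafst_def) linarith
  qed
 qed
qed

end

section \<open>The preprocessing program: cells and references\<close>

definition rmapf :: "st => nat => emap" where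
 "rmapf s r = ((rg s r, rg s (r + 1)), (rg s (r + 2), rg s (r + 3)))"

text \<open>\<open>Const 22 0\<close> is padding for the jump that ends the other branch, so both
  branches take 4 steps.\<close>

definition cme_code :: "nat => com" where
 "cme_code fb = Cond ZERO 20 (Const 22 0 ;; Copy 22 (fb + 2) ;; Add 23 (fb + 3) 21)
   (Copy 22 fb ;; Add 23 (fb + 1) 21)"

definition ldref :: "nat => nat => nat => com" where
 "ldref sl fb out = (Load out 11 sl) ;; Load 20 12 sl ;; Load 21 13 sl ;; cme_code fb ;;
   Copy (out + 1) 22 ;; Copy (out + 2) 23 ;; Load 20 14 sl ;; Load 21 15 sl ;; cme_code fb ;;
   Copy (out + 3) 22 ;; Copy (out + 4) 23"

definition mkcell_body :: "nat => com" where
 "mkcell_body k = (Const 75 k) ;; Store 16 32 75 ;; Store 17 32 54 ;; Store 18 32 55 ;;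
   Store 19 32 56 ;; Store 20 32 57 ;; Store 21 32 58 ;; Store 22 32 70 ;;
   Store 23 32 71 ;; Store 24 32 72 ;; Store 25 32 73 ;; Store 26 32 74 ;;
   Load 20 32 54 ;; Load 21 33 54"

definition mkcell_end :: com where
 "mkcell_end = Copy 54 32 ;; Const 55 0 ;; Const 56 0 ;; Const 57 1 ;; Const 58 0 ;;
   Add 32 32 ONE"

text \<open>\<open>cme_code\<close> runs three times: on the first element of the first child and on
  both entries of its leading map. The first child alone determines these stored shortcuts.\<close>

definition mkunion :: com where
 "mkunion = mkcell_body 2 ;; cme_code 55 ;;
   (Store 32 32 22 ;; Store 33 32 23 ;; Load 24 27 54 ;; Store 27 32 24 ;;
   Load 20 28 54 ;; Load 21 29 54) ;; cme_code 55 ;;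
   (Store 28 32 22 ;; Store 29 32 23 ;; Load 20 30 54 ;; Load 21 31 54) ;; cme_code 55 ;;
   (Store 30 32 22 ;; Store 31 32 23) ;; mkcell_end"

definition mkproduct :: com where
 "mkproduct = mkcell_body 1 ;; cme_code 55 ;;
   (Store 32 32 22 ;; Store 33 32 23 ;; Store 27 32 32 ;; Store 28 32 ZERO ;;
   Store 29 32 ZERO ;; Store 30 32 ONE ;; Store 31 32 ZERO) ;; mkcell_end"

text \<open>Registers 54 to 58 hold a family as a cell and a map. One new union cell puts it in
  front of the family already in the slot; an empty slot just receives it.\<close>

definition add_item :: com where
 "add_item = (Load 20 11 59) ;;
   Cond ZERO 20 (Load 70 11 59 ;; Load 71 12 59 ;; Load 72 13 59 ;; Load 73 14 59 ;;
    Load 74 15 59 ;; mkunion) Skip ;;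
   Store 11 59 54 ;; Store 12 59 55 ;; Store 13 59 56 ;; Store 14 59 57 ;; Store 15 59 58"

lemma mod_cme [simp]: "modr (cme_code fb) = {22, 23}" "moda (cme_code fb) = {}" "silent (cme_code fb)"
 by (auto simp: cme_code_def)

lemma mod_ldref [simp]: "modr (ldref sl fb out) = {20, 21, 22, 23, out, out + 1, out + 2, out + 3, out + 4}"
 "moda (ldref sl fb out) = {}" "silent (ldref sl fb out)"
 by (auto simp: ldref_def)

lemma mod_mkcell_body [simp]: "modr (mkcell_body k) = {20, 21, 75}"
 "moda (mkcell_body k) = {16, 17, 18, 19, 20, 21, 22, 23, 24, 25, 26}" "silent (mkcell_body k)"
 by (auto simp: mkcell_body_def)

lemma mod_mkcell_end [simp]: "modr mkcell_end = {32, 54, 55, 56, 57, 58}" "moda mkcell_end = {}" "silent mkcell_end"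
 by (auto simp: mkcell_end_def)

lemma mod_mkunion [simp]: "modr mkunion = {20, 21, 22, 23, 24, 32, 54, 55, 56, 57, 58, 75}"
 "moda mkunion = {16, 17, 18, 19, 20, 21, 22, 23, 24, 25, 26, 27, 28, 29, 30, 31, 32, 33}" "silent mkunion"
 by (auto simp: mkunion_def)

lemma mod_mkproduct [simp]: "modr mkproduct = {20, 21, 22, 23, 32, 54, 55, 56, 57, 58, 75}"
 "moda mkproduct = {16, 17, 18, 19, 20, 21, 22, 23, 24, 25, 26, 27, 28, 29, 30, 31, 32, 33}" "silent mkproduct"
 by (auto simp: mkproduct_def)

lemma mod_add_item [simp]: "modr add_item = {20, 21, 22, 23, 24, 32, 54, 55, 56, 57, 58, 70, 71, 72, 73, 74, 75}"
 "moda add_item = {11, 12, 13, 14, 15, 16, 17, 18, 19, 20, 21, 22, 23, 24, 25, 26, 27, 28, 29, 30, 31, 32, 33}" "silent add_item"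
 by (auto simp: add_item_def)

text \<open>The two branches take the same time, which allows for an exact rule.\<close>

lemma wp_cme:
 assumes "rg s ZERO = 0" "map_ok Z (rmapf s fb)" "rg s 21 + Z < W" "fb > 23"
 shows "wp W (cme_code fb) Q s = Q (s(|rg := (rg s)(22 := fst (cme (rmapf s fb) (rg s 20, rg s 21)),
  23 := snd (cme (rmapf s fb) (rg s 20, rg s 21))), tm := Suc (Suc (Suc (Suc (tm s))))|))"
 using assms by (simp add: cme_code_def cme_def rmapf_def map_ok_def)

lemma wp_ldref:
 assumes "rg s ZERO = 0" "mapat (mm s) 12 (rg s sl) f" "map_ok Y f" "map_ok Z (rmapf s fb)" "Y + Z < W"
  and "(sl, fb, out) \<in> {(78, 80, 54), (79, 84, 70), (79, 84, 54)}"
 shows "wp W (ldref sl fb out) (\<lambda>s'. rg s' out = mm s 11 (rg s sl) \<and> rmapf s' (out + 1) = cm (rmapf s fb) f \<and> tm s' \<le> tm s + 20) s"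
proof -
 have f: "mm s 12 (rg s sl) = fst (fst f)" "mm s 13 (rg s sl) = snd (fst f)" "mm s 14 (rg s sl) = fst (snd f)"
  "mm s 15 (rg s sl) = snd (snd f)" "snd (fst f) \<le> Y" "snd (snd f) \<le> Y"
  using assms(2,3) by (auto simp: mapat_def map_ok_def)
 have z: "rg s (fb + 1) \<le> Z" "rg s (fb + 3) \<le> Z" using assms(4) by (auto simp: map_ok_def rmapf_def)
 from assms(6) have "(sl, fb, out) = (78, 80, 54) \<or> (sl, fb, out) = (79, 84, 70) \<or> (sl, fb, out) = (79, 84, 54)" by blast
 then show ?thesis using f z assms(1,5)
  by (elim disjE) (simp_all add: ldref_def cme_code_def cm_def cme_def rmapf_def)
qed

definition cells_ext :: "(nat => nat => nat) => (nat => nat => nat) => nat => bool" where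
 "cells_ext \<mu> \<mu>' N \<longleftrightarrow> (\<forall>a \<in> {16..33}. \<forall>i < N. \<mu>' a i = \<mu> a i)"

lemma cells_ext_refl: "cells_ext \<mu> \<mu> N"
 by (simp add: cells_ext_def)

lemma cells_ext_trans: "cells_ext \<mu> \<mu>' N ==> cells_ext \<mu>' \<mu>'' N' ==> N \<le> N' ==> cells_ext \<mu> \<mu>'' N"
 by (simp add: cells_ext_def)

text \<open>Cells are only appended, and a tree reaches no index above its own.\<close>

lemma rep_ext: "rep \<mu> X c t ==> c < N ==> cells_ext \<mu> \<mu>' N ==> rep \<mu>' X c t"
proof (induction t arbitrary: c)
 case CL
 have e: "\<mu>' a c = \<mu> a c" if "a \<in> {16..33}" for a using CL that by (simp add: cells_ext_def)
 show ?case using CL(1) by (simp add: hdr_def mapat_def e)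
next
 case (CU t f u g)
 have e: "\<mu>' a i = \<mu> a i" if "a \<in> {16..33}" "i \<le> c" for a i using CU that by (simp add: cells_ext_def)
 have l: "\<mu> 17 c < c" "\<mu> 22 c < c" "rep \<mu> X (\<mu> 17 c) t" "rep \<mu> X (\<mu> 22 c) u" using CU.prems by auto
 have "rep \<mu>' X (\<mu> 17 c) t" "rep \<mu>' X (\<mu> 22 c) u" using CU.IH l CU.prems by auto
 then show ?case using CU.prems(1) l by (simp add: hdr_def mapat_def e)
next
 case (CP t f u g)
 have e: "\<mu>' a i = \<mu> a i" if "a \<in> {16..33}" "i \<le> c" for a i using CP that by (simp add: cells_ext_def)
 have l: "\<mu> 17 c < c" "\<mu> 22 c < c" "rep \<mu> X (\<mu> 17 c) t" "rep \<mu> X (\<mu> 22 c) u" using CP.prems by auto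
 have "rep \<mu>' X (\<mu> 17 c) t" "rep \<mu>' X (\<mu> 22 c) u" using CP.IH l CP.prems by auto
 then show ?case using CP.prems(1) l by (simp add: hdr_def mapat_def e)
qed

context
 fixes W X :: nat and s :: st and t u :: ct and f g :: emap
 assumes z: "rg s 5 = 0" and o: "rg s 6 = 1" and t: "rep (mm s) X (rg s 54) t" and u: "rep (mm s) X (rg s 70) u"
  and lt: "rg s 54 < rg s 32" "rg s 70 < rg s 32"
  and f: "rmapf s 55 = f" and g: "rmapf s 71 = g" and fok: "map_ok X f" and gok: "map_ok X g"
  and W: "(rg s 32 + 1) * X < W" "rg s 32 + 2 < W"
begin

lemma cX: "rg s 54 * X + X < W"
proof -
 have "rg s 54 * X \<le> rg s 32 * X" using lt by (intro mult_le_mono1) simp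
 then show ?thesis using W(1) unfolding add_mult_distrib by linarith
qed

lemma rg_fg: "rg s 55 = fst (fst f)" "rg s 56 = snd (fst f)" "rg s 57 = fst (snd f)" "rg s 58 = snd (snd f)"
 "rg s 71 = fst (fst g)" "rg s 72 = snd (fst g)" "rg s 73 = fst (snd g)" "rg s 74 = snd (snd g)"
 using f g by (auto simp: rmapf_def)

lemma el_t: "el t = (mm s 32 (rg s 54), mm s 33 (rg s 54))" "mm s 33 (rg s 54) \<le> rg s 54 * X"
 using t rep_el[OF t] by (cases t; auto simp: hdr_def prod_eq_iff)+

lemmas mk_simps = mkcell_body_def mkcell_end_def wp_cme[where Z = X] rmapf_def cells_ext_def hdr_def mapat_def idm_def rg_fg

lemma wp_mkproduct:
 "wp W mkproduct (\<lambda>s'. rep (mm s') X (rg s 32) (CP t f u g) \<and> cells_ext (mm s) (mm s') (rg s 32) \<and> rg s' 54 = rg s 32 \<and>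
   rmapf s' 55 = idm \<and> rg s' 32 = rg s 32 + 1 \<and> tm s' \<le> tm s + 60) s"
 using z o W lt cX el_t f fok gok rep_ext[OF t lt(1)] rep_ext[OF u lt(2)] by (simp add: mkproduct_def mk_simps)

lemma wp_mkunion:
 "wp W mkunion (\<lambda>s'. rep (mm s') X (rg s 32) (CU t f u g) \<and> cells_ext (mm s) (mm s') (rg s 32) \<and> rg s' 54 = rg s 32 \<and>
   rmapf s' 55 = idm \<and> rg s' 32 = rg s 32 + 1 \<and> tm s' \<le> tm s + 60) s"
proof -
 let ?d = "rg s 54"
 have ld: "snd (lead t) = ((mm s 28 ?d, mm s 29 ?d), (mm s 30 ?d, mm s 31 ?d))"
  using t by (cases t; auto simp: hdr_def mapat_def prod_eq_iff)
 have "map_ok ((?d - mm s 27 ?d) * X) (snd (lead t))" using rep_lead[OF t] by blast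
 then have "map_ok (?d * X) (snd (lead t))" by (rule map_ok_mono) (simp add: mult_le_mono1)
 then have "mm s 29 ?d \<le> ?d * X" "mm s 31 ?d \<le> ?d * X" unfolding map_ok_def ld by simp_all
 then show ?thesis
  using z o W lt cX el_t f fok gok rep_ext[OF t lt(1)] rep_ext[OF u lt(2)] ld by (simp add: mkunion_def mk_simps cm_def)
qed

end

text \<open>A slot is a reference that serves all occurrences of a vertex: one tree and one map are
  correct for every admissible pair \<open>p\<close>. Content 0 means the empty family and 1 is
  reserved for the empty marking, so cells are numbered from 2.\<close>

definition slot_ok :: "(nat => nat => nat) => nat => nat => nat => (nat \<times> nat => bool) => nat => (nat \<times> nat => nat set set) => bool" where
 "slot_ok \<mu> N X Y PP sl A \<longleftrightarrow> (\<exists>f. mapat \<mu> 12 sl f \<and> map_ok Y f \<and>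
   (\<mu> 11 sl = 0 \<and> (\<forall>p. PP p --> A p = {}) \<or>
   (\<exists>t. 2 \<le> \<mu> 11 sl \<and> \<mu> 11 sl < N \<and> rep \<mu> X (\<mu> 11 sl) t \<and> (\<forall>p. PP p --> enumerates (alls t (ap f p)) (A p)))))"

definition item_ok :: "st => nat => nat => (nat \<times> nat => bool) => (nat \<times> nat => nat set set) => bool" where
 "item_ok s X Y PP A \<longleftrightarrow> 2 \<le> rg s 54 \<and> rg s 54 < rg s 32 \<and> map_ok Y (rmapf s 55) \<and>
   (\<exists>t. rep (mm s) X (rg s 54) t \<and> (\<forall>p. PP p --> enumerates (alls t (ap (rmapf s 55) p)) (A p)))"

lemma slot_ok_ext:
 assumes "slot_ok \<mu> N X Y PP sl A" "cells_ext \<mu> \<mu>' N" "N \<le> N'" "\<And>a. a \<in> {11..15} ==> \<mu>' a sl = \<mu> a sl"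
 shows "slot_ok \<mu>' N' X Y PP sl A"
proof -
 obtain f where f: "mapat \<mu> 12 sl f" "map_ok Y f" and c: "\<mu> 11 sl = 0 \<and> (\<forall>p. PP p --> A p = {}) \<or>
   (\<exists>t. 2 \<le> \<mu> 11 sl \<and> \<mu> 11 sl < N \<and> rep \<mu> X (\<mu> 11 sl) t \<and> (\<forall>p. PP p --> enumerates (alls t (ap f p)) (A p)))"
  using assms(1) unfolding slot_ok_def by blast
 have e: "\<mu>' 11 sl = \<mu> 11 sl" "mapat \<mu>' 12 sl f" using assms(4) f(1) by (simp_all add: mapat_def)
 show ?thesis
  unfolding slot_ok_def
 proof (intro exI[of _ f] conjI e(2) f(2))
  show "\<mu>' 11 sl = 0 \<and> (\<forall>p. PP p --> A p = {}) \<or>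
   (\<exists>t. 2 \<le> \<mu>' 11 sl \<and> \<mu>' 11 sl < N' \<and> rep \<mu>' X (\<mu>' 11 sl) t \<and> (\<forall>p. PP p --> enumerates (alls t (ap f p)) (A p)))"
   using c
  proof
   assume "\<exists>t. 2 \<le> \<mu> 11 sl \<and> \<mu> 11 sl < N \<and> rep \<mu> X (\<mu> 11 sl) t \<and> (\<forall>p. PP p --> enumerates (alls t (ap f p)) (A p))"
   then obtain t where t: "2 \<le> \<mu> 11 sl" "\<mu> 11 sl < N" "rep \<mu> X (\<mu> 11 sl) t" "\<forall>p. PP p --> enumerates (alls t (ap f p)) (A p)"
    by blast
   then show ?thesis using rep_ext[OF t(3,2) assms(2)] assms(3) unfolding e(1) by (intro disjI2 exI[of _ t]) simp
  qed (simp add: e(1))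
 qed
qed

lemma slot_ok_cong:
 assumes "slot_ok \<mu> N X Y PP sl A" "\<And>p. PP p ==> A p = A' p"
 shows "slot_ok \<mu> N X Y PP sl A'"
 using assms unfolding slot_ok_def by fastforce

lemma wp_add_item:
 assumes z: "rg s 5 = 0" and o: "rg s 6 = 1" and slot: "slot_ok (mm s) (rg s 32) X Y PP (rg s 59) A0"
  and item: "item_ok s X Y PP A1" and disj: "\<And>p. PP p ==> A1 p \<inter> A0 p = {}" and YX: "Y \<le> X"
  and W: "(rg s 32 + 1) * X < W" "rg s 32 + 2 < W"
 shows "wp W add_item (\<lambda>s'. slot_ok (mm s') (rg s' 32) X Y PP (rg s 59) (\<lambda>p. A1 p \<union> A0 p) \<and>
   rg s 32 \<le> rg s' 32 \<and> rg s' 32 \<le> rg s 32 + 1 \<and> cells_ext (mm s) (mm s') (rg s 32) \<and>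
   (\<forall>a \<in> {11..15}. \<forall>i. i ~= rg s 59 --> mm s' a i = mm s a i) \<and> tm s' \<le> tm s + 80) s"
proof -
 let ?sl = "rg s 59"
 obtain f where f: "mapat (mm s) 12 ?sl f" "map_ok Y f" and c: "mm s 11 ?sl = 0 \<and> (\<forall>p. PP p --> A0 p = {}) \<or>
   (\<exists>t. 2 \<le> mm s 11 ?sl \<and> mm s 11 ?sl < rg s 32 \<and> rep (mm s) X (mm s 11 ?sl) t \<and> (\<forall>p. PP p --> enumerates (alls t (ap f p)) (A0 p)))"
  using slot unfolding slot_ok_def by blast
 obtain t where t: "2 \<le> rg s 54" "rg s 54 < rg s 32" "map_ok Y (rmapf s 55)" "rep (mm s) X (rg s 54) t"
  "\<And>p. PP p ==> enumerates (alls t (ap (rmapf s 55) p)) (A1 p)"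
  using item unfolding item_ok_def by blast
 let ?A = "\<lambda>p. A1 p \<union> A0 p"
 let ?c1 = "Load 20 11 59 ;;
   Cond ZERO 20 (Load 70 11 59 ;; Load 71 12 59 ;; Load 72 13 59 ;; Load 73 14 59 ;;
    Load 74 15 59 ;; mkunion) Skip"
 have 1: "wp W ?c1 (\<lambda>s'. item_ok s' X Y PP ?A \<and> rg s 32 \<le> rg s' 32 \<and> rg s' 32 \<le> rg s 32 + 1 \<and> cells_ext (mm s) (mm s') (rg s 32) \<and>
   tm s' \<le> tm s + 70) s"
 proof (cases "mm s 11 ?sl = 0")
  case True
  then have "\<And>p. PP p ==> A0 p = {}" using c by auto
  then have "item_ok s X Y PP ?A" using item unfolding item_ok_def by fastforce
  then have "item_ok (s(|rg := (rg s)(20 := mm s 11 ?sl), tm := k|)) X Y PP ?A" for k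
   by (simp add: item_ok_def rmapf_def)
  then show ?thesis using z True by (simp add: cells_ext_refl)
 next
  case False
  then have "\<exists>u. 2 \<le> mm s 11 ?sl \<and> mm s 11 ?sl < rg s 32 \<and> rep (mm s) X (mm s 11 ?sl) u \<and>
   (\<forall>p. PP p --> enumerates (alls u (ap f p)) (A0 p))" using c by (simp only: simp_thms)
  then obtain u where u: "2 \<le> mm s 11 ?sl" "mm s 11 ?sl < rg s 32" "rep (mm s) X (mm s 11 ?sl) u"
   and uall: "\<forall>p. PP p --> enumerates (alls u (ap f p)) (A0 p)" by (elim exE conjE)
  let ?s1 = "s(|rg := (rg s)(20 := mm s 11 ?sl, 70 := mm s 11 ?sl, 71 := mm s 12 ?sl, 72 := mm s 13 ?sl, 73 := mm s 14 ?sl, 74 := mm s 15 ?sl),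
   tm := Suc (Suc (Suc (Suc (Suc (Suc (Suc (tm s)))))))|)"
  have f1: "rmapf ?s1 71 = f" "rmapf ?s1 55 = rmapf s 55" using f(1) by (simp_all add: rmapf_def mapat_def)
  have mu: "wp W mkunion (\<lambda>s'. rep (mm s') X (rg ?s1 32) (CU t (rmapf ?s1 55) u (rmapf ?s1 71)) \<and> cells_ext (mm ?s1) (mm s') (rg ?s1 32) \<and>
   rg s' 54 = rg ?s1 32 \<and> rmapf s' 55 = idm \<and> rg s' 32 = rg ?s1 32 + 1 \<and> tm s' \<le> tm ?s1 + 60) ?s1"
   by (rule wp_mkunion[OF _ _ _ _ _ _ refl refl])
    (use z o t u W map_ok_mono[OF t(3) YX] map_ok_mono[OF f(2) YX] f1 in simp_all)
  have "wp W mkunion (\<lambda>s'. item_ok s' X Y PP ?A \<and> rg s 32 \<le> rg s' 32 \<and> rg s' 32 \<le> rg s 32 + 1 \<and> cells_ext (mm s) (mm s') (rg s 32) \<and>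
   tm s' \<le> tm s + 70) ?s1"
  proof (rule wp_mono[OF mu], goal_cases)
   case (1 s')
   have "enumerates (alls (CU t (rmapf s 55) u f) (ap idm p)) (?A p)" if "PP p" for p
    unfolding ap_idm by (rule enumerates_CU) (use t(5) uall disj that in blast)+
   then have "item_ok s' X Y PP ?A"
    unfolding item_ok_def using 1 t(1,2) f1 map_ok_idm by (auto intro!: exI[of _ "CU t (rmapf s 55) u f"])
   then show ?case using 1 by simp
  qed
  then show ?thesis using z False by simp
 qed
 have e: "wp W add_item Q s = wp W ?c1 (wp W (Store 11 59 54 ;; Store 12 59 55 ;; Store 13 59 56 ;;
   Store 14 59 57 ;; Store 15 59 58) Q) s" for Q
  by (simp only: add_item_def wp_Seq_fun)
 show ?thesis unfolding e
 proof (rule wp_use[OF 1], goal_cases)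
  case (1 s1)
  have r1: "rg s1 59 = ?sl" using 1(2) by simp
  have a1: "mm s1 a = mm s a" if "a \<in> {11..15}" for a using 1(3)[of a] that by auto
  let ?blk = "Store 11 59 54 ;; Store 12 59 55 ;; Store 13 59 56 ;; Store 14 59 57 ;; Store 15 59 58"
  have b: "wp W ?blk (\<lambda>s'. mm s' 11 = (mm s 11)(?sl := rg s1 54) \<and> mm s' 12 = (mm s 12)(?sl := rg s1 55) \<and> mm s' 13 = (mm s 13)(?sl := rg s1 56) \<and>
   mm s' 14 = (mm s 14)(?sl := rg s1 57) \<and> mm s' 15 = (mm s 15)(?sl := rg s1 58) \<and> tm s' = tm s1 + 5) s1"
   using r1 a1 by simp
  show ?case
  proof (rule wp_use[OF b], goal_cases)
   case (1 s2)
   have r2: "rg s2 = rg s1" using 1(2) by (simp add: fun_eq_iff)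
   have c2: "cells_ext (mm s1) (mm s2) N" for N using 1(3) by (auto simp: cells_ext_def)
   obtain t' where t': "2 \<le> rg s1 54" "rg s1 54 < rg s1 32" "map_ok Y (rmapf s1 55)" "rep (mm s1) X (rg s1 54) t'"
    "\<And>p. PP p ==> enumerates (alls t' (ap (rmapf s1 55) p)) (?A p)"
    using \<open>item_ok s1 X Y PP ?A \<and> _\<close> unfolding item_ok_def by blast
   have "mapat (mm s2) 12 ?sl (rmapf s1 55)" using 1(1) by (simp add: mapat_def rmapf_def)
   then have "slot_ok (mm s2) (rg s2 32) X Y PP ?sl ?A"
    unfolding slot_ok_def using t' rep_ext[OF t'(4,2) c2] 1(1) r2 by (intro exI[of _ "rmapf s1 55"]) auto
   moreover have "\<forall>a \<in> {11..15}. \<forall>i. i ~= ?sl --> mm s2 a i = mm s a i"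
   proof (intro ballI allI impI)
    fix a i :: nat assume "a \<in> {11..15}" and i: "i ~= ?sl"
    then have "a = 11 \<or> a = 12 \<or> a = 13 \<or> a = 14 \<or> a = 15" by auto
    then show "mm s2 a i = mm s a i" using i 1(1) by (elim disjE) simp_all
   qed
   moreover have "cells_ext (mm s) (mm s2) (rg s 32)"
    using \<open>item_ok s1 X Y PP ?A \<and> _\<close> c2 cells_ext_trans by blast
   ultimately show ?case using 1(1) r2 \<open>item_ok s1 X Y PP ?A \<and> _\<close> by simp
  qed
 qed
qed

section \<open>The vertices of the data structure\<close>

context automaton
begin

text \<open>The empty marking is kept apart under the index \<open>2 ^ K\<close>.\<close>

definition ES :: "nat fsym btree => nat => nat \<times> nat => nat set set" where
 "ES e s p = (if s = 2 ^ K then {{}} else {P. P ~= {} \<and> (s, P) \<in> G e p})"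

definition sidx :: "nat => nat => nat" where
 "sidx u a = (if a = 2 ^ K then u else a)"

text \<open>The share of the index pairs in \<open>\<Pi>\<close>, which are those processed so far
  by the loop over pairs. The pair of two empty markings is left out, since it yields the empty
  set.\<close>

definition PR :: "nat fsym => nat fsym btree => nat fsym btree => nat => nat => (nat \<times> nat) set => nat => nat \<times> nat => nat set set" where
 "PR l e1 e2 u1 u2 \<Pi> s p = {P1 \<union> P2 | a b P1 P2. (a, b) \<in> \<Pi> \<and> (a, b) ~= (2 ^ K, 2 ^ K) \<and>
   P1 \<in> ES e1 a (ap (lm l e1 e2) p) \<and> P2 \<in> ES e2 b (ap (rm l e1) p) \<and> opst (kind_code l) (sidx u1 a) (sidx u2 b) = s}"

lemma PR_empty [simp]: "PR l e1 e2 u1 u2 {} s p = {}"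
 by (simp add: PR_def)

lemma PR_insert: "PR l e1 e2 u1 u2 (insert x \<Pi>) s p = PR l e1 e2 u1 u2 {x} s p \<union> PR l e1 e2 u1 u2 \<Pi> s p"
 unfolding PR_def by blast

lemma PR_none:
 assumes "ES e1 a (ap (lm l e1 e2) p) = {} \<or> ES e2 b (ap (rm l e1) p) = {}"
 shows "PR l e1 e2 u1 u2 {(a, b)} s p = {}"
 using assms unfolding PR_def by blast

lemma PR_empties: "PR l e1 e2 u1 u2 {(2 ^ K, 2 ^ K)} s p = {}"
 unfolding PR_def by simp

lemma PR_other: "s ~= opst (kind_code l) (sidx u1 a) (sidx u2 b) ==> PR l e1 e2 u1 u2 {(a, b)} s p = {}"
 unfolding PR_def by auto

lemma PR_single:
 assumes "(a, b) ~= (2 ^ K, 2 ^ K)"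
 shows "PR l e1 e2 u1 u2 {(a, b)} (opst (kind_code l) (sidx u1 a) (sidx u2 b)) p =
  {P1 \<union> P2 | P1 P2. P1 \<in> ES e1 a (ap (lm l e1 e2) p) \<and> P2 \<in> ES e2 b (ap (rm l e1) p)}"
 using assms unfolding PR_def by auto

context
 fixes l e1 e2 u1 u2 p
 assumes ok: "eval_fexp (BNode l e1 e2) ~= None" and pos: "pos_ok (BNode l e1 e2) p"
  and u1: "\<And>q. (u1, {}) \<in> G e1 q" and u2: "\<And>q. (u2, {}) \<in> G e2 q"
begin

lemma ES_G:
 "P \<in> ES e1 a q ==> (sidx u1 a, P) \<in> G e1 q" "P \<in> ES e2 a q ==> (sidx u2 a, P) \<in> G e2 q"
 using u1 u2 by (auto simp: ES_def sidx_def split: if_splits)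

lemma ok12: "eval_fexp e1 ~= None" "eval_fexp e2 ~= None"
 using eval_BNode[OF ok] by (metis option.distinct(1))+

lemma ES_unique: "eval_fexp e ~= None ==> pos_ok e q ==> P \<in> ES e a q ==> P \<in> ES e b q ==> a = b"
 using G_unique[of e q a P b] by (auto simp: ES_def split: if_splits)

text \<open>Decomposition and state are both unique, so a set stems from at most one index
  pair.\<close>

lemma PR_disj:
 assumes "(a, b) \<notin> \<Pi>"
 shows "PR l e1 e2 u1 u2 {(a, b)} s p \<inter> PR l e1 e2 u1 u2 \<Pi> s p = {}"
proof -
 note q = pos_ok_BNode[OF ok pos]
 have False if P: "P1 \<in> ES e1 a (ap (lm l e1 e2) p)" "P2 \<in> ES e2 b (ap (rm l e1) p)"
  and P': "P1' \<in> ES e1 a' (ap (lm l e1 e2) p)" "P2' \<in> ES e2 b' (ap (rm l e1) p)" "(a', b') \<in> \<Pi>"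
  and eq: "P1 \<union> P2 = P1' \<union> P2'" for a' b' P1 P2 P1' P2'
 proof -
  have "P1 = P1' \<and> P2 = P2'" using q(4)[OF ES_G(1)[OF P(1)] ES_G(2)[OF P(2)] ES_G(1)[OF P'(1)] ES_G(2)[OF P'(2)] eq] .
  then have "a = a'" "b = b'" using ES_unique[OF ok12(1) q(1) P(1)] ES_unique[OF ok12(2) q(2) P(2)] P' by auto
  then show False using assms P'(3) by simp
 qed
 then show ?thesis unfolding PR_def by blast
qed

lemma PR_all:
 assumes "s < 2 ^ K"
 shows "PR l e1 e2 u1 u2 ({..2 ^ K} \<times> {..2 ^ K}) s p = ES (BNode l e1 e2) s p" (is "?L = ?R")
proof (intro subset_antisym subsetI)
 note q = pos_ok_BNode[OF ok pos]
 fix P assume "P \<in> ?L"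
 then obtain a b P1 P2 where P: "P = P1 \<union> P2" "(a, b) ~= (2 ^ K, 2 ^ K)" "P1 \<in> ES e1 a (ap (lm l e1 e2) p)"
  "P2 \<in> ES e2 b (ap (rm l e1) p)" "opst (kind_code l) (sidx u1 a) (sidx u2 b) = s"
  unfolding PR_def by blast
 have "P ~= {}" using P(1-4) by (auto simp: ES_def split: if_splits)
 moreover have "(s, P) \<in> G (BNode l e1 e2) p"
  unfolding G_BNode[OF ok] using ES_G(1)[OF P(3)] ES_G(2)[OF P(4)] P(1,5) by blast
 ultimately show "P \<in> ?R" using assms by (simp add: ES_def)
next
 note q = pos_ok_BNode[OF ok pos]
 fix P assume "P \<in> ?R"
 then have P: "P ~= {}" "(s, P) \<in> G (BNode l e1 e2) p" using assms by (auto simp: ES_def)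
 obtain s1 P1 s2 P2 where a: "s = opst (kind_code l) s1 s2" "P = P1 \<union> P2"
  "(s1, P1) \<in> G e1 (ap (lm l e1 e2) p)" "(s2, P2) \<in> G e2 (ap (rm l e1) p)"
  using P(2) unfolding G_BNode[OF ok] by auto
 \<comment> \<open>An empty part gets the index of the empty marking, a nonempty part its
   state.\<close>
 define a where "a = (if P1 = {} then 2 ^ K else s1)"
 define b where "b = (if P2 = {} then 2 ^ K else s2)"
 have s: "s1 < 2 ^ K" "s2 < 2 ^ K" using G_subset[OF ok12(1) a(3)] G_subset[OF ok12(2) a(4)] by auto
 have m: "P1 \<in> ES e1 a (ap (lm l e1 e2) p)" "P2 \<in> ES e2 b (ap (rm l e1) p)"
  using a s by (auto simp: a_def b_def ES_def)
 have "sidx u1 a = s1" using G_unique[OF ok12(1) q(1) u1, of s1] a(3) s by (auto simp: a_def sidx_def)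
 moreover have "sidx u2 b = s2" using G_unique[OF ok12(2) q(2) u2, of s2] a(4) s by (auto simp: b_def sidx_def)
 moreover have "(a, b) ~= (2 ^ K, 2 ^ K)" using P(1) a(2) s by (auto simp: a_def b_def)
 moreover have "(a, b) \<in> {..2 ^ K} \<times> {..2 ^ K}" using s by (auto simp: a_def b_def)
 ultimately show "P \<in> ?L" unfolding PR_def using m a(1,2) by blast
qed

lemma PR_product:
 assumes "a < 2 ^ K" "b < 2 ^ K" "enumerates (alls t (ap f (ap (lm l e1 e2) p))) (ES e1 a (ap (lm l e1 e2) p))"
  "enumerates (alls t' (ap f' (ap (rm l e1) p))) (ES e2 b (ap (rm l e1) p))"
 shows "enumerates (alls (CP t (cm (lm l e1 e2) f) t' (cm (rm l e1) f')) p)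
  (PR l e1 e2 u1 u2 {(a, b)} (opst (kind_code l) (sidx u1 a) (sidx u2 b)) p)"
proof -
 note q = pos_ok_BNode[OF ok pos]
 have ab: "(a, b) ~= (2 ^ K, 2 ^ K)" using assms by simp
 show ?thesis unfolding PR_single[OF ab]
 proof (rule enumerates_CP)
  show "P1 \<inter> P2 = {}" if "P1 \<in> ES e1 a (ap (lm l e1 e2) p)" "P2 \<in> ES e2 b (ap (rm l e1) p)" for P1 P2
   using q(3)[OF ES_G(1)[OF that(1)] ES_G(2)[OF that(2)]] .
  show "P1 = P1' \<and> P2 = P2'" if "P1 \<in> ES e1 a (ap (lm l e1 e2) p)" "P2 \<in> ES e2 b (ap (rm l e1) p)"
   "P1' \<in> ES e1 a (ap (lm l e1 e2) p)" "P2' \<in> ES e2 b (ap (rm l e1) p)" "P1 \<union> P2 = P1' \<union> P2'" for P1 P2 P1' P2'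
   using q(4)[OF ES_G(1)[OF that(1)] ES_G(2)[OF that(2)] ES_G(1)[OF that(3)] ES_G(2)[OF that(4)] that(5)] .
 qed (use assms in simp_all)
qed

text \<open>Against an empty part the family is that of the child itself. Only the offset map has to
  be composed with its reference, which keeps chains of such vertices from costing time in the
  enumeration.\<close>

lemma PR_left:
 assumes "a < 2 ^ K"
 shows "PR l e1 e2 u1 u2 {(a, 2 ^ K)} (opst (kind_code l) (sidx u1 a) (sidx u2 (2 ^ K))) p = ES e1 a (ap (lm l e1 e2) p)"
 using assms PR_single[of a "2 ^ K"] by (simp add: ES_def[of e2])

lemma PR_right:
 assumes "b < 2 ^ K"
 shows "PR l e1 e2 u1 u2 {(2 ^ K, b)} (opst (kind_code l) (sidx u1 (2 ^ K)) (sidx u2 b)) p = ES e2 b (ap (rm l e1) p)"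
 using assms PR_single[of "2 ^ K" b] by (simp add: ES_def[of e1])

end

definition FS :: "nat fsym btree => nat => nat \<times> nat => nat set set" where
 "FS e k p = (\<Union>s \<in> {s. s < k \<and> acc s}. ES e s p)"

text \<open>Arrays 7 to 9 keep the lengths and the type for the offset maps, array 10 the state of
  the empty marking, and array 6 the first slot. The entry 1 in slot \<open>2 ^ K\<close> makes the
  empty marking look nonempty to the loop over pairs.\<close>

definition half_ok :: "(nat => nat => nat) => nat => nat => nat => nat fsym btree => nat => bool" where
 "half_ok \<mu> N X Y e v \<longleftrightarrow> \<mu> 7 v = lc (wd e) \<and> \<mu> 8 v = rc (wd e) \<and> \<mu> 9 v = ty (wd e) \<and>
   \<mu> 10 v < 2 ^ K \<and> (\<forall>p. (\<mu> 10 v, {}) \<in> G e p) \<and>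
   (\<forall>s < 2 ^ K. slot_ok \<mu> N X Y (pos_ok e) (\<mu> 6 v + s) (ES e s)) \<and> \<mu> 11 (\<mu> 6 v + 2 ^ K) = 1"

text \<open>The last slot of a vertex collects its nonempty accepted sets, and array 40 decides the
  empty set; a query starts from these two. \<open>S\<close> is the number of slots in use.\<close>

definition vert_ok :: "(nat => nat => nat) => nat => nat => nat => nat => nat fsym btree => nat => bool" where
 "vert_ok \<mu> N S X Y e v \<longleftrightarrow> half_ok \<mu> N X Y e v \<and> \<mu> 6 v + 2 ^ K + 2 \<le> S \<and>
   \<mu> 53 v = \<mu> 6 v + 2 ^ K + 1 \<and> \<mu> 40 v = of_bool (acc (\<mu> 10 v)) \<and>
   slot_ok \<mu> N X Y (pos_ok e) (\<mu> 53 v) (FS e (2 ^ K))"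

definition verts_ext :: "(nat => nat => nat) => (nat => nat => nat) => nat => nat => nat => bool" where
 "verts_ext \<mu> \<mu>' N S v \<longleftrightarrow> cells_ext \<mu> \<mu>' N \<and> (\<forall>a \<in> {11..15}. \<forall>i. i < S \<or> S + 2 ^ K + 2 \<le> i --> \<mu>' a i = \<mu> a i) \<and>
   (\<forall>a \<in> {6, 7, 8, 9, 10, 40, 53}. \<forall>u. u ~= v --> \<mu>' a u = \<mu> a u)"

lemma half_ok_ext:
 assumes "half_ok \<mu> N X Y e v" "cells_ext \<mu> \<mu>' N" "N \<le> N'" "\<And>a i. a \<in> {11..15} ==> i \<le> \<mu> 6 v + 2 ^ K ==> \<mu>' a i = \<mu> a i"
  "\<And>a. a \<in> {6, 7, 8, 9, 10} ==> \<mu>' a v = \<mu> a v"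
 shows "half_ok \<mu>' N' X Y e v"
proof -
 have b: "\<mu>' 6 v = \<mu> 6 v" "\<mu>' 7 v = \<mu> 7 v" "\<mu>' 8 v = \<mu> 8 v" "\<mu>' 9 v = \<mu> 9 v" "\<mu>' 10 v = \<mu> 10 v" "\<mu>' 11 (\<mu> 6 v + 2 ^ K) = \<mu> 11 (\<mu> 6 v + 2 ^ K)"
  using assms(4,5) by simp_all
 have "slot_ok \<mu>' N' X Y (pos_ok e) (\<mu> 6 v + s) (ES e s)" if "s < 2 ^ K" for s
  using assms(1) that by (intro slot_ok_ext[OF _ assms(2,3) assms(4)]) (auto simp: half_ok_def)
 then show ?thesis using assms(1) unfolding half_ok_def b by blast
qed

lemma vert_ok_ext:
 assumes "vert_ok \<mu> N S X Y e u" "verts_ext \<mu> \<mu>' N S v" "N \<le> N'" "S \<le> S'" "u ~= v"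
 shows "vert_ok \<mu>' N' S' X Y e u"
proof -
 have s: "\<mu>' a i = \<mu> a i" if "a \<in> {11..15}" "i < S" for a i
  using assms(2) that by (simp_all add: verts_ext_def)
 have c: "cells_ext \<mu> \<mu>' N" using assms(2) by (simp add: verts_ext_def)
 have a: "\<mu>' a u = \<mu> a u" if "a \<in> {6, 7, 8, 9, 10, 40, 53}" for a
  using assms(2,5) that unfolding verts_ext_def by blast
 have b: "\<mu>' 6 u = \<mu> 6 u" "\<mu>' 40 u = \<mu> 40 u" "\<mu>' 53 u = \<mu> 53 u" "\<mu>' 10 u = \<mu> 10 u" using a by simp_all
 have v: "half_ok \<mu> N X Y e u" "\<mu> 6 u + 2 ^ K + 2 \<le> S" "\<mu> 53 u = \<mu> 6 u + 2 ^ K + 1" "\<mu> 40 u = of_bool (acc (\<mu> 10 u))"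
   "slot_ok \<mu> N X Y (pos_ok e) (\<mu> 53 u) (FS e (2 ^ K))" using assms(1) by (auto simp: vert_ok_def)
 have "half_ok \<mu>' N' X Y e u" by (rule half_ok_ext[OF v(1) c assms(3)]) (use s v a in auto)
 moreover have "slot_ok \<mu>' N' X Y (pos_ok e) (\<mu> 53 u) (FS e (2 ^ K))"
  by (rule slot_ok_ext[OF v(5) c assms(3)]) (use s v in auto)
 ultimately show ?thesis using v assms(4) unfolding vert_ok_def b by simp
qed

end

section \<open>The preprocessing program: inner vertices\<close>

lemma slot_okE:
 assumes "slot_ok \<mu> N X Y PP sl A" "\<mu> 11 sl ~= 0"
 obtains f t where "mapat \<mu> 12 sl f" "map_ok Y f" "2 \<le> \<mu> 11 sl" "\<mu> 11 sl < N" "rep \<mu> X (\<mu> 11 sl) t"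
  "\<And>p. PP p ==> enumerates (alls t (ap f p)) (A p)"
 using assms unfolding slot_ok_def by meson

lemma slot_ok_zero: "slot_ok \<mu> N X Y PP sl A ==> \<mu> 11 sl = 0 ==> PP p ==> A p = {}"
 unfolding slot_ok_def by (metis not_numeral_le_zero)

lemma slot_ok_mono: "slot_ok \<mu> N X Y PP sl A ==> Y \<le> Y' ==> slot_ok \<mu> N X Y' PP sl A"
 unfolding slot_ok_def using map_ok_mono by meson

text \<open>Registers 80 to 83 and 84 to 87 receive the two offset maps, 94 to 96 the type and the
  two lengths of the value.\<close>

definition map_code :: com where
 "map_code = (Load 88 7 41) ;; Load 89 8 41 ;; Load 90 9 41 ;; Load 91 7 42 ;;
   Load 92 8 42 ;; Load 93 9 42 ;; Load 97 6 41 ;; Load 98 6 42 ;;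
   Cond 43 39
    (Const 80 0 ;; Const 81 0 ;; Const 82 1 ;; Const 83 0 ;;
    Cond ZERO 90 (Const 84 1 ;; Copy 85 89 ;; Const 94 1 ;; Copy 95 88 ;; Add 96 89 91)
     (Const 84 0 ;; Copy 85 88 ;; Copy 94 93 ;; Add 95 88 91 ;; Copy 96 92))
    (Const 84 0 ;; Copy 85 88 ;; Copy 94 93 ;; Const 80 0 ;; Const 81 0 ;;
    Cond ZERO 93 (Const 82 1 ;; Copy 83 92 ;; Add 95 88 91 ;; Add 96 92 89)
     (Const 82 0 ;; Add 83 88 91 ;; Add 95 83 89 ;; Const 96 0)) ;;
   Const 86 1 ;; Const 87 0 ;;
   Store 6 40 33 ;; Store 7 40 95 ;; Store 8 40 96 ;; Store 9 40 94"

definition pair_item :: com where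
 "pair_item = Cond 76 9 (Cond 77 9 (ldref 78 80 54 ;; ldref 79 84 70 ;; mkproduct) (ldref 78 80 54)) (ldref 79 84 54)"

definition put_pair :: com where
 "put_pair = pair_item ;; Add 59 33 53 ;; add_item"

definition pair_states :: com where
 "pair_states = Cond 76 9 (Copy 50 76) (Load 50 10 41) ;; Cond 77 9 (Copy 51 77) (Load 51 10 42)"

text \<open>Pairs with an empty slot are skipped. If both indices are \<open>2 ^ K\<close>, the
  result is the state of the empty marking, which goes to array 10 rather than into a
  family.\<close>

definition pair_code :: com where
 "pair_code = (Add 78 97 76 ;; Add 79 98 77 ;; Load 54 11 78 ;; Load 70 11 79) ;;
   Cond ZERO 54 (Cond ZERO 70 (pair_states ;; op_code ;;
    Cond 76 9 put_pair (Cond 77 9 put_pair (Store 10 40 53 ;; Add 59 33 9 ;; Store 11 59 ONE))) Skip) Skip"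

definition pairs_code :: com where
 "pairs_code = For 76 34 (For 77 34 pair_code)"

lemma mod_map_code [simp]: "modr map_code = {80, 81, 82, 83, 84, 85, 86, 87, 88, 89, 90, 91, 92, 93, 94, 95, 96, 97, 98}"
 "moda map_code = {6, 7, 8, 9}" "silent map_code"
 by (auto simp: map_code_def)

lemma mod_pair_item [simp]: "modr pair_item = {20, 21, 22, 23, 32, 54, 55, 56, 57, 58, 70, 71, 72, 73, 74, 75}"
 "moda pair_item = {16, 17, 18, 19, 20, 21, 22, 23, 24, 25, 26, 27, 28, 29, 30, 31, 32, 33}" "silent pair_item"
 by (auto simp: pair_item_def)

lemma mod_put_pair [simp]: "modr put_pair = {20, 21, 22, 23, 24, 32, 54, 55, 56, 57, 58, 59, 70, 71, 72, 73, 74, 75}"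
 "moda put_pair = {11, 12, 13, 14, 15, 16, 17, 18, 19, 20, 21, 22, 23, 24, 25, 26, 27, 28, 29, 30, 31, 32, 33}" "silent put_pair"
 by (auto simp: put_pair_def)

lemma mod_pair_states [simp]: "modr pair_states = {50, 51}" "moda pair_states = {}" "silent pair_states"
 by (auto simp: pair_states_def)

lemma mod_pair_code [simp]: "modr pair_code = {20, 21, 22, 23, 24, 25, 26, 27, 28, 29, 32, 50, 51, 53, 54, 55, 56, 57, 58, 59,
  60, 61, 62, 63, 64, 70, 71, 72, 73, 74, 75, 78, 79}"
 "moda pair_code = {10, 11, 12, 13, 14, 15, 16, 17, 18, 19, 20, 21, 22, 23, 24, 25, 26, 27, 28, 29, 30, 31, 32, 33, 35, 36, 37}"
 "silent pair_code"
 by (auto simp: pair_code_def)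

lemma mod_pairs_code [simp]: "modr pairs_code = {20, 21, 22, 23, 24, 25, 26, 27, 28, 29, 32, 50, 51, 53, 54, 55, 56, 57, 58, 59,
  60, 61, 62, 63, 64, 70, 71, 72, 73, 74, 75, 76, 77, 78, 79}"
 "moda pairs_code = {10, 11, 12, 13, 14, 15, 16, 17, 18, 19, 20, 21, 22, 23, 24, 25, 26, 27, 28, 29, 30, 31, 32, 33, 35, 36, 37}"
 "silent pairs_code"
 by (auto simp: pairs_code_def)

text \<open>\<open>Yc\<close> bounds the constants in the references of the children,
  \<open>Z\<close> the offsets added at this vertex, and \<open>Y\<close> the resulting references;
  \<open>X\<close> is the bound common to all cells.\<close>

locale node = machine +
 fixes l :: "nat fsym" and e1 e2 :: "nat fsym btree" and X Yc Z Y :: nat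
 assumes ok: "eval_fexp (BNode l e1 e2) ~= None"
  and Z: "lc (wd e1) + lc (wd e2) + rc (wd e1) + rc (wd e2) \<le> Z" "Yc + Z \<le> Y" and YX: "Y \<le> X" "X < W"
begin

abbreviation "e \<equiv> BNode l e1 e2"
abbreviation "kd \<equiv> kind_code l"

lemma kind: "kd = 2 \<or> kd = 3"
 using eval_BNode[OF ok] by (metis kind_code.simps(3,4))

lemma info: "ty (wd e) = (if kd = 2 \<and> ty (wd e1) ~= 0 then 1 else ty (wd e2))"
 "lc (wd e) = (if kd = 2 then if ty (wd e1) = 0 then lc (wd e1) + lc (wd e2) else lc (wd e1)
      else if ty (wd e2) = 0 then lc (wd e1) + lc (wd e2) + rc (wd e1) else lc (wd e1) + lc (wd e2))"
 "rc (wd e) = (if kd = 2 then if ty (wd e1) = 0 then rc (wd e2) else rc (wd e1) + lc (wd e2)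
      else if ty (wd e2) = 0 then 0 else rc (wd e2) + rc (wd e1))"
proof -
 obtain F1 F2 where b: "wpre kd (wd e1) (wd e2)" "wd e = wop kd (wd e1) (wd e2)"
  using eval_BNode[OF ok] by metis
 show "ty (wd e) = (if kd = 2 \<and> ty (wd e1) ~= 0 then 1 else ty (wd e2))"
  "lc (wd e) = (if kd = 2 then if ty (wd e1) = 0 then lc (wd e1) + lc (wd e2) else lc (wd e1)
      else if ty (wd e2) = 0 then lc (wd e1) + lc (wd e2) + rc (wd e1) else lc (wd e1) + lc (wd e2))"
  "rc (wd e) = (if kd = 2 then if ty (wd e1) = 0 then rc (wd e2) else rc (wd e1) + lc (wd e2)
      else if ty (wd e2) = 0 then 0 else rc (wd e2) + rc (wd e1))"
  unfolding b(2) by (rule wop_info[OF b(1)])+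
qed

lemma maps_ok: "map_ok Z (lm l e1 e2)" "map_ok Z (rm l e1)"
 using Z(1) by (auto simp: map_ok_def lm_def rm_def lmap_def rmap_def idm_def)

lemma wp_map_code:
 assumes g: "glob s" and k: "rg s 43 = kd"
  and i1: "mm s 7 (rg s 41) = lc (wd e1)" "mm s 8 (rg s 41) = rc (wd e1)" "mm s 9 (rg s 41) = ty (wd e1)"
  and i2: "mm s 7 (rg s 42) = lc (wd e2)" "mm s 8 (rg s 42) = rc (wd e2)" "mm s 9 (rg s 42) = ty (wd e2)"
 shows "wp W map_code (\<lambda>s'. rmapf s' 80 = lm l e1 e2 \<and> rmapf s' 84 = rm l e1 \<and> rg s' 97 = mm s 6 (rg s 41) \<and> rg s' 98 = mm s 6 (rg s 42) \<and>
  mm s' 6 = (mm s 6)(rg s 40 := rg s 33) \<and> mm s' 7 = (mm s 7)(rg s 40 := lc (wd e)) \<and> mm s' 8 = (mm s 8)(rg s 40 := rc (wd e)) \<and>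
  mm s' 9 = (mm s 9)(rg s 40 := ty (wd e)) \<and> tm s' \<le> tm s + 40) s"
proof -
 note gd = globD[OF g]
 have t: "ty (wd e1) = 0 \<or> ty (wd e1) = 1" "ty (wd e2) = 0 \<or> ty (wd e2) = 1" by (auto simp: ty_def)
 have w: "1 < W" "lc (wd e1) + lc (wd e2) < W" "rc (wd e1) + lc (wd e2) < W" "rc (wd e2) + rc (wd e1) < W"
  "lc (wd e1) + lc (wd e2) + rc (wd e1) < W"
  using bounds(6) Z YX by linarith+
 from kind show ?thesis
 proof
  assume "kd = 2"
  then show ?thesis using t w gd k i1 i2
   by (elim disjE) (simp_all add: map_code_def rmapf_def info lm_def rm_def lmap_def rmap_def idm_def)
 next
  assume "kd = 3"
  then show ?thesis using t w gd k i1 i2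
   by (elim disjE) (simp_all add: map_code_def rmapf_def info lm_def rm_def lmap_def rmap_def idm_def)
 qed
qed

lemma wp_pair_item:
 assumes z: "rg s 5 = 0" "rg s 6 = 1" and ab: "rg s 76 = a" "rg s 77 = b" "rg s 9 = 2 ^ K" "a \<le> 2 ^ K" "b \<le> 2 ^ K" "(a, b) ~= (2 ^ K, 2 ^ K)"
  and maps: "rmapf s 80 = lm l e1 e2" "rmapf s 84 = rm l e1"
  and s1: "a < 2 ^ K ==> slot_ok (mm s) (rg s 32) X Yc (pos_ok e1) (rg s 78) (ES e1 a)" "mm s 11 (rg s 78) ~= 0"
  and s2: "b < 2 ^ K ==> slot_ok (mm s) (rg s 32) X Yc (pos_ok e2) (rg s 79) (ES e2 b)" "mm s 11 (rg s 79) ~= 0"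
  and u: "\<And>q. (u1, {}) \<in> G e1 q" "\<And>q. (u2, {}) \<in> G e2 q"
  and WW: "(rg s 32 + 1) * X < W" "rg s 32 + 2 < W"
 shows "wp W pair_item (\<lambda>s'. item_ok s' X Y (pos_ok e) (PR l e1 e2 u1 u2 {(a, b)} (opst kd (sidx u1 a) (sidx u2 b))) \<and>
  rg s 32 \<le> rg s' 32 \<and> rg s' 32 \<le> rg s 32 + 1 \<and> cells_ext (mm s) (mm s') (rg s 32) \<and> tm s' \<le> tm s + 110) s"
proof -
 have YZ: "Yc + Z < W" using Z(2) YX by linarith
 have cmok: "map_ok Y (cm (lm l e1 e2) f)" "map_ok Y (cm (rm l e1) f)" if "map_ok Yc f" for f
 proof -
  have "Z + Yc \<le> Y" using Z(2) by simp
  then show "map_ok Y (cm (lm l e1 e2) f)" "map_ok Y (cm (rm l e1) f)"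
   using map_ok_mono[OF map_ok_cm[OF maps_ok(1) that]] map_ok_mono[OF map_ok_cm[OF maps_ok(2) that]] by blast+
 qed
 note pos = pos_ok_BNode(1,2)[OF ok]
 let ?P = "PR l e1 e2 u1 u2 {(a, b)} (opst kd (sidx u1 a) (sidx u2 b))"
 let ?R = "\<lambda>s'. item_ok s' X Y (pos_ok e) ?P \<and>
  rg s 32 \<le> rg s' 32 \<and> rg s' 32 \<le> rg s 32 + 1 \<and> cells_ext (mm s) (mm s') (rg s 32) \<and> tm s' \<le> tm s + 110"
 have r: "rmapf (s(|tm := k|)) j = rmapf s j" for k j by (simp add: rmapf_def)
 \<comment> \<open>Covers both cases with exactly one empty marking; \<open>sl\<close> and
   \<open>fb\<close> select the nonempty side and its map.\<close>
 have half: "wp W (ldref sl fb 54) (\<lambda>s'. ?R (s'(|tm := Suc (tm s')|))) (s(|tm := k|))"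
  if c: "(sl, fb) \<in> {(78, 80), (79, 84)}" "slot_ok (mm s) (rg s 32) X Yc P (rg s sl) E" "mm s 11 (rg s sl) ~= 0"
   "map_ok Z (rmapf s fb)" "\<And>f. map_ok Yc f ==> map_ok Y (cm (rmapf s fb) f)"
   and E: "\<And>p. pos_ok e p ==> P (ap (rmapf s fb) p) \<and> ?P p = E (ap (rmapf s fb) p)" and k: "k \<le> tm s + 2" for sl fb P E k
 proof -
  obtain f t where f: "mapat (mm s) 12 (rg s sl) f" "map_ok Yc f" "2 \<le> mm s 11 (rg s sl)" "mm s 11 (rg s sl) < rg s 32"
   "rep (mm s) X (mm s 11 (rg s sl)) t" "\<And>p. P p ==> enumerates (alls t (ap f p)) (E p)"
   using slot_okE[OF c(2,3)] by metis
  let ?s = "s(|tm := k|)"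
  have "wp W (ldref sl fb 54) (\<lambda>s'. rg s' 54 = mm ?s 11 (rg ?s sl) \<and> rmapf s' (54 + 1) = cm (rmapf ?s fb) f \<and> tm s' \<le> tm ?s + 20) ?s"
   by (rule wp_ldref[where Y = Yc and Z = Z]) (use z f r c YZ in auto)
  then show ?thesis
  proof (rule wp_use, goal_cases)
   case (1 s')
   have c': "rg s' 32 = rg s 32" "mm s' = mm s" "rg s' 54 = mm s 11 (rg s sl)" "rmapf s' 55 = cm (rmapf s fb) f"
    using 1 by (simp_all add: fun_eq_iff r)
   have "enumerates (alls t (ap (cm (rmapf s fb) f) p)) (?P p)" if "pos_ok e p" for p
    using f(6) E[OF that] by simp
   then have "item_ok s' X Y (pos_ok e) ?P" unfolding item_ok_def c' using f c(5) by blast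
   then have "item_ok (s'(|tm := Suc (tm s')|)) X Y (pos_ok e) ?P" by (simp add: item_ok_def rmapf_def)
   then show ?case using 1(1) c' k by (simp add: cells_ext_refl)
  qed
 qed
 consider (L) "a < 2 ^ K" "b = 2 ^ K" | (R) "a = 2 ^ K" "b < 2 ^ K" | (B) "a < 2 ^ K" "b < 2 ^ K"
  using ab(4-6) by fastforce
 then show ?thesis
 proof cases
  case L
  have "wp W (ldref 78 80 54) (\<lambda>s'. ?R (s'(|tm := Suc (tm s')|))) (s(|tm := Suc (Suc (tm s))|))"
   by (rule half[where P = "pos_ok e1"]) (use L s1 maps maps_ok cmok pos(1) PR_left[OF ok _ u] in auto)
  then show ?thesis using L ab by (simp add: pair_item_def)
 next
  case R
  have "wp W (ldref 79 84 54) (\<lambda>s'. ?R (s'(|tm := Suc (tm s')|))) (s(|tm := Suc (tm s)|))"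
   by (rule half[where P = "pos_ok e2"]) (use R s2 maps maps_ok cmok pos(2) PR_right[OF ok _ u] in auto)
  then show ?thesis using R ab by (simp add: pair_item_def)
 next
  case B
  obtain f t where f: "mapat (mm s) 12 (rg s 78) f" "map_ok Yc f" "2 \<le> mm s 11 (rg s 78)" "mm s 11 (rg s 78) < rg s 32"
   "rep (mm s) X (mm s 11 (rg s 78)) t" "\<And>p. pos_ok e1 p ==> enumerates (alls t (ap f p)) (ES e1 a p)"
   using slot_okE[OF s1(1)[OF B(1)] s1(2)] by metis
  obtain f' t' where f': "mapat (mm s) 12 (rg s 79) f'" "map_ok Yc f'" "2 \<le> mm s 11 (rg s 79)" "mm s 11 (rg s 79) < rg s 32"
   "rep (mm s) X (mm s 11 (rg s 79)) t'" "\<And>p. pos_ok e2 p ==> enumerates (alls t' (ap f' p)) (ES e2 b p)"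
   using slot_okE[OF s2(1)[OF B(2)] s2(2)] by metis
  let ?f = "cm (lm l e1 e2) f" and ?f' = "cm (rm l e1) f'"
  let ?s = "s(|tm := Suc (Suc (tm s))|)"
  have A: "wp W (ldref 78 80 54) (\<lambda>s'. rg s' 54 = mm ?s 11 (rg ?s 78) \<and> rmapf s' (54 + 1) = cm (rmapf ?s 80) f \<and> tm s' \<le> tm ?s + 20) ?s"
   by (rule wp_ldref[where Y = Yc and Z = Z]) (use z f r maps maps_ok YZ in auto)
  have "wp W (ldref 78 80 54 ;; ldref 79 84 70 ;; mkproduct) ?R ?s"
   unfolding wp_Seq
  proof (rule wp_use[OF A], goal_cases)
   case (1 s1)
   note H1 = 1
   have r1: "rg s1 q = rg s q" if "q \<notin> {20, 21, 22, 23, 54, 55, 56, 57, 58}" for q using H1(2) that by simp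
   have mm1: "mm s1 = mm s" using H1(3) by (simp add: fun_eq_iff)
   have m1: "rmapf s1 84 = rm l e1" using maps r1 by (simp add: rmapf_def)
   have A2: "wp W (ldref 79 84 70) (\<lambda>s'. rg s' 70 = mm s1 11 (rg s1 79) \<and> rmapf s' (70 + 1) = cm (rmapf s1 84) f' \<and> tm s' \<le> tm s1 + 20) s1"
    by (rule wp_ldref[where Y = Yc and Z = Z]) (use z f' r1 m1 mm1 maps_ok YZ in auto)
   show ?case
   proof (rule wp_use[OF A2], goal_cases)
    case (1 s2)
    note H2 = 1
    have r2: "rg s2 q = rg s q" if "q \<notin> {20, 21, 22, 23, 54, 55, 56, 57, 58, 70, 71, 72, 73, 74}" for q using H2(2) r1 that by simp
    have r2': "rg s2 q = rg s1 q" if "q \<notin> {20, 21, 22, 23, 70, 71, 72, 73, 74}" for q using H2(2) that by simp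
    have mm2: "mm s2 = mm s" using H2(3) mm1 by (simp add: fun_eq_iff)
    have c: "rg s2 54 = mm s 11 (rg s 78)" "rmapf s2 55 = ?f" "rg s2 70 = mm s 11 (rg s 79)" "rmapf s2 71 = ?f'"
     using H1(1) H2(1) maps r m1 mm1 r1 r2' by (simp_all add: rmapf_def)
    have mk: "wp W mkproduct (\<lambda>s'. rep (mm s') X (rg s2 32) (CP t ?f t' ?f') \<and> cells_ext (mm s2) (mm s') (rg s2 32) \<and> rg s' 54 = rg s2 32 \<and>
      rmapf s' 55 = idm \<and> rg s' 32 = rg s2 32 + 1 \<and> tm s' \<le> tm s2 + 60) s2"
     by (rule wp_mkproduct) (use r2 mm2 c z f f' WW map_ok_mono[OF cmok(1)[OF f(2)] YX(1)] map_ok_mono[OF cmok(2)[OF f'(2)] YX(1)] in simp_all)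
    show ?case
    proof (rule wp_mono[OF mk], goal_cases)
     case (1 s3)
     have "enumerates (alls (CP t ?f t' ?f') (ap idm p)) (?P p)"
      if p: "pos_ok e p" for p
      unfolding ap_idm by (rule PR_product[OF ok p u B f(6)[OF pos(1)[OF p]] f'(6)[OF pos(2)[OF p]]])
     then have "item_ok s3 X Y (pos_ok e) ?P"
      unfolding item_ok_def using 1 r2 f(3,4) map_ok_idm
      by (intro conjI exI[of _ "CP t ?f t' ?f'"]) simp_all
     then show ?case using 1 H1(1) H2(1) mm2 r2 by simp
    qed
   qed
  qed
  then show ?thesis using B ab by (simp add: pair_item_def)
 qed
qed

end

lemma slot_ok_eq:
 assumes "slot_ok \<mu> N X Y PP sl A" "\<And>a. a \<in> {11..33} ==> \<mu>' a = \<mu> a"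
 shows "slot_ok \<mu>' N X Y PP sl A"
 by (rule slot_ok_ext[OF assms(1) _ order_refl]) (use assms(2) in \<open>auto simp: cells_ext_def\<close>)

text \<open>\<open>s0\<close> is the state before the loop over the pairs and \<open>ns\<close> the
  first fresh slot. Each pair creates at most a product and a union, hence the factor 2 in the space
  bounds.\<close>

locale node_run = node +
 fixes s0 :: st and v B C ns :: nat
 assumes g0: "glob s0" and r0: "rg s0 40 = v" "rg s0 41 = B" "rg s0 42 = C" "rg s0 43 = kind_code l" "rg s0 33 = ns"
  and base0: "rg s0 97 = mm s0 6 B" "rg s0 98 = mm s0 6 C" "mm s0 6 B + 2 ^ K < ns" "mm s0 6 C + 2 ^ K < ns"
  and map0: "rmapf s0 80 = lm l e1 e2" "rmapf s0 84 = rm l e1"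
  and child0: "half_ok (mm s0) (rg s0 32) X Yc e1 B" "half_ok (mm s0) (rg s0 32) X Yc e2 C" "B ~= v" "C ~= v"
  and W0: "(rg s0 32 + 2 * ((2 ^ K + 1) * (2 ^ K + 1)) + 2) * X < W" "rg s0 32 + 2 * ((2 ^ K + 1) * (2 ^ K + 1)) + 4 < W" "ns + 2 ^ K + 2 < W"
  and fresh0: "\<And>a i. a \<in> {11..15} ==> ns \<le> i ==> mm s0 a i = 0"
begin

abbreviation "u1 \<equiv> mm s0 10 B"
abbreviation "u2 \<equiv> mm s0 10 C"
abbreviation "PP \<equiv> pos_ok e"
abbreviation "RR \<equiv> PR l e1 e2 u1 u2"
abbreviation "pregs \<equiv> {20, 21, 22, 23, 24, 25, 26, 27, 28, 29, 32, 50, 51, 53, 54, 55, 56, 57, 58, 59,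
  60, 61, 62, 63, 64, 70, 71, 72, 73, 74, 75, 76, 77, 78, 79 :: nat}"
abbreviation "parrs \<equiv> {10, 11, 12, 13, 14, 15, 16, 17, 18, 19, 20, 21, 22, 23, 24, 25, 26, 27, 28, 29, 30, 31, 32, 33, 35, 36, 37 :: nat}"

text \<open>Slot \<open>ns + q\<close> holds the sets of state \<open>q\<close> that come from the
  pairs in \<open>\<Pi>\<close>. The frame conditions keep the slots of the children and all older
  cells intact.\<close>

definition pinv :: "(nat \<times> nat) set => st => bool" where
 "pinv \<Pi> s \<longleftrightarrow> (\<forall>r. r \<notin> pregs --> rg s r = rg s0 r) \<and> (\<forall>a. a \<notin> parrs --> mm s a = mm s0 a) \<and>
   (\<forall>q < 2 ^ K. slot_ok (mm s) (rg s 32) X Y PP (ns + q) (RR \<Pi> q)) \<and>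
   rg s0 32 \<le> rg s 32 \<and> rg s 32 \<le> rg s0 32 + 2 * card \<Pi> \<and> cells_ext (mm s0) (mm s) (rg s0 32) \<and>
   (\<forall>a \<in> {11..15}. \<forall>i. i < ns \<or> ns + 2 ^ K < i --> mm s a i = mm s0 a i) \<and>
   (\<forall>i. i ~= v --> mm s 10 i = mm s0 10 i) \<and>
   ((2 ^ K, 2 ^ K) \<in> \<Pi> --> mm s 10 v = opst kd u1 u2 \<and> mm s 11 (ns + 2 ^ K) = 1)"

lemma pinv_scratch:
 assumes "pinv \<Pi> s" "\<And>r. r \<notin> pregs - {32} ==> rg s' r = rg s r" "\<And>a. a \<notin> {35, 36, 37} ==> mm s' a = mm s a"
 shows "pinv \<Pi> s'"
proof -
 have r: "rg s' 32 = rg s 32" "\<And>r. r \<notin> pregs ==> rg s' r = rg s r" using assms(2) by auto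
 have a: "mm s' 10 = mm s 10" "mm s' 11 = mm s 11" "\<And>a. a \<in> {11..33} ==> mm s' a = mm s a" "\<And>a. a \<notin> parrs ==> mm s' a = mm s a"
  using assms(3) by auto
 have c: "cells_ext (mm s0) (mm s') (rg s0 32)" using assms(1) a(3) by (simp add: pinv_def cells_ext_def)
 have sl: "slot_ok (mm s') (rg s 32) X Y PP (ns + q) (RR \<Pi> q)" if "q < 2 ^ K" for q
  by (rule slot_ok_eq[OF _ a(3)]) (use assms(1) that in \<open>simp_all add: pinv_def\<close>)
 have sa: "\<forall>a \<in> {11..15}. \<forall>i. i < ns \<or> ns + 2 ^ K < i --> mm s' a i = mm s0 a i"
  using assms(1) a(3) by (simp add: pinv_def)
 show ?thesis unfolding pinv_def r(1) a(1,2)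
  using assms(1)[unfolded pinv_def] c sl sa r(2) a(4) by simp
qed

lemma pinvD:
 assumes "pinv \<Pi> s"
 shows "r \<notin> pregs ==> rg s r = rg s0 r" "a \<notin> parrs ==> mm s a = mm s0 a"
  "q < 2 ^ K ==> slot_ok (mm s) (rg s 32) X Y PP (ns + q) (RR \<Pi> q)" "rg s0 32 \<le> rg s 32"
  "rg s 32 \<le> rg s0 32 + 2 * card \<Pi>" "cells_ext (mm s0) (mm s) (rg s0 32)"
  "a \<in> {11..15} ==> i < ns \<or> ns + 2 ^ K < i ==> mm s a i = mm s0 a i"
  "i ~= v ==> mm s 10 i = mm s0 10 i"
  "(2 ^ K, 2 ^ K) \<in> \<Pi> ==> mm s 10 v = opst kd u1 u2 \<and> mm s 11 (ns + 2 ^ K) = 1"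
proof -
 note p1 = assms[unfolded pinv_def]
 note p2 = p1[THEN conjunct2] note p3 = p2[THEN conjunct2] note p4 = p3[THEN conjunct2] note p5 = p4[THEN conjunct2]
 note p6 = p5[THEN conjunct2] note p7 = p6[THEN conjunct2] note p8 = p7[THEN conjunct2] note p9 = p8[THEN conjunct2]
 show "r \<notin> pregs ==> rg s r = rg s0 r" by (rule p1[THEN conjunct1, rule_format])
 show "a \<notin> parrs ==> mm s a = mm s0 a" by (rule p2[THEN conjunct1, rule_format])
 show "q < 2 ^ K ==> slot_ok (mm s) (rg s 32) X Y PP (ns + q) (RR \<Pi> q)" by (rule p3[THEN conjunct1, rule_format])
 show "rg s0 32 \<le> rg s 32" by (rule p4[THEN conjunct1])
 show "rg s 32 \<le> rg s0 32 + 2 * card \<Pi>" by (rule p5[THEN conjunct1])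
 show "cells_ext (mm s0) (mm s) (rg s0 32)" by (rule p6[THEN conjunct1])
 show "a \<in> {11..15} ==> i < ns \<or> ns + 2 ^ K < i ==> mm s a i = mm s0 a i" using p7[THEN conjunct1] by blast
 show "i ~= v ==> mm s 10 i = mm s0 10 i" by (rule p8[THEN conjunct1, rule_format])
 show "(2 ^ K, 2 ^ K) \<in> \<Pi> ==> mm s 10 v = opst kd u1 u2 \<and> mm s 11 (ns + 2 ^ K) = 1" using p9 by blast
qed

lemma pinv_u: "(u1, {}) \<in> G e1 q" "(u2, {}) \<in> G e2 q" "u1 < 2 ^ K" "u2 < 2 ^ K"
 using child0(1,2) unfolding half_ok_def by blast+

lemma pinv_facts:
 assumes "pinv \<Pi> s" "finite \<Pi>" "\<Pi> \<subseteq> {..2 ^ K} \<times> {..2 ^ K}"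
 shows "glob s" "rg s 40 = v" "rg s 41 = B" "rg s 42 = C" "rg s 43 = kd" "rg s 33 = ns" "rg s 97 = mm s0 6 B" "rg s 98 = mm s0 6 C"
  "rmapf s 80 = lm l e1 e2" "rmapf s 84 = rm l e1" "half_ok (mm s) (rg s 32) X Yc e1 B" "half_ok (mm s) (rg s 32) X Yc e2 C"
  "mm s 6 B = mm s0 6 B" "mm s 6 C = mm s0 6 C" "mm s 10 B = u1" "mm s 10 C = u2"
  "(rg s 32 + 2) * X < W" "rg s 32 + 4 < W"
proof -
 note p = pinvD[OF assms(1)] and rf = pinvD(1)[OF assms(1)] and af = pinvD(2)[OF assms(1)]
 show "glob s" by (rule glob_frame[OF g0]) (use rf af in auto)
 show "rg s 40 = v" "rg s 41 = B" "rg s 42 = C" "rg s 43 = kd" "rg s 33 = ns" "rg s 97 = mm s0 6 B" "rg s 98 = mm s0 6 C"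
  using rf r0 base0 by simp_all
 show "rmapf s 80 = lm l e1 e2" "rmapf s 84 = rm l e1" using rf map0 by (simp_all add: rmapf_def)
 have c: "cells_ext (mm s0) (mm s) (rg s0 32)" "rg s0 32 \<le> rg s 32" using p(4,6) by blast+
 have sl: "mm s a i = mm s0 a i" if "a \<in> {11..15}" "i < ns" for a i using p(7) that by blast
 have t: "mm s a i = mm s0 a i" if "a \<in> {6, 7, 8, 9, 10}" "i ~= v" for a i
 proof (cases "a = 10")
  case True
  show ?thesis unfolding True using p(8) that(2) by blast
 next
  case False
  then have "a \<notin> parrs" using that(1) by auto
  then show ?thesis using af by simp
 qed
 show h: "half_ok (mm s) (rg s 32) X Yc e1 B"
 proof (rule half_ok_ext[OF child0(1) c])
  show "mm s a i = mm s0 a i" if "a \<in> {11..15}" "i \<le> mm s0 6 B + 2 ^ K" for a i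
   by (rule sl[OF that(1) le_less_trans[OF that(2) base0(3)]])
  show "mm s a B = mm s0 a B" if "a \<in> {6, 7, 8, 9, 10}" for a by (rule t[OF that child0(3)])
 qed
 show "half_ok (mm s) (rg s 32) X Yc e2 C"
 proof (rule half_ok_ext[OF child0(2) c])
  show "mm s a i = mm s0 a i" if "a \<in> {11..15}" "i \<le> mm s0 6 C + 2 ^ K" for a i
   by (rule sl[OF that(1) le_less_trans[OF that(2) base0(4)]])
  show "mm s a C = mm s0 a C" if "a \<in> {6, 7, 8, 9, 10}" for a by (rule t[OF that child0(4)])
 qed
 show "mm s 6 B = mm s0 6 B" "mm s 6 C = mm s0 6 C" "mm s 10 B = u1" "mm s 10 C = u2"
  using t[of _ B] t[of _ C] child0(3,4) by blast+
 have "card \<Pi> \<le> (2 ^ K + 1) * (2 ^ K + 1)"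
  using card_mono[OF _ assms(3)] by simp
 then have n: "rg s 32 \<le> rg s0 32 + 2 * ((2 ^ K + 1) * (2 ^ K + 1))" using p(5) by linarith
 then have "(rg s 32 + 2) * X \<le> (rg s0 32 + 2 * ((2 ^ K + 1) * (2 ^ K + 1)) + 2) * X" by (intro mult_le_mono1) linarith
 then show "(rg s 32 + 2) * X < W" using W0(1) by linarith
 show "rg s 32 + 4 < W" using n W0(2) by linarith
qed

lemma wp_put_pair:
 assumes inv: "pinv \<Pi> s" and fin: "finite \<Pi>" "\<Pi> \<subseteq> {..2 ^ K} \<times> {..2 ^ K}"
  and ab: "rg s 76 = a" "rg s 77 = b" "a \<le> 2 ^ K" "b \<le> 2 ^ K" "(a, b) ~= (2 ^ K, 2 ^ K)" "(a, b) \<notin> \<Pi>"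
  and sl: "rg s 78 = mm s 6 B + a" "rg s 79 = mm s 6 C + b" "mm s 11 (rg s 78) ~= 0" "mm s 11 (rg s 79) ~= 0"
  and r53: "rg s 53 = opst kd (sidx u1 a) (sidx u2 b)"
 shows "wp W put_pair (\<lambda>s'. pinv (insert (a, b) \<Pi>) s' \<and> tm s' \<le> tm s + 200) s" (is "wp W _ ?Q _")
proof -
 define q where "q = opst kd (sidx u1 a) (sidx u2 b)"
 have qK: "q < 2 ^ K" by (simp add: q_def opst_less)
 note F = pinv_facts[OF inv fin] and gd = globD[OF pinv_facts(1)[OF inv fin]]
 note p = pinvD[OF inv]
 have I: "wp W pair_item (\<lambda>s'. item_ok s' X Y PP (RR {(a, b)} q) \<and>
  rg s 32 \<le> rg s' 32 \<and> rg s' 32 \<le> rg s 32 + 1 \<and> cells_ext (mm s) (mm s') (rg s 32) \<and> tm s' \<le> tm s + 110) s"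
  unfolding q_def
 proof (rule wp_pair_item)
  show "slot_ok (mm s) (rg s 32) X Yc (pos_ok e1) (rg s 78) (ES e1 a)" if "a < 2 ^ K"
   using F(11) that sl(1) by (simp add: half_ok_def)
  show "slot_ok (mm s) (rg s 32) X Yc (pos_ok e2) (rg s 79) (ES e2 b)" if "b < 2 ^ K"
   using F(12) that sl(2) by (simp add: half_ok_def)
  show "(u1, {}) \<in> G e1 q" "(u2, {}) \<in> G e2 q" for q using pinv_u by blast+
  show "(rg s 32 + 1) * X < W" using F(17) by (simp add: add_mult_distrib)
  show "rg s 32 + 2 < W" using F(18) by simp
 qed (use gd ab sl(3,4) F(9,10) in simp_all)
 show ?thesis unfolding put_pair_def wp_Seq
 proof (rule wp_use[OF I], goal_cases)
  case (1 s1)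
  note H1 = 1
  have r1: "rg s1 59 = rg s 59" "rg s1 33 = ns" "rg s1 53 = q" "rg s1 5 = 0" "rg s1 6 = 1" using H1(2) F gd r53 by (simp_all add: q_def)
  define s2 where "s2 = s1(|rg := (rg s1)(59 := ns + q), tm := Suc (tm s1)|)"
  have bokk: "ns + q < W" using qK W0 by linarith
  have r2: "rg s2 59 = ns + q" "rg s2 32 = rg s1 32" "rg s2 5 = 0" "rg s2 6 = 1" "mm s2 = mm s1" "tm s2 = Suc (tm s1)"
   using r1 by (simp_all add: s2_def)
  have sa1: "mm s1 a' = mm s a'" if "a' \<in> {11..15}" for a' using H1(3)[of a'] that by auto
  have A: "wp W add_item (\<lambda>s'. slot_ok (mm s') (rg s' 32) X Y PP (rg s2 59) (\<lambda>p. RR {(a, b)} q p \<union> RR \<Pi> q p) \<and>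
    rg s2 32 \<le> rg s' 32 \<and> rg s' 32 \<le> rg s2 32 + 1 \<and> cells_ext (mm s2) (mm s') (rg s2 32) \<and>
    (\<forall>a \<in> {11..15}. \<forall>i. i ~= rg s2 59 --> mm s' a i = mm s2 a i) \<and> tm s' \<le> tm s2 + 80) s2"
  proof (rule wp_add_item[OF r2(3,4)])
   have "slot_ok (mm s) (rg s 32) X Y PP (ns + q) (RR \<Pi> q)" using p(3) qK by blast
   then have "slot_ok (mm s1) (rg s1 32) X Y PP (ns + q) (RR \<Pi> q)"
    by (rule slot_ok_ext) (use H1(1) sa1 in auto)
   then show "slot_ok (mm s2) (rg s2 32) X Y PP (rg s2 59) (RR \<Pi> q)" by (simp add: r2)
   show "item_ok s2 X Y PP (RR {(a, b)} q)" using H1(1) unfolding s2_def item_ok_def rmapf_def by simp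
   show "RR {(a, b)} q p \<inter> RR \<Pi> q p = {}" if "PP p" for p
    by (rule PR_disj[OF ok that pinv_u(1,2) ab(6)])
   have "(rg s1 32 + 1) * X \<le> (rg s 32 + 2) * X" using H1(1) by (intro mult_le_mono1) linarith
   then show "(rg s2 32 + 1) * X < W" using F(17) r2(2) by simp
   show "rg s2 32 + 2 < W" using H1(1) F(18) r2(2) by linarith
  qed (rule YX)
  have "wp W add_item ?Q s2"
  proof (rule wp_use[OF A], goal_cases)
   case (1 s3)
   note H3 = 1
   have r3: "rg s3 r = rg s0 r" if "r \<notin> pregs" for r
   proof -
    have "rg s3 r = rg s2 r" using H3(2)[of r] that by auto
    also have "\<dots> = rg s1 r" using that by (auto simp: s2_def)
    also have "\<dots> = rg s r" using H1(2)[of r] that by auto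
    also have "\<dots> = rg s0 r" by (rule p(1)[OF that])
    finally show ?thesis .
   qed
   have a3: "mm s3 a' = mm s a'" if "a' \<notin> {11, 12, 13, 14, 15, 16, 17, 18, 19, 20, 21, 22, 23, 24, 25, 26, 27, 28, 29, 30, 31, 32, 33}" for a'
    using H3(3)[of a'] H1(3)[of a'] r2(5) that by auto
   have a3': "mm s3 a' = mm s0 a'" if "a' \<notin> parrs" for a'
    using a3[of a'] p(2)[of a'] that by auto
   have ce: "cells_ext (mm s) (mm s3) (rg s 32)"
    using cells_ext_trans[of "mm s" "mm s1" "rg s 32" "mm s3" "rg s1 32"] H1(1) H3(1) r2 by simp
   have ce0: "cells_ext (mm s0) (mm s3) (rg s0 32)"
    using cells_ext_trans[of "mm s0" "mm s" "rg s0 32" "mm s3" "rg s 32"] ce p(4,6) by blast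
   have s3s: "mm s3 a' i = mm s a' i" if "a' \<in> {11..15}" "i ~= ns + q" for a' i
    using H3(1) r2 sa1 that by simp
   have n: "rg s 32 \<le> rg s3 32" "rg s3 32 \<le> rg s 32 + 2" using H1(1) H3(1) r2(2) by linarith+
   have ins: "RR (insert (a, b) \<Pi>) q' = (\<lambda>p. RR {(a, b)} q' p \<union> RR \<Pi> q' p)" for q'
    by (rule ext, rule PR_insert)
   have sl: "slot_ok (mm s3) (rg s3 32) X Y PP (ns + q') (RR (insert (a, b) \<Pi>) q')" if "q' < 2 ^ K" for q'
   proof (cases "q' = q")
    case True
    then show ?thesis unfolding ins using H3(1) r2(1) by simp
   next
    case False
    have "slot_ok (mm s) (rg s 32) X Y PP (ns + q') (RR \<Pi> q')" using p(3) that by blast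
    then have "slot_ok (mm s3) (rg s3 32) X Y PP (ns + q') (RR \<Pi> q')"
     by (rule slot_ok_ext[OF _ ce n(1)]) (use s3s False in auto)
    then show ?thesis unfolding ins
     by (rule slot_ok_cong) (use PR_other[of q' l u1 a u2 b] False in \<open>simp add: q_def\<close>)
   qed
   have card: "card (insert (a, b) \<Pi>) = card \<Pi> + 1" using fin ab(6) by simp
   have s0s: "\<forall>a \<in> {11..15}. \<forall>i. i < ns \<or> ns + 2 ^ K < i --> mm s3 a i = mm s0 a i"
   proof (intro ballI allI impI)
    fix a' i :: nat assume x: "a' \<in> {11..15}" "i < ns \<or> ns + 2 ^ K < i"
    then have "mm s3 a' i = mm s a' i" using s3s qK by auto
    then show "mm s3 a' i = mm s0 a' i" using p(7) x by simp
   qed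
   have m10: "mm s3 10 = mm s 10" using a3 by simp
   have m11: "mm s3 11 (ns + 2 ^ K) = mm s 11 (ns + 2 ^ K)" using s3s qK by simp
   have "pinv (insert (a, b) \<Pi>) s3"
    unfolding pinv_def card m10 m11
   proof (intro conjI allI impI)
    show "rg s0 32 \<le> rg s3 32" "rg s3 32 \<le> rg s0 32 + 2 * (card \<Pi> + 1)" by (use n(1) p(4) in linarith, use n(2) p(5) in simp)
    show "mm s 10 v = opst kd u1 u2" "mm s 11 (ns + 2 ^ K) = 1" if "(2 ^ K, 2 ^ K) \<in> insert (a, b) \<Pi>"
     using p(9) ab(5) that by auto
   qed (use r3 a3' sl ce0 s0s p(8) in blast)+
   moreover have "tm s3 \<le> tm s + 200" using H3(1) H1(1) r2(6) by linarith
   ultimately show ?case by blast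
  qed
  then show ?case using bokk r1 by (simp add: s2_def)
 qed
qed

end

context node_run
begin

lemma wp_pair:
 assumes inv: "pinv \<Pi> s" and fin: "finite \<Pi>" "\<Pi> \<subseteq> {..2 ^ K} \<times> {..2 ^ K}"
  and ab: "rg s 76 = a" "rg s 77 = b" "a \<le> 2 ^ K" "b \<le> 2 ^ K" "(a, b) \<notin> \<Pi>"
 shows "wp W pair_code (\<lambda>s'. pinv (insert (a, b) \<Pi>) s' \<and> tm s' \<le> tm s + 500 * (K * K * K)) s"
proof -
 define TT where "TT = K * K * K"
 have TT: "1 \<le> TT" unfolding TT_def using KK by linarith
 note F = pinv_facts[OF inv fin] and gd = globD[OF pinv_facts(1)[OF inv fin]]
 let ?sl1 = "mm s0 6 B + a" and ?sl2 = "mm s0 6 C + b"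
 let ?blk = "Add 78 97 76 ;; Add 79 98 77 ;; Load 54 11 78 ;; Load 70 11 79"
 have lt: "?sl1 < ns" "?sl2 < ns" "ns < W" using base0 ab W0 by linarith+
 have blk: "wp W ?blk (\<lambda>s'. rg s' 78 = ?sl1 \<and> rg s' 79 = ?sl2 \<and> rg s' 54 = mm s 11 ?sl1 \<and> rg s' 70 = mm s 11 ?sl2 \<and> tm s' = tm s + 4) s"
  using F(7,8) ab lt by simp
 \<comment> \<open>A pair with an empty child family contributes nothing, so it counts as processed
   without any action.\<close>
 have new: "pinv (insert (a, b) \<Pi>) s'" if z: "mm s 11 ?sl1 = 0 \<or> mm s 11 ?sl2 = 0" and inv': "pinv \<Pi> s'" for s'
 proof -
  have e: "mm s 11 (mm s0 6 B + 2 ^ K) = 1" "mm s 11 (mm s0 6 C + 2 ^ K) = 1"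
   using F(11-14) by (auto simp: half_ok_def)
  have emp: "RR {(a, b)} q p = {}" if p: "PP p" for q p
  proof (rule PR_none)
   note pos = pos_ok_BNode(1,2)[OF ok p]
   from z show "ES e1 a (ap (lm l e1 e2) p) = {} \<or> ES e2 b (ap (rm l e1) p) = {}"
   proof
    assume z: "mm s 11 ?sl1 = 0"
    then have "a < 2 ^ K" using e ab(3) by (cases "a = 2 ^ K") auto
    then have "slot_ok (mm s) (rg s 32) X Yc (pos_ok e1) ?sl1 (ES e1 a)" using F(11,13) by (simp add: half_ok_def)
    then show ?thesis using slot_ok_zero z pos(1) by blast
   next
    assume z: "mm s 11 ?sl2 = 0"
    then have "b < 2 ^ K" using e ab(4) by (cases "b = 2 ^ K") auto
    then have "slot_ok (mm s) (rg s 32) X Yc (pos_ok e2) ?sl2 (ES e2 b)" using F(12,14) by (simp add: half_ok_def)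
    then show ?thesis using slot_ok_zero z pos(2) by blast
   qed
  qed
  have ne: "(a, b) ~= (2 ^ K, 2 ^ K)" using e z by auto
  have card: "card (insert (a, b) \<Pi>) = card \<Pi> + 1" using fin ab(5) by simp
  have sl: "slot_ok (mm s') (rg s' 32) X Y PP (ns + q) (RR (insert (a, b) \<Pi>) q)" if "q < 2 ^ K" for q
   by (rule slot_ok_cong[OF pinvD(3)[OF inv' that]]) (simp add: PR_insert[of _ _ _ _ _ "(a, b)" \<Pi>] emp)
  show ?thesis
   unfolding pinv_def card
  proof (intro conjI allI impI ballI)
   show "rg s' 32 \<le> rg s0 32 + 2 * (card \<Pi> + 1)" using pinvD(5)[OF inv'] by simp
   show "mm s' 10 v = opst kd u1 u2" "mm s' 11 (ns + 2 ^ K) = 1" if "(2 ^ K, 2 ^ K) \<in> insert (a, b) \<Pi>"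
    using pinvD(9)[OF inv'] ne that by auto
   show "mm s' a' i = mm s0 a' i" if "a' \<in> {11..15}" "i < ns \<or> ns + 2 ^ K < i" for a' i by (rule pinvD(7)[OF inv' that])
   show "mm s' 10 i = mm s0 10 i" if "i ~= v" for i by (rule pinvD(8)[OF inv' that])
  qed (fact pinvD(1,2,4,6)[OF inv'] sl)+
 qed
 show ?thesis unfolding pair_code_def wp_Seq_fun[of _ ?blk] TT_def[symmetric]
 proof (rule wp_use[OF blk], goal_cases)
  case (1 s1)
  note H1 = 1
  have inv1: "pinv \<Pi> (s1(|tm := t|))" for t
   by (rule pinv_scratch[OF inv]) (use H1(2,3) in auto)
  have inv1': "pinv \<Pi> s1" by (rule pinv_scratch[OF inv]) (use H1(2,3) in auto)
  have z1: "rg s1 5 = 0" "mm s1 = mm s" "rg s1 76 = a" "rg s1 77 = b" using H1(2,3) gd ab by (simp_all add: fun_eq_iff)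
  consider (z1) "mm s 11 ?sl1 = 0" | (z2) "mm s 11 ?sl1 ~= 0" "mm s 11 ?sl2 = 0" | (nz) "mm s 11 ?sl1 ~= 0" "mm s 11 ?sl2 ~= 0" by blast
  then show ?case
  proof cases
   case z1
   have "pinv (insert (a, b) \<Pi>) (s1(|tm := Suc (Suc (tm s1))|))" using new inv1 z1 by blast
   then show ?thesis using z1 H1(1) \<open>rg s1 5 = 0\<close> TT by simp
  next
   case z2
   have "pinv (insert (a, b) \<Pi>) (s1(|tm := Suc (Suc (Suc (tm s1)))|))" using new inv1 z2 by blast
   then show ?thesis using z2 H1(1) \<open>rg s1 5 = 0\<close> TT by simp
  next
   case nz
   define s2 where "s2 = s1(|tm := Suc (Suc (tm s1))|)"
   have inv2: "pinv \<Pi> s2" using inv1 by (simp add: s2_def)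
   note F2 = pinv_facts[OF inv2 fin] and gd2 = globD[OF pinv_facts(1)[OF inv2 fin]]
   have x2: "rg s2 76 = a" "rg s2 77 = b" "rg s2 78 = ?sl1" "rg s2 79 = ?sl2" "mm s2 = mm s" "tm s2 = tm s + 6"
    using z1 H1(1) by (simp_all add: s2_def)
   have PS: "wp W pair_states (\<lambda>s'. rg s' 50 = sidx u1 a \<and> rg s' 51 = sidx u2 b \<and> tm s' \<le> tm s2 + 6) s2"
    using x2 gd2 F2(3,4,15,16) ab(3,4) by (auto simp: pair_states_def sidx_def)
   let ?rest = "Cond 76 9 put_pair (Cond 77 9 put_pair (Store 10 40 53 ;; Add 59 33 9 ;; Store 11 59 ONE))"
   have main: "wp W (pair_states ;; op_code ;; ?rest) (\<lambda>s'. pinv (insert (a, b) \<Pi>) s' \<and> tm s' + 2 \<le> tm s + 500 * TT) s2"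
    unfolding wp_Seq
   proof (rule wp_use[OF PS], goal_cases)
    case (1 s3)
    note H3 = 1
    have inv3: "pinv \<Pi> s3" by (rule pinv_scratch[OF inv2]) (use H3(2,3) in auto)
    note F3 = pinv_facts[OF inv3 fin] and gd3 = globD[OF pinv_facts(1)[OF inv3 fin]]
    have sx: "sidx u1 a < 2 ^ K" "sidx u2 b < 2 ^ K" using pinv_u(3,4) ab(3,4) by (auto simp: sidx_def)
    have OP: "wp W op_code (\<lambda>s'. rg s' 53 = opst (rg s3 43) (rg s3 50) (rg s3 51) \<and> tm s' \<le> tm s3 + 200 * (K * K * K)) s3"
     by (rule wp_op[OF F3(1)]) (use F3(5) kind H3(1) sx in auto)
    show ?case
    proof (rule wp_use[OF OP], goal_cases)
     case (1 s4)
     note H4 = 1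
     have inv4: "pinv \<Pi> s4" by (rule pinv_scratch[OF inv3]) (use H4(2,3) in auto)
     note F4 = pinv_facts[OF inv4 fin] and gd4 = globD[OF pinv_facts(1)[OF inv4 fin]]
     have x4: "rg s4 76 = a" "rg s4 77 = b" "rg s4 78 = ?sl1" "rg s4 79 = ?sl2" "rg s4 53 = opst kd (sidx u1 a) (sidx u2 b)"
      using H4(1,2) H3(1,2) x2 F3(5) by simp_all
     have m11: "mm s4 11 = mm s 11" using H4(3)[of 11] H3(3)[of 11] x2 by simp
     have t4: "tm s4 \<le> tm s + 200 * TT + 12" using H4(1) H3(1) x2(6) unfolding TT_def by linarith
     have put: "wp W put_pair (\<lambda>s'. pinv (insert (a, b) \<Pi>) s' \<and> tm s' \<le> tm (s4(|tm := t|)) + 200) (s4(|tm := t|))"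
      if "(a, b) ~= (2 ^ K, 2 ^ K)" for t
     proof (rule wp_put_pair[OF _ fin])
      show "pinv \<Pi> (s4(|tm := t|))" by (rule pinv_scratch[OF inv4]) auto
     qed (use that x4 ab nz m11 F4(13,14) in simp_all)
     have inv_tm: "pinv \<Pi>' s' ==> pinv \<Pi>' (s'(|tm := t|))" for \<Pi>' s' t by (rule pinv_scratch) auto
     consider (A) "a < 2 ^ K" | (B) "a = 2 ^ K" "b < 2 ^ K" | (N) "a = 2 ^ K" "b = 2 ^ K" using ab(3,4) by linarith
     then show ?case
     proof cases
      case A
      have "wp W put_pair (\<lambda>s'. pinv (insert (a, b) \<Pi>) s' \<and> tm s' + 2 \<le> tm s + 500 * TT) (s4(|tm := Suc (tm s4)|))"
       by (rule wp_mono[OF put]) (use A t4 TT in auto)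
      then show ?thesis using A gd4 x4 by simp
     next
      case B
      have "wp W put_pair (\<lambda>s'. pinv (insert (a, b) \<Pi>) (s'(|tm := Suc (tm s')|)) \<and> Suc (tm s') + 2 \<le> tm s + 500 * TT) (s4(|tm := Suc (Suc (tm s4))|))"
       by (rule wp_mono[OF put]) (use B t4 TT inv_tm in auto)
      then show ?thesis using B gd4 x4 by simp
     next
      case N
      let ?b = "Store 10 40 53 ;; Add 59 33 9 ;; Store 11 59 ONE"
      let ?s4 = "s4(|tm := Suc (Suc (tm s4))|)"
      have w: "ns + 2 ^ K < W" using W0(3) by linarith
      have bb: "wp W ?b (\<lambda>s'. mm s' 10 = (mm s4 10)(v := opst kd u1 u2) \<and> mm s' 11 = (mm s4 11)(ns + 2 ^ K := 1) \<and> tm s' = tm s4 + 5) ?s4"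
       using F4(2,6) gd4 x4 N w by (simp add: sidx_def)
      have "wp W ?b (\<lambda>s'. pinv (insert (a, b) \<Pi>) (s'(|tm := Suc (Suc (tm s'))|)) \<and> Suc (Suc (tm s')) + 2 \<le> tm s + 500 * TT) ?s4"
      proof (rule wp_use[OF bb], goal_cases)
       case (1 s5)
       note H5 = 1
       have r5: "rg s5 32 = rg s4 32" "\<And>r. r \<notin> pregs ==> rg s5 r = rg s4 r" using H5(2) by auto
       have a5: "\<And>a. a \<notin> {10, 11} ==> mm s5 a = mm s4 a" using H5(3) by auto
       have c5: "cells_ext (mm s4) (mm s5) n'" for n' using a5 by (auto simp: cells_ext_def)
       have s5s: "mm s5 a' i = mm s4 a' i" if "a' \<in> {11..15}" "i ~= ns + 2 ^ K" for a' i
        using H5(1) a5[of a'] that by (cases "a' = 11") auto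
       have "slot_ok (mm s5) (rg s5 32) X Y PP (ns + q) (RR (insert (a, b) \<Pi>) q)" if q: "q < 2 ^ K" for q
       proof -
        have "slot_ok (mm s5) (rg s5 32) X Y PP (ns + q) (RR \<Pi> q)"
         by (rule slot_ok_ext[OF pinvD(3)[OF inv4 q] c5]) (use r5 s5s q in auto)
        then show ?thesis
         by (rule slot_ok_cong) (use N in \<open>simp add: PR_insert[of _ _ _ _ _ "(2 ^ K, 2 ^ K)" \<Pi>] PR_empties\<close>)
       qed
       note sl5 = this
       have card: "card (insert (a, b) \<Pi>) = card \<Pi> + 1" using fin ab(5) by simp
       have "pinv (insert (a, b) \<Pi>) s5"
        unfolding pinv_def card r5(1)
       proof (intro conjI allI impI ballI)
        show "rg s5 r = rg s0 r" if "r \<notin> pregs" for r using r5(2)[OF that] pinvD(1)[OF inv4 that] by simp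
        show "mm s5 a' = mm s0 a'" if "a' \<notin> parrs" for a' using a5[of a'] pinvD(2)[OF inv4 that] that by auto
        show "slot_ok (mm s5) (rg s4 32) X Y PP (ns + q) (RR (insert (a, b) \<Pi>) q)" if "q < 2 ^ K" for q
         using sl5[OF that] r5(1) by simp
        show "rg s0 32 \<le> rg s4 32" "rg s4 32 \<le> rg s0 32 + 2 * (card \<Pi> + 1)" using pinvD(4,5)[OF inv4] by simp_all
        show "cells_ext (mm s0) (mm s5) (rg s0 32)" by (rule cells_ext_trans[OF pinvD(6)[OF inv4] c5 order_refl])
        show "mm s5 a' i = mm s0 a' i" if "a' \<in> {11..15}" "i < ns \<or> ns + 2 ^ K < i" for a' i
         using s5s[OF that(1)] pinvD(7)[OF inv4 that] that(2) by auto
        show "mm s5 10 i = mm s0 10 i" if "i ~= v" for i using H5(1) pinvD(8)[OF inv4 that] that by simp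
        show "mm s5 10 v = opst kd u1 u2" "mm s5 11 (ns + 2 ^ K) = 1" using H5(1) by simp_all
       qed
       then show ?case using inv_tm H5(1) t4 TT by simp
      qed
      then show ?thesis using N gd4 x4 by simp
     qed
    qed
   qed
   have "wp W (pair_states ;; op_code ;; ?rest) (\<lambda>s'. pinv (insert (a, b) \<Pi>) s' \<and> tm s' \<le> tm s + 500 * TT) s2"
    by (rule wp_mono[OF main]) auto
   then show ?thesis using nz H1(1) z1 by (simp add: s2_def)
  qed
 qed
qed

lemma pinv_empty: "pinv {} s0"
proof -
 have "slot_ok (mm s0) (rg s0 32) X Y PP (ns + q) (RR {} q)" for q
  unfolding slot_ok_def using fresh0[of _ "ns + q"]
  by (intro exI[of _ "((0, 0), (0, 0))"]) (simp add: mapat_def map_ok_def)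
 then show ?thesis by (simp add: pinv_def cells_ext_refl)
qed

lemma wp_pairs:
 "wp W pairs_code (\<lambda>s'. pinv ({..2 ^ K} \<times> {..2 ^ K}) s' \<and> tm s' \<le> tm s0 + 520 * ((2 ^ K + 1) * (2 ^ K + 1) * (K * K * K))) s0"
proof -
 define N1 where "N1 = (2::nat) ^ K + 1"
 define TT where "TT = K * K * K"
 have TT: "1 \<le> TT" unfolding TT_def using KK by linarith
 have N1: "1 \<le> N1" "N1 < W" unfolding N1_def using KW bounds(4) by linarith+
 have stab: "pinv \<Pi> (s(|rg := (rg s)(i := w), tm := t|))" if "pinv \<Pi> s" "i = 76 \<or> i = 77" for \<Pi> s i w t
  by (rule pinv_scratch[OF that(1)]) (use that(2) in auto)
 have le: "{..2 ^ K} = {..<N1}" unfolding N1_def by auto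
 \<comment> \<open>The pairs processed after \<open>k\<close> full rows and \<open>j\<close> entries
   of row \<open>k\<close>.\<close>
 let ?P = "\<lambda>k j. {..<k} \<times> {..2 ^ K} \<union> {k} \<times> {..<j}"
 have inner: "wp W (For 77 34 pair_code) (\<lambda>s'. pinv ({..<Suc k} \<times> {..2 ^ K}) s' \<and> tm s' \<le> tm s + 506 * (N1 * TT)) s"
  if inv: "pinv ({..<k} \<times> {..2 ^ K}) s" and k: "rg s 76 = k" "k < N1" for k s
 proof -
  have s: "rg s 34 = N1" "rg s 6 = 1" using pinvD(1)[OF inv] globD[OF g0] by (simp_all add: N1_def)
  have "wp W (For 77 34 pair_code) (\<lambda>s'. pinv (?P k (rg s 34)) s' \<and> tm s' \<le> tm s + rg s 34 * (500 * TT + 3) + 3) s"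
  proof (rule wp_For[where Inv = "\<lambda>j. pinv (?P k j)"])
   show "pinv (?P k 0) (s(|rg := (rg s)(77 := 0), tm := Suc (tm s)|))" using stab[OF inv] by simp
  next
   fix j and s' :: st assume j: "j < rg s 34" and I: "pinv (?P k j) s'" and i: "rg s' 77 = j"
    and f: "\<And>r. r \<notin> modr (For 77 34 pair_code) ==> rg s' r = rg s r"
   have ins: "insert (k, j) (?P k j) = ?P k (Suc j)" by auto
   have "wp W pair_code (\<lambda>s'a. pinv (insert (k, j) (?P k j)) s'a \<and> tm s'a \<le> tm s' + 500 * (K * K * K)) s'"
   proof (rule wp_pair[OF I])
    show "rg s' 76 = k" using f[of 76] k by simp
    have "k \<le> 2 ^ K" "j \<le> 2 ^ K" using k j s unfolding N1_def by linarith+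
    then show "?P k j \<subseteq> {..2 ^ K} \<times> {..2 ^ K}" by auto
    show "k \<le> 2 ^ K" "j \<le> 2 ^ K" by fact+
   qed (use i in auto)
   then show "wp W pair_code (\<lambda>s''. pinv (?P k (Suc j)) s'' \<and> tm s'' \<le> tm s' + 500 * TT) s'"
    unfolding ins TT_def .
  next
   fix j and s' :: st and w t assume "pinv (?P k j) s'"
   then show "pinv (?P k j) (s'(|rg := (rg s')(77 := w), tm := t|))" by (rule stab) simp
  qed (use s N1 in simp_all)
  then show ?thesis
  proof (rule wp_mono)
   fix s' assume h: "pinv (?P k (rg s 34)) s' \<and> tm s' \<le> tm s + rg s 34 * (500 * TT + 3) + 3"
   have e: "?P k (rg s 34) = {..<Suc k} \<times> {..2 ^ K}" using s by (auto simp: le)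
   have "N1 * (500 * TT + 3) = 500 * (N1 * TT) + 3 * N1" by (simp add: algebra_simps)
   moreover have "N1 \<le> N1 * TT" "1 \<le> N1 * TT" using N1 TT by simp_all
   moreover have "tm s' \<le> tm s + N1 * (500 * TT + 3) + 3" using h s(1) by metis
   ultimately have "tm s' \<le> tm s + 506 * (N1 * TT)" by linarith
   then show "pinv ({..<Suc k} \<times> {..2 ^ K}) s' \<and> tm s' \<le> tm s + 506 * (N1 * TT)" using h unfolding e by blast
  qed
 qed
 have r: "rg s0 34 = N1" "rg s0 6 = 1" using globD[OF g0] by (simp_all add: N1_def)
 have "wp W pairs_code (\<lambda>s'. pinv ({..<rg s0 34} \<times> {..2 ^ K}) s' \<and> tm s' \<le> tm s0 + rg s0 34 * (506 * (N1 * TT) + 3) + 3) s0"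
  unfolding pairs_code_def
 proof (rule wp_For[where Inv = "\<lambda>k. pinv ({..<k} \<times> {..2 ^ K})"])
  show "pinv ({..<0} \<times> {..2 ^ K}) (s0(|rg := (rg s0)(76 := 0), tm := Suc (tm s0)|))" using stab[OF pinv_empty] by simp
 next
  fix k and s' :: st assume "k < rg s0 34" "pinv ({..<k} \<times> {..2 ^ K}) s'" "rg s' 76 = k"
  then show "wp W (For 77 34 pair_code) (\<lambda>s''. pinv ({..<Suc k} \<times> {..2 ^ K}) s'' \<and> tm s'' \<le> tm s' + 506 * (N1 * TT)) s'"
   using inner r by simp
 next
  fix k and s' :: st and w t assume "pinv ({..<k} \<times> {..2 ^ K}) s'"
  then show "pinv ({..<k} \<times> {..2 ^ K}) (s'(|rg := (rg s')(76 := w), tm := t|))" by (rule stab) simp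
 qed (use r N1 in simp_all)
 then show ?thesis
 proof (rule wp_mono)
  fix s' assume h: "pinv ({..<rg s0 34} \<times> {..2 ^ K}) s' \<and> tm s' \<le> tm s0 + rg s0 34 * (506 * (N1 * TT) + 3) + 3"
  have "N1 * (506 * (N1 * TT) + 3) = 506 * (N1 * N1 * TT) + 3 * N1" by (simp add: algebra_simps)
  moreover have "N1 * 1 \<le> N1 * (N1 * TT)" using N1 TT by (intro mult_le_mono2) simp
  then have "N1 \<le> N1 * N1 * TT" by (simp add: mult.assoc)
  moreover have "tm s' \<le> tm s0 + N1 * (506 * (N1 * TT) + 3) + 3" using h r(1) by metis
  ultimately have "tm s' \<le> tm s0 + 520 * (N1 * N1 * TT)" using N1(1) by linarith
  moreover have "pinv ({..2 ^ K} \<times> {..2 ^ K}) s'" using h unfolding le r(1) by blast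
  ultimately show "pinv ({..2 ^ K} \<times> {..2 ^ K}) s' \<and> tm s' \<le> tm s0 + 520 * ((2 ^ K + 1) * (2 ^ K + 1) * (K * K * K))"
   unfolding N1_def TT_def by blast
 qed
qed

lemma half_ok_pairs:
 assumes inv: "pinv ({..2 ^ K} \<times> {..2 ^ K}) s"
  and v: "mm s0 6 v = ns" "mm s0 7 v = lc (wd e)" "mm s0 8 v = rc (wd e)" "mm s0 9 v = ty (wd e)"
 shows "half_ok (mm s) (rg s 32) X Y e v"
proof -
 note p = pinvD[OF inv]
 have v': "mm s 6 v = ns" "mm s 7 v = lc (wd e)" "mm s 8 v = rc (wd e)" "mm s 9 v = ty (wd e)" using p(2) v by simp_all
 have x: "mm s 10 v = opst kd u1 u2" "mm s 11 (ns + 2 ^ K) = 1" using p(9) by simp_all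
 have "(opst kd u1 u2, {}) \<in> G e q" for q
  unfolding G_BNode[OF ok] using pinv_u by blast
 moreover have "slot_ok (mm s) (rg s 32) X Y PP (ns + q) (ES e q)" if "q < 2 ^ K" for q
  by (rule slot_ok_cong[OF p(3)[OF that]]) (rule PR_all[OF ok _ pinv_u(1,2) that])
 ultimately show ?thesis unfolding half_ok_def v' x by (simp add: opst_less)
qed

end

section \<open>The preprocessing program: processing a vertex\<close>

definition fin_item :: com where
 "fin_item = (Load 55 12 78 ;; Load 56 13 78 ;; Load 57 14 78 ;; Load 58 15 78 ;;
   Add 59 33 9 ;; Add 59 59 ONE) ;; add_item"

text \<open>A state is accepting if its bit at the index in register 30 is set. The families of
  accepting states are collected in one slot, so that a query starts with a single
  reference.\<close>

definition fin_body :: com where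
 "fin_body = (Add 78 33 76 ;; Load 54 11 78) ;;
   Cond ZERO 54 (decode 76 35 ;; Load 60 35 30 ;; Cond ZERO 60 fin_item Skip) Skip"

definition fin_code :: com where
 "fin_code = For 76 9 fin_body ;; Load 50 10 40 ;; decode 50 35 ;;
   (Load 60 35 30 ;; Store 40 40 60 ;; Add 59 33 9 ;; Add 59 59 ONE ;;
   Store 53 40 59 ;; Add 33 59 ONE)"

text \<open>\<open>leaf_code\<close> runs for the unmarked and for the marked letter. All leaves
  share cell 2 through the identity map; the position comes from the pair alone.\<close>

definition leaf_proc :: com where
 "leaf_proc = (Store 6 40 33 ;; Store 7 40 ONE ;; Store 8 40 ZERO ;; Store 9 40 43 ;; Const 45 0) ;;
   leaf_code ;; (Store 10 40 53 ;; Add 59 33 9 ;; Store 11 59 ONE ;; Const 45 1) ;; leaf_code ;;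
   (Add 59 33 53 ;; Const 54 2 ;; Store 11 59 54 ;; Store 12 59 ZERO ;; Store 13 59 ZERO ;;
   Store 14 59 ONE ;; Store 15 59 ZERO)"

definition process :: com where
 "process = (Load 43 0 40 ;; Load 44 1 40 ;; Copy 41 44 ;; Load 42 2 40) ;;
   Cond ONE 43 (map_code ;; pairs_code) leaf_proc ;; fin_code"

lemma mod_fin_item [simp]: "modr fin_item = {20, 21, 22, 23, 24, 32, 54, 55, 56, 57, 58, 59, 70, 71, 72, 73, 74, 75}"
 "moda fin_item = {11, 12, 13, 14, 15, 16, 17, 18, 19, 20, 21, 22, 23, 24, 25, 26, 27, 28, 29, 30, 31, 32, 33}" "silent fin_item"
 by (auto simp: fin_item_def)

lemma mod_fin_body [simp]: "modr fin_body = {20, 21, 22, 23, 24, 32, 54, 55, 56, 57, 58, 59, 60, 70, 71, 72, 73, 74, 75, 78}"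
 "moda fin_body = {11, 12, 13, 14, 15, 16, 17, 18, 19, 20, 21, 22, 23, 24, 25, 26, 27, 28, 29, 30, 31, 32, 33, 35}" "silent fin_body"
 by (auto simp: fin_body_def)

lemma mod_fin_code [simp]: "modr fin_code = {20, 21, 22, 23, 24, 32, 33, 50, 54, 55, 56, 57, 58, 59, 60, 70, 71, 72, 73, 74, 75, 76, 78}"
 "moda fin_code = {11, 12, 13, 14, 15, 16, 17, 18, 19, 20, 21, 22, 23, 24, 25, 26, 27, 28, 29, 30, 31, 32, 33, 35, 40, 53}" "silent fin_code"
 by (auto simp: fin_code_def)

lemma mod_leaf_proc [simp]: "modr leaf_proc = {21, 22, 23, 24, 25, 26, 27, 28, 29, 45, 46, 47, 48, 49, 53, 54, 59, 60, 61, 62, 63, 64}"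
 "moda leaf_proc = {6, 7, 8, 9, 10, 11, 12, 13, 14, 15, 37}" "silent leaf_proc"
 by (auto simp: leaf_proc_def)

lemma mod_process: "modr process \<subseteq> {20..33} \<union> {41..64} \<union> {70..98}" "moda process \<subseteq> {6..33} \<union> {35, 36, 37, 40, 53}" "silent process"
 by (simp_all add: process_def)

context automaton
begin

lemma ES_disj: "eval_fexp e ~= None ==> pos_ok e p ==> a ~= b ==> ES e a p \<inter> ES e b p = {}"
 using G_unique[of e p a _ b] by (auto simp: ES_def)

lemma FS_0 [simp]: "FS e 0 p = {}"
 by (simp add: FS_def)

lemma FS_Suc: "FS e (Suc k) p = (if acc k then ES e k p \<union> FS e k p else FS e k p)"
 by (auto simp: FS_def less_Suc_eq)

lemma FS_disj: "eval_fexp e ~= None ==> pos_ok e p ==> ES e k p \<inter> FS e k p = {}"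
 using ES_disj[of e p k] by (fastforce simp: FS_def)

lemma half_ok_mono: "half_ok \<mu> N X Y e v ==> Y \<le> Y' ==> half_ok \<mu> N X Y' e v"
 unfolding half_ok_def using slot_ok_mono by meson

end

context machine
begin

lemma acc_idx: "idx (q0 M) (qf M) 0 < K"
 using idx_less[OF q_less, of 0] m_pos by simp

lemma wp_fin_body:
 assumes g: "glob s" and ok: "eval_fexp e ~= None" and k: "k < 2 ^ K" "rg s 76 = k" "rg s 33 = ns"
  and sl: "slot_ok (mm s) (rg s 32) X Y (pos_ok e) (ns + k) (ES e k)"
  and fs: "slot_ok (mm s) (rg s 32) X Y (pos_ok e) (ns + 2 ^ K + 1) (FS e k)"
  and W: "(rg s 32 + 1) * X < W" "rg s 32 + 2 < W" "ns + 2 ^ K + 2 < W" and YX: "Y \<le> X"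
 shows "wp W fin_body (\<lambda>s'. slot_ok (mm s') (rg s' 32) X Y (pos_ok e) (ns + 2 ^ K + 1) (FS e (Suc k)) \<and>
  rg s 32 \<le> rg s' 32 \<and> rg s' 32 \<le> rg s 32 + 1 \<and> cells_ext (mm s) (mm s') (rg s 32) \<and>
  (\<forall>a \<in> {11..15}. \<forall>i. i ~= ns + 2 ^ K + 1 --> mm s' a i = mm s a i) \<and> tm s' \<le> tm s + 150 * K) s" (is "wp W _ ?Q _")
proof -
 note gd = globD[OF g]
 have K1: "1 \<le> K" by (rule bounds)
 let ?blk = "Add 78 33 76 ;; Load 54 11 78"
 have blk: "wp W ?blk (\<lambda>s'. rg s' 78 = ns + k \<and> rg s' 54 = mm s 11 (ns + k) \<and> tm s' = tm s + 2) s"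
  using k W by simp
 show ?thesis unfolding fin_body_def wp_Seq_fun[of _ ?blk]
 proof (rule wp_use[OF blk], goal_cases)
  case (1 s1)
  note H1 = 1
  have z1: "rg s1 5 = 0" "mm s1 = mm s" "rg s1 32 = rg s 32" using H1(2,3) gd by (simp_all add: fun_eq_iff)
  show ?case
  proof (cases "mm s 11 (ns + k) = 0")
   case True
   have "slot_ok (mm s) (rg s 32) X Y (pos_ok e) (ns + 2 ^ K + 1) (FS e (Suc k))"
    by (rule slot_ok_cong[OF fs]) (use slot_ok_zero[OF sl True] in \<open>simp add: FS_Suc\<close>)
   then show ?thesis using True H1(1) z1 K1 by (simp add: cells_ext_refl)
  next
   case False
   define s2 where "s2 = s1(|tm := Suc (tm s1)|)"
   have x2: "rg s2 = rg s1" "mm s2 = mm s" "tm s2 = tm s + 3" using z1 H1(1) by (simp_all add: s2_def)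
   have rr: "rg s2 r = rg s r" if "r \<notin> {54, 78}" for r using H1(2) that by (simp add: x2)
   have g2: "glob s2" by (rule glob_frame[OF g]) (use rr x2 in auto)
   note gd2 = globD[OF g2]
   have D: "wp W (decode 76 35) (\<lambda>s'. (\<forall>i < K. mm s' 35 i = of_bool (bit (rg s2 76) i)) \<and> tm s' \<le> tm s2 + 15 * K) s2"
    by (rule wp_decode[OF g2]) (use rr k in auto)
   have main: "wp W (decode 76 35 ;; Load 60 35 30 ;; Cond ZERO 60 fin_item Skip)
    ?Q s2"
    unfolding wp_Seq
   proof (rule wp_use[OF D], goal_cases)
    case (1 s3)
    note H3 = 1
    have r3: "rg s3 r = rg s r" if "r \<notin> {20, 21, 22, 23, 54, 78}" for r using H3(2)[of r] rr[of r] that by simp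
    have q3: "rg s3 78 = ns + k" "rg s3 54 = mm s 11 (ns + k)" using H3(2) x2(1) H1(1) by simp_all
    have a3: "mm s3 a = mm s a" if "a ~= 35" for a using H3(3) x2(2) that by simp
    have b3: "mm s3 35 (rg s3 30) = of_bool (acc k)"
     using H3(1) rr[of 76] r3[of 30] gd acc_idx k by (simp add: acc_def)
    have c3: "cells_ext (mm s) (mm s3) n'" for n' using a3 by (auto simp: cells_ext_def)
    have ss3: "mm s3 a i = mm s a i" if "a \<in> {11..15}" for a i using a3[of a] that by auto
    have fs3: "slot_ok (mm s3) (rg s 32) X Y (pos_ok e) (ns + 2 ^ K + 1) (FS e k)"
     by (rule slot_ok_ext[OF fs c3]) (use ss3 in auto)
    show ?case
    proof (cases "acc k")
     case False
     have e: "FS e (Suc k) = FS e k" using False by (simp add: FS_Suc fun_eq_iff)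
     show ?thesis using fs3 False b3 r3 gd c3 ss3 H3(1) x2(3) K1 unfolding e by simp
    next
     case True
     define s4 where "s4 = s3(|rg := (rg s3)(60 := 1), tm := Suc (Suc (tm s3))|)"
     have r4: "rg s4 r = rg s r" if "r \<notin> {20, 21, 22, 23, 54, 60, 78}" for r using r3 that by (simp add: s4_def)
     have q4: "rg s4 78 = ns + k" "rg s4 54 = mm s 11 (ns + k)" "mm s4 = mm s3" "tm s4 = tm s3 + 2" using q3 by (simp_all add: s4_def)
     obtain f t where f: "mapat (mm s) 12 (ns + k) f" "map_ok Y f" "2 \<le> mm s 11 (ns + k)" "mm s 11 (ns + k) < rg s 32"
      "rep (mm s) X (mm s 11 (ns + k)) t" "\<And>p. pos_ok e p ==> enumerates (alls t (ap f p)) (ES e k p)"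
      using slot_okE[OF sl] \<open>mm s 11 (ns + k) ~= 0\<close> by metis
     let ?b = "Load 55 12 78 ;; Load 56 13 78 ;; Load 57 14 78 ;; Load 58 15 78 ;;
       Add 59 33 9 ;; Add 59 59 ONE"
     have B: "wp W ?b (\<lambda>s'. rmapf s' 55 = f \<and> rg s' 59 = ns + 2 ^ K + 1 \<and> tm s' = tm s4 + 6) s4"
      using f(1) q4 a3 r4 gd k W by (simp add: mapat_def rmapf_def)
     have "wp W fin_item ?Q s4"
      unfolding fin_item_def wp_Seq_fun[of _ ?b]
     proof (rule wp_use[OF B], goal_cases)
      case (1 s5)
      note H5 = 1
      have r5: "rg s5 32 = rg s 32" "rg s5 5 = 0" "rg s5 6 = 1" "rg s5 54 = mm s 11 (ns + k)" using H5(2) r4 q4 gd by simp_all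
      have m5: "mm s5 = mm s3" using H5(3) q4 by (simp add: fun_eq_iff)
      have A: "wp W add_item (\<lambda>s'. slot_ok (mm s') (rg s' 32) X Y (pos_ok e) (rg s5 59) (\<lambda>p. ES e k p \<union> FS e k p) \<and>
        rg s5 32 \<le> rg s' 32 \<and> rg s' 32 \<le> rg s5 32 + 1 \<and> cells_ext (mm s5) (mm s') (rg s5 32) \<and>
        (\<forall>a \<in> {11..15}. \<forall>i. i ~= rg s5 59 --> mm s' a i = mm s5 a i) \<and> tm s' \<le> tm s5 + 80) s5"
      proof (rule wp_add_item[OF r5(2,3)])
       show "slot_ok (mm s5) (rg s5 32) X Y (pos_ok e) (rg s5 59) (FS e k)" using fs3 m5 r5(1) H5(1) by simp
       have "rep (mm s5) X (mm s 11 (ns + k)) t" unfolding m5 by (rule rep_ext[OF f(5,4) c3])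
       then show "item_ok s5 X Y (pos_ok e) (ES e k)"
        unfolding item_ok_def r5(1,4) using f H5(1) by blast
       show "ES e k p \<inter> FS e k p = {}" if "pos_ok e p" for p by (rule FS_disj[OF ok that])
      qed (use W YX r5(1) in simp_all)
      have e: "FS e (Suc k) = (\<lambda>p. ES e k p \<union> FS e k p)" using True by (simp add: FS_Suc fun_eq_iff)
      show ?case
      proof (rule wp_mono[OF A], goal_cases)
       case (1 s6)
       have t: "tm s6 \<le> tm s + 150 * K" using 1 H5(1) q4(4) H3(1) x2(3) K1 by linarith
       have c: "cells_ext (mm s) (mm s6) (rg s 32)"
        using cells_ext_trans[OF c3, of "mm s6" "rg s 32" "rg s 32"] 1 m5 r5(1) by simp
       have "\<forall>a \<in> {11..15}. \<forall>i. i ~= ns + 2 ^ K + 1 --> mm s6 a i = mm s a i"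
       proof (intro ballI allI impI)
        fix a i :: nat assume x: "a \<in> {11..15}" "i ~= ns + 2 ^ K + 1"
        have "\<forall>a \<in> {11..15}. \<forall>i. i ~= rg s5 59 --> mm s6 a i = mm s5 a i" using 1 by blast
        then have "mm s6 a i = mm s5 a i" using x H5(1) by simp
        then show "mm s6 a i = mm s a i" using ss3 x m5 by simp
       qed
       then show ?case unfolding e using 1 t c H5(1) r5(1) by simp
      qed
     qed
     then show ?thesis using True b3 r3 gd by (simp add: s4_def)
    qed
   qed
   then show ?thesis using False H1(1) z1 by (simp add: s2_def)
  qed
 qed
qed

end

context machine
begin

lemma wp_fin:
 assumes g: "glob s" and ok: "eval_fexp e ~= None" and v: "rg s 40 = v" "rg s 33 = ns" "mm s 6 v = ns"
  and half: "half_ok (mm s) (rg s 32) X Y e v"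
  and fresh: "\<And>a. a \<in> {11..15} ==> mm s a (ns + 2 ^ K + 1) = 0"
  and W: "(rg s 32 + 2 ^ K + 2) * X < W" "rg s 32 + 2 ^ K + 4 < W" "ns + 2 ^ K + 3 < W" and YX: "Y \<le> X"
 shows "wp W fin_code (\<lambda>s'. vert_ok (mm s') (rg s' 32) (rg s' 33) X Y e v \<and> rg s' 33 = ns + 2 ^ K + 2 \<and>
  rg s 32 \<le> rg s' 32 \<and> rg s' 32 \<le> rg s 32 + 2 ^ K \<and> cells_ext (mm s) (mm s') (rg s 32) \<and>
  (\<forall>a \<in> {11..15}. \<forall>i. i ~= ns + 2 ^ K + 1 --> mm s' a i = mm s a i) \<and>
  (\<forall>a \<in> {40, 53}. \<forall>u. u ~= v --> mm s' a u = mm s a u) \<and> tm s' \<le> tm s + 180 * (2 ^ K * K)) s" (is "wp W _ ?Q _")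
proof -
 note gd = globD[OF g]
 have K1: "1 \<le> K" by (rule bounds)
 let ?fs = "ns + 2 ^ K + 1"
 let ?I = "\<lambda>k (s' :: st). slot_ok (mm s') (rg s' 32) X Y (pos_ok e) ?fs (FS e k) \<and>
  rg s 32 \<le> rg s' 32 \<and> rg s' 32 \<le> rg s 32 + k \<and> cells_ext (mm s) (mm s') (rg s 32) \<and>
  (\<forall>a \<in> {11..15}. \<forall>i. i ~= ?fs --> mm s' a i = mm s a i)"
 have F: "wp W (For 76 9 fin_body) (\<lambda>s'. ?I (rg s 9) s' \<and> tm s' \<le> tm s + rg s 9 * (150 * K + 3) + 3) s"
 proof (rule wp_For[where Inv = ?I])
  have "slot_ok (mm s) (rg s 32) X Y (pos_ok e) ?fs (FS e 0)"
   unfolding slot_ok_def using fresh by (intro exI[of _ "((0, 0), (0, 0))"]) (simp add: mapat_def map_ok_def)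
  then show "?I 0 (s(|rg := (rg s)(76 := 0), tm := Suc (tm s)|))" by (simp add: cells_ext_refl)
 next
  fix k and s' :: st assume k: "k < rg s 9" and I: "?I k s'" and i: "rg s' 76 = k"
   and fr: "\<And>r. r \<notin> modr (For 76 9 fin_body) ==> rg s' r = rg s r" and fa: "\<And>a. a \<notin> moda fin_body ==> mm s' a = mm s a"
  have kK: "k < 2 ^ K" using k gd by simp
  have g': "glob s'" by (rule glob_frame[OF g]) (use fr fa in auto)
  have r33: "rg s' 33 = ns" using fr[of 33] v by simp
  have n: "rg s 32 \<le> rg s' 32" "rg s' 32 \<le> rg s 32 + k" and ce: "cells_ext (mm s) (mm s') (rg s 32)"
   and ss: "\<forall>a \<in> {11..15}. \<forall>i. i ~= ?fs --> mm s' a i = mm s a i" and fs: "slot_ok (mm s') (rg s' 32) X Y (pos_ok e) ?fs (FS e k)"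
   using I by blast+
  have "slot_ok (mm s) (rg s 32) X Y (pos_ok e) (ns + k) (ES e k)" using half kK v by (simp add: half_ok_def)
  then have sl: "slot_ok (mm s') (rg s' 32) X Y (pos_ok e) (ns + k) (ES e k)"
   by (rule slot_ok_ext[OF _ ce n(1)]) (use ss kK in simp)
  have "(rg s' 32 + 1) * X \<le> (rg s 32 + 2 ^ K + 2) * X" using n kK by (intro mult_le_mono1) linarith
  then have W1: "(rg s' 32 + 1) * X < W" using W(1) by linarith
  have W2: "rg s' 32 + 2 < W" "ns + 2 ^ K + 2 < W" using W n kK by linarith+
  show "wp W fin_body (\<lambda>s''. ?I (Suc k) s'' \<and> tm s'' \<le> tm s' + 150 * K) s'"
  proof (rule wp_mono[OF wp_fin_body[OF g' ok kK i r33 sl fs W1 W2 YX]])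
   fix s'' :: st assume h: "slot_ok (mm s'') (rg s'' 32) X Y (pos_ok e) ?fs (FS e (Suc k)) \<and>
    rg s' 32 \<le> rg s'' 32 \<and> rg s'' 32 \<le> rg s' 32 + 1 \<and> cells_ext (mm s') (mm s'') (rg s' 32) \<and>
    (\<forall>a\<in>{11..15}. \<forall>i. i ~= ?fs --> mm s'' a i = mm s' a i) \<and> tm s'' \<le> tm s' + 150 * K"
   have "cells_ext (mm s) (mm s'') (rg s 32)" using cells_ext_trans[OF ce _ n(1)] h by blast
   moreover have "\<forall>a \<in> {11..15}. \<forall>i. i ~= ?fs --> mm s'' a i = mm s a i" using h ss by simp
   moreover have "rg s 32 \<le> rg s'' 32" "rg s'' 32 \<le> rg s 32 + Suc k" using h n by linarith+
   ultimately show "?I (Suc k) s'' \<and> tm s'' \<le> tm s' + 150 * K" using h by blast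
  qed
 next
  fix k and s' :: st and w t assume "?I k s'"
  then show "?I k (s'(|rg := (rg s')(76 := w), tm := t|))" by simp
 qed (use gd KW in simp_all)
 let ?b = "Load 60 35 30 ;; Store 40 40 60 ;; Add 59 33 9 ;; Add 59 59 ONE ;;
   Store 53 40 59 ;; Add 33 59 ONE"
 show ?thesis unfolding fin_code_def wp_Seq_fun[of _ "For 76 9 fin_body"]
 proof (rule wp_use[OF F], goal_cases)
  case (1 s1)
  note H1 = 1
  have r1: "rg s1 r = rg s r" if "r \<notin> {20, 21, 22, 23, 24, 32, 54, 55, 56, 57, 58, 59, 60, 70, 71, 72, 73, 74, 75, 76, 78}" for r
   using H1(2)[of r] that by simp
  have a1: "mm s1 a = mm s a" if "a \<in> {3, 4, 6, 7, 8, 9, 10, 34, 40, 53}" for a using H1(3)[of a] that by auto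
  have g1: "glob s1" by (rule glob_frame[OF g]) (use r1 a1 in auto)
  have I1: "slot_ok (mm s1) (rg s1 32) X Y (pos_ok e) ?fs (FS e (2 ^ K))" "rg s 32 \<le> rg s1 32" "rg s1 32 \<le> rg s 32 + 2 ^ K"
   "cells_ext (mm s) (mm s1) (rg s 32)" "\<forall>a \<in> {11..15}. \<forall>i. i ~= ?fs --> mm s1 a i = mm s a i"
   "tm s1 \<le> tm s + 2 ^ K * (150 * K + 3) + 3" using H1(1) gd by auto
  define s2 where "s2 = s1(|rg := (rg s1)(50 := mm s 10 v), tm := Suc (tm s1)|)"
  have r2: "rg s2 r = rg s1 r" if "r ~= 50" for r using that by (simp add: s2_def)
  have x2: "rg s2 50 = mm s 10 v" "mm s2 = mm s1" "tm s2 = tm s1 + 1" by (simp_all add: s2_def)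
  have g2: "glob s2" by (rule glob_frame[OF g1]) (use r2 x2 in auto)
  have D: "wp W (decode 50 35) (\<lambda>s'. (\<forall>i < K. mm s' 35 i = of_bool (bit (rg s2 50) i)) \<and> tm s' \<le> tm s2 + 15 * K) s2"
   by (rule wp_decode[OF g2]) (use half x2 in \<open>auto simp: half_ok_def\<close>)
  have "wp W (decode 50 35 ;; ?b) ?Q s2"
   unfolding wp_Seq_fun[of _ "decode 50 35"]
  proof (rule wp_use[OF D], goal_cases)
   case (1 s3)
   note H3 = 1
   have r3: "rg s3 40 = v" "rg s3 33 = ns" "rg s3 30 = idx (q0 M) (qf M) 0" "rg s3 9 = 2 ^ K" "rg s3 6 = 1" "rg s3 32 = rg s1 32"
    using H3(2) r2 r1 v gd by simp_all
   have a3: "mm s3 a = mm s1 a" if "a ~= 35" for a using H3(3) x2 that by simp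
   have e3: "mm s3 35 (rg s3 30) = of_bool (acc (mm s 10 v))" using H3(1) r3(3) acc_idx x2 by (simp add: acc_def)
   have B: "wp W ?b (\<lambda>s'. mm s' 40 = (mm s 40)(v := of_bool (acc (mm s 10 v))) \<and> mm s' 53 = (mm s 53)(v := ?fs) \<and>
     rg s' 33 = ns + 2 ^ K + 2 \<and> tm s' = tm s3 + 6) s3"
    using r3 e3 a3[of 40] a3[of 53] a1[of 40] a1[of 53] W(3) by simp
   show ?case
   proof (rule wp_use[OF B], goal_cases)
    case (1 s4)
    note H4 = 1
    have r4: "rg s4 32 = rg s1 32" using H4(2) r3 by simp
    have a4: "mm s4 a = mm s1 a" if "a \<notin> {35, 40, 53}" for a using H4(3)[of a] a3 that by simp
    have c4: "cells_ext (mm s1) (mm s4) n'" for n' using a4 by (auto simp: cells_ext_def)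
    have c: "cells_ext (mm s) (mm s4) (rg s 32)" by (rule cells_ext_trans[OF I1(4) c4 order_refl])
    have s4s: "mm s4 a i = mm s1 a i" if "a \<in> {11..15}" for a i using a4[of a] that by auto
    have ss: "\<forall>a \<in> {11..15}. \<forall>i. i ~= ?fs --> mm s4 a i = mm s a i" using I1(5) s4s by simp
    have h: "half_ok (mm s4) (rg s4 32) X Y e v"
     by (rule half_ok_ext[OF half c]) (use I1(2) r4 ss v a4 a1 in auto)
    have f: "slot_ok (mm s4) (rg s4 32) X Y (pos_ok e) ?fs (FS e (2 ^ K))"
     by (rule slot_ok_ext[OF I1(1) c4]) (use r4 s4s in auto)
    have b: "mm s4 6 v = ns" "mm s4 53 v = ?fs" "mm s4 40 v = of_bool (acc (mm s 10 v))" "mm s4 10 = mm s 10"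
     using H4(1) a4 a1 v by simp_all
    have "vert_ok (mm s4) (rg s4 32) (rg s4 33) X Y e v"
     unfolding vert_ok_def b using h f H4(1) by simp
    moreover have "tm s4 \<le> tm s + 180 * (2 ^ K * K)"
    proof -
     have "2 ^ K * (150 * K + 3) = 150 * (2 ^ K * K) + 3 * 2 ^ K" by (simp add: algebra_simps)
     moreover have "(2::nat) ^ K \<le> 2 ^ K * K" using K1 by simp
     moreover have "K \<le> 2 ^ K * K" using K1 by simp
     ultimately show ?thesis using H4(1) H3(1) x2(3) I1(6) K1 by linarith
    qed
    ultimately show ?case using H4(1) I1(2,3) r4 c ss by auto
   qed
  qed
  then show ?case using r1[of 40] a1[of 10] v by (simp add: s2_def)
 qed
qed

lemma slot_ok_empty: "(\<And>a. a \<in> {11..15} ==> \<mu> a i = 0) ==> (\<And>p. PP p ==> A p = {}) ==> slot_ok \<mu> N X Y PP i A"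
 unfolding slot_ok_def by (intro exI[of _ "((0, 0), (0, 0))"]) (simp add: mapat_def map_ok_def)

lemma wp_leaf_proc:
 assumes g: "glob s" and v: "rg s 40 = v" "rg s 33 = ns" and l: "l = Atom x \<or> l = CtxAtom x" "x < \<sigma>" "rg s 43 = kind_code l" "rg s 44 = x"
  and cell: "rep (mm s) X 2 CL" "2 < rg s 32"
  and fresh: "\<And>a i. a \<in> {11..15} ==> ns \<le> i ==> mm s a i = 0"
  and W: "ns + 2 ^ K + 3 < W"
 shows "wp W leaf_proc (\<lambda>s'. half_ok (mm s') (rg s' 32) X Y (BLeaf l) v \<and> mm s' 6 v = ns \<and> cells_ext (mm s) (mm s') (rg s 32) \<and>
  (\<forall>a \<in> {11..15}. \<forall>i. i < ns \<or> ns + 2 ^ K < i --> mm s' a i = mm s a i) \<and>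
  (\<forall>a \<in> {6, 7, 8, 9, 10}. \<forall>u. u ~= v --> mm s' a u = mm s a u) \<and> tm s' \<le> tm s + 450 * (K * K * K)) s"
proof -
 note gd = globD[OF g]
 define TT where "TT = K * K * K"
 have TT: "1 \<le> TT" unfolding TT_def using KK by linarith
 let ?k = "kind_code l"
 have kd: "?k \<le> 1" using l(1) by auto
 let ?b1 = "Store 6 40 33 ;; Store 7 40 ONE ;; Store 8 40 ZERO ;; Store 9 40 43 ;; Const 45 0"
 let ?b2 = "Store 10 40 53 ;; Add 59 33 9 ;; Store 11 59 ONE ;; Const 45 1"
 let ?b3 = "Add 59 33 53 ;; Const 54 2 ;; Store 11 59 54 ;; Store 12 59 ZERO ;; Store 13 59 ZERO ;;
   Store 14 59 ONE ;; Store 15 59 ZERO"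
 let ?p = "leafst ?k x False" and ?q = "leafst ?k x True"
 have pq: "?p < 2 ^ K" "?q < 2 ^ K" by (rule leafst_less)+
 have W2: "2 < W" using bounds by linarith
 have B1: "wp W ?b1 (\<lambda>s'. mm s' 6 = (mm s 6)(v := ns) \<and> mm s' 7 = (mm s 7)(v := 1) \<and> mm s' 8 = (mm s 8)(v := 0) \<and>
   mm s' 9 = (mm s 9)(v := ?k) \<and> rg s' 45 = 0 \<and> tm s' = tm s + 5) s"
  using v l(3) gd W2 by simp
 show ?thesis unfolding leaf_proc_def wp_Seq_fun[of _ ?b1] TT_def[symmetric]
 proof (rule wp_use[OF B1], goal_cases)
  case (1 s1)
  note H1 = 1
  have r1: "rg s1 r = rg s r" if "r ~= 45" for r using H1(2) that by simp
  have g1: "glob s1" by (rule glob_frame[OF g]) (use r1 H1(3) in auto)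
  have L1: "wp W leaf_code (\<lambda>s'. rg s' 53 = leafst (rg s1 43) x False \<and> tm s' \<le> tm s1 + 200 * (K * K * K)) s1"
   by (rule wp_leaf[OF g1]) (use r1 l kd H1(1) in auto)
  show ?case unfolding wp_Seq_fun[of _ leaf_code]
  proof (rule wp_use[OF L1], goal_cases)
   case (1 s2)
   note H2 = 1
   have r2: "rg s2 r = rg s r" if "r \<notin> {21, 22, 23, 24, 25, 26, 27, 28, 29, 45, 46, 47, 48, 49, 53, 60, 61, 62, 63, 64}" for r
    using H2(2)[of r] r1[of r] that by simp
   have x2: "rg s2 53 = ?p" using H2(1) r1 l(3) by simp
   have a2: "mm s2 a = mm s1 a" if "a ~= 37" for a using H2(3) that by simp
   have a2': "mm s2 a = mm s a" if "a \<notin> {6, 7, 8, 9, 37}" for a using H2(3) H1(3) that by simp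
   have B2: "wp W ?b2 (\<lambda>s'. mm s' 10 = (mm s 10)(v := ?p) \<and> mm s' 11 = (mm s 11)(ns + 2 ^ K := 1) \<and> rg s' 45 = 1 \<and> tm s' = tm s2 + 4) s2"
    using r2 x2 a2' v gd W W2 by simp
   show ?case unfolding wp_Seq_fun[of _ ?b2]
   proof (rule wp_use[OF B2], goal_cases)
    case (1 s3)
    note H3 = 1
    have r3: "rg s3 r = rg s r" if "r \<notin> {21, 22, 23, 24, 25, 26, 27, 28, 29, 45, 46, 47, 48, 49, 53, 59, 60, 61, 62, 63, 64}" for r
     using H3(2)[of r] r2[of r] that by simp
    have a3: "mm s3 a = mm s a" if "a \<notin> {6, 7, 8, 9, 10, 11, 37}" for a using H3(3) a2' that by simp
    have g3: "glob s3" by (rule glob_frame[OF g]) (use r3 a3 in auto)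
    have L3: "wp W leaf_code (\<lambda>s'. rg s' 53 = leafst (rg s3 43) x True \<and> tm s' \<le> tm s3 + 200 * (K * K * K)) s3"
     by (rule wp_leaf[OF g3]) (use r3 l kd H3(1) in auto)
    show ?case unfolding wp_Seq_fun[of _ leaf_code]
    proof (rule wp_use[OF L3], goal_cases)
     case (1 s4)
     note H4 = 1
     have r4: "rg s4 r = rg s r" if "r \<notin> {21, 22, 23, 24, 25, 26, 27, 28, 29, 45, 46, 47, 48, 49, 53, 59, 60, 61, 62, 63, 64}" for r
      using H4(2)[of r] r3[of r] that by simp
     have x4: "rg s4 53 = ?q" using H4(1) r3 l(3) by simp
     have a4: "mm s4 a = mm s a" if "a \<notin> {6, 7, 8, 9, 10, 11, 37}" for a using H4(3) a3 that by simp
     have m11: "mm s4 11 = (mm s 11)(ns + 2 ^ K := 1)" using H4(3) H3(1) by simp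
     have nq: "ns + ?q < W" using pq W by linarith
     have B4: "wp W ?b3 (\<lambda>s'. mm s' 11 = (mm s 11)(ns + 2 ^ K := 1, ns + ?q := 2) \<and> mm s' 12 = (mm s 12)(ns + ?q := 0) \<and>
       mm s' 13 = (mm s 13)(ns + ?q := 0) \<and> mm s' 14 = (mm s 14)(ns + ?q := 1) \<and> mm s' 15 = (mm s 15)(ns + ?q := 0) \<and> tm s' = tm s4 + 7) s4"
      using r4 x4 a4 v gd m11 nq W2 by simp
     show ?case
     proof (rule wp_use[OF B4], goal_cases)
      case (1 s5)
      note H5 = 1
      have a5: "mm s5 a = mm s4 a" if "a \<notin> {11..15}" for a using H5(3)[of a] that by auto
      have v5: "mm s5 6 = (mm s 6)(v := ns)" "mm s5 7 = (mm s 7)(v := 1)" "mm s5 8 = (mm s 8)(v := 0)"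
       "mm s5 9 = (mm s 9)(v := ?k)" "mm s5 10 = (mm s 10)(v := ?p)"
       using a5 H4(3) H3(1,3) a2 H1(1) by simp_all
      have e5: "cells_ext (mm s) (mm s5) n'" for n'
       unfolding cells_ext_def using a5 a4 by auto
      have r5: "rg s5 32 = rg s 32" using H5(2) r4 by simp
      have leafG: "G (BLeaf l) p = {(?p, {}), (?q, {fst p})}" for p using l(1) by (auto simp: G_leaf)
      have other: "mm s5 a i = mm s a i" if "a \<in> {11..15}" "i ~= ns + ?q" "a = 11 --> i ~= ns + 2 ^ K" for a i
      proof -
       have "a = 11 \<or> a = 12 \<or> a = 13 \<or> a = 14 \<or> a = 15" using that(1) by auto
       then show ?thesis using that(2,3) H5(1) by (elim disjE) simp_all
      qed
      have wd: "lc (wd (BLeaf l)) = 1" "rc (wd (BLeaf l)) = 0" "ty (wd (BLeaf l)) = ?k"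
       using l(1) by (auto simp: lc_def rc_def ty_def)
      have "slot_ok (mm s5) (rg s5 32) X Y (pos_ok (BLeaf l)) (ns + s) (ES (BLeaf l) s)" if "s < 2 ^ K" for s
      proof (cases "s = ?q")
       case True
       have e: "ES (BLeaf l) s p = {{fst p}}" for p
        using True that by (auto simp: ES_def leafG)
       have m: "mapat (mm s5) 12 (ns + s) idm" "mm s5 11 (ns + s) = 2"
        using H5(1) True by (simp_all add: mapat_def idm_def)
       have "rep (mm s5) X 2 CL" by (rule rep_ext[OF cell e5])
       then show ?thesis
        unfolding slot_ok_def m(2) using m(1) map_ok_idm cell(2) r5
        by (intro exI[of _ idm]) (auto intro!: exI[of _ CL] simp: e enumerates_def)
      next
       case False
       have "ES (BLeaf l) s p = {}" for p using False that by (auto simp: ES_def leafG)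
       moreover have "mm s5 a (ns + s) = 0" if "a \<in> {11..15}" for a
        using other[OF that, of "ns + s"] fresh[OF that, of "ns + s"] False \<open>s < 2 ^ K\<close> by simp
       ultimately show ?thesis by (intro slot_ok_empty) auto
      qed
      note sl = this
      have "half_ok (mm s5) (rg s5 32) X Y (BLeaf l) v"
       unfolding half_ok_def v5 wd using sl pq H5(1) by (simp add: leafG)
      moreover have "\<forall>a \<in> {11..15}. \<forall>i. i < ns \<or> ns + 2 ^ K < i --> mm s5 a i = mm s a i"
       using other pq(2) by auto
      moreover have "\<forall>a \<in> {6, 7, 8, 9, 10}. \<forall>u. u ~= v --> mm s5 a u = mm s a u" using v5 by simp
      moreover have "tm s5 \<le> tm s + 450 * TT"
       using H5(1) H4(1) H3(1) H2(1) H1(1) TT unfolding TT_def by linarith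
      ultimately show ?case using e5 v5(1) by simp
     qed
    qed
   qed
  qed
 qed
qed

end

text \<open>Abstracts from the DAG: \<open>ex\<close> is the unfolding, \<open>lb\<close> the label,
  \<open>lf\<close> and \<open>rt\<close> are the children, and \<open>rk\<close> decreases along
  edges. \<open>NW\<close> makes room for the cells of all vertices times the largest offset
  \<open>4 ^ n\<close>.\<close>

locale graph = machine +
 fixes ex :: "nat => nat fsym btree" and lb :: "nat => nat fsym" and lf rt rk :: "nat => nat"
 assumes ex_ok: "v < n ==> eval_fexp (ex v) ~= None"
  and leaf: "v < n ==> kind_code (lb v) \<le> 1 ==> ex v = BLeaf (lb v) \<and> set_fsym (lb v) \<subseteq> {..<\<sigma>}"
  and inner: "v < n ==> 1 < kind_code (lb v) ==> ex v = BNode (lb v) (ex (lf v)) (ex (rt v)) \<and> lf v < n \<and> rt v < n \<and>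
   rk (lf v) < rk v \<and> rk (rt v) < rk v"
  and rk: "v < n ==> rk v \<le> n"
  and NW: "(n * (3 * ((2 ^ K + 1) * (2 ^ K + 1))) + 8) * 4 ^ n < W"
begin

abbreviation "X \<equiv> (4::nat) ^ n"
abbreviation "N2 \<equiv> (2 ^ K + 1) * (2 ^ K + 1 :: nat)"

text \<open>A leaf contributes one letter and lengths at most add up at an inner vertex, so they at
  most double from one rank to the next.\<close>

lemma wd_bound: "v < n ==> lc (wd (ex v)) + rc (wd (ex v)) \<le> 2 ^ rk v"
proof (induction "rk v" arbitrary: v rule: less_induct)
 case less
 show ?case
 proof (cases "kind_code (lb v) \<le> 1")
  case True
  have "ex v = BLeaf (lb v)" using leaf[OF less.prems True] by blast
  then show ?thesis using True by (cases "lb v") (auto simp: lc_def rc_def)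
 next
  case False
  then have i: "ex v = BNode (lb v) (ex (lf v)) (ex (rt v))" "lf v < n" "rt v < n" "rk (lf v) < rk v" "rk (rt v) < rk v"
   using inner[OF less.prems] by auto
  obtain r where r: "rk v = Suc r" using i(4) by (cases "rk v") auto
  have "(2::nat) ^ rk (lf v) \<le> 2 ^ r" "(2::nat) ^ rk (rt v) \<le> 2 ^ r" using i r by simp_all
  then have b: "lc (wd (ex (lf v))) + rc (wd (ex (lf v))) \<le> 2 ^ r" "lc (wd (ex (rt v))) + rc (wd (ex (rt v))) \<le> 2 ^ r"
   using less.hyps[OF i(4,2)] less.hyps[OF i(5,3)] by linarith+
  obtain F1 F2 where w: "wpre (kind_code (lb v)) (wd (ex (lf v))) (wd (ex (rt v)))"
   "wd (ex v) = wop (kind_code (lb v)) (wd (ex (lf v))) (wd (ex (rt v)))"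
   using eval_BNode[of "lb v" "ex (lf v)" "ex (rt v)"] ex_ok[OF less.prems] i(1) by metis
  show ?thesis unfolding w(2) wop_info[OF w(1)] r using b by simp
 qed
qed

definition inp :: "st => bool" where
 "inp s \<longleftrightarrow> (\<forall>v < n. mm s 0 v = kind_code (lb v) \<and> (kind_code (lb v) \<le> 1 --> mm s 1 v \<in> set_fsym (lb v)) \<and>
   (1 < kind_code (lb v) --> mm s 1 v = lf v \<and> mm s 2 v = rt v))"

text \<open>A vertex takes \<open>2 ^ K + 2\<close> slots and at most \<open>3 * N2\<close> cells:
  \<open>2 * N2\<close> from the pairs and \<open>2 ^ K\<close> from collecting accepting states.
  The offset 3 accounts for the reserved indices 0 and 1 and the leaf cell 2.\<close>

definition dinv :: "nat set => st => bool" where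
 "dinv A s \<longleftrightarrow> glob s \<and> inp s \<and> A \<subseteq> {..<n} \<and> (\<forall>v \<in> A. vert_ok (mm s) (rg s 32) (rg s 33) X (4 ^ rk v) (ex v) v) \<and>
   rg s 33 = card A * (2 ^ K + 2) \<and> 3 \<le> rg s 32 \<and> rg s 32 \<le> 3 + card A * (3 * N2) \<and> rep (mm s) X 2 CL \<and>
   (\<forall>a \<in> {11..15}. \<forall>i \<ge> rg s 33. mm s a i = 0)"

lemma dinvD:
 assumes "dinv A s"
 shows "glob s" "inp s" "A \<subseteq> {..<n}" "v \<in> A ==> vert_ok (mm s) (rg s 32) (rg s 33) X (4 ^ rk v) (ex v) v"
  "rg s 33 = card A * (2 ^ K + 2)" "3 \<le> rg s 32" "rg s 32 \<le> 3 + card A * (3 * N2)" "rep (mm s) X 2 CL"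
  "a \<in> {11..15} ==> rg s 33 \<le> i ==> mm s a i = 0"
proof -
 note p1 = assms[unfolded dinv_def]
 note p2 = p1[THEN conjunct2] note p3 = p2[THEN conjunct2] note p4 = p3[THEN conjunct2] note p5 = p4[THEN conjunct2]
 note p6 = p5[THEN conjunct2] note p7 = p6[THEN conjunct2] note p8 = p7[THEN conjunct2] note p9 = p8[THEN conjunct2]
 show "glob s" "inp s" "A \<subseteq> {..<n}" by (rule p1[THEN conjunct1] p2[THEN conjunct1] p3[THEN conjunct1])+
 show "v \<in> A ==> vert_ok (mm s) (rg s 32) (rg s 33) X (4 ^ rk v) (ex v) v" by (rule p4[THEN conjunct1, rule_format])
 show "rg s 33 = card A * (2 ^ K + 2)" "3 \<le> rg s 32" "rg s 32 \<le> 3 + card A * (3 * N2)" "rep (mm s) X 2 CL"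
  by (rule p5[THEN conjunct1] p6[THEN conjunct1] p7[THEN conjunct1] p8[THEN conjunct1])+
 show "a \<in> {11..15} ==> rg s 33 \<le> i ==> mm s a i = 0" by (rule p9[rule_format])
qed

lemma dinv_frame:
 assumes "dinv A s" "\<And>r. r \<in> {0, 1, 5, 6, 7, 8, 9, 30, 31, 32, 33, 34, 39} ==> rg s' r = rg s r"
  "\<And>a. a \<in> {0..4} \<union> {6..34} \<union> {40, 53} ==> mm s' a = mm s a"
 shows "dinv A s'"
proof -
 note d = dinvD[OF assms(1)]
 have g: "glob s'"
 proof (rule glob_frame[OF d(1)])
  show "rg s' r = rg s r" if "r \<in> {0, 1, 5, 6, 7, 8, 9, 30, 31, 34, 39}" for r by (rule assms(2)) (use that in blast)
  show "mm s' a = mm s a" if "a \<in> {3, 4, 34}" for a by (rule assms(3)) (use that in auto)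
 qed
 have r: "rg s' 32 = rg s 32" "rg s' 33 = rg s 33" by (rule assms(2); simp)+
 have m: "mm s' 0 = mm s 0" "mm s' 1 = mm s 1" "mm s' 2 = mm s 2" by (rule assms(3); simp)+
 have ma: "mm s' a = mm s a" if "6 \<le> a" "a \<le> 34" for a by (rule assms(3)) (use that in simp)
 have mb: "mm s' 40 = mm s 40" "mm s' 53 = mm s 53" by (rule assms(3); simp)+
 have ce: "cells_ext (mm s) (mm s') k" for k unfolding cells_ext_def using ma by simp
 have ve: "verts_ext (mm s) (mm s') k j v" for k j v
  unfolding verts_ext_def using ce ma mb by simp
 have v: "vert_ok (mm s') (rg s 32) (rg s 33) X (4 ^ rk v) (ex v) v" if "v \<in> A" for v
  by (rule vert_ok_ext[OF d(4)[OF that] ve[where v = "Suc v"]]) auto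
 have c: "rep (mm s') X 2 CL" by (rule rep_ext[OF d(8) lessI ce])
 have z: "\<forall>a \<in> {11..15}. \<forall>i \<ge> rg s 33. mm s' a i = 0" using d(9) ma by simp
 have "inp s'" using d(2) unfolding inp_def m .
 show ?thesis unfolding dinv_def r
 proof (intro conjI)
  show "\<forall>v \<in> A. vert_ok (mm s') (rg s 32) (rg s 33) X (4 ^ rk v) (ex v) v" by (rule ballI, rule v)
 qed (rule g \<open>inp s'\<close> c z d(3) d(5) d(6) d(7))+
qed

lemma dinv_bounds:
 assumes "dinv A s" "v < n" "v \<notin> A"
 shows "(rg s 32 + 3 * N2 + 4) * X < W" "rg s 32 + 3 * N2 + 4 < W" "rg s 33 + 2 ^ K + 4 < W" "X < W"
proof -
 note d = dinvD[OF assms(1)]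
 have f: "finite A" using d(3) finite_subset by blast
 have "card (insert v A) \<le> n" using card_mono[of "{..<n}" "insert v A"] d(3) assms(2) by simp
 then have c: "card A + 1 \<le> n" using f assms(3) by simp
 define q where "q = 3 * N2"
 define w where "w = (2::nat) ^ K + 2"
 have "(card A + 1) * q \<le> n * q" "(card A + 1) * w \<le> n * w" using c by (intro mult_le_mono1; simp)+
 then have "card A * q + q \<le> n * q" "card A * w + w \<le> n * w" by simp_all
 moreover have "w \<le> q" unfolding q_def w_def by (simp add: algebra_simps)
 then have "n * w \<le> n * q" by (rule mult_le_mono2)
 moreover have "rg s 32 \<le> 3 + card A * q" "rg s 33 = card A * w" using d(5,7) unfolding q_def w_def by blast+
 moreover have "rg s 33 + 2 ^ K + 4 = rg s 33 + w + 2" unfolding w_def by simp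
 ultimately have "rg s 32 + q + 4 \<le> n * q + 8" "rg s 33 + 2 ^ K + 4 \<le> n * q + 8" by linarith+
 then have b: "rg s 32 + 3 * N2 + 4 \<le> n * (3 * N2) + 8" "rg s 33 + 2 ^ K + 4 \<le> n * (3 * N2) + 8"
  unfolding q_def by blast+
 have X: "1 \<le> X" by simp
 have "(rg s 32 + 3 * N2 + 4) * X \<le> (n * (3 * N2) + 8) * X" using b(1) by (rule mult_le_mono1)
 then show "(rg s 32 + 3 * N2 + 4) * X < W" using NW by (rule le_less_trans)
 have "(n * (3 * N2) + 8) * 1 \<le> (n * (3 * N2) + 8) * X" by (intro mult_le_mono2 X)
 then have w: "n * (3 * N2) + 8 < W" using le_less_trans[OF _ NW] unfolding mult_1_right by blast
 show "rg s 32 + 3 * N2 + 4 < W" "rg s 33 + 2 ^ K + 4 < W" using b[THEN le_less_trans[OF _ w]] by blast+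
 have "1 * X \<le> (n * (3 * N2) + 8) * X" by (intro mult_le_mono1) simp
 then show "X < W" using le_less_trans[OF _ NW] unfolding mult_1_left by blast
qed

lemma wp_inner:
 assumes d: "dinv A s" and v: "v < n" "v \<notin> A" "1 < kind_code (lb v)" "lf v \<in> A" "rt v \<in> A"
  and r: "rg s 40 = v" "rg s 41 = lf v" "rg s 42 = rt v" "rg s 43 = kind_code (lb v)" "rg s 33 = ns"
 shows "wp W (map_code ;; pairs_code) (\<lambda>s'. half_ok (mm s') (rg s' 32) X (4 ^ rk v) (ex v) v \<and> mm s' 6 v = ns \<and>
  cells_ext (mm s) (mm s') (rg s 32) \<and> rg s 32 \<le> rg s' 32 \<and> rg s' 32 \<le> rg s 32 + 2 * N2 \<and>
  (\<forall>a \<in> {11..15}. \<forall>i. i < ns \<or> ns + 2 ^ K < i --> mm s' a i = mm s a i) \<and>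
  (\<forall>a \<in> {6, 7, 8, 9, 10}. \<forall>u. u ~= v --> mm s' a u = mm s a u) \<and> tm s' \<le> tm s + 560 * (N2 * (K * K * K))) s"
proof -
 note D = dinvD[OF d] and b = dinv_bounds[OF d v(1,2)]
 have i: "ex v = BNode (lb v) (ex (lf v)) (ex (rt v))" "lf v < n" "rt v < n" "rk (lf v) < rk v" "rk (rt v) < rk v"
  using inner[OF v(1,3)] by auto
 obtain q where q: "rk v = Suc q" using i(4) by (cases "rk v") auto
 let ?e1 = "ex (lf v)" and ?e2 = "ex (rt v)"
 have le: "rk (lf v) \<le> q" "rk (rt v) \<le> q" using i q by simp_all
 \<comment> \<open>The offsets added here are at most the lengths of the children, hence at most
   \<open>2 ^ Suc q\<close>, and \<open>4 ^ q + 2 ^ Suc q \<le> 4 ^ Suc q\<close>. This is why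
   references are bounded by a power of 4.\<close>
 have node: "node \<sigma> m M W (lb v) ?e1 ?e2 X (4 ^ q) (2 ^ rk v) (4 ^ rk v)"
 proof unfold_locales
  show "eval_fexp (BNode (lb v) ?e1 ?e2) ~= None" using ex_ok[OF v(1)] i(1) by simp
  have "(2::nat) ^ rk (lf v) \<le> 2 ^ q" "(2::nat) ^ rk (rt v) \<le> 2 ^ q" using le by simp_all
  then show "lc (wd ?e1) + lc (wd ?e2) + rc (wd ?e1) + rc (wd ?e2) \<le> 2 ^ rk v"
   using wd_bound[OF i(2)] wd_bound[OF i(3)] unfolding q power_Suc by linarith
  have "(2::nat) ^ q \<le> 4 ^ q" by (rule power_mono) simp_all
  then show "4 ^ q + 2 ^ rk v \<le> (4::nat) ^ rk v" unfolding q by simp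
  show "(4::nat) ^ rk v \<le> X" using rk[OF v(1)] by simp
 qed (rule b(4))
 have ch: "vert_ok (mm s) (rg s 32) ns X (4 ^ rk (lf v)) ?e1 (lf v)" "vert_ok (mm s) (rg s 32) ns X (4 ^ rk (rt v)) ?e2 (rt v)"
  using D(4)[OF v(4)] D(4)[OF v(5)] r(5) by simp_all
 have q4: "(4::nat) ^ rk (lf v) \<le> 4 ^ q" "(4::nat) ^ rk (rt v) \<le> 4 ^ q" using le by simp_all
 have h: "half_ok (mm s) (rg s 32) X (4 ^ q) ?e1 (lf v)" "half_ok (mm s) (rg s 32) X (4 ^ q) ?e2 (rt v)"
  using ch half_ok_mono q4 unfolding vert_ok_def by blast+
 have bs: "mm s 6 (lf v) + 2 ^ K < ns" "mm s 6 (rt v) + 2 ^ K < ns" using ch unfolding vert_ok_def by linarith+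
 have ne: "lf v ~= v" "rt v ~= v" using v(2,4,5) by metis+
 have M: "wp W map_code (\<lambda>s'. rmapf s' 80 = lm (lb v) ?e1 ?e2 \<and> rmapf s' 84 = rm (lb v) ?e1 \<and> rg s' 97 = mm s 6 (rg s 41) \<and> rg s' 98 = mm s 6 (rg s 42) \<and>
  mm s' 6 = (mm s 6)(rg s 40 := rg s 33) \<and> mm s' 7 = (mm s 7)(rg s 40 := lc (wd (BNode (lb v) ?e1 ?e2))) \<and> mm s' 8 = (mm s 8)(rg s 40 := rc (wd (BNode (lb v) ?e1 ?e2))) \<and>
  mm s' 9 = (mm s 9)(rg s 40 := ty (wd (BNode (lb v) ?e1 ?e2))) \<and> tm s' \<le> tm s + 40) s"
  by (rule node.wp_map_code[OF node D(1) r(4)]) (use h r in \<open>simp_all add: half_ok_def\<close>)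
 show ?thesis unfolding wp_Seq
 proof (rule wp_use[OF M], goal_cases)
  case (1 s0)
  note H0 = 1
  have r0: "rg s0 k = rg s k" if "k \<notin> {80..98}" for k by (rule H0(2)) (use that in auto)
  have a0: "mm s0 a = mm s a" if "a \<notin> {6, 7, 8, 9}" for a using H0(3) that by simp
  have g0: "glob s0" by (rule glob_frame[OF D(1)]) (use r0 a0 in auto)
  have ce: "cells_ext (mm s) (mm s0) k" for k using a0 by (auto simp: cells_ext_def)
  have t0: "mm s0 a u = mm s a u" if "a \<in> {6, 7, 8, 9, 10}" "u ~= v" for a u
   using that H0(1) a0[of 10] r by auto
  have s0: "mm s0 a = mm s a" if "a \<in> {11..15}" for a using a0[of a] that by auto
  have h0: "half_ok (mm s0) (rg s0 32) X (4 ^ q) ?e1 (lf v)" "half_ok (mm s0) (rg s0 32) X (4 ^ q) ?e2 (rt v)"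
   by (rule half_ok_ext[OF h(1) ce] half_ok_ext[OF h(2) ce]; use r0 s0 t0 ne in simp)+
  have bs0: "mm s0 6 (lf v) = mm s 6 (lf v)" "mm s0 6 (rt v) = mm s 6 (rt v)" using t0 ne by simp_all
  interpret nr: node_run \<sigma> m M W n "lb v" ?e1 ?e2 X "4 ^ q" "2 ^ rk v" "4 ^ rk v" s0 v "lf v" "rt v" ns
  proof (intro node_run.intro node_run_axioms.intro)
   show "node \<sigma> m M W (lb v) ?e1 ?e2 X (4 ^ q) (2 ^ rk v) (4 ^ rk v)" by (rule node)
   show "(rg s0 32 + 2 * N2 + 2) * X < W"
   proof -
    have "(rg s0 32 + 2 * N2 + 2) * X \<le> (rg s 32 + 3 * N2 + 4) * X" using r0 by (intro mult_le_mono1) simp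
    then show ?thesis using b(1) by (rule le_less_trans)
   qed
   show "rg s0 32 + 2 * N2 + 4 < W" "ns + 2 ^ K + 2 < W" using b(2,3) r0[of 32] r(5) by simp_all
   show "mm s0 a i = 0" if "a \<in> {11..15}" "ns \<le> i" for a i using D(9)[OF that(1)] that(2) s0[OF that(1)] r(5) by simp
  qed (use g0 H0(1) h0 r0 bs bs0 r ne in simp_all)
  show ?case
  proof (rule wp_mono[OF nr.wp_pairs], goal_cases)
   case (1 s')
   note p = nr.pinvD[OF conjunct1[OF 1]]
   have "half_ok (mm s') (rg s' 32) X (4 ^ rk v) (BNode (lb v) ?e1 ?e2) v"
    by (rule nr.half_ok_pairs[OF conjunct1[OF 1]]) (use H0(1) r in simp_all)
   moreover have "mm s' 6 v = ns" using p(2)[of 6] H0(1) r by simp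
   moreover have "cells_ext (mm s) (mm s') (rg s 32)"
    by (rule cells_ext_trans[OF ce p(6)]) (use r0 in simp)
   moreover have "rg s 32 \<le> rg s' 32" "rg s' 32 \<le> rg s 32 + 2 * N2" using p(4,5) r0[of 32] by simp_all
   moreover have "\<forall>a \<in> {11..15}. \<forall>i. i < ns \<or> ns + 2 ^ K < i --> mm s' a i = mm s a i" using p(7) s0 by simp
   moreover have "\<forall>a \<in> {6, 7, 8, 9, 10}. \<forall>u. u ~= v --> mm s' a u = mm s a u"
   proof (intro ballI allI impI)
    fix a u assume x: "a \<in> {6, 7, 8, 9, 10 :: nat}" "u ~= v"
    have "mm s' a u = mm s0 a u"
    proof (cases "a = 10")
     case False
     then have "a \<notin> {10, 11, 12, 13, 14, 15, 16, 17, 18, 19, 20, 21, 22, 23, 24, 25, 26, 27, 28, 29, 30, 31, 32, 33, 35, 36, 37}" using x(1) by auto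
     from p(2)[OF this] show ?thesis by simp
    qed (use p(8)[OF x(2)] in simp)
    then show "mm s' a u = mm s a u" using t0[OF x] by simp
   qed
   moreover have "tm s' \<le> tm s + 560 * (N2 * (K * K * K))"
   proof -
    have "1 \<le> K * K * K" using KK by linarith
    then have "1 * 1 \<le> N2 * (K * K * K)" by (intro mult_le_mono) simp_all
    then show ?thesis using 1 H0(1) by linarith
   qed
   ultimately show ?case unfolding i(1)[symmetric] by blast
  qed
 qed
qed

end

context graph
begin

lemma wp_process:
 assumes d: "dinv A s" and v: "v < n" "v \<notin> A" "1 < kind_code (lb v) ==> lf v \<in> A \<and> rt v \<in> A" and r: "rg s 40 = v"
 shows "wp W process (\<lambda>s'. dinv (insert v A) s' \<and> tm s' \<le> tm s + 1000 * (N2 * (K * K * K))) s"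
proof -
 note D = dinvD[OF d] and b = dinv_bounds[OF d v(1,2)] and gd = globD[OF dinvD(1)[OF d]]
 define TT where "TT = K * K * K"
 have TT: "1 \<le> TT" "K \<le> TT" unfolding TT_def using KK by linarith+
 define N1 where "N1 = (2::nat) ^ K + 1"
 define ns where "ns = rg s 33"
 let ?blk = "Load 43 0 40 ;; Load 44 1 40 ;; Copy 41 44 ;; Load 42 2 40"
 have B: "wp W ?blk (\<lambda>s'. rg s' 43 = kind_code (lb v) \<and> rg s' 44 = mm s 1 v \<and> rg s' 41 = mm s 1 v \<and> rg s' 42 = mm s 2 v \<and> tm s' = tm s + 4) s"
  using D(2) v(1) r gd by (simp add: inp_def)
 let ?Q = "\<lambda>s'. half_ok (mm s') (rg s' 32) X (4 ^ rk v) (ex v) v \<and> mm s' 6 v = ns \<and>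
  cells_ext (mm s) (mm s') (rg s 32) \<and> rg s 32 \<le> rg s' 32 \<and> rg s' 32 \<le> rg s 32 + 2 * N2 \<and>
  (\<forall>a \<in> {11..15}. \<forall>i. i < ns \<or> ns + 2 ^ K < i --> mm s' a i = mm s a i) \<and>
  (\<forall>a \<in> {6, 7, 8, 9, 10}. \<forall>u. u ~= v --> mm s' a u = mm s a u) \<and> tm s' \<le> tm s + 562 * (N2 * TT) + 6"
 show ?thesis unfolding process_def wp_Seq_fun[of _ ?blk] TT_def[symmetric]
 proof (rule wp_use[OF B], goal_cases)
  case (1 s1)
  note H1 = 1
  have m1: "mm s1 = mm s" using H1(3) by (simp add: fun_eq_iff)
  have r1: "rg s1 k = rg s k" if "k \<notin> {41, 42, 43, 44}" for k by (rule H1(2)) (use that in simp)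
  have d1: "dinv A s1"
  proof (rule dinv_frame[OF d])
   show "rg s1 k = rg s k" if "k \<in> {0, 1, 5, 6, 7, 8, 9, 30, 31, 32, 33, 34, 39}" for k by (rule r1) (use that in auto)
  qed (simp add: m1)
  have d1t: "dinv A (s1(|tm := t|))" for t by (rule dinv_frame[OF d1]) simp_all
  have NT: "TT \<le> N2 * TT" by simp
  have half: "wp W (Cond ONE 43 (map_code ;; pairs_code) leaf_proc) ?Q s1"
  proof (cases "1 < kind_code (lb v)")
   case True
   have i: "mm s 1 v = lf v" "mm s 2 v = rt v" using D(2) v(1) True by (simp_all add: inp_def)
   let ?s = "s1(|tm := Suc (tm s1)|)"
   have "wp W (map_code ;; pairs_code) (\<lambda>s'. half_ok (mm s') (rg s' 32) X (4 ^ rk v) (ex v) v \<and> mm s' 6 v = ns \<and>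
    cells_ext (mm ?s) (mm s') (rg ?s 32) \<and> rg ?s 32 \<le> rg s' 32 \<and> rg s' 32 \<le> rg ?s 32 + 2 * N2 \<and>
    (\<forall>a \<in> {11..15}. \<forall>i. i < ns \<or> ns + 2 ^ K < i --> mm s' a i = mm ?s a i) \<and>
    (\<forall>a \<in> {6, 7, 8, 9, 10}. \<forall>u. u ~= v --> mm s' a u = mm ?s a u) \<and> tm s' \<le> tm ?s + 560 * (N2 * (K * K * K))) ?s"
    by (rule wp_inner[OF d1t v(1,2) True]) (use v(3) True H1(1) r1 r i in \<open>simp_all add: ns_def\<close>)
   then have "wp W (map_code ;; pairs_code) ?Q ?s"
   proof (rule wp_mono, goal_cases)
    case (1 s')
    have t: "tm s' \<le> tm s + 562 * (N2 * TT) + 6" using 1 H1(1) unfolding TT_def[symmetric] by simp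
    show ?case using 1 t m1 r1 by simp
   qed
   then show ?thesis using True H1(1) r1 gd by simp
  next
   case False
   then have l: "ex v = BLeaf (lb v)" "set_fsym (lb v) \<subseteq> {..<\<sigma>}" using leaf[OF v(1)] by auto
   obtain x where x: "lb v = Atom x \<or> lb v = CtxAtom x" using False by (cases "lb v") auto
   have xs: "x < \<sigma>" "mm s 1 v = x" using x l(2) D(2) v(1) False by (auto simp: inp_def)
   let ?s = "s1(|tm := Suc (tm s1)|)"
   have "wp W leaf_proc (\<lambda>s'. half_ok (mm s') (rg s' 32) X (4 ^ rk v) (BLeaf (lb v)) v \<and> mm s' 6 v = ns \<and> cells_ext (mm ?s) (mm s') (rg ?s 32) \<and>
    (\<forall>a \<in> {11..15}. \<forall>i. i < ns \<or> ns + 2 ^ K < i --> mm s' a i = mm ?s a i) \<and>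
    (\<forall>a \<in> {6, 7, 8, 9, 10}. \<forall>u. u ~= v --> mm s' a u = mm ?s a u) \<and> tm s' \<le> tm ?s + 450 * (K * K * K)) ?s"
   proof (rule wp_leaf_proc[OF dinvD(1)[OF d1t] _ _ x xs(1)])
    show "mm ?s a i = 0" if "a \<in> {11..15}" "ns \<le> i" for a i using D(9)[OF that(1)] that(2) m1 by (simp add: ns_def)
    show "ns + 2 ^ K + 3 < W" using b(3) unfolding ns_def by linarith
   qed (use H1(1) r1 r xs m1 D(6,8) in \<open>simp_all add: ns_def\<close>)
   then have "wp W leaf_proc (\<lambda>s'. ?Q (s'(|tm := Suc (tm s')|))) ?s"
   proof (rule wp_use, goal_cases)
    case (1 s')
    have t: "Suc (tm s') \<le> tm s + 562 * (N2 * TT) + 6" using 1(1) H1(1) NT unfolding TT_def[symmetric] by simp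
    have "rg s' 32 = rg s 32" using 1(2)[of 32] r1[of 32] by simp
    then show ?case using 1(1) t m1 r1 l(1) by simp
   qed
   then show ?thesis using False H1(1) r1 gd by simp
  qed
  show ?case unfolding wp_Seq_fun[of _ "Cond ONE 43 (map_code ;; pairs_code) leaf_proc"]
  proof (rule wp_use[OF half], goal_cases)
   case (1 s2)
   note H2 = 1
   have r2: "rg s2 k = rg s k" if "k \<in> {0, 1, 5, 6, 7, 8, 9, 30, 31, 33, 34, 39, 40}" for k
   proof -
    have "rg s2 k = rg s1 k" by (rule H2(2)) (use that in \<open>elim insertE emptyE; simp\<close>)
    moreover have "rg s1 k = rg s k" by (rule r1) (use that in \<open>elim insertE emptyE; simp\<close>)
    ultimately show ?thesis by simp
   qed
   have a2: "mm s2 a = mm s a" if "a \<in> {0, 1, 2, 3, 4, 34, 40, 53}" for a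
   proof -
    have "mm s2 a = mm s1 a" by (rule H2(3)) (use that in \<open>elim insertE emptyE; simp\<close>)
    then show ?thesis using m1 by simp
   qed
   have g2: "glob s2" by (rule glob_frame[OF D(1) r2 a2]) auto
   have c2: "rg s2 32 \<le> rg s 32 + 2 * N2" "rg s 32 \<le> rg s2 32" "cells_ext (mm s) (mm s2) (rg s 32)" using H2(1) by blast+
   have N2: "(2::nat) ^ K + 2 \<le> N2 + 1" by simp
   have F: "wp W fin_code (\<lambda>s'. vert_ok (mm s') (rg s' 32) (rg s' 33) X (4 ^ rk v) (ex v) v \<and> rg s' 33 = ns + 2 ^ K + 2 \<and>
    rg s2 32 \<le> rg s' 32 \<and> rg s' 32 \<le> rg s2 32 + 2 ^ K \<and> cells_ext (mm s2) (mm s') (rg s2 32) \<and>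
    (\<forall>a \<in> {11..15}. \<forall>i. i ~= ns + 2 ^ K + 1 --> mm s' a i = mm s2 a i) \<and>
    (\<forall>a \<in> {40, 53}. \<forall>u. u ~= v --> mm s' a u = mm s2 a u) \<and> tm s' \<le> tm s2 + 180 * (2 ^ K * K)) s2"
   proof (rule wp_fin[OF g2 ex_ok[OF v(1)]])
    show "mm s2 a (ns + 2 ^ K + 1) = 0" if "a \<in> {11..15}" for a
     using H2(1) that D(9)[OF that, of "ns + 2 ^ K + 1"] by (simp add: ns_def)
    have le: "rg s2 32 + 2 ^ K + 4 \<le> rg s 32 + 3 * N2 + 4" "rg s2 32 + 2 ^ K + 2 \<le> rg s 32 + 3 * N2 + 4" using c2(1) by simp_all
    show "(rg s2 32 + 2 ^ K + 2) * X < W" by (rule le_less_trans[OF mult_le_mono1[OF le(2)] b(1)])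
    show "rg s2 32 + 2 ^ K + 4 < W" by (rule le_less_trans[OF le(1) b(2)])
    show "ns + 2 ^ K + 3 < W" using b(3) unfolding ns_def by linarith
    show "4 ^ rk v \<le> X" using rk[OF v(1)] by simp
   qed (use H2(1) r2 r in \<open>simp_all add: ns_def\<close>)
   show ?case
   proof (rule wp_use[OF F], goal_cases)
    case (1 s3)
    note H3 = 1
    have r3: "rg s3 k = rg s k" if "k \<in> {0, 1, 5, 6, 7, 8, 9, 30, 31, 34, 39}" for k
    proof -
     have "rg s3 k = rg s2 k" by (rule H3(2)) (use that in \<open>elim insertE emptyE; simp\<close>)
     moreover have "rg s2 k = rg s k" by (rule r2) (use that in blast)
     ultimately show ?thesis by simp
    qed
    have a3: "mm s3 a = mm s a" if "a \<in> {0, 1, 2, 3, 4, 34}" for a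
    proof -
     have "mm s3 a = mm s2 a" by (rule H3(3)) (use that in \<open>elim insertE emptyE; simp\<close>)
     moreover have "mm s2 a = mm s a" by (rule a2) (use that in blast)
     ultimately show ?thesis by simp
    qed
    have g3: "glob s3" by (rule glob_frame[OF D(1) r3 a3]) auto
    have i3: "inp s3" using D(2) a3 by (simp add: inp_def)
    have c3: "cells_ext (mm s) (mm s3) (rg s 32)" using cells_ext_trans[OF c2(3) _ c2(2)] H3(1) by blast
    have n3: "rg s 32 \<le> rg s3 32" "rg s3 32 \<le> rg s 32 + 3 * N2" "rg s3 33 = ns + 2 ^ K + 2"
     using c2 H3(1) by simp_all
    have s3: "mm s3 a i = mm s a i" if "a \<in> {11..15}" "i < ns \<or> ns + 2 ^ K + 2 \<le> i" for a i
    proof -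
     have "mm s3 a i = mm s2 a i" using H3(1) that by auto
     moreover have "mm s2 a i = mm s a i" using H2(1) that by auto
     ultimately show ?thesis by simp
    qed
    have t3: "mm s3 a u = mm s a u" if "a \<in> {6, 7, 8, 9, 10, 40, 53}" "u ~= v" for a u
    proof (cases "a \<in> {40, 53}")
     case True
     then have "mm s3 a u = mm s2 a u" using H3(1) that(2) by blast
     then show ?thesis using a2[of a] True by auto
    next
     case False
     then have "a \<in> {6, 7, 8, 9, 10}" using that(1) by blast
     then have "mm s2 a u = mm s a u" using H2(1) that(2) by blast
     moreover have "mm s3 a = mm s2 a" by (rule H3(3)) (use \<open>a \<in> {6, 7, 8, 9, 10}\<close> in auto)
     ultimately show ?thesis by simp
    qed
    have ve: "verts_ext (mm s) (mm s3) (rg s 32) (rg s 33) v"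
     unfolding verts_ext_def ns_def[symmetric]
    proof (intro conjI ballI allI impI)
     show "mm s3 a i = mm s a i" if "a \<in> {11..15}" "i < ns \<or> ns + 2 ^ K + 2 \<le> i" for a i by (rule s3[OF that])
     show "mm s3 a u = mm s a u" if "a \<in> {6, 7, 8, 9, 10, 40, 53}" "u ~= v" for a u by (rule t3[OF that])
    qed (rule c3)
    have nn: "rg s 33 \<le> rg s3 33" using n3(3) ns_def by linarith
    have vo: "vert_ok (mm s3) (rg s3 32) (rg s3 33) X (4 ^ rk u) (ex u) u" if "u \<in> insert v A" for u
    proof (cases "u = v")
     case True
     then show ?thesis using H3(1) by blast
    next
     case False
     then have "u \<in> A" using that by blast
     from vert_ok_ext[OF D(4)[OF this] ve n3(1) nn False] show ?thesis .
    qed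
    have fin: "finite A" using D(3) finite_subset by blast
    have card: "card (insert v A) = card A + 1" using fin v(2) by simp
    have "dinv (insert v A) s3"
     unfolding dinv_def card
    proof (intro conjI)
     show "rg s3 33 = (card A + 1) * (2 ^ K + 2)" using n3(3) D(5) by (simp add: ns_def)
     show "3 \<le> rg s3 32" using n3(1) D(6) by linarith
     show "rg s3 32 \<le> 3 + (card A + 1) * (3 * N2)"
     proof -
      have "(card A + 1) * (3 * N2) = card A * (3 * N2) + 3 * N2" by (simp only: add_mult_distrib mult_1_left)
      moreover have "rg s3 32 \<le> 3 + card A * (3 * N2) + 3 * N2"
       using le_trans[OF n3(2) add_right_mono[OF D(7)]] .
      ultimately show ?thesis by (simp only: add.assoc)
     qed
     show "rep (mm s3) X 2 CL" by (rule rep_ext[OF D(8) _ c3]) (use D(6) in linarith)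
     show "\<forall>a \<in> {11..15}. \<forall>i \<ge> rg s3 33. mm s3 a i = 0"
     proof (intro ballI allI impI)
      fix a i :: nat assume x: "a \<in> {11..15}" "rg s3 33 \<le> i"
      then have "mm s3 a i = mm s a i" using s3 n3(3) by simp
      then show "mm s3 a i = 0" using D(9)[OF x(1), of i] x(2) nn by simp
     qed
    qed (use g3 i3 D(3) v(1) vo in auto)
    moreover have "tm s3 \<le> tm s + 1000 * (N2 * TT)"
    proof -
     have "2 ^ K * K \<le> N2 * TT" using TT(2) by (intro mult_le_mono) simp_all
     then have "tm s3 \<le> tm s2 + 180 * (N2 * TT)" using H3(1) by linarith
     moreover have "tm s2 \<le> tm s + 562 * (N2 * TT) + 6" using H2(1) by blast
     moreover have "1 \<le> N2 * TT" using TT(1) NT by linarith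
     ultimately show ?thesis by linarith
    qed
    ultimately show ?case by blast
   qed
  qed
 qed
qed

end

section \<open>The preprocessing program: traversal of the DAG\<close>

definition push :: "nat => com" where
 "push r = (Store 38 35 r) ;; Add 35 35 ONE"

definition finish :: com where
 "finish = process ;; Store 5 40 ONE ;; Sub 35 35 ONE"

text \<open>The top of the stack is finished once both children are processed; until then an
  unprocessed child is pushed and the vertex is looked at again later.\<close>

definition visit :: com where
 "visit = (Sub 20 35 ONE ;; Load 40 38 20 ;; Load 43 0 40) ;;
   Cond ONE 43 ((Load 41 1 40 ;; Load 42 2 40 ;; Load 20 5 41 ;; Load 21 5 42) ;;
    Cond ZERO 20 (Cond ZERO 21 finish (push 42)) (push 41)) finish"

definition next_root :: com where
 "next_root = (Load 20 5 36) ;; Cond ZERO 20 Skip (push 36) ;; Add 36 36 ONE"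

definition dfs_step :: com where
 "dfs_step = Cond ZERO 35 visit next_root"

text \<open>The number of untried roots plus the stack height is 0 exactly when no work is left, so
  one test controls both.\<close>

definition dfs_cond :: com where
 "dfs_cond = (Sub 37 0 36) ;; Add 37 37 35"

definition dfs :: com where
 "dfs = dfs_cond ;; Loop ZERO 37 (dfs_step ;; dfs_cond)"

section \<open>Correctness and time of the traversal\<close>

context graph
begin

text \<open>Ranks increase from the top of the stack to its bottom, so no vertex occurs twice and
  the stack has at most \<open>n - card A\<close> entries.\<close>

definition dstate :: "nat set => nat list => nat => st => bool" where
 "dstate A ss i s \<longleftrightarrow> dinv A s \<and> rg s 35 = length ss \<and> rg s 36 = i \<and> i \<le> n \<and> (\<forall>j < length ss. mm s 38 j = rev ss ! j) \<and>
   set ss \<subseteq> {..<n} - A \<and> sorted_wrt (\<lambda>a b. rk a < rk b) ss \<and> (\<forall>u < n. mm s 5 u = of_bool (u \<in> A)) \<and> (\<forall>u < i. u \<in> A \<or> u \<in> set ss)"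

text \<open>A push lowers it by 1, finishing a vertex by \<open>2 - 1\<close>, and trying a root by
  at least 1. It starts at \<open>3 * n\<close>, which bounds the number of rounds.\<close>

definition dfs_measure :: "nat set \<times> nat list \<times> nat => nat" where
 "dfs_measure g = (case g of (A, ss, i) => 2 * (n - card A) - length ss + (n - i))"

lemma dstateD:
 assumes "dstate A ss i s"
 shows "dinv A s" "rg s 35 = length ss" "rg s 36 = i" "i \<le> n" "j < length ss ==> mm s 38 j = rev ss ! j"
   "set ss \<subseteq> {..<n} - A" "sorted_wrt (\<lambda>a b. rk a < rk b) ss" "u < n ==> mm s 5 u = of_bool (u \<in> A)" "u < i ==> u \<in> A \<or> u \<in> set ss"
proof -
 note p1 = assms[unfolded dstate_def]
 note p2 = p1[THEN conjunct2] note p3 = p2[THEN conjunct2] note p4 = p3[THEN conjunct2] note p5 = p4[THEN conjunct2]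
 note p6 = p5[THEN conjunct2] note p7 = p6[THEN conjunct2] note p8 = p7[THEN conjunct2] note p9 = p8[THEN conjunct2]
 show "dinv A s" "rg s 35 = length ss" "rg s 36 = i" "i \<le> n" "set ss \<subseteq> {..<n} - A" "sorted_wrt (\<lambda>a b. rk a < rk b) ss"
  by (rule p1[THEN conjunct1] p2[THEN conjunct1] p3[THEN conjunct1] p4[THEN conjunct1] p6[THEN conjunct1] p7[THEN conjunct1])+
 show "j < length ss ==> mm s 38 j = rev ss ! j" by (rule p5[THEN conjunct1, rule_format])
 show "u < n ==> mm s 5 u = of_bool (u \<in> A)" by (rule p8[THEN conjunct1, rule_format])
 show "u < i ==> u \<in> A \<or> u \<in> set ss" by (rule p9[rule_format])
qed

lemma dstate_length:
 assumes "dstate A ss i s"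
 shows "finite A" "card A + length ss \<le> n"
proof -
 note d = dstateD[OF assms]
 show f: "finite A" using dinvD(3)[OF d(1)] finite_subset by blast
 have "distinct ss" using d(7) by (induction ss) fastforce+
 then have "length ss = card (set ss)" by (simp add: distinct_card)
 also have "\<dots> \<le> card ({..<n} - A)" using d(6) by (intro card_mono) auto
 also have "\<dots> = n - card A" using dinvD(3)[OF d(1)] f by (simp add: card_Diff_subset)
 finally show "card A + length ss \<le> n" using card_mono[OF _ dinvD(3)[OF d(1)]] by simp
qed

lemma nW: "2 * n + 1 < W"
proof -
 define q where "q = 3 * N2"
 have "n * 2 \<le> n * q" by (intro mult_le_mono2) (simp add: q_def)
 then have "2 * n + 1 \<le> n * q + 8" by linarith
 then have "2 * n + 1 \<le> n * (3 * N2) + 8" unfolding q_def .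
 also have "\<dots> \<le> (n * (3 * N2) + 8) * X" by simp
 finally show ?thesis using NW by (rule le_less_trans)
qed

lemma dinv_dfs:
 assumes "dinv A s" "\<And>r. r \<notin> {20, 21, 35, 36, 37, 40, 41, 42, 43} ==> rg s' r = rg s r" "\<And>a. a \<notin> {5, 38} ==> mm s' a = mm s a"
 shows "dinv A s'"
proof (rule dinv_frame[OF assms(1)])
 show "rg s' r = rg s r" if "r \<in> {0, 1, 5, 6, 7, 8, 9, 30, 31, 32, 33, 34, 39}" for r
  by (rule assms(2)) (use that in \<open>elim insertE emptyE; simp\<close>)
 show "mm s' a = mm s a" if "a \<in> {0..4} \<union> {6..34} \<union> {40, 53}" for a
  by (rule assms(3)) (use that in auto)
qed

lemma dstate_frame:
 assumes "dstate A ss i s" "\<And>r. r \<notin> {20, 21, 37, 40, 41, 42, 43} ==> rg s' r = rg s r" "mm s' = mm s"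
 shows "dstate A ss i s'"
proof -
 have "dinv A s'" by (rule dinv_dfs[OF dstateD(1)[OF assms(1)]]) (use assms(2,3) in simp_all)
 moreover have "rg s' 35 = rg s 35" "rg s' 36 = rg s 36" by (rule assms(2); simp)+
 ultimately show ?thesis using assms(1,3) by (simp add: dstate_def)
qed

lemma wp_push:
 assumes d: "dstate A ss i s" and c: "rg s r = c" "c < n" "c \<notin> A" "\<And>a. a \<in> set ss ==> rk c < rk a" "r ~= 35"
 shows "wp W (push r) (\<lambda>s'. dstate A (c # ss) i s' \<and> tm s' = tm s + 2) s"
proof -
 note D = dstateD[OF d] and gd = globD[OF dinvD(1)[OF dstateD(1)[OF d]]]
 have b: "length ss + 1 < W" using dstate_length(2)[OF d] nW by linarith
 let ?s = "s(|mm := (mm s)(38 := (mm s 38)(length ss := c)), rg := (rg s)(35 := length ss + 1), tm := tm s + 2|)"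
 have "dinv A ?s" by (rule dinv_dfs[OF D(1)]) simp_all
 moreover have "mm ?s 38 j = rev (c # ss) ! j" if "j < length (c # ss)" for j
  using that D(5)[of j] by (auto simp: nth_append less_Suc_eq)
 moreover have seen: "\<forall>u < i. u \<in> A \<or> u \<in> set ss" using D(9) by blast
 ultimately have "dstate A (c # ss) i ?s"
  unfolding dstate_def using D(2-4,6-8) seen c by auto
 then show ?thesis using D(2) c(1,5) gd b by (simp add: push_def)
qed

lemma wp_next_root:
 assumes d: "dstate A [] i s" and i: "i < n"
 shows "wp W next_root (\<lambda>s'. (\<exists>A' ss' i'. dstate A' ss' i' s' \<and> dfs_measure (A', ss', i') < dfs_measure (A, [], i)) \<and> tm s' \<le> tm s + 10) s"
proof -
 note D = dstateD[OF d] and gd = globD[OF dinvD(1)[OF dstateD(1)[OF d]]]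
 define s1 where "s1 = s(|rg := (rg s)(20 := of_bool (i \<in> A)), tm := Suc (Suc (tm s))|)"
 have d1: "dstate A [] i s1" by (rule dstate_frame[OF d]) (simp_all add: s1_def)
 have nx: "dstate A ss (Suc i) (s'(|rg := (rg s')(36 := Suc i), tm := t|))" if "dstate A ss i s'" "i \<in> A \<or> i \<in> set ss" for ss s' t
 proof -
  note E = dstateD[OF that(1)]
  have "dinv A (s'(|rg := (rg s')(36 := Suc i), tm := t|))" by (rule dinv_dfs[OF E(1)]) simp_all
  moreover have "\<forall>u < i. u \<in> A \<or> u \<in> set ss" using E(9) by blast
  ultimately show ?thesis unfolding dstate_def using E(2-8) that(2) i by (auto simp: less_Suc_eq)
 qed
 have iW: "i + 1 < W" using i nW by linarith
 show ?thesis
 proof (cases "i \<in> A")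
  case True
  have "dstate A [] (Suc i) (s1(|rg := (rg s1)(36 := Suc i), tm := Suc (Suc (Suc (tm s)))|))" using nx[OF d1] True by blast
  moreover have "dfs_measure (A, [], Suc i) < dfs_measure (A, [], i)" using i by (simp add: dfs_measure_def)
  ultimately have "\<exists>A' ss' i'. dstate A' ss' i' (s1(|rg := (rg s1)(36 := Suc i), tm := Suc (Suc (Suc (tm s)))|)) \<and> dfs_measure (A', ss', i') < dfs_measure (A, [], i)" by blast
  then show ?thesis using True D(3,8) i gd iW by (simp add: next_root_def s1_def)
 next
  case False
  have P: "wp W (push 36) (\<lambda>s'. dstate A [i] i s' \<and> tm s' = tm s1 + 2) s1"
   by (rule wp_push[OF d1]) (use D(3) i False in \<open>simp_all add: s1_def\<close>)
  have "wp W (push 36) (\<lambda>s'. rg s' 36 = i \<and> rg s' 6 = 1 \<and> (\<exists>A' ss' i'. dstate A' ss' i' (s'(|rg := (rg s')(36 := Suc i), tm := Suc (Suc (tm s'))|)) \<and>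
    dfs_measure (A', ss', i') < dfs_measure (A, [], i)) \<and> tm s' \<le> tm s + 8) s1"
  proof (rule wp_mono[OF P], goal_cases)
   case (1 s')
   have "dstate A [i] (Suc i) (s'(|rg := (rg s')(36 := Suc i), tm := Suc (Suc (tm s'))|))" using nx 1 by simp
   moreover have "dfs_measure (A, [i], Suc i) < dfs_measure (A, [], i)" using i by (simp add: dfs_measure_def)
   moreover have "rg s' 36 = i" "rg s' 6 = 1" using 1 dstateD(3) globD dinvD(1) dstateD(1) by blast+
   ultimately show ?case using 1 by (auto simp: s1_def)
  qed
  then have "wp W (push 36) (\<lambda>s'. rg s' 36 + rg s' 6 < W \<and> (\<exists>A' ss' i'. dstate A' ss' i' (s'(|rg := (rg s')(36 := rg s' 36 + rg s' 6), tm := Suc (Suc (tm s'))|)) \<and>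
    dfs_measure (A', ss', i') < dfs_measure (A, [], i)) \<and> Suc (Suc (tm s')) \<le> tm s + 10) s1"
   by (rule wp_mono) (use iW in simp)
  then show ?thesis using False D(3) D(8)[OF i] gd by (simp add: next_root_def s1_def)
 qed
qed

lemma wp_finish:
 assumes d: "dstate A (v # ss) i s" and v: "1 < kind_code (lb v) ==> lf v \<in> A \<and> rt v \<in> A" and r: "rg s 40 = v"
 shows "wp W finish (\<lambda>s'. (\<exists>A' ss' i'. dstate A' ss' i' s' \<and> dfs_measure (A', ss', i') < dfs_measure (A, v # ss, i)) \<and>
  tm s' \<le> tm s + 1000 * (N2 * (K * K * K)) + 2) s"
proof -
 note D = dstateD[OF d] and L = dstate_length[OF d]
 have vn: "v < n" "v \<notin> A" using D(6) by auto
 have vs: "v \<notin> set ss" using D(7) by auto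
 show ?thesis unfolding finish_def wp_Seq
 proof (rule wp_use[OF wp_process[OF D(1) vn v r]], goal_cases)
  case (2 s1)
  have r1: "rg s1 k = rg s k" if "k \<notin> {20..33} \<union> {41..64} \<union> {70..98}" for k by (rule 2(2)) (use mod_process(1) that in blast)
  have a1: "mm s1 a = mm s a" if "a \<notin> {6..33} \<union> {35, 36, 37, 40, 53}" for a by (rule 2(3)) (use mod_process(2) that in blast)
  have q1: "rg s1 40 = v" "rg s1 35 = Suc (length ss)" "rg s1 36 = i" "rg s1 6 = 1" "mm s1 5 = mm s 5" "mm s1 38 = mm s 38"
   using r1[of 40] r1[of 35] r1[of 36] a1[of 5] a1[of 38] r D(2,3) globD[OF dinvD(1)[OF conjunct1[OF 2(1)]]] by simp_all
  define s2 where "s2 = s1(|mm := (mm s1)(5 := (mm s1 5)(v := 1)), rg := (rg s1)(35 := length ss), tm := Suc (Suc (tm s1))|)"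
  have "dinv (insert v A) s2" by (rule dinv_dfs[OF conjunct1[OF 2(1)]]) (simp_all add: s2_def)
  moreover have "mm s2 38 j = rev ss ! j" if "j < length ss" for j
   using D(5)[of j] that q1 by (simp add: s2_def nth_append)
  moreover have "rg s2 35 = length ss" "rg s2 36 = i" using q1 by (simp_all add: s2_def)
  moreover have "mm s2 5 u = of_bool (u \<in> insert v A)" if "u < n" for u using D(8)[OF that] q1 by (simp add: s2_def)
  moreover have "\<forall>u < i. u \<in> A \<or> u \<in> set (v # ss)" using D(9) by blast
  ultimately have "dstate (insert v A) ss i s2"
   unfolding dstate_def using D(4,6,7) vs by auto
  moreover have "dfs_measure (insert v A, ss, i) < dfs_measure (A, v # ss, i)"
   using L vn by (simp add: dfs_measure_def)
  ultimately show ?case using 2(1) q1 by (auto simp: s2_def)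
 qed
qed

lemma wp_visit:
 assumes d: "dstate A (v # ss) i s"
 shows "wp W visit (\<lambda>s'. (\<exists>A' ss' i'. dstate A' ss' i' s' \<and> dfs_measure (A', ss', i') < dfs_measure (A, v # ss, i)) \<and>
  tm s' \<le> tm s + 1000 * (N2 * (K * K * K)) + 20) s"
proof -
 note D = dstateD[OF d] and gd = globD[OF dinvD(1)[OF dstateD(1)[OF d]]] and L = dstate_length[OF d]
 have vn: "v < n" "v \<notin> A" using D(6) by auto
 let ?k = "kind_code (lb v)"
 have inp: "mm s 0 v = ?k" "1 < ?k ==> mm s 1 v = lf v \<and> mm s 2 v = rt v"
  using dinvD(2)[OF D(1)] vn(1) by (simp_all add: inp_def)
 have top: "mm s 38 (length ss) = v" using D(5)[of "length ss"] nth_append_length[of "rev ss" v "[]"] by simp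
 have meas: "dfs_measure (A, c # v # ss, i) < dfs_measure (A, v # ss, i)" for c using L by (simp add: dfs_measure_def)
 let ?G = "\<lambda>s'. \<exists>A' ss' i'. dstate A' ss' i' s' \<and> dfs_measure (A', ss', i') < dfs_measure (A, v # ss, i)"
 have Gt: "?G s' ==> ?G (s'(|tm := t|))" for s' t
  using dstate_frame[of _ _ _ s' "s'(|tm := t|)"] by (metis (no_types, lifting) st.select_convs(1,2) st.surjective st.update_convs(3))
 let ?T = "1000 * (N2 * (K * K * K))"
 show ?thesis
 proof (cases "1 < ?k")
  case False
  let ?s = "s(|rg := (rg s)(20 := length ss, 40 := v, 43 := ?k), tm := Suc (Suc (Suc (Suc (tm s))))|)"
  have d1: "dstate A (v # ss) i ?s" by (rule dstate_frame[OF d]) simp_all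
  have "wp W finish (\<lambda>s'. ?G s' \<and> tm s' \<le> tm ?s + ?T + 2) ?s" by (rule wp_finish[OF d1]) (use False in simp_all)
  then have "wp W finish (\<lambda>s'. ?G (s'(|tm := Suc (tm s')|)) \<and> Suc (tm s') \<le> tm s + ?T + 20) ?s"
   by (rule wp_mono) (use Gt in auto)
  then show ?thesis using False D(2) top gd inp by (simp add: visit_def)
 next
  case True
  have i: "lf v < n" "rt v < n" "rk (lf v) < rk v" "rk (rt v) < rk v" using inner[OF vn(1) True] by auto
  have kids: "mm s 1 v = lf v" "mm s 2 v = rt v" using inp(2)[OF True] by auto
  define s1 where "s1 = s(|rg := (rg s)(20 := of_bool (lf v \<in> A), 21 := of_bool (rt v \<in> A), 40 := v, 41 := lf v, 42 := rt v, 43 := ?k)|)"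
  have d1: "dstate A (v # ss) i (s1(|tm := t|))" for t by (rule dstate_frame[OF d]) (simp_all add: s1_def)
  have s1': "(s(|rg := (rg s)(20 := length ss, 40 := v, 43 := ?k, 41 := lf v, 42 := rt v, 20 := of_bool (lf v \<in> A), 21 := of_bool (rt v \<in> A)), tm := t|)) = s1(|tm := t|)" for t
   by (simp add: s1_def fun_eq_iff)
  have rk: "rk a \<ge> rk v" if "a \<in> set (v # ss)" for a using D(7) that by auto
  have P1: "wp W (push 41) (\<lambda>s'. ?G (s'(|tm := t' s'|)) \<and> tm s' = t + 2) (s1(|tm := t|))" if "lf v \<notin> A" for t t'
  proof -
   have "wp W (push 41) (\<lambda>s'. dstate A (lf v # v # ss) i s' \<and> tm s' = tm (s1(|tm := t|)) + 2) (s1(|tm := t|))"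
    by (rule wp_push[OF d1]) (use i that le_less_trans rk in \<open>auto simp: s1_def intro: less_le_trans\<close>)
   then show ?thesis by (rule wp_mono) (use meas in \<open>blast intro!: Gt\<close> | simp)+
  qed
  have P2: "wp W (push 42) (\<lambda>s'. ?G (s'(|tm := t' s'|)) \<and> tm s' = t + 2) (s1(|tm := t|))" if "rt v \<notin> A" for t t'
  proof -
   have "wp W (push 42) (\<lambda>s'. dstate A (rt v # v # ss) i s' \<and> tm s' = tm (s1(|tm := t|)) + 2) (s1(|tm := t|))"
    by (rule wp_push[OF d1]) (use i that rk in \<open>auto simp: s1_def intro: less_le_trans\<close>)
   then show ?thesis by (rule wp_mono) (use meas in \<open>blast intro!: Gt\<close> | simp)+
  qed
  have F: "wp W finish (\<lambda>s'. ?G s' \<and> tm s' \<le> t + ?T + 2) (s1(|tm := t|))" if "lf v \<in> A" "rt v \<in> A" for t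
   using wp_finish[OF d1, of t] that by (simp add: s1_def)
  let ?b1 = "Sub 20 35 ONE ;; Load 40 38 20 ;; Load 43 0 40"
  let ?b2 = "Load 41 1 40 ;; Load 42 2 40 ;; Load 20 5 41 ;; Load 21 5 42"
  define t8 where "t8 = Suc (Suc (Suc (Suc (Suc (Suc (Suc (Suc (tm s))))))))"
  have e: "wp W visit Q s \<longleftrightarrow> wp W (Cond ZERO 20 (Cond ZERO 21 finish (push 42)) (push 41)) Q (s1(|tm := t8|))" for Q
   using True D(2) top gd inp kids D(8)[OF i(1)] D(8)[OF i(2)] unfolding visit_def s1'[symmetric] t8_def by simp
  have z: "rg s1 5 = 0" "rg s1 20 = of_bool (lf v \<in> A)" "rg s1 21 = of_bool (rt v \<in> A)" using gd by (simp_all add: s1_def)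
  consider (a) "lf v \<notin> A" | (b) "lf v \<in> A" "rt v \<notin> A" | (c) "lf v \<in> A" "rt v \<in> A" by blast
  then show ?thesis unfolding e
  proof cases
   case a
   have "wp W (push 41) (\<lambda>s'. ?G (s'(|tm := Suc (tm s')|)) \<and> Suc (tm s') \<le> tm s + ?T + 20) (s1(|tm := Suc t8|))"
    by (rule wp_mono[OF P1[OF a, where t' = "\<lambda>s'. Suc (tm s')"]]) (elim conjE, rule conjI, assumption, simp add: t8_def)
   then show "wp W (Cond ZERO 20 (Cond ZERO 21 finish (push 42)) (push 41)) (\<lambda>s'. ?G s' \<and> tm s' \<le> tm s + ?T + 20) (s1(|tm := t8|))"
    using a z by simp
  next
   case b
   have "wp W (push 42) (\<lambda>s'. ?G (s'(|tm := Suc (tm s')|)) \<and> Suc (tm s') \<le> tm s + ?T + 20) (s1(|tm := Suc (Suc t8)|))"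
    by (rule wp_mono[OF P2[OF b(2), where t' = "\<lambda>s'. Suc (tm s')"]]) (elim conjE, rule conjI, assumption, simp add: t8_def)
   then show "wp W (Cond ZERO 20 (Cond ZERO 21 finish (push 42)) (push 41)) (\<lambda>s'. ?G s' \<and> tm s' \<le> tm s + ?T + 20) (s1(|tm := t8|))"
    using b z by simp
  next
   case c
   have "wp W finish (\<lambda>s'. ?G s' \<and> tm s' \<le> tm s + ?T + 20) (s1(|tm := Suc (Suc t8)|))"
    by (rule wp_mono[OF F[OF c]]) (simp add: t8_def)
   then show "wp W (Cond ZERO 20 (Cond ZERO 21 finish (push 42)) (push 41)) (\<lambda>s'. ?G s' \<and> tm s' \<le> tm s + ?T + 20) (s1(|tm := t8|))"
    using c z by simp
  qed
 qed
qed

end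

text \<open>The powers of two are produced by doubling, and register 30 gets the index of the
  accepting bit. For the leaf cell 2 only two entries differ from 0: its leading cell is itself, and
  the second component of the identity map has selector 1.\<close>

definition init :: com where
 "init = (Const 6 1) ;; Mul 7 1 1 20 ;; Mul 8 7 7 20 ;; Const 9 1 ;;
   For 21 8 (Store 34 21 9 ;; Add 9 9 9) ;; Store 34 8 9 ;;
   Mul 20 3 1 22 ;; Add 20 20 4 ;; Mul 30 20 7 22 ;;
   (Add 31 2 2 ;; Add 34 9 6 ;; Const 39 3 ;; Const 20 2 ;; Store 27 20 20 ;;
   Store 30 20 6 ;; Const 32 3)"

definition prep_prog :: com where
 "prep_prog = init ;; dfs"

context graph
begin

lemma wp_dfs_step:
 assumes d: "dstate A ss i s" and c: "0 < n - i + length ss"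
 shows "wp W dfs_step (\<lambda>s'. (\<exists>A' ss' i'. dstate A' ss' i' s' \<and> dfs_measure (A', ss', i') < dfs_measure (A, ss, i)) \<and>
  tm s' \<le> tm s + 1000 * (N2 * (K * K * K)) + 22) s"
proof -
 note D = dstateD[OF d] and gd = globD[OF dinvD(1)[OF dstateD(1)[OF d]]]
 have dt: "dstate A ss i (s(|tm := t|))" for t by (rule dstate_frame[OF d]) simp_all
 have Gt: "\<exists>A' ss' i'. dstate A' ss' i' (s'(|tm := t|)) \<and> dfs_measure (A', ss', i') < k"
  if h: "\<exists>A' ss' i'. dstate A' ss' i' s' \<and> dfs_measure (A', ss', i') < k" for s' t k
 proof -
  obtain A' ss' i' where x: "dstate A' ss' i' s'" "dfs_measure (A', ss', i') < k" using h by blast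
  have "dstate A' ss' i' (s'(|tm := t|))" by (rule dstate_frame[OF x(1)]) simp_all
  then show ?thesis using x(2) by blast
 qed
 let ?s = "s(|tm := Suc (tm s)|)"
 show ?thesis
 proof (cases ss)
  case Nil
  have "wp W next_root (\<lambda>s'. (\<exists>A' ss' i'. dstate A' ss' i' s' \<and> dfs_measure (A', ss', i') < dfs_measure (A, [], i)) \<and> tm s' \<le> tm ?s + 10) ?s"
   by (rule wp_next_root) (use dt c Nil in simp_all)
  then have "wp W next_root (\<lambda>s'. (\<exists>A' ss' i'. dstate A' ss' i' (s'(|tm := Suc (tm s')|)) \<and> dfs_measure (A', ss', i') < dfs_measure (A, ss, i)) \<and>
   Suc (tm s') \<le> tm s + 1000 * (N2 * (K * K * K)) + 22) ?s"
   by (rule wp_mono) (elim conjE, rule conjI, rule Gt, simp_all add: Nil)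
  then show ?thesis using Nil D(2) gd by (simp add: dfs_step_def)
 next
  case (Cons v ss')
  have "wp W visit (\<lambda>s'. (\<exists>A' ss'' i'. dstate A' ss'' i' s' \<and> dfs_measure (A', ss'', i') < dfs_measure (A, v # ss', i)) \<and>
   tm s' \<le> tm ?s + 1000 * (N2 * (K * K * K)) + 20) ?s"
   by (rule wp_visit) (use dt Cons in simp)
  then have "wp W visit (\<lambda>s'. (\<exists>A' ss'' i'. dstate A' ss'' i' s' \<and> dfs_measure (A', ss'', i') < dfs_measure (A, ss, i)) \<and>
   tm s' \<le> tm s + 1000 * (N2 * (K * K * K)) + 22) ?s"
   unfolding Cons by (rule wp_mono) simp
  then show ?thesis using Cons D(2) gd by (simp add: dfs_step_def)
 qed
qed

lemma wp_dfs_cond: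
 assumes d: "dstate A ss i s"
 shows "wp W dfs_cond (\<lambda>s'. dstate A ss i s' \<and> rg s' 37 = n - i + length ss \<and> tm s' = tm s + 2) s"
proof -
 note D = dstateD[OF d] and gd = globD[OF dinvD(1)[OF dstateD(1)[OF d]]]
 let ?s = "s(|rg := (rg s)(37 := n - i + length ss), tm := Suc (Suc (tm s))|)"
 have "n - i + length ss < W" using dstate_length(2)[OF d] nW by linarith
 moreover have "dstate A ss i ?s" by (rule dstate_frame[OF d]) simp_all
 ultimately show ?thesis using D(2,3) gd by (simp add: dfs_cond_def)
qed

lemma wp_dfs:
 assumes d: "dstate {} [] 0 s"
 shows "wp W dfs (\<lambda>s'. dinv {..<n} s' \<and> tm s' \<le> tm s + 3 * n * (1000 * (N2 * (K * K * K)) + 30) + 10) s"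
proof -
 define C where "C = 1000 * (N2 * (K * K * K)) + 30"
 define T where "T = tm s + 2 + 3 * n * C"
 \<comment> \<open>Amortized time: each unit of the measure prepays \<open>C\<close> steps.\<close>
 let ?I = "\<lambda>g s'. (case g of (A, ss, i) => dstate A ss i s' \<and> rg s' 37 = n - i + length ss) \<and> tm s' + dfs_measure g * C \<le> T"
 show ?thesis unfolding dfs_def C_def[symmetric] wp_Seq_fun[of _ dfs_cond]
 proof (rule wp_use[OF wp_dfs_cond[OF d]], goal_cases)
  case (1 s1)
  show ?case
  proof (rule wp_Loop_ghost[where Inv = ?I and f = dfs_measure and g = "({}, [], 0)"], goal_cases)
   case 1
   have "dfs_measure ({}, [], 0) = 3 * n" by (simp add: dfs_measure_def)
   then show ?case using \<open>_ \<and> _ \<and> tm s1 = tm s + 2\<close> by (simp add: T_def)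
  next
   case (2 g s2)
   obtain A ss i where g: "g = (A, ss, i)" by (cases g)
   have d2: "dstate A ss i s2" "rg s2 37 = n - i + length ss" "tm s2 + dfs_measure (A, ss, i) * C \<le> T" using 2(1) g by auto
   have z: "rg s2 5 = 0" using globD[OF dinvD(1)[OF dstateD(1)[OF d2(1)]]] by simp
   have dt: "dstate A ss i (s2(|tm := Suc (tm s2)|))" by (rule dstate_frame[OF d2(1)]) simp_all
   have pos: "0 < n - i + length ss" using 2(2) d2(2) z by simp
   show ?case unfolding wp_Seq
   proof (rule wp_use[OF wp_dfs_step[OF dt pos]], goal_cases)
    case (1 s3)
    obtain A' ss' i' where x: "dstate A' ss' i' s3" "dfs_measure (A', ss', i') < dfs_measure (A, ss, i)" using 1(1) by blast
    have t3: "tm s3 \<le> tm s2 + C - 7" using 1(1) by (simp add: C_def)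
    show ?case
    proof (rule wp_mono[OF wp_dfs_cond[OF x(1)]], goal_cases)
     case (1 s4)
     have d4: "dstate A' ss' i' (s4(|tm := Suc (tm s4)|))" by (rule dstate_frame[OF conjunct1[OF 1]]) simp_all
     have "Suc (dfs_measure (A', ss', i')) * C \<le> dfs_measure (A, ss, i) * C" using x(2) by (intro mult_le_mono1) simp
     then have "dfs_measure (A', ss', i') * C + C \<le> dfs_measure (A, ss, i) * C" by simp
     moreover have "7 \<le> C" by (simp add: C_def)
     ultimately have "Suc (tm s4) + dfs_measure (A', ss', i') * C \<le> T" using 1 t3 d2(3) by linarith
     then have "?I (A', ss', i') (s4(|tm := Suc (tm s4)|))" using d4 1 by simp
     then show ?case using x(2) g by blast
    qed
   qed
  next
   case (3 g s2)
   obtain A ss i where g: "g = (A, ss, i)" by (cases g)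
   have d2: "dstate A ss i s2" "rg s2 37 = n - i + length ss" "tm s2 \<le> T" using 3(1) g by auto
   note D = dstateD[OF d2(1)]
   have z: "rg s2 5 = 0" using globD[OF dinvD(1)[OF D(1)]] by simp
   have "n - i + length ss = 0" using 3(2) d2(2) z by simp
   then have "length ss = 0" "i = n" using D(4) by linarith+
   then have e: "ss = []" "i = n" by simp_all
   have "A = {..<n}" using D(9) e dinvD(3)[OF D(1)] by auto
   then have "dinv {..<n} (s2(|tm := Suc (Suc (tm s2))|))" using dinv_dfs[OF D(1), of "s2(|tm := Suc (Suc (tm s2))|)"] by simp
   then show ?case using d2(3) by (simp add: T_def)
  qed
 qed
qed

lemma wp_init:
 assumes r: "rg s 0 = n" "rg s 1 = m" "rg s 2 = \<sigma>" "rg s 3 = q0 M" "rg s 4 = qf M" "\<And>r. 5 \<le> r ==> rg s r = 0"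
  and a: "\<And>a i. 5 \<le> a ==> mm s a i = 0" and i: "inp s"
  and d: "\<forall>p < m. \<forall>t < m. \<forall>q < m. mm s 3 ((p * m + t) * m + q) = of_bool ((p, t, q) \<in> delta M)"
  and io: "\<forall>x < \<sigma>. \<forall>b. \<forall>q < m. mm s 4 (q * (2 * \<sigma>) + 2 * x + of_bool b) = of_bool (q \<in> iota M (x, b))"
 shows "wp W init (\<lambda>s'. dstate {} [] 0 s' \<and> tm s' \<le> tm s + 60 * K + 60) s"
proof -
 have mW: "m < W" "m\<^sup>2 < W" "K < W" "3 < W" "2 ^ K + 1 < W" "m \<le> K" "m\<^sup>2 \<le> K" using bounds KW by linarith+
 have K2: "m\<^sup>2 * m\<^sup>2 = K" by (rule bounds)
 have q: "q0 M * m + qf M < m\<^sup>2" using mult_add_less[OF q_less] by (simp add: power2_eq_square)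
 have "(q0 M * m + qf M) * m\<^sup>2 + 0 < m\<^sup>2 * m\<^sup>2" by (rule mult_add_less[OF q]) (use m_pos in simp)
 then have qm: "q0 M * m < W" "q0 M * m + qf M < W" "(q0 M * m + qf M) * m\<^sup>2 < W" using q mW unfolding K2 by linarith+
 have "1 * (\<sigma> + 1) \<le> m * (\<sigma> + 1)" using m_pos by (intro mult_le_mono1) simp
 then have sg: "\<sigma> + \<sigma> < W" using sW by simp
 let ?Q = "\<lambda>s'. dstate {} [] 0 s' \<and> tm s' \<le> tm s + 60 * K + 60" and ?pb = "Store 34 21 9 ;; Add 9 9 9"
 let ?rest = "Store 34 8 9 ;; Mul 20 3 1 22 ;; Add 20 20 4 ;; Mul 30 20 7 22 ;;
  (Add 31 2 2 ;; Add 34 9 6 ;; Const 39 3 ;; Const 20 2 ;; Store 27 20 20 ;;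
   Store 30 20 6 ;; Const 32 3)"
 have loop: "wp W (For 21 8 ?pb) (wp W ?rest ?Q) s4"
  if r4: "\<And>r. r \<notin> {6, 7, 8, 9, 20} ==> rg s4 r = rg s r" "rg s4 6 = 1" "rg s4 7 = m\<^sup>2" "rg s4 8 = K" "rg s4 9 = 1"
   and s4: "mm s4 = mm s" "tm s4 \<le> tm s + 8 * K + 10" for s4
 proof -
  have "wp W (For 21 8 ?pb) (\<lambda>s'. (rg s' 9 = 2 ^ rg s4 8 \<and> (\<forall>i < rg s4 8. mm s' 34 i = 2 ^ i)) \<and> tm s' \<le> tm s4 + rg s4 8 * (2 + 3) + 3) s4"
  proof (rule wp_For[where Inv = "\<lambda>k s'. rg s' 9 = 2 ^ k \<and> (\<forall>i<k. mm s' 34 i = 2 ^ i)"])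
   fix k and s' :: st assume k: "k < rg s4 8" and I: "rg s' 9 = 2 ^ k \<and> (\<forall>i<k. mm s' 34 i = 2 ^ i)" and i: "rg s' 21 = k"
   have "(2::nat) ^ Suc k \<le> 2 ^ K" using k r4(4) by (intro power_increasing) simp_all
   then have "(2::nat) ^ k + 2 ^ k < W" using KW by simp
   then show "wp W ?pb (\<lambda>s''. (rg s'' 9 = 2 ^ Suc k \<and> (\<forall>i<Suc k. mm s'' 34 i = 2 ^ i)) \<and> tm s'' \<le> tm s' + 2) s'"
    using I i by (simp add: less_Suc_eq)
  qed (use r4 mW in simp_all)
  then show ?thesis
  proof (rule wp_use, goal_cases)
   case (1 s5)
   have r5: "rg s5 k = rg s4 k" if "k \<notin> {9, 21}" for k using 1(2)[of k] that by simp
   have a5: "mm s5 a = mm s a" if "a ~= 34" for a using 1(3) s4 that by simp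
   have x5: "rg s5 0 = n" "rg s5 1 = m" "rg s5 2 = \<sigma>" "rg s5 3 = q0 M" "rg s5 4 = qf M" "rg s5 5 = 0" "rg s5 6 = 1" "rg s5 7 = m\<^sup>2"
    "rg s5 8 = K" "rg s5 9 = 2 ^ K" "rg s5 33 = 0" "rg s5 35 = 0" "rg s5 36 = 0" "\<forall>i < K. mm s5 34 i = 2 ^ i"
    using 1(1) r5 r4 r by simp_all
   have "dstate {} [] 0 s'" if s': "s' = s5(|mm := g, rg := f, tm := k|)"
    and f: "\<And>j. j \<notin> {20, 22, 30, 31, 32, 34, 39} ==> f j = rg s5 j" "f 30 = (q0 M * m + qf M) * m\<^sup>2" "f 31 = \<sigma> + \<sigma>"
     "f 32 = 3" "f 34 = 2 ^ K + 1" "f 39 = 3"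
    and g: "\<And>a. a \<notin> {27, 30, 34} ==> g a = mm s5 a" "g 27 = (mm s5 27)(2 := 2)" "g 30 = (mm s5 30)(2 := 1)" "g 34 = (mm s5 34)(K := 2 ^ K)"
    for f g k s'
   proof -
    have aa: "g a = mm s a" if "a \<notin> {27, 30, 34}" for a using g(1)[OF that] a5 that by simp
    have z: "g a i = 0" if "5 \<le> a" "a \<notin> {27, 30, 34}" for a i using aa[OF that(2)] a[OF that(1)] by simp
    have "rep g X 2 CL" using z g a5 a by (simp add: hdr_def mapat_def idm_def)
    moreover have "glob s'"
     unfolding glob_def s' using f g(4) x5 aa[of 3] aa[of 4] d io by (auto simp: idx_def)
    moreover have "inp s'" unfolding s' using i aa[of 0] aa[of 1] aa[of 2] by (simp add: inp_def)
    moreover have "\<forall>a \<in> {11..15}. \<forall>i. g a i = 0" using z by auto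
    ultimately show ?thesis unfolding dstate_def dinv_def using s' f x5 z by simp
   qed
   note D = this
   show ?case using x5 mW qm sg 1(1) s4(2) r4(4) by (simp add: wp_Mul) (rule D[OF refl]; simp)
  qed
 qed
 show ?thesis
  unfolding init_def using r mW K2 by (simp add: wp_Mul power2_eq_square) (rule loop[simplified], auto simp: power2_eq_square)
qed

end

section \<open>Unfoldings of a binary DAG\<close>

context
 fixes D :: "(nat, nat fsym) dag" and \<sigma> n :: nat
 assumes slp: "fslp {..<\<sigma>} D" and vs: "dverts D = {..<n}"
begin

definition succs :: "(nat \<times> nat) set" where
 "succs = {(v, w). \<exists>s. (v, s, w) \<in> dedges D}"

lemma dagD: "dedges D \<subseteq> dverts D \<times> UNIV \<times> dverts D" "acyclic succs"
 "v < n ==> is_dag_leaf D v \<or> (\<exists>!w. (v, LeftChild, w) \<in> dedges D) \<and> (\<exists>!w. (v, RightChild, w) \<in> dedges D)"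
 using slp vs by (auto simp: fslp_def binary_dag_def succs_def)

lemma succs_less: "(v, w) \<in> succs ==> v < n \<and> w < n"
 using dagD(1) vs by (auto simp: succs_def)

lemma wf_succs: "wf (succs\<inverse>)"
proof (rule finite_acyclic_wf_converse)
 show "finite succs" by (rule finite_subset[of _ "{..<n} \<times> {..<n}"]) (use succs_less in auto)
qed (rule dagD(2))

text \<open>Justifies the definite description in \<open>unfolding_from\<close>.\<close>

lemma unfolds_det: "unfolds_to D v e ==> unfolds_to D v e' ==> e = e'"
proof (induction arbitrary: e' rule: unfolds_to.induct)
 case (1 v)
 from 1(3) show ?case
 proof cases
  case 1
  then show ?thesis by simp
 next
  case (2 w1 w2 e1 e2)
  then show ?thesis using \<open>is_dag_leaf D v\<close> by (auto simp: is_dag_leaf_def)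
 qed
next
 case (2 v w1 w2 e1 e2)
 have v: "v < n" using succs_less[of v w1] 2(1) by (auto simp: succs_def)
 have nl: "\<not> is_dag_leaf D v" using 2(1) by (auto simp: is_dag_leaf_def)
 note u = dagD(3)[OF v]
 from 2(7) show ?case
 proof cases
  case 1
  then show ?thesis using nl by simp
 next
  case (2 w1' w2' e1' e2')
  have "w1' = w1" "w2' = w2" using u nl 2(2,3) \<open>(v, LeftChild, w1) \<in> dedges D\<close> \<open>(v, RightChild, w2) \<in> dedges D\<close> by blast+
  then show ?thesis using 2 \<open>\<And>e'. unfolds_to D w1 e' ==> e1 = e'\<close> \<open>\<And>e'. unfolds_to D w2 e' ==> e2 = e'\<close> by simp
 qed
qed

lemma unfolds_ex: "v < n ==> \<exists>e. unfolds_to D v e"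
proof (induction v rule: wf_induct_rule[OF wf_succs])
 case (1 v)
 show ?case
 proof (cases "is_dag_leaf D v")
  case True
  then show ?thesis using 1(2) vs unfolds_to.intros(1)[of v D] by blast
 next
  case False
  then obtain w1 w2 where w: "(v, LeftChild, w1) \<in> dedges D" "(v, RightChild, w2) \<in> dedges D" using dagD(3)[OF 1(2)] by blast
  then have "(w1, v) \<in> succs\<inverse>" "(w2, v) \<in> succs\<inverse>" by (auto simp: succs_def)
  moreover from this have "w1 < n" "w2 < n" using succs_less by auto
  ultimately show ?thesis using 1(1) unfolds_to.intros(2)[OF w] by blast
 qed
qed

lemma unfolding_eq: "unfolds_to D v e ==> unfolding_from D v = e"
 unfolding unfolding_from_def using unfolds_det by blast

lemma unfolds_from: "v < n ==> unfolds_to D v (unfolding_from D v)"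
 using unfolds_ex unfolding_eq by metis

lemma eval_ok: "v < n ==> eval_fexp (unfolding_from D v) ~= None"
 using slp vs by (auto simp: fslp_def)

text \<open>The number of vertices properly below \<open>v\<close>: it is at most \<open>n\<close>
  and, by acyclicity, decreases along edges.\<close>

definition rank :: "nat => nat" where
 "rank v = card (succs\<^sup>+ `` {v})"

lemma rank_finite: "succs\<^sup>+ `` {v} \<subseteq> {..<n}"
proof
 fix w assume "w \<in> succs\<^sup>+ `` {v}"
 then have "(v, w) \<in> succs\<^sup>+" by simp
 then show "w \<in> {..<n}" by (induction rule: trancl_induct) (use succs_less in auto)
qed

lemma rank_le: "rank v \<le> n"
 unfolding rank_def using card_mono[OF _ rank_finite[of v]] by simp

lemma rank_less: "(v, w) \<in> succs ==> rank w < rank v"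
proof -
 assume e: "(v, w) \<in> succs"
 have "succs\<^sup>+ `` {w} \<subset> succs\<^sup>+ `` {v}"
 proof
  show "succs\<^sup>+ `` {w} \<subseteq> succs\<^sup>+ `` {v}" using e by (auto intro: trancl_into_trancl2)
  have "w \<in> succs\<^sup>+ `` {v}" "w \<notin> succs\<^sup>+ `` {w}" using e dagD(2) by (auto simp: acyclic_def)
  then show "succs\<^sup>+ `` {w} ~= succs\<^sup>+ `` {v}" by blast
 qed
 then show ?thesis unfolding rank_def using finite_subset[OF rank_finite] by (intro psubset_card_mono) auto
qed

lemma leaf_facts:
 assumes "v < n" "kind_code (dlabel D v) \<le> 1"
 shows "unfolding_from D v = BLeaf (dlabel D v) \<and> set_fsym (dlabel D v) \<subseteq> {..<\<sigma>}"
proof -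
 have s: "set_fsym (dlabel D v) \<subseteq> {..<\<sigma>}" using slp vs assms(1) by (auto simp: fslp_def)
 from unfolds_from[OF assms(1)] show ?thesis
 proof cases
  case 1
  then show ?thesis using s by simp
 next
  case (2 w1 w2 e1 e2)
  then have "eval_fexp (BNode (dlabel D v) e1 e2) ~= None" using eval_ok[OF assms(1)] by simp
  then show ?thesis using assms(2) by (cases "dlabel D v") auto
 qed
qed

lemma inner_facts:
 assumes "v < n" "1 < kind_code (dlabel D v)"
 defines "w1 \<equiv> child D LeftChild v" and "w2 \<equiv> child D RightChild v"
 shows "unfolding_from D v = BNode (dlabel D v) (unfolding_from D w1) (unfolding_from D w2) \<and> w1 < n \<and> w2 < n \<and>
  rank w1 < rank v \<and> rank w2 < rank v"
proof -
 from unfolds_from[OF assms(1)] show ?thesis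
 proof cases
  case 1
  then have "eval_fexp (BLeaf (dlabel D v)) ~= None" using eval_ok[OF assms(1)] by simp
  then show ?thesis using assms(2) by (cases "dlabel D v") auto
 next
  case (2 x1 x2 e1 e2)
  have nl: "\<not> is_dag_leaf D v" using 2(2) by (auto simp: is_dag_leaf_def)
  have "\<exists>!w. (v, LeftChild, w) \<in> dedges D" "\<exists>!w. (v, RightChild, w) \<in> dedges D" using dagD(3)[OF assms(1)] nl by auto
  then have w: "w1 = x1" "w2 = x2" unfolding w1_def w2_def child_def using 2(2,3) by (auto intro: the1_equality)
  have "(v, x1) \<in> succs" "(v, x2) \<in> succs" using 2 by (auto simp: succs_def)
  then show ?thesis unfolding w using 2(1) unfolding_eq[OF 2(4)] unfolding_eq[OF 2(5)] rank_less succs_less by simp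
 qed
qed

end

section \<open>Numerical bounds\<close>

text \<open>Each quantity is at most 2 to the power of a linear form in \<open>n\<close>,
  \<open>K\<close> and \<open>L\<close>; 40 is a generous common factor.\<close>

lemma word_bounds:
 fixes S L K n m \<sigma> w :: nat
 assumes "n \<le> S" "1 \<le> K" "m \<le> K" "\<sigma> < 2 ^ L" and w: "w = 40 * (S + K + L)"
 defines "N2 \<equiv> (2 ^ K + 1) * (2 ^ K + 1 :: nat)"
 shows "2 ^ K * 16 < (2::nat) ^ w" "4 * m * (\<sigma> + 1) < 2 ^ w"
  "(n * (3 * N2) + 8) * 4 ^ n < 2 ^ w" "(2 * 2 ^ n + 3) * (n * (3 * N2) + 8) + (n * (3 * N2) + 8) < 2 ^ w"
  "n < 2 ^ w" "m < 2 ^ w" "\<sigma> < 2 ^ w" "3 < (2::nat) ^ w"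
proof -
 have p: "(2::nat) ^ a < 2 ^ w" if "a < w" for a using that by simp
 have e: "2 ^ K * 16 = (2::nat) ^ (K + 4)" by (simp add: power_add)
 show "2 ^ K * 16 < (2::nat) ^ w" unfolding e by (rule p) (use assms(2) w in simp)
 have "m * (\<sigma> + 1) \<le> 2 ^ K * 2 ^ L"
  using assms(3,4) less_exp[of K] by (intro mult_le_mono) linarith+
 then have "4 * m * (\<sigma> + 1) \<le> 2 ^ (2 + K + L)" by (simp add: power_add)
 also have "\<dots> < 2 ^ w" by (rule p) (use assms(2) w in simp)
 finally show "4 * m * (\<sigma> + 1) < 2 ^ w" .
 have k1: "2 ^ K + 1 \<le> (2::nat) ^ (K + 1)" by simp
 have "N2 \<le> 2 ^ (K + 1) * 2 ^ (K + 1)" unfolding N2_def by (rule mult_le_mono[OF k1 k1])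
 also have "\<dots> = 2 ^ (2 * K + 2)" unfolding power_add[symmetric] by (rule arg_cong[where f = "(^) 2"]) simp
 finally have "3 * N2 \<le> 4 * 2 ^ (2 * K + 2)" by linarith
 then have "n * (3 * N2) \<le> 2 ^ n * 2 ^ (2 * K + 4)" using less_exp[of n] by (intro mult_le_mono) (simp_all add: power_add)
 moreover have "(8::nat) \<le> 2 ^ n * 2 ^ (2 * K + 4)"
 proof -
  have "(2::nat) ^ 3 \<le> 2 ^ (n + (2 * K + 4))" by (rule power_increasing) simp_all
  then show ?thesis by (simp add: power_add)
 qed
 ultimately have "n * (3 * N2) + 8 \<le> 2 * (2 ^ n * 2 ^ (2 * K + 4))" by linarith
 also have "\<dots> = 2 ^ (n + 2 * K + 5)" by (simp add: power_add)
 finally have Q: "n * (3 * N2) + 8 \<le> 2 ^ (n + 2 * K + 5)" .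
 have "(n * (3 * N2) + 8) * 4 ^ n \<le> 2 ^ (n + 2 * K + 5) * 2 ^ (2 * n)"
  using Q by (intro mult_le_mono) (simp_all add: power_mult)
 also have "\<dots> = 2 ^ (3 * n + 2 * K + 5)" by (simp add: power_add[symmetric])
 also have "\<dots> < 2 ^ w" by (rule p) (use assms(1,2) w in simp)
 finally show "(n * (3 * N2) + 8) * 4 ^ n < 2 ^ w" .
 have "(a + 3) * q + q = (a + 4) * q" for a q :: nat by (simp add: algebra_simps)
 then have "(2 * 2 ^ n + 3) * (n * (3 * N2) + 8) + (n * (3 * N2) + 8) = (2 * 2 ^ n + 4) * (n * (3 * N2) + 8)" .
 also have "\<dots> \<le> 2 ^ (n + 3) * 2 ^ (n + 2 * K + 5)"
 proof (rule mult_le_mono[OF _ Q])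
  have "(1::nat) \<le> 2 ^ n" by simp
  then have "2 * 2 ^ n + 4 \<le> 8 * (2 ^ n :: nat)" by linarith
  then show "2 * 2 ^ n + 4 \<le> (2::nat) ^ (n + 3)" by (simp add: power_add)
 qed
 also have "\<dots> = 2 ^ (2 * n + 2 * K + 8)" by (simp add: power_add[symmetric])
 also have "\<dots> < 2 ^ w" by (rule p) (use assms(1,2) w in simp)
 finally show "(2 * 2 ^ n + 3) * (n * (3 * N2) + 8) + (n * (3 * N2) + 8) < 2 ^ w" .
 have "n \<le> w" "m \<le> w" using assms(1,3) w by simp_all
 then show "n < 2 ^ w" "m < 2 ^ w" using less_exp[of w] by linarith+
 have "(2::nat) ^ L \<le> 2 ^ w" by (rule power_increasing) (use w in simp_all)
 then show "\<sigma> < 2 ^ w" using assms(4) by linarith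
 have "(2::nat) ^ 2 \<le> 2 ^ w" by (rule power_increasing) (use assms(2) w in simp_all)
 then show "3 < (2::nat) ^ w" by simp
qed

lemma time_bound:
 fixes S K n :: nat
 assumes "n \<le> S" "1 \<le> K"
 defines "N2 \<equiv> (2 ^ K + 1) * (2 ^ K + 1 :: nat)"
 shows "60 * K + 60 + (3 * n * (1000 * (N2 * (K * K * K)) + 30) + 10) \<le> max 1 S * 2 ^ (20 * K)"
proof -
 have c: "(2::nat) ^ a \<le> (2 ^ K) ^ a" for a
 proof -
  have "(2::nat) ^ a \<le> 2 ^ (K * a)" by (rule power_increasing) (use assms(2) in simp_all)
  then show ?thesis by (simp add: power_mult)
 qed
 \<comment> \<open>With \<open>z = 2 ^ K\<close>, \<open>N2\<close> takes four factors
   \<open>z\<close> and \<open>K * K * K\<close> takes three; the constant 3090 is below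
   \<open>2 ^ 12 \<le> z ^ 12\<close>, and one more \<open>z\<close> pays for adding two such terms.
   Together these are 20.\<close>
 define z where "z = (2::nat) ^ K"
 have z: "K \<le> z" "2 \<le> z" unfolding z_def using less_exp[of K] c[of 1] by simp_all
 have "N2 * (K * K * K) \<le> (z * z * (z * z)) * (z * z * z)"
 proof (rule mult_le_mono)
  have "2 * z \<le> z * z" using z(2) by (rule mult_le_mono1)
  then have "z + 1 \<le> z * z" using z(2) by linarith
  then show "N2 \<le> z * z * (z * z)" unfolding N2_def z_def[symmetric] by (intro mult_le_mono)
  show "K * K * K \<le> z * z * z" by (intro mult_le_mono z(1))
 qed
 then have a: "N2 * (K * K * K) \<le> z ^ 7" by (simp add: eval_nat_numeral mult.assoc)
 have z12: "4096 \<le> z ^ 12" using c[of 12] unfolding z_def by simp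
 have "1 \<le> z ^ 7" using z by simp
 have "3 * n * (1000 * (N2 * (K * K * K)) + 30) \<le> n * (3090 * z ^ 7)"
 proof -
  have "1000 * (N2 * (K * K * K)) + 30 \<le> 1030 * z ^ 7" using a \<open>1 \<le> z ^ 7\<close> by linarith
  then have "3 * n * (1000 * (N2 * (K * K * K)) + 30) \<le> 3 * n * (1030 * z ^ 7)" by (rule mult_le_mono2)
  then show ?thesis by simp
 qed
 also have "\<dots> \<le> max 1 S * (z ^ 12 * z ^ 7)" using assms(1) z12 by (intro mult_le_mono) simp_all
 finally have 1: "3 * n * (1000 * (N2 * (K * K * K)) + 30) \<le> max 1 S * z ^ 19" by (simp add: power_add[symmetric])
 have "60 * K + 70 \<le> 130 * z" using z assms(2) by linarith
 also have "\<dots> \<le> z ^ 12 * z ^ 7"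
  using z12 self_le_power[of z 7] z by (intro mult_le_mono) simp_all
 also have "\<dots> \<le> max 1 S * z ^ 19" by (simp add: power_add[symmetric])
 finally have 2: "60 * K + 70 \<le> max 1 S * z ^ 19" .
 have "max 1 S * z ^ 19 + max 1 S * z ^ 19 = max 1 S * (2 * z ^ 19)" by simp
 also have "\<dots> \<le> max 1 S * (z * z ^ 19)" using z by (intro mult_le_mono) simp_all
 also have "\<dots> = max 1 S * 2 ^ (20 * K)" unfolding z_def by (simp add: power_mult[symmetric] power_add[symmetric] mult.commute)
 finally show ?thesis using 1 2 by linarith
qed

context graph
begin

text \<open>The empty set is decided by array 40, all other accepted sets form \<open>FS\<close>,
  and the two parts are disjoint. The size bound \<open>2 ^ n\<close> comes from the length of the
  forest.\<close>

lemma query_facts: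
 assumes d: "dinv {..<n} s" and A: "A < n" and F: "eval_fexp (ex A) = Some F" "is_forest F"
 obtains f t LST where "mapat (mm s) 12 (mm s 53 A) f" "map_ok X f" "mm s 40 A = of_bool (acc (mm s 10 A))"
  "mm s 11 (mm s 53 A) = 0 \<and> LST = [] \<or> 0 < mm s 11 (mm s 53 A) \<and> mm s 11 (mm s 53 A) < rg s 32 \<and>
    rep (mm s) X (mm s 11 (mm s 53 A)) t \<and> LST = alls t (ap f (0, 0))"
  "\<forall>xs \<in> set LST. length xs \<le> 2 ^ n"
  "enumerates ((if acc (mm s 10 A) then [[]] else []) @ LST) {P. \<exists>q. (q, P) \<in> G (ex A) (0, 0) \<and> acc q}"
proof -
 let ?e = "ex A" and ?u = "mm s 10 A" and ?c = "mm s 11 (mm s 53 A)"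
 have ok: "eval_fexp ?e ~= None" using F by simp
 have "ty (wd ?e) = 0" using F by (auto simp: wd_def ty_def is_forest_iff)
 then have pos: "pos_ok ?e (0, 0)" by (simp add: pos_ok_def valid_def)
 have v: "vert_ok (mm s) (rg s 32) (rg s 33) X (4 ^ rk A) ?e A" using dinvD(4)[OF d] A by simp
 then have sl: "slot_ok (mm s) (rg s 32) X (4 ^ rk A) (pos_ok ?e) (mm s 53 A) (FS ?e (2 ^ K))"
  and est: "(?u, {}) \<in> G ?e (0, 0)" and efin: "mm s 40 A = of_bool (acc ?u)"
  unfolding vert_ok_def half_ok_def by blast+
 let ?S = "{P. \<exists>q. (q, P) \<in> G ?e (0, 0) \<and> acc q}"
 have S: "?S = (if acc ?u then {{}} else {}) \<union> FS ?e (2 ^ K) (0, 0)"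
 proof -
  have "q = ?u" if "(q, {}) \<in> G ?e (0, 0)" for q using G_unique[OF ok pos that est] .
  then have e: "(\<exists>q. (q, {}) \<in> G ?e (0, 0) \<and> acc q) \<longleftrightarrow> acc ?u" using est by blast
  have l: "q < 2 ^ K" if "(q, P) \<in> G ?e (0, 0)" for q P using G_subset[OF ok that] by blast
  have FS: "P \<in> FS ?e (2 ^ K) (0, 0) \<longleftrightarrow> P ~= {} \<and> (\<exists>q. (q, P) \<in> G ?e (0, 0) \<and> acc q)" for P
   unfolding FS_def ES_def using l by auto
  show ?thesis
  proof (rule set_eqI)
   fix P
   show "P \<in> ?S \<longleftrightarrow> P \<in> (if acc ?u then {{}} else {}) \<union> FS ?e (2 ^ K) (0, 0)"
    using e FS[of P] by (cases "P = {}") auto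
  qed
 qed
 have disj: "(if acc ?u then {{}} else {}) \<inter> FS ?e (2 ^ K) (0, 0) = {}" by (auto simp: FS_def ES_def)
 have en: "enumerates ((if acc ?u then [[]] else []) @ LST) ?S" if "enumerates LST (FS ?e (2 ^ K) (0, 0))" for LST
  unfolding S
 proof (rule enumerates_append[OF _ that disj])
  show "enumerates (if acc ?u then [[]] else []) (if acc ?u then {{}} else {})" by (simp add: enumerates_def)
 qed
 have len: "\<forall>xs \<in> set LST. length xs \<le> 2 ^ n" if e: "enumerates LST (FS ?e (2 ^ K) (0, 0))" for LST
 proof
  fix xs assume xs: "xs \<in> set LST"
  have "set xs \<in> FS ?e (2 ^ K) (0, 0)" "distinct xs" using e xs by (auto simp: enumerates_def)
  then obtain q where "(q, set xs) \<in> G ?e (0, 0)" by (auto simp: FS_def ES_def split: if_splits)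
  then have "set xs \<subseteq> {0..<lc (wd ?e)} \<union> {0..<rc (wd ?e)}" using G_subset[OF ok] mp_all[OF wd_count[OF ok]] by fastforce
  then have "card (set xs) \<le> card ({0..<lc (wd ?e)} \<union> {0..<rc (wd ?e)})" by (intro card_mono) auto
  also have "\<dots> \<le> lc (wd ?e) + rc (wd ?e)" using card_Un_le[of "{0..<lc (wd ?e)}" "{0..<rc (wd ?e)}"] by simp
  also have "\<dots> \<le> 2 ^ rk A" by (rule wd_bound[OF A])
  also have "\<dots> \<le> 2 ^ n" using rk[OF A] by simp
  finally show "length xs \<le> 2 ^ n" using \<open>distinct xs\<close> by (simp add: distinct_card)
 qed
 have YX: "(4::nat) ^ rk A \<le> X" using rk[OF A] by simp
 show ?thesis
 proof (cases "?c = 0")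
  case True
  obtain f where f: "mapat (mm s) 12 (mm s 53 A) f" "map_ok (4 ^ rk A) f" using sl unfolding slot_ok_def by blast
  have "FS ?e (2 ^ K) (0, 0) = {}" by (rule slot_ok_zero[OF sl True pos])
  then have e: "enumerates [] (FS ?e (2 ^ K) (0, 0))" by (simp add: enumerates_Nil)
  show ?thesis
   by (rule that[OF f(1) map_ok_mono[OF f(2) YX] efin _ _ en[OF e]]) (use True in simp_all)
 next
  case False
  obtain f t where f: "mapat (mm s) 12 (mm s 53 A) f" "map_ok (4 ^ rk A) f" "2 \<le> ?c" "?c < rg s 32" "rep (mm s) X ?c t"
   "\<And>p. pos_ok ?e p ==> enumerates (alls t (ap f p)) (FS ?e (2 ^ K) p)"
   using slot_okE[OF sl False] by metis
  have e: "enumerates (alls t (ap f (0, 0))) (FS ?e (2 ^ K) (0, 0))" by (rule f(6)[OF pos])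
  show ?thesis
   by (rule that[OF f(1) map_ok_mono[OF f(2) YX] efin _ len[OF e] en[OF e], of t]) (use f in simp_all)
 qed
qed

end

theorem theorem6p1:
  "\<exists>(prep :: instr list) (enum :: instr list) (c :: nat) (k :: nat) (f :: nat \<Rightarrow> nat).
     \<forall>(\<sigma> :: nat) (m :: nat) (n :: nat)
       (M :: (nat, nat \<times> bool) nsta) (D :: (nat, nat fsym) dag).
       is_nsta ({..<\<sigma>} \<times> UNIV) M \<and> states M = {..<m} \<and>
       fslp {..<\<sigma>} D \<and> dverts D = {..<n} \<longrightarrow>
       (\<exists>T. T \<le> max 1 (dag_size D) * 2 ^ (c * m ^ 4) \<and>
            halts_within (word_length k \<sigma> m D) prep (input_config \<sigma> M D) T \<and>
            (\<forall>A. forest_vertex D A \<longrightarrow>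
               enumerates_with_delay (word_length k \<sigma> m D) (f m) enum
                 (query_config (config_at prep (input_config \<sigma> M D) T) A)
                 ((\<lambda>S. preorder_number (forest_value D A) ` S) `
                    select M (forest_value D A))))"
proof (rule exI[of _ "comp 0 prep_prog"], rule exI[of _ "comp 0 enum_prog"], rule exI[of _ 20], rule exI[of _ 40],
  rule exI[of _ "\<lambda>_. 400"], intro allI impI, elim conjE)
 fix \<sigma> m n :: nat and M :: "(nat, nat \<times> bool) nsta" and D :: "(nat, nat fsym) dag"
 assume nsta: "is_nsta ({..<\<sigma>} \<times> UNIV) M" and st: "states M = {..<m}" and slp: "fslp {..<\<sigma>} D" and vs: "dverts D = {..<n}"
 \<comment> \<open>The word length has a summand for each kind of exponent:
   \<open>dag_size D\<close> for positions, \<open>m ^ 4\<close> for states and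
   \<open>floorlog 2 \<sigma>\<close> for letters.\<close>
 define w where "w = word_length 40 \<sigma> m D"
 let ?K = "m ^ 4" and ?N2 = "(2 ^ m ^ 4 + 1) * (2 ^ m ^ 4 + 1) :: nat"
 interpret automaton \<sigma> m M by unfold_locales (rule nsta st)+
 have K: "1 \<le> ?K" "m \<le> ?K" using m_pos power_increasing[of 1 4 m] by simp_all
 have nS: "n \<le> dag_size D" using vs by (simp add: dag_size_def)
 have \<sigma>: "\<sigma> < 2 ^ floorlog 2 \<sigma>"
 proof (cases "\<sigma> = 0")
  case False
  then show ?thesis using floorlog_bounds[of \<sigma> 2] by simp
 qed (simp add: floorlog_def)
 note wb = word_bounds[OF nS K \<sigma> w_def[unfolded word_length_def]]
 interpret graph \<sigma> m M "2 ^ w" n "unfolding_from D" "dlabel D" "child D LeftChild" "child D RightChild" "rank D"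
 proof unfold_locales
  show "2 ^ ?K * 16 < (2::nat) ^ w" "4 * m * (\<sigma> + 1) < 2 ^ w" by (rule wb)+
  show "(n * (3 * ?N2) + 8) * 4 ^ n < 2 ^ w" by (rule wb)
  fix v assume v: "v < n"
  show "eval_fexp (unfolding_from D v) ~= None" by (rule eval_ok[OF slp vs v])
  show "rank D v \<le> n" by (rule rank_le[OF slp vs])
  show "unfolding_from D v = BLeaf (dlabel D v) \<and> set_fsym (dlabel D v) \<subseteq> {..<\<sigma>}" if "kind_code (dlabel D v) \<le> 1"
   by (rule leaf_facts[OF slp vs v that])
  show "unfolding_from D v = BNode (dlabel D v) (unfolding_from D (child D LeftChild v)) (unfolding_from D (child D RightChild v)) \<and>
   child D LeftChild v < n \<and> child D RightChild v < n \<and> rank D (child D LeftChild v) < rank D v \<and> rank D (child D RightChild v) < rank D v"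
   if "1 < kind_code (dlabel D v)"
   by (rule inner_facts[OF slp vs v that])
 qed
 define s where "s = (|rg = input_regs \<sigma> M D, mm = input_mem \<sigma> M D, tm = 0, tr = []|)"
 have c0: "cfg 0 s = input_config \<sigma> M D" by (simp add: cfg_def s_def input_config_def)
 have cn: "card (dverts D) = n" "card (states M) = m" using vs st by simp_all
 have kids: "child D LeftChild v < n" "child D RightChild v < n" if "v < n" "1 < kind_code (dlabel D v)" for v
  using inner[OF that] by auto
 have lets: "x < \<sigma>" if "v < n" "dlabel D v = Atom x \<or> dlabel D v = CtxAtom x" for v x
  using leaf[OF that(1)] that(2) by auto
 have fits0: "fits (2 ^ w) s"
 proof -
  have "input_regs \<sigma> M D r < 2 ^ w" for r
   using wb(5-7) q_less cn less_trans by (auto simp: input_regs_def)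
  moreover have "input_mem \<sigma> M D a i < 2 ^ w" for a i
  proof -
   have one: "1 < (2::nat) ^ w" using wb(8) by linarith
   have ob: "of_bool P < (2::nat) ^ w" for P using one by (cases P) simp_all
   consider "a = 0 \<and> i < n" | "a = 1 \<and> i < n" | "a = 2 \<and> i < n" | "a = 3" | "a = 4" | "\<not> (a \<le> 2 \<and> i < n) \<and> a ~= 3 \<and> a ~= 4" by linarith
   then show ?thesis
   proof cases
    case 1
    then show ?thesis using wb(8) vs by (cases "dlabel D i") (simp_all add: input_mem_def)
   next
    case 2
    then show ?thesis using kids[of i] lets[of i] wb(5,7) vs
     by (cases "dlabel D i") (auto simp: input_mem_def intro: less_trans)
   next
    case 3
    then show ?thesis using kids[of i] one wb(5) vs
     by (cases "dlabel D i") (auto simp: input_mem_def intro: less_trans)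
   next
    case 4
    then show ?thesis by (simp add: input_mem_def Let_def ob)
   next
    case 5
    have "input_mem \<sigma> M D a i = of_bool (\<exists>x < \<sigma>. \<exists>b. \<exists>q \<in> iota M (x, b). i = q * (2 * \<sigma>) + 2 * x + of_bool b)"
    proof -
     have "((4::nat) = 0 \<and> i \<in> dverts D) = False" "((4::nat) = 1 \<and> i \<in> dverts D) = False"
      "((4::nat) = 2 \<and> i \<in> dverts D) = False" "((4::nat) = 3) = False" by simp_all
     then show ?thesis unfolding input_mem_def 5 by (simp only: if_False if_True refl)
    qed
    then show ?thesis by (simp only: ob)
   next
    case 6
    then have z: "\<not> (a = 0 \<and> i < n)" "\<not> (a = 1 \<and> i < n)" "\<not> (a = 2 \<and> i < n)" "a ~= 3" "a ~= 4" by linarith+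
    have "input_mem \<sigma> M D a i = 0" unfolding input_mem_def vs lessThan_iff using z by (simp only: if_False)
    then show ?thesis using one by simp
   qed
  qed
  ultimately show ?thesis by (simp add: fits_def s_def)
 qed
 \<comment> \<open>The input arrays code triples and pairs as mixed-radix numbers; uniqueness of
   digits lets a single entry be read as membership.\<close>
 have digit: "a = a' \<and> b = b'" if "a * k + b = a' * k + b'" "b < k" "b' < k" for a b a' b' k :: nat
 proof -
  have "(a * k + b) div k = a" "(a' * k + b') div k = a'" using that(2,3) by simp_all
  then have "a = a'" using that(1) by metis
  then show ?thesis using that(1) by simp
 qed
 have wpi: "wp (2 ^ w) init (\<lambda>s'. dstate {} [] 0 s' \<and> tm s' \<le> tm s + 60 * ?K + 60) s"
 proof (rule wp_init)
  show "inp s"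
   unfolding inp_def
  proof (intro allI impI conjI)
   fix v assume v: "v < n"
   show "mm s 0 v = kind_code (dlabel D v)" using v vs by (simp add: s_def input_mem_def)
   show "mm s 1 v \<in> set_fsym (dlabel D v)" if "kind_code (dlabel D v) \<le> 1"
    using that v vs by (cases "dlabel D v") (simp_all add: s_def input_mem_def)
   show "mm s 1 v = child D LeftChild v" "mm s 2 v = child D RightChild v" if "1 < kind_code (dlabel D v)"
    using that v vs by (cases "dlabel D v"; simp add: s_def input_mem_def)+
  qed
  show "\<forall>p<m. \<forall>t<m. \<forall>q<m. mm s 3 ((p * m + t) * m + q) = of_bool ((p, t, q) \<in> delta M)"
  proof (intro allI impI)
   fix p t q assume l: "p < m" "t < m" "q < m"
   have "(\<exists>(p', t', q') \<in> delta M. (p * m + t) * m + q = (p' * m + t') * m + q') \<longleftrightarrow> (p, t, q) \<in> delta M"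
   proof
    assume "\<exists>(p', t', q') \<in> delta M. (p * m + t) * m + q = (p' * m + t') * m + q'"
    then obtain p' t' q' where x: "(p', t', q') \<in> delta M" "(p * m + t) * m + q = (p' * m + t') * m + q'" by blast
    then have l': "t' < m" "q' < m" using delta_sub by auto
    have "p * m + t = p' * m + t'" "q = q'" using digit[OF x(2) l(3) l'(2)] by auto
    then show "(p, t, q) \<in> delta M" using digit[of p m t p' t'] l(2) l'(1) x(1) by auto
   qed blast
   then show "mm s 3 ((p * m + t) * m + q) = of_bool ((p, t, q) \<in> delta M)"
    by (simp add: s_def input_mem_def cn(2))
  qed
  show "\<forall>x<\<sigma>. \<forall>b. \<forall>q<m. mm s 4 (q * (2 * \<sigma>) + 2 * x + of_bool b) = of_bool (q \<in> iota M (x, b))"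
  proof (intro allI impI)
   fix x b q assume l: "x < \<sigma>" "q < m"
   have "(\<exists>x'<\<sigma>. \<exists>b'. \<exists>q' \<in> iota M (x', b'). q * (2 * \<sigma>) + 2 * x + of_bool b = q' * (2 * \<sigma>) + 2 * x' + of_bool b') \<longleftrightarrow> q \<in> iota M (x, b)"
   proof
    assume "\<exists>x'<\<sigma>. \<exists>b'. \<exists>q' \<in> iota M (x', b'). q * (2 * \<sigma>) + 2 * x + of_bool b = q' * (2 * \<sigma>) + 2 * x' + of_bool b'"
    then obtain x' b' q' where y: "x' < \<sigma>" "q' \<in> iota M (x', b')"
     "q * (2 * \<sigma>) + (2 * x + of_bool b) = q' * (2 * \<sigma>) + (2 * x' + of_bool b')" by (auto simp: add.assoc)
    have "q = q' \<and> 2 * x + of_bool b = 2 * x' + of_bool b'"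
     by (rule digit[OF y(3)]) (use l y(1) in \<open>cases b; cases b'; simp\<close>)+
    moreover from this have "x = x' \<and> b = b'" by (cases b; cases b'; simp; presburger)
    ultimately show "q \<in> iota M (x, b)" using y(2) by simp
   qed (use l in blast)
   then show "mm s 4 (q * (2 * \<sigma>) + 2 * x + of_bool b) = of_bool (q \<in> iota M (x, b))"
    by (simp add: s_def input_mem_def)
  qed
 qed (use cn in \<open>simp_all add: s_def input_regs_def input_mem_def\<close>)
 have "wp (2 ^ w) prep_prog (\<lambda>s'. dinv {..<n} s' \<and> tm s' \<le> 60 * ?K + 60 + (3 * n * (1000 * (?N2 * (?K * ?K * ?K)) + 30) + 10)) s"
  unfolding prep_prog_def wp_Seq
 proof (rule wp_mono[OF wpi], goal_cases)
  case (1 s1)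
  show ?case
   by (rule wp_mono[OF wp_dfs[OF conjunct1[OF 1]]]) (use 1 in \<open>simp add: s_def\<close>)
 qed
 then obtain s' where b: "big (2 ^ w) prep_prog s s'" and d: "dinv {..<n} s'"
  and t: "tm s' \<le> 60 * ?K + 60 + (3 * n * (1000 * (?N2 * (?K * ?K * ?K)) + 30) + 10)"
  unfolding wp_def by blast
 have run: "halts_within w (comp 0 prep_prog) (input_config \<sigma> M D) (tm s')"
  "config_at (comp 0 prep_prog) (input_config \<sigma> M D) (tm s') = cfg (csize prep_prog) s'" "fits (2 ^ w) s'"
  using big_run[OF b fits0] unfolding c0 by (simp_all add: s_def)
 show "\<exists>T. T \<le> max 1 (dag_size D) * 2 ^ (20 * ?K) \<and> halts_within (word_length 40 \<sigma> m D) (comp 0 prep_prog) (input_config \<sigma> M D) T \<and>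
  (\<forall>A. forest_vertex D A --> enumerates_with_delay (word_length 40 \<sigma> m D) 400 (comp 0 enum_prog)
    (query_config (config_at (comp 0 prep_prog) (input_config \<sigma> M D) T) A)
    ((\<lambda>S. preorder_number (forest_value D A) ` S) ` select M (forest_value D A)))"
  unfolding w_def[symmetric]
 proof (intro exI[of _ "tm s'"] conjI allI impI run(1))
  show "tm s' \<le> max 1 (dag_size D) * 2 ^ (20 * ?K)" by (rule le_trans[OF t time_bound[OF nS K(1)]])
  fix A assume fv: "forest_vertex D A"
  then have A: "A < n" using vs by (simp add: forest_vertex_def)
  obtain F where F: "eval_fexp (unfolding_from D A) = Some F" using ex_ok[OF A] by auto
  have isf: "is_forest F" using fv F by (simp add: forest_vertex_def)
  have fval: "forest_value D A = map (map_rtree the) F" using F by (simp add: forest_value_def)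
  let ?c = "query_config (config_at (comp 0 prep_prog) (input_config \<sigma> M D) (tm s')) A"
  have c: "pc ?c = 0" "regs ?c = (rg s')(0 := A)" "mem ?c = mm s'" unfolding run(2) by (simp_all add: query_config_def cfg_def)
  obtain f t LST where q: "mapat (mm s') 12 (mm s' 53 A) f" "map_ok X f" "mm s' 40 A = of_bool (acc (mm s' 10 A))"
   "mm s' 11 (mm s' 53 A) = 0 \<and> LST = [] \<or> 0 < mm s' 11 (mm s' 53 A) \<and> mm s' 11 (mm s' 53 A) < rg s' 32 \<and>
     rep (mm s') X (mm s' 11 (mm s' 53 A)) t \<and> LST = alls t (ap f (0, 0))"
   "\<forall>xs \<in> set LST. length xs \<le> 2 ^ n"
   "enumerates ((if acc (mm s' 10 A) then [[]] else []) @ LST) {P. \<exists>q. (q, P) \<in> G (unfolding_from D A) (0, 0) \<and> acc q}"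
   by (rule query_facts[OF d A F isf], rule that)
  have gd: "rg s' 5 = 0" "rg s' 6 = 1" using globD[OF dinvD(1)[OF d]] by simp_all
  have "rg s' 32 \<le> 3 + n * (3 * ?N2)" using dinvD(7)[OF d] unfolding card_lessThan .
  moreover have "a + 2 \<le> y + 8 \<and> a \<le> y + 8" if "a \<le> 3 + y" for a y :: nat using that by simp
  ultimately have N: "rg s' 32 + 2 \<le> n * (3 * ?N2) + 8" "rg s' 32 \<le> n * (3 * ?N2) + 8" by blast+
  have cells: "cells (rg s' 32) X (2 ^ w) (2 ^ n)"
  proof
   show "rg s' 32 * X < 2 ^ w" by (rule le_less_trans[OF mult_le_mono1[OF N(2)] wb(3)])
   show "(2 * 2 ^ n + 3) * (rg s' 32 + 2) + rg s' 32 < 2 ^ w"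
    by (rule le_less_trans[OF add_mono[OF mult_le_mono2[OF N(1)] N(2)] wb(4)])
  qed
  have "1 * X \<le> (n * (3 * ?N2) + 8) * X" by (intro mult_le_mono1) simp
  then have X: "X < 2 ^ w" using le_less_trans[OF _ wb(3)] unfolding mult_1_left by blast
  have "enumerates_with_delay w 400 (comp 0 enum_prog) ?c {P. \<exists>q. (q, P) \<in> G (unfolding_from D A) (0, 0) \<and> acc q}"
  proof (rule enum_correct[OF _ c(1) cells, where f = f and eb = "acc (mm s' 10 A)" and LST = LST and t = t])
   show "fits_word w ?c" using run(3) A wb(5) unfolding fits_word_def fits_def c by auto
   show "length xs \<le> 2 ^ n" if "xs \<in> set LST" for xs using q(5) that by blast
  qed (use q c gd X in simp_all)
  then show "enumerates_with_delay w 400 (comp 0 enum_prog) ?c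
    ((\<lambda>S. preorder_number (forest_value D A) ` S) ` select M (forest_value D A))"
   unfolding fval select_eq[OF F isf] .
 qed
qed

end
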